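(* If the injectivity assumption holds, then $T_k(\mathfrak{D}_{\mathbf{s}})$ is a consistent scattering diagram for $N^+_{\mu_k(\mathbf{s})}$. Moreover, the diagrams $\mathfrak{D}_{\mu_k(\mathbf{s})}$ and $T_k(\mathfrak{D}_{\mathbf{s}})$ are equivalent.
   Context: Let $k$ denote a field of characteristic zero and $R = k[a_{i,j}]$, where the $a_{i,j}$ are formal variables. Fix generalized fixed data: a lattice $N$ with skew-symmetric form $\{\cdot,\cdot\}$, unfrozen sublattice $N_{\mathrm{uf}}$, index sets $I_{\mathrm{uf}}\subseteq I$, positive integers $d_i$ (gcd 1), a finite-index sublattice $N^\circ$, $M=\mathrm{Hom}(N,\mathbb{Z})$, $M^\circ=\mathrm{Hom}(N^\circ,\mathbb{Z})$, positive integers $r_i$, and formal variables $a_{i,j}$. A reciprocal generalized torus seed $\mathbf{s}=\{(e_i,(a_{i,j}))\}$ has $\{e_i\}$ a basis of $N$, $\{d_ie_i\}$ a basis of $N^\circ$, and $a_{i,j}=a_{i,r_i-j}$. Let $\epsilon_{ij}=\{e_i,e_j\}d_j$, $v_i=p_1^*(e_i)=\{e_i,\cdot\}$. The injectivity assumption says $p_1^*:N_{\mathrm{uf}}\to M^\circ$ is injective. $N^+_{\mathbf{s}}$ is the set of nonzero non-negative combinations of $e_i$, $i\in I_{\mathrm{uf}}$. The generalized cluster scattering diagram $\mathfrak{D}_{\mathbf{s}}$ (over $\widehat{R[P]}$) is the unique up to equivalence consistent scattering diagram containing the initial walls $(e_i^\perp, 1+a_{i,1}z^{v_i}+\cdots+a_{i,r_i-1}z^{(r_i-1)v_i}+z^{r_iv_i})$,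 $i\in I_{\mathrm{uf}}$, with all other walls outgoing. Mutation $\mu_k(\mathbf{s})$ sends $e_i\mapsto e_i+r_k[\epsilon_{ik}]_+e_k$ ($i\neq k$), $e_k\mapsto -e_k$. Let $\mathcal{H}_{k,\pm}=\{m\in M_\mathbb{R}:\pm\langle e_k,m\rangle\ge 0\}$ and $T_k(m)=m+r_kv_k\langle d_ke_k,m\rangle$ for $m\in\mathcal{H}_{k,+}$, $T_k(m)=m$ for $m\in\mathcal{H}_{k,-}$. $T_k(\mathfrak{D}_{\mathbf{s}})$ is obtained by replacing the wall $(e_k^\perp,1+a_{k,1}z^{v_k}+\cdots+z^{r_kv_k})$ with $(e_k^\perp,1+a_{k,1}z^{-v_k}+\cdots+z^{-r_kv_k})$, and each other wall $(\mathfrak{d},f_\mathfrak{d})$ with the walls $(T_k(\mathfrak{d}\cap\mathcal{H}_{k,\pm}),T_{k,\pm}(f_\mathfrak{d}))$ (dropping those of dimension less than $\mathrm{rank}(M)-1$), where $T_{k,\pm}$ acts on exponents.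
   Formalization: Since the diagram for s is defined only up to equivalence and T_k acts on walls, the result is stated for representatives without cancelling walls (no non-empty family of walls through a general point has product 1); for representatives with cancelling walls the literal claim can fail. *)

theory Defs
  imports "HOL-Analysis.Analysis" "HOL-Algebra.Ring" "HOL-Library.Poly_Mapping"
begin

section \<open>Generalized fixed data and seeds\<close>

text \<open>
  A lattice of positive rank is realised as a full lattice in a Euclidean space \<^typ>\<open>'a\<close>, which
  plays the role of \<open>N\<^sub>\<real>\<close>. The dual space \<open>M\<^sub>\<real> = Hom(N, \<real>)\<close> is identified with \<^typ>\<open>'a\<close> itself by
  means of the inner product, so that the pairing \<open>\<langle>n, m\<rangle>\<close> is \<open>n \<bullet> m\<close> and \<open>Hom(L, \<int>)\<close> is the dual
  lattice of \<open>L\<close>. The skew-symmetric form is given by its bilinear extension to \<open>N\<^sub>\<real>\<close>.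
\<close>

definition lattice_basis :: "'i set \<Rightarrow> ('i \<Rightarrow> 'a::real_vector) \<Rightarrow> 'a set \<Rightarrow> bool" where
  "lattice_basis I b L \<longleftrightarrow> finite I \<and> inj_on b I \<and> independent (b ` I) \<and>
     L = {(\<Sum>i\<in>I. of_int (c i) *\<^sub>R b i) | c :: 'i \<Rightarrow> int. True}"

definition full_lattice :: "'a::euclidean_space set \<Rightarrow> bool" where
  "full_lattice L \<longleftrightarrow> (\<exists>B. lattice_basis B (\<lambda>x. x) L \<and> span B = UNIV)"

definition sublattice :: "'a::real_vector set \<Rightarrow> 'a set \<Rightarrow> bool" where
  "sublattice K L \<longleftrightarrow> K \<subseteq> L \<and> 0 \<in> K \<and> (\<forall>x\<in>K. \<forall>y\<in>K. x - y \<in> K)"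

definition saturated_in :: "'a::real_vector set \<Rightarrow> 'a set \<Rightarrow> bool" where
  "saturated_in K L \<longleftrightarrow> (\<forall>x\<in>L. \<forall>c::nat. 0 < c \<and> of_nat c *\<^sub>R x \<in> K \<longrightarrow> x \<in> K)"

definition finite_index :: "'a::real_vector set \<Rightarrow> 'a set \<Rightarrow> bool" where
  "finite_index K L \<longleftrightarrow> finite ((\<lambda>x. (+) x ` K) ` L)"

definition dual_lattice :: "'a::real_inner set \<Rightarrow> 'a set" where
  "dual_lattice L = {m. \<forall>n\<in>L. n \<bullet> m \<in> \<int>}"

definition primitive_in :: "'a::real_vector set \<Rightarrow> 'a \<Rightarrow> bool" where
  "primitive_in L n \<longleftrightarrow> n \<in> L \<and> n \<noteq> 0 \<and> (\<forall>x\<in>L. \<forall>c::nat. n = of_nat c *\<^sub>R x \<longrightarrow> c = 1)"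

text \<open>
  \<open>fd_a i j\<close> is the name of the formal variable \<open>a\<^sub>i\<^sub>,\<^sub>j\<close>, meaningful for \<open>i \<in> I\<close> and \<open>0 < j < r\<^sub>i\<close>.
\<close>

record ('i, 'a, 'x) fixed_data =
  fd_N :: "'a set"
  fd_form :: "'a \<Rightarrow> 'a \<Rightarrow> real"
  fd_Nuf :: "'a set"
  fd_I :: "'i set"
  fd_Iuf :: "'i set"
  fd_d :: "'i \<Rightarrow> nat"
  fd_Ncirc :: "'a set"
  fd_r :: "'i \<Rightarrow> nat"
  fd_a :: "'i \<Rightarrow> nat \<Rightarrow> 'x"

definition fd_M :: "('i, 'a::euclidean_space, 'x) fixed_data \<Rightarrow> 'a set" where
  "fd_M \<Gamma> = dual_lattice (fd_N \<Gamma>)"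

definition fd_Mcirc :: "('i, 'a::euclidean_space, 'x) fixed_data \<Rightarrow> 'a set" where
  "fd_Mcirc \<Gamma> = dual_lattice (fd_Ncirc \<Gamma>)"

text \<open>
  The last clause allows for the coincidences \<open>a\<^sub>i\<^sub>,\<^sub>j = a\<^sub>i\<^sub>,\<^sub>r\<^sub>-\<^sub>j\<close> required of a reciprocal seed, but for
  no others.
\<close>

definition generalized_fixed_data :: "('i, 'a::euclidean_space, 'x) fixed_data \<Rightarrow> bool" where
  "generalized_fixed_data \<Gamma> \<longleftrightarrow>
     full_lattice (fd_N \<Gamma>) \<and>
     bilinear (fd_form \<Gamma>) \<and>
     (\<forall>x y. fd_form \<Gamma> x y = - fd_form \<Gamma> y x) \<and>
     (\<forall>x\<in>fd_N \<Gamma>. \<forall>y\<in>fd_N \<Gamma>. fd_form \<Gamma> x y \<in> \<rat>) \<and>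
     sublattice (fd_Nuf \<Gamma>) (fd_N \<Gamma>) \<and> saturated_in (fd_Nuf \<Gamma>) (fd_N \<Gamma>) \<and>
     finite (fd_I \<Gamma>) \<and> card (fd_I \<Gamma>) = DIM('a) \<and>
     fd_Iuf \<Gamma> \<subseteq> fd_I \<Gamma> \<and> card (fd_Iuf \<Gamma>) = dim (fd_Nuf \<Gamma>) \<and>
     (\<forall>i\<in>fd_I \<Gamma>. 0 < fd_d \<Gamma> i) \<and> Gcd (fd_d \<Gamma> ` fd_I \<Gamma>) = 1 \<and>
     sublattice (fd_Ncirc \<Gamma>) (fd_N \<Gamma>) \<and> finite_index (fd_Ncirc \<Gamma>) (fd_N \<Gamma>) \<and>
     (\<forall>x\<in>fd_Nuf \<Gamma>. \<forall>y\<in>fd_Ncirc \<Gamma>. fd_form \<Gamma> x y \<in> \<int>) \<and>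
     (\<forall>x\<in>fd_N \<Gamma>. \<forall>y\<in>fd_Nuf \<Gamma> \<inter> fd_Ncirc \<Gamma>. fd_form \<Gamma> x y \<in> \<int>) \<and>
     (\<forall>i\<in>fd_I \<Gamma>. 0 < fd_r \<Gamma> i) \<and>
     (\<forall>i\<in>fd_I \<Gamma>. \<forall>i'\<in>fd_I \<Gamma>. \<forall>j\<in>{0<..<fd_r \<Gamma> i}. \<forall>j'\<in>{0<..<fd_r \<Gamma> i'}.
        fd_a \<Gamma> i j = fd_a \<Gamma> i' j' \<longrightarrow> i' = i \<and> (j' = j \<or> j' = fd_r \<Gamma> i - j))"

text \<open>
  A seed is given by its vectors \<open>e\<^sub>i\<close>; its second components, the formal variables, belong to the
  fixed data and are not changed by mutation of a reciprocal seed.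
\<close>

definition reciprocal_torus_seed ::
  "('i, 'a::euclidean_space, 'x) fixed_data \<Rightarrow> ('i \<Rightarrow> 'a) \<Rightarrow> bool" where
  "reciprocal_torus_seed \<Gamma> e \<longleftrightarrow>
     lattice_basis (fd_I \<Gamma>) e (fd_N \<Gamma>) \<and>
     lattice_basis (fd_Iuf \<Gamma>) e (fd_Nuf \<Gamma>) \<and>
     lattice_basis (fd_I \<Gamma>) (\<lambda>i. of_nat (fd_d \<Gamma> i) *\<^sub>R e i) (fd_Ncirc \<Gamma>) \<and>
     (\<forall>i\<in>fd_I \<Gamma>. \<forall>j\<in>{0<..<fd_r \<Gamma> i}. fd_a \<Gamma> i j = fd_a \<Gamma> i (fd_r \<Gamma> i - j))"

text \<open>\<open>p\<^sub>1\<^sup>*(n) = {n, \<cdot>}\<close>, that is, \<open>n' \<bullet> p1 \<Gamma> n = {n, n'}\<close> for all \<open>n'\<close>.\<close>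

definition p1 :: "('i, 'a::euclidean_space, 'x) fixed_data \<Rightarrow> 'a \<Rightarrow> 'a" where
  "p1 \<Gamma> n = (\<Sum>b\<in>Basis. fd_form \<Gamma> n b *\<^sub>R b)"

definition injectivity_assumption :: "('i, 'a::euclidean_space, 'x) fixed_data \<Rightarrow> bool" where
  "injectivity_assumption \<Gamma> \<longleftrightarrow> inj_on (p1 \<Gamma>) (fd_Nuf \<Gamma>)"

definition seed_epsilon ::
  "('i, 'a::euclidean_space, 'x) fixed_data \<Rightarrow> ('i \<Rightarrow> 'a) \<Rightarrow> 'i \<Rightarrow> 'i \<Rightarrow> real" where
  "seed_epsilon \<Gamma> e i j = fd_form \<Gamma> (e i) (e j) * of_nat (fd_d \<Gamma> j)"

definition mutate_seed ::
  "('i, 'a::euclidean_space, 'x) fixed_data \<Rightarrow> 'i \<Rightarrow> ('i \<Rightarrow> 'a) \<Rightarrow> 'i \<Rightarrow> 'a" where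
  "mutate_seed \<Gamma> k e = (\<lambda>i. if i = k then - e k
     else e i + (of_nat (fd_r \<Gamma> k) * max 0 (seed_epsilon \<Gamma> e i k)) *\<^sub>R e k)"

definition Nplus :: "('i, 'a::euclidean_space, 'x) fixed_data \<Rightarrow> ('i \<Rightarrow> 'a) \<Rightarrow> 'a set" where
  "Nplus \<Gamma> e = {(\<Sum>i\<in>fd_Iuf \<Gamma>. of_nat (c i) *\<^sub>R e i) | c :: 'i \<Rightarrow> nat. True} - {0}"

definition orth :: "'a::real_inner \<Rightarrow> 'a set" where
  "orth n = {m. n \<bullet> m = 0}"

section \<open>The completed monoid ring\<close>

type_synonym ('x, 'k) coeff_poly = "('x \<Rightarrow>\<^sub>0 nat) \<Rightarrow>\<^sub>0 'k"

text \<open>The polynomial ring \<open>R = k[a\<^sub>i\<^sub>,\<^sub>j]\<close> inside the polynomials over all variable names.\<close>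

definition coeff_ring :: "('i, 'a, 'x) fixed_data \<Rightarrow> ('x, 'k::field_char_0) coeff_poly set" where
  "coeff_ring \<Gamma> = {p. \<forall>u\<in>Poly_Mapping.keys p.
     Poly_Mapping.keys u \<subseteq> {fd_a \<Gamma> i j | i j. i \<in> fd_I \<Gamma> \<and> j \<in> {0<..<fd_r \<Gamma> i}}}"

definition rational_cone :: "('i, 'a::euclidean_space, 'x) fixed_data \<Rightarrow> 'a set \<Rightarrow> bool" where
  "rational_cone \<Gamma> C \<longleftrightarrow> (\<exists>U. finite U \<and> U \<subseteq> fd_M \<Gamma> \<and> C = convex_cone hull U)"

definition seed_monoid ::
  "('i, 'a::euclidean_space, 'x) fixed_data \<Rightarrow> ('i \<Rightarrow> 'a) \<Rightarrow> 'a set \<Rightarrow> bool" where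
  "seed_monoid \<Gamma> e P \<longleftrightarrow> (\<exists>C. rational_cone \<Gamma> C \<and> C \<inter> uminus ` C = {0} \<and>
     aff_dim C = int DIM('a) \<and> P = C \<inter> fd_Mcirc \<Gamma>) \<and>
     (\<forall>i\<in>fd_Iuf \<Gamma>. p1 \<Gamma> (e i) \<in> P - {0})"

text \<open>
  The completion of \<open>R[P]\<close> at the monomial ideal \<open>J\<close> spanned by \<open>P - {0}\<close>. Since \<open>P\<close> is a strictly
  convex toric monoid, the complement of each \<open>J\<^sup>l\<close> in \<open>P\<close> is finite and the intersection of all
  \<open>J\<^sup>l\<close> is empty, so the elements of the completion are the formal sums \<open>\<Sum>m\<in>P. F(m) z\<^sup>m\<close>, that
  is, all functions \<open>F : P \<rightarrow> R\<close> (extended by \<open>0\<close>). All sums over \<open>{p \<in> P. m - p \<in> P}\<close> are finite.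
\<close>

definition completed_ring ::
  "('i, 'a::euclidean_space, 'x) fixed_data \<Rightarrow> 'a set \<Rightarrow>
     ('a \<Rightarrow> ('x, 'k::field_char_0) coeff_poly) ring" where
  "completed_ring \<Gamma> P =
     \<lparr>carrier = {F. (\<forall>m. F m \<in> coeff_ring \<Gamma>) \<and> (\<forall>m. m \<notin> P \<longrightarrow> F m = 0)},
      mult = (\<lambda>F G m. \<Sum>p | p \<in> P \<and> m - p \<in> P. F p * G (m - p)),
      one = (\<lambda>m. if m = 0 then 1 else 0),
      zero = (\<lambda>m. 0),
      add = (\<lambda>F G m. F m + G m)\<rparr>"

text \<open>The exponents of the monomials in \<open>J\<^sup>l\<close>.\<close>

definition ideal_power :: "'a::real_vector set \<Rightarrow> nat \<Rightarrow> 'a set" where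
  "ideal_power P l = {q + sum_list ms | q ms. q \<in> P \<and> length ms = l \<and> set ms \<subseteq> P - {0}}"

definition cong_mod :: "'a::real_vector set \<Rightarrow> nat \<Rightarrow> ('a \<Rightarrow> 'r) \<Rightarrow> ('a \<Rightarrow> 'r) \<Rightarrow> bool" where
  "cong_mod P l F G \<longleftrightarrow> (\<forall>m. m \<in> P - ideal_power P l \<longrightarrow> F m = G m)"

section \<open>Scattering diagrams\<close>

text \<open>
  A diagram is an indexed family of walls \<open>(\<dd>, f\<^sub>\<dd>)\<close>; the same wall may occur several times. This
  matters for mutation, which can map pieces of different walls to the same wall.
\<close>

record ('w, 'a, 'r) diagram =
  sd_index :: "'w set"
  sd_supp :: "'w \<Rightarrow> 'a set"
  sd_fun :: "'w \<Rightarrow> 'a \<Rightarrow> 'r"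

definition wall_for ::
  "('i, 'a::euclidean_space, 'x) fixed_data \<Rightarrow> ('i \<Rightarrow> 'a) \<Rightarrow> 'a set \<Rightarrow> 'a \<Rightarrow>
     'a set \<Rightarrow> ('a \<Rightarrow> ('x, 'k::field_char_0) coeff_poly) \<Rightarrow> bool" where
  "wall_for \<Gamma> e P n0 \<dd> f \<longleftrightarrow>
     n0 \<in> Nplus \<Gamma> e \<and> primitive_in (fd_N \<Gamma>) n0 \<and>
     rational_cone \<Gamma> \<dd> \<and> aff_dim \<dd> = int DIM('a) - 1 \<and> \<dd> \<subseteq> orth n0 \<and>
     f \<in> carrier (completed_ring \<Gamma> P) \<and> f 0 = 1 \<and>
     (\<forall>m. f m \<noteq> 0 \<longrightarrow> (\<exists>j::nat. m = of_nat j *\<^sub>R p1 \<Gamma> n0))"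

text \<open>The indices of the walls that are non-trivial modulo \<open>J\<^sup>l\<close>.\<close>

definition sd_walls_mod ::
  "('i, 'a::euclidean_space, 'x) fixed_data \<Rightarrow> 'a set \<Rightarrow> nat \<Rightarrow>
     ('w, 'a, ('x, 'k::field_char_0) coeff_poly) diagram \<Rightarrow> 'w set" where
  "sd_walls_mod \<Gamma> P l D =
     {w \<in> sd_index D. \<not> cong_mod P l (sd_fun D w) \<one>\<^bsub>completed_ring \<Gamma> P\<^esub>}"

definition scattering_diagram ::
  "('i, 'a::euclidean_space, 'x) fixed_data \<Rightarrow> ('i \<Rightarrow> 'a) \<Rightarrow> 'a set \<Rightarrow>
     ('w, 'a, ('x, 'k::field_char_0) coeff_poly) diagram \<Rightarrow> bool" where
  "scattering_diagram \<Gamma> e P D \<longleftrightarrow>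
     (\<forall>w\<in>sd_index D. \<exists>n0. wall_for \<Gamma> e P n0 (sd_supp D w) (sd_fun D w)) \<and>
     (\<forall>l. finite (sd_walls_mod \<Gamma> P l D))"

definition sd_support :: "('w, 'a, 'r) diagram \<Rightarrow> 'a set" where
  "sd_support D = (\<Union>w\<in>sd_index D. sd_supp D w)"

definition sd_sing :: "('w, 'a::euclidean_space, 'r) diagram \<Rightarrow> 'a set" where
  "sd_sing D = (\<Union>w\<in>sd_index D. rel_frontier (sd_supp D w)) \<union>
     \<Union>{sd_supp D w \<inter> sd_supp D w' | w w'. w \<in> sd_index D \<and> w' \<in> sd_index D \<and>
        aff_dim (sd_supp D w \<inter> sd_supp D w') = int DIM('a) - 2}"

definition smooth_immersion :: "(real \<Rightarrow> 'a::real_normed_vector) \<Rightarrow> bool" where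
  "smooth_immersion \<gamma> \<longleftrightarrow> (\<exists>g :: nat \<Rightarrow> real \<Rightarrow> 'a. g 0 = \<gamma> \<and>
     (\<forall>j. \<forall>t\<in>{0..1}. (g j has_vector_derivative g (Suc j) t) (at t within {0..1})) \<and>
     (\<forall>t\<in>{0..1}. g 1 t \<noteq> 0))"

definition velocity :: "(real \<Rightarrow> 'a::real_normed_vector) \<Rightarrow> real \<Rightarrow> 'a" where
  "velocity \<gamma> t = vector_derivative \<gamma> (at t within {0..1})"

text \<open>
  Transversality to a wall: the velocity is not tangent to the hyperplane spanned by the wall.
\<close>

definition admissible_path ::
  "('w, 'a::euclidean_space, 'r) diagram \<Rightarrow> (real \<Rightarrow> 'a) \<Rightarrow> bool" where
  "admissible_path D \<gamma> \<longleftrightarrow>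
     smooth_immersion \<gamma> \<and> \<gamma> ` {0..1} \<inter> sd_sing D = {} \<and>
     \<gamma> 0 \<notin> sd_support D \<and> \<gamma> 1 \<notin> sd_support D \<and>
     (\<forall>w\<in>sd_index D. \<forall>t\<in>{0..1}. \<gamma> t \<in> sd_supp D w \<longrightarrow> velocity \<gamma> t \<notin> span (sd_supp D w))"

text \<open>
  The action \<open>z\<^sup>m \<mapsto> z\<^sup>m f\<^bsup>\<langle>n,m\<rangle>\<^esup>\<close> on the completed ring, for \<open>n \<in> N\<^sup>\<circ>\<close>; the pairing \<open>\<langle>n, m\<rangle>\<close>
  is an integer for \<open>m \<in> M\<^sup>\<circ>\<close>.
\<close>

definition wall_aut ::
  "('i, 'a::euclidean_space, 'x) fixed_data \<Rightarrow> 'a set \<Rightarrow> 'a \<Rightarrow>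
     ('a \<Rightarrow> ('x, 'k::field_char_0) coeff_poly) \<Rightarrow>
     ('a \<Rightarrow> ('x, 'k) coeff_poly) \<Rightarrow> ('a \<Rightarrow> ('x, 'k) coeff_poly)" where
  "wall_aut \<Gamma> P n f F =
     (\<lambda>q. \<Sum>m | m \<in> P \<and> q - m \<in> P. F m * (f [^]\<^bsub>completed_ring \<Gamma> P\<^esub> \<lfloor>n \<bullet> m\<rfloor>) (q - m))"

text \<open>
  The normal vector \<open>\<epsilon> n\<^sub>0'\<close> used when a wall is crossed with velocity \<open>v\<close>: here \<open>n\<^sub>0'\<close> generates
  \<open>\<real>\<^sub>\<ge>\<^sub>0 n\<^sub>0 \<inter> N\<^sup>\<circ>\<close> and \<open>\<epsilon> = - sgn \<langle>n\<^sub>0, v\<rangle>\<close>. As \<open>\<langle>n\<^sub>0', p\<^sub>1\<^sup>*(n\<^sub>0)\<rangle> = 0\<close>, the automorphism \<open>z\<^sup>m \<mapsto> z\<^sup>m f\<^bsup>\<langle>n\<^sub>0',m\<rangle>\<^esup>\<close>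
  fixes \<open>f\<close>, and so its inverse is obtained by changing the sign of \<open>n\<^sub>0'\<close>.
\<close>

definition crossing_normal ::
  "('i, 'a::euclidean_space, 'x) fixed_data \<Rightarrow> 'a set \<Rightarrow> 'a \<Rightarrow> 'a" where
  "crossing_normal \<Gamma> \<dd> v =
     (THE n. primitive_in (fd_Ncirc \<Gamma>) n \<and> \<dd> \<subseteq> orth n \<and> n \<bullet> v < 0)"

text \<open>
  The order of walls crossed simultaneously is irrelevant, because such walls lie in a common
  hyperplane and the corresponding automorphisms commute.
\<close>

definition crossing_list ::
  "('i, 'a::euclidean_space, 'x) fixed_data \<Rightarrow> 'a set \<Rightarrow> nat \<Rightarrow>
     ('w, 'a, ('x, 'k::field_char_0) coeff_poly) diagram \<Rightarrow> (real \<Rightarrow> 'a) \<Rightarrow>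
     (real \<times> 'w) list \<Rightarrow> bool" where
  "crossing_list \<Gamma> P l D \<gamma> xs \<longleftrightarrow> distinct xs \<and> sorted (map fst xs) \<and>
     set xs = {(t, w). t \<in> {0..1} \<and> w \<in> sd_walls_mod \<Gamma> P l D \<and> \<gamma> t \<in> sd_supp D w}"

definition path_product_mod ::
  "('i, 'a::euclidean_space, 'x) fixed_data \<Rightarrow> 'a set \<Rightarrow> nat \<Rightarrow>
     ('w, 'a, ('x, 'k::field_char_0) coeff_poly) diagram \<Rightarrow> (real \<Rightarrow> 'a) \<Rightarrow>
     ('a \<Rightarrow> ('x, 'k) coeff_poly) \<Rightarrow> ('a \<Rightarrow> ('x, 'k) coeff_poly)" where
  "path_product_mod \<Gamma> P l D \<gamma> =
     fold (\<lambda>(t, w) g.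
        wall_aut \<Gamma> P (crossing_normal \<Gamma> (sd_supp D w) (velocity \<gamma> t)) (sd_fun D w) \<circ> g)
       (SOME xs. crossing_list \<Gamma> P l D \<gamma> xs) id"

text \<open>
  The limit over \<open>l\<close> in the \<open>J\<close>-adic topology: each coefficient is eventually constant.
\<close>

definition path_product ::
  "('i, 'a::euclidean_space, 'x) fixed_data \<Rightarrow> 'a set \<Rightarrow>
     ('w, 'a, ('x, 'k::field_char_0) coeff_poly) diagram \<Rightarrow> (real \<Rightarrow> 'a) \<Rightarrow>
     ('a \<Rightarrow> ('x, 'k) coeff_poly) \<Rightarrow> ('a \<Rightarrow> ('x, 'k) coeff_poly)" where
  "path_product \<Gamma> P D \<gamma> F =
     (\<lambda>m. THE c. \<forall>\<^sub>F l in sequentially. path_product_mod \<Gamma> P l D \<gamma> F m = c)"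

definition consistent_diagram ::
  "('i, 'a::euclidean_space, 'x) fixed_data \<Rightarrow> 'a set \<Rightarrow>
     ('w, 'a, ('x, 'k::field_char_0) coeff_poly) diagram \<Rightarrow> bool" where
  "consistent_diagram \<Gamma> P D \<longleftrightarrow>
     (\<forall>\<gamma> \<gamma>'. admissible_path D \<gamma> \<and> admissible_path D \<gamma>' \<and> \<gamma> 0 = \<gamma>' 0 \<and> \<gamma> 1 = \<gamma>' 1 \<longrightarrow>
        (\<forall>F\<in>carrier (completed_ring \<Gamma> P). path_product \<Gamma> P D \<gamma> F = path_product \<Gamma> P D \<gamma>' F))"

definition equivalent_diagrams ::
  "('i, 'a::euclidean_space, 'x) fixed_data \<Rightarrow> 'a set \<Rightarrow>
     ('v, 'a, ('x, 'k::field_char_0) coeff_poly) diagram \<Rightarrow>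
     ('w, 'a, ('x, 'k) coeff_poly) diagram \<Rightarrow> bool" where
  "equivalent_diagrams \<Gamma> P D D' \<longleftrightarrow>
     (\<forall>\<gamma>. admissible_path D \<gamma> \<and> admissible_path D' \<gamma> \<longrightarrow>
        (\<forall>F\<in>carrier (completed_ring \<Gamma> P). path_product \<Gamma> P D \<gamma> F = path_product \<Gamma> P D' \<gamma> F))"

section \<open>Generalized cluster scattering diagrams and their mutation\<close>

definition exchange_coeff ::
  "('i, 'a, 'x) fixed_data \<Rightarrow> 'i \<Rightarrow> nat \<Rightarrow> ('x, 'k::field_char_0) coeff_poly" where
  "exchange_coeff \<Gamma> i j = (if j = 0 \<or> j = fd_r \<Gamma> i then 1
     else Poly_Mapping.single (Poly_Mapping.single (fd_a \<Gamma> i j) 1) 1)"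

text \<open>\<open>1 + a\<^sub>i\<^sub>,\<^sub>1 z\<^sup>v + \<dots> + a\<^sub>i\<^sub>,\<^sub>r\<^sub>-\<^sub>1 z\<^bsup>(r-1)v\<^esup> + z\<^bsup>rv\<^esup>\<close> with \<open>r = r\<^sub>i\<close>.\<close>

definition exchange_fun ::
  "('i, 'a::euclidean_space, 'x) fixed_data \<Rightarrow> 'i \<Rightarrow> 'a \<Rightarrow>
     'a \<Rightarrow> ('x, 'k::field_char_0) coeff_poly" where
  "exchange_fun \<Gamma> i v =
     (\<lambda>m. \<Sum>j\<le>fd_r \<Gamma> i. if m = of_nat j *\<^sub>R v then exchange_coeff \<Gamma> i j else 0)"

definition is_initial_wall ::
  "('i, 'a::euclidean_space, 'x) fixed_data \<Rightarrow> ('i \<Rightarrow> 'a) \<Rightarrow> 'i \<Rightarrow>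
     ('w, 'a, ('x, 'k::field_char_0) coeff_poly) diagram \<Rightarrow> 'w \<Rightarrow> bool" where
  "is_initial_wall \<Gamma> e i D w \<longleftrightarrow>
     sd_supp D w = orth (e i) \<and> sd_fun D w = exchange_fun \<Gamma> i (p1 \<Gamma> (e i))"

definition outgoing_wall ::
  "('i, 'a::euclidean_space, 'x) fixed_data \<Rightarrow> ('i \<Rightarrow> 'a) \<Rightarrow> 'a set \<Rightarrow>
     ('w, 'a, ('x, 'k::field_char_0) coeff_poly) diagram \<Rightarrow> 'w \<Rightarrow> bool" where
  "outgoing_wall \<Gamma> e P D w \<longleftrightarrow>
     (\<exists>n0. wall_for \<Gamma> e P n0 (sd_supp D w) (sd_fun D w) \<and> p1 \<Gamma> n0 \<notin> sd_supp D w)"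

text \<open>\<open>D\<close> is a representative of the equivalence class \<open>\<DD>\<^sub>s\<close>.\<close>

definition cluster_scattering_diagram ::
  "('i, 'a::euclidean_space, 'x) fixed_data \<Rightarrow> ('i \<Rightarrow> 'a) \<Rightarrow> 'a set \<Rightarrow>
     ('w, 'a, ('x, 'k::field_char_0) coeff_poly) diagram \<Rightarrow> bool" where
  "cluster_scattering_diagram \<Gamma> e P D \<longleftrightarrow>
     scattering_diagram \<Gamma> e P D \<and> consistent_diagram \<Gamma> P D \<and>
     (\<exists>w0. inj_on w0 (fd_Iuf \<Gamma>) \<and> w0 ` fd_Iuf \<Gamma> \<subseteq> sd_index D \<and>
        (\<forall>i\<in>fd_Iuf \<Gamma>. is_initial_wall \<Gamma> e i D (w0 i)) \<and>
        (\<forall>w\<in>sd_index D - w0 ` fd_Iuf \<Gamma>. outgoing_wall \<Gamma> e P D w))"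

text \<open>
  No cancellation: the product of the functions of a non-empty family of walls through a general
  point is never \<open>1\<close> (in particular, no wall function is \<open>1\<close>). Every \<open>\<DD>\<^sub>s\<close> has such representatives.
  Mutation of diagrams is not compatible with equivalence on representatives that violate this: for
  instance, a pair of walls \<open>(\<dd>, f)\<close>, \<open>(\<dd>, f\<^sup>-\<^sup>1)\<close> with a normal vector \<open>n\<^sub>0 \<in> N\<^sup>+\<^sub>s\<close> outside
  \<open>N\<^sup>+\<close> of the mutated seed may be added to any diagram without changing its equivalence class, but its
  image need not consist of walls for the mutated seed.
\<close>

definition reduced_diagram ::
  "('i, 'a::euclidean_space, 'x) fixed_data \<Rightarrow> 'a set \<Rightarrow>
     ('w, 'a, ('x, 'k::field_char_0) coeff_poly) diagram \<Rightarrow> bool" where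
  "reduced_diagram \<Gamma> P D \<longleftrightarrow>
     (\<forall>x. x \<notin> sd_sing D \<longrightarrow>
        (\<forall>S. S \<noteq> {} \<and> S \<subseteq> {w \<in> sd_index D. x \<in> sd_supp D w} \<longrightarrow>
           (\<exists>l. \<not> cong_mod P l
              (finprod (completed_ring \<Gamma> P) (sd_fun D) (S \<inter> sd_walls_mod \<Gamma> P l D))
              \<one>\<^bsub>completed_ring \<Gamma> P\<^esub>)))"

text \<open>In the following, the sign \<open>+\<close> is \<^const>\<open>True\<close> and the sign \<open>-\<close> is \<^const>\<open>False\<close>.\<close>

definition halfspace :: "('i \<Rightarrow> 'a::euclidean_space) \<Rightarrow> 'i \<Rightarrow> bool \<Rightarrow> 'a set" where
  "halfspace e k s = (if s then {m. 0 \<le> e k \<bullet> m} else {m. e k \<bullet> m \<le> 0})"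

definition T_sign ::
  "('i, 'a::euclidean_space, 'x) fixed_data \<Rightarrow> ('i \<Rightarrow> 'a) \<Rightarrow> 'i \<Rightarrow> bool \<Rightarrow> 'a \<Rightarrow> 'a" where
  "T_sign \<Gamma> e k s m = (if s
     then m + (of_nat (fd_r \<Gamma> k) * ((of_nat (fd_d \<Gamma> k) *\<^sub>R e k) \<bullet> m)) *\<^sub>R p1 \<Gamma> (e k) else m)"

definition T_map ::
  "('i, 'a::euclidean_space, 'x) fixed_data \<Rightarrow> ('i \<Rightarrow> 'a) \<Rightarrow> 'i \<Rightarrow> 'a \<Rightarrow> 'a" where
  "T_map \<Gamma> e k m = T_sign \<Gamma> e k (m \<in> halfspace e k True) m"

text \<open>
  The replacement of the wall \<open>\<dd>\<^sub>k\<close> indexed by \<open>w\<close> gets the index \<open>(w, True)\<close>; the pieces of any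
  other wall \<open>w\<close> get the indices \<open>(w, True)\<close> and \<open>(w, False)\<close>. The bijection \<open>T\<^sub>k\<^sub>,\<^sub>\<plusminus>\<close> acts on series by
  \<open>z\<^sup>m \<mapsto> z\<^bsup>T(m)\<^esup>\<close>.
\<close>

definition mutate_diagram ::
  "('i, 'a::euclidean_space, 'x) fixed_data \<Rightarrow> ('i \<Rightarrow> 'a) \<Rightarrow> 'i \<Rightarrow>
     ('w, 'a, ('x, 'k::field_char_0) coeff_poly) diagram \<Rightarrow>
     ('w \<times> bool, 'a, ('x, 'k) coeff_poly) diagram" where
  "mutate_diagram \<Gamma> e k D =
     \<lparr>sd_index = {(w, s). w \<in> sd_index D \<and>
        (if is_initial_wall \<Gamma> e k D w then s
         else aff_dim (T_map \<Gamma> e k ` (sd_supp D w \<inter> halfspace e k s)) = int DIM('a) - 1)},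
      sd_supp = (\<lambda>(w, s). if is_initial_wall \<Gamma> e k D w then orth (e k)
         else T_map \<Gamma> e k ` (sd_supp D w \<inter> halfspace e k s)),
      sd_fun = (\<lambda>(w, s). if is_initial_wall \<Gamma> e k D w then exchange_fun \<Gamma> k (- p1 \<Gamma> (e k))
         else sd_fun D w \<circ> inv_into UNIV (T_sign \<Gamma> e k s))\<rparr>"

end

theory Submission
 imports Defs "HOL-Computational_Algebra.Formal_Power_Series"
begin

text \<open>
  The automorphisms attached to paths are encoded by kernels. For a consistent diagram they only depend
  on the end points, so they form a cocycle, and two diagrams with the same local functions at generic
  points have the same path products. It remains to compare the local functions of \<open>\<DD>\<^sub>s\<close> on each side
  of \<open>e\<^sub>k\<^sup>\<bottom>\<close> with those of the diagram of the mutated seed, transported by the linear maps \<open>T\<^sub>k\<^sub>,\<^sub>\<plusminus>\<close>.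
  This is an induction on the level \<open>\<Sum>i\<noteq>k. c\<^sub>i\<close> of \<open>n = \<Sum>i. c\<^sub>i e\<^sub>i\<close>, which is the same for both seeds and is
  positive for all walls that meet the complement of \<open>e\<^sub>k\<^sup>\<bottom>\<close>. In the lowest level where they could
  differ, the difference of the cocycles is additive, so the difference of the local functions is
  constant along \<open>n\<^sup>\<bottom>\<close> on each side of \<open>e\<^sub>k\<^sup>\<bottom>\<close>. On the side of \<open>p\<^sub>1\<^sup>*(n)\<close> it vanishes, because near
  \<open>p\<^sub>1\<^sup>*(n)\<close> there are only initial walls. The two sides are related by the crossing of \<open>e\<^sub>k\<^sup>\<bottom>\<close>, on monomials
  orthogonal to \<open>e\<^sub>k\<close> for both diagrams the multiplication by a power of the exchange polynomial; the two
  multiplications agree because this polynomial is palindromic. Reducedness of \<open>\<DD>\<^sub>s\<close> guarantees that all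
  normal vectors of the transported walls are positive for the mutated seed.
\<close>

text \<open>The maps \<open>T_{k,+}\<close> and \<open>T_{k,-}\<close> need not carry
  \<open>P\<close> into \<open>P'\<close>, so the automorphisms over the two completed rings cannot
  be compared as a whole. What is compared is the coefficient of a kernel at \<open>p1 n\<close> for
  n in \<open>fd_Nuf\<close>: injectivity of \<open>p1\<close> makes n unique, and both products
  become finite sums over splittings of n. Crossing e_k^perp produces exponents of level zero and
  would spoil additivity. Hence paths stay inside one open half-space, and the passage between the
  half-spaces is tested only on exponents m orthogonal to e_k, for which the crossing at the start
  of a path is trivial. Such m suffice: n of positive level is not parallel to e_k, so some such m
  pairs nontrivially with n, and the resulting integer factor cancels in characteristic zero. The
  crossing at the other end multiplies by the N-th power of the exchange polynomial, N = d_k |<e_k,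
  p1 n>|. Its degree is bounded by r_k N, and \<open>T_{k,+}\<close> shifts p1 n by exactly that
  multiple of p1 e_k, up to sign; so the sum for the mutated seed is the other one read
  backwards.\<close>

unbundle no vec_syntax
unbundle fps_syntax

section \<open>Integer powers of power series with constant term one\<close>

text \<open>The coefficients form only a commutative ring, so a general series has no inverse;
  constant term 1, which all wall functions have, makes \<open>fps_right_inverse g 1\<close>
  one.\<close>

definition fpow :: "'r::comm_ring_1 fps=>int=>'r fps" where
 "fpow g N = (if 0\<le>N then g ^ nat N else (fps_right_inverse g 1) ^ nat (- N))"

lemma fps_right_inverse_one:
 fixes g :: "'r::comm_ring_1 fps" assumes "g $ 0 = 1" shows "g * fps_right_inverse g 1 = 1"
 using fps_right_inverse[of g 1] assms by simp

lemma fpow_0 [simp]: "fpow g 0 = 1" by (simp add: fpow_def)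

lemma fpow_1 [simp]: "fpow g 1 = g" by (simp add: fpow_def)

lemma fpow_of_nat: "fpow g (int n) = g ^ n" by (simp add: fpow_def)

lemma fpow_nth_0: assumes "g $ 0 = (1::'r::comm_ring_1)" shows "fpow g N $ 0 = 1"
 using assms by (simp add: fpow_def fps_power_zeroth)

lemma fpow_uminus: assumes "g $ 0 = (1::'r::comm_ring_1)" shows "fpow g N * fpow g (- N) = 1"
proof -
 have "g ^ n * (fps_right_inverse g 1) ^ n = 1" for n
  using fps_right_inverse_one[OF assms] by (simp flip: power_mult_distrib)
 thus ?thesis by (cases "N = 0") (auto simp: fpow_def mult.commute)
qed

lemma fpow_Suc: assumes "g $ 0 = (1::'r::comm_ring_1)" shows "fpow g (N + 1) = g * fpow g N"
proof (cases "0\<le>N")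
 case True
 thus ?thesis by (simp add: fpow_def nat_add_distrib)
next
 case False
 hence eq: "nat (- N) = Suc (nat (- (N + 1)))" by simp
 have "g * fpow g N = g * fps_right_inverse g 1 * fps_right_inverse g 1 ^ nat (- (N + 1))"
  using False eq by (simp add: fpow_def mult.assoc)
 also have "\<dots> = fpow g (N + 1)" using False assms fps_right_inverse_one[OF assms] by (auto simp: fpow_def)
 finally show ?thesis by simp
qed

lemma fpow_add: assumes "g $ 0 = (1::'r::comm_ring_1)" shows "fpow g (N + M) = fpow g N * fpow g M"
proof -
 have pos: "fpow g (N + int n) = fpow g N * fpow g (int n)" for N n
 proof (induction n)
  case (Suc n)
  have "fpow g (N + int (Suc n)) = fpow g ((N + int n) + 1)" by (simp add: algebra_simps)
  also have "\<dots> = fpow g N * (g * fpow g (int n))" using fpow_Suc[OF assms] Suc by (simp add: mult.left_commute)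
  also have "g * fpow g (int n) = fpow g (int (Suc n))"
   using fpow_Suc[OF assms, of "int n"] by (simp add: algebra_simps)
  finally show ?case .
 qed simp
 show ?thesis
 proof (cases "0\<le>M")
  case True
  thus ?thesis using pos[of N "nat M"] by simp
 next
  case False
  hence "fpow g N = fpow g (N + M) * fpow g (- M)" using pos[of "N + M" "nat (- M)"] by simp
  hence "fpow g N * fpow g M = fpow g (N + M) * (fpow g (- M) * fpow g M)" by (simp add: mult.assoc)
  also have "fpow g (- M) * fpow g M = 1" using fpow_uminus[OF assms, of M] by (simp add: mult.commute)
  finally show ?thesis by simp
 qed
qed

lemma fpow_one [simp]: "fpow (1::'r::comm_ring_1 fps) N = 1"
proof -
 have "fps_right_inverse (1::'r fps) 1 = 1" using fps_right_inverse_one[of "1::'r fps"] by simp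
 thus ?thesis by (simp add: fpow_def)
qed

lemma fps_right_inverse_mult:
 fixes g h :: "'r::comm_ring_1 fps" assumes "g $ 0 = 1" "h $ 0 = 1"
 shows "fps_right_inverse (g * h) 1 = fps_right_inverse g 1 * fps_right_inverse h 1"
proof -
 let ?i = "\<lambda>g. fps_right_inverse g (1::'r)"
 have 1: "(g * h) * ?i (g * h) = 1" using assms by (intro fps_right_inverse_one) simp
 have 2: "(g * h) * (?i g * ?i h) = 1"
 proof -
  have "(g * h) * (?i g * ?i h) = (g * ?i g) * (h * ?i h)" by (simp only: mult_ac)
  thus ?thesis using fps_right_inverse_one[OF assms(1)] fps_right_inverse_one[OF assms(2)] by simp
 qed
 have "?i (g * h) = ?i (g * h) * ((g * h) * (?i g * ?i h))" using 2 by simp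
 also have "\<dots> = ((g * h) * ?i (g * h)) * (?i g * ?i h)" by (simp only: mult_ac)
 finally show ?thesis using 1 by simp
qed

lemma fpow_mult:
 fixes g h :: "'r::comm_ring_1 fps" assumes "g $ 0 = 1" "h $ 0 = 1" shows "fpow (g * h) N = fpow g N * fpow h N"
 using assms by (simp add: fpow_def power_mult_distrib fps_right_inverse_mult)

text \<open>With constant terms 1, the coefficient j of a product consists of the two extreme terms
  and of mixed terms in lower coefficients, and the latter cancel in the difference. This is the
  one-variable form of the additivity in the lowest degree that drives the main comparison.\<close>

lemma fps_mult_nth_diff:
 fixes a b :: "'r::comm_ring_1 fps" assumes "a $ 0 = 1" "a' $ 0 = 1" "b $ 0 = 1" "b' $ 0 = 1"
  and "\<And>i. i < j ==> a $ i = a' $ i" and "\<And>i. i < j ==> b $ i = b' $ i" and "0 < j"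
 shows "(a * b) $ j - (a' * b') $ j = (a $ j - a' $ j) + (b $ j - b' $ j)"
proof -
 have *: "(c * d) $ j = c $ j + d $ j + (\<Sum>i\<in>{0<..<j}. c $ i * d $ (j - i))"
  if "c $ 0 = 1" "d $ 0 = 1" for c d :: "'r fps"
 proof -
  have "{0..j} = insert 0 (insert j {0<..<j})" using \<open>0 < j\<close> by auto
  thus ?thesis using that \<open>0 < j\<close> by (simp add: fps_mult_nth)
 qed
 have "(\<Sum>i\<in>{0<..<j}. a $ i * b $ (j - i)) = (\<Sum>i\<in>{0<..<j}. a' $ i * b' $ (j - i))"
  using assms by (intro sum.cong) auto
 thus ?thesis using assms by (simp add: *)
qed

lemma fps_mult_nth_cong:
 fixes a b :: "'r::comm_ring_1 fps" assumes "\<And>i. i\<le>j ==> a $ i = a' $ i" and "\<And>i. i\<le>j ==> b $ i = b' $ i" and "i\<le>j"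
 shows "(a * b) $ i = (a' * b') $ i"
 unfolding fps_mult_nth by (intro sum.cong refl arg_cong2[where f = times]) (use assms in auto)

text \<open>Both claims share one induction, since additivity in degree j requires agreement of the
  powers below j. For a negative exponent, the product with the opposite power is 1 for both series,
  which transfers the claim with changed sign. In characteristic zero the second claim recovers a
  coefficient from any nonzero power.\<close>

lemma fpow_nth_diff_aux:
 fixes g h :: "'r::comm_ring_1 fps" assumes g: "g $ 0 = 1" and h: "h $ 0 = 1"
  and eq: "\<And>i. i < j ==> g $ i = h $ i" and j: "0 < j"
 shows "(\<forall>i<j. fpow g N $ i = fpow h N $ i) \<and> fpow g N $ j - fpow h N $ j = of_int N * (g $ j - h $ j)"
  (is "?Q N")
proof -
 have nat: "?Q (int n)" for n
 proof (induction n)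
  case (Suc n)
  have s: "fpow f (int (Suc n)) = f * fpow f (int n)" if "f $ 0 = 1" for f :: "'r fps"
   using fpow_Suc[OF that, of "int n"] by (simp add: add.commute)
  have "fpow g (int (Suc n)) $ i = fpow h (int (Suc n)) $ i" if "i < j" for i
   unfolding s[OF g] s[OF h] using that eq Suc by (intro fps_mult_nth_cong[where j = i]) auto
  moreover have "fpow g (int (Suc n)) $ j - fpow h (int (Suc n)) $ j
   = (g $ j - h $ j) + (fpow g (int n) $ j - fpow h (int n) $ j)" unfolding s[OF g] s[OF h] using Suc g h eq j
   by (intro fps_mult_nth_diff) (auto simp: fpow_nth_0)
  ultimately show ?case using Suc by (simp add: algebra_simps)
 qed simp
 show ?thesis
 proof (cases "0\<le>N")
  case True
  thus ?thesis using nat[of "nat N"] by simp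
 next
  case False
  define n where "n = nat (- N)"
  have N: "N = - int n" using False by (simp add: n_def)
  have q: "?Q (int n)" by (rule nat)
  have inv: "fpow g (int n) * fpow g N = 1" "fpow h (int n) * fpow h N = 1"
   unfolding N using fpow_uminus g h by blast+
  have lt: "fpow g N $ i = fpow h N $ i" if "i < j" for i using that
  proof (induction i rule: less_induct)
   case (less i)
   show ?case
   proof (cases "i = 0")
    case True
    thus ?thesis using g h by (simp add: fpow_nth_0)
   next
    case False
    have "(fpow g (int n) * fpow g N) $ i - (fpow h (int n) * fpow h N) $ i
     = (fpow g (int n) $ i - fpow h (int n) $ i) + (fpow g N $ i - fpow h N $ i)"
     using less False q g h by (intro fps_mult_nth_diff) (auto simp: fpow_nth_0)
    thus ?thesis using inv q less by simp
   qed
  qed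
  have "(fpow g (int n) * fpow g N) $ j - (fpow h (int n) * fpow h N) $ j
   = (fpow g (int n) $ j - fpow h (int n) $ j) + (fpow g N $ j - fpow h N $ j)"
   using lt q g h j by (intro fps_mult_nth_diff) (auto simp: fpow_nth_0)
  hence "fpow g N $ j - fpow h N $ j = - (of_int (int n) * (g $ j - h $ j))"
   using inv q by (simp add: eq_neg_iff_add_eq_0 add.commute)
  thus ?thesis using lt N by simp
 qed
qed

lemma fpow_nth_diff:
 fixes g h :: "'r::comm_ring_1 fps" assumes "g $ 0 = 1" "h $ 0 = 1" "\<And>i. i < j ==> g $ i = h $ i" "0 < j"
 shows "fpow g N $ j - fpow h N $ j = of_int N * (g $ j - h $ j)"
 by (rule conjunct2[OF fpow_nth_diff_aux]) (fact assms)+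

lemma fpow_nth_cong:
 fixes g h :: "'r::comm_ring_1 fps" assumes "g $ 0 = 1" "h $ 0 = 1" "\<And>i. i\<le>j ==> g $ i = h $ i"
 shows "fpow g N $ j = fpow h N $ j"
proof -
 have "\<forall>i<Suc j. fpow g N $ i = fpow h N $ i"
  by (rule conjunct1[OF fpow_nth_diff_aux]) (use assms in \<open>auto simp: less_Suc_eq_le\<close>)
 thus ?thesis by blast
qed

text \<open>Inverses of wall functions must stay over the subring \<open>coeff_ring\<close>. The
  recursion for the coefficients of the inverse uses only ring operations, because g has constant
  term 1.\<close>

lemma fps_right_inverse_closed:
 fixes g :: "'r::comm_ring_1 fps" assumes g: "g $ 0 = 1" "\<And>i. g $ i\<in>S"
  and S: "1\<in>S" "\<And>x y. x\<in>S ==> y\<in>S ==> x * y\<in>S" "\<And>x y. x\<in>S ==> y\<in>S ==> x - y\<in>S" shows "fps_right_inverse g 1 $ i\<in>S"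
proof (induction i rule: less_induct)
 case (less i)
 have zero: "0\<in>S" using S(1) S(3)[of 1 1] by simp
 have add: "x + y\<in>S" if "x\<in>S" "y\<in>S" for x y using S(3)[of x "0 - y"] S(3)[of 0 y] that zero by simp
 have sum: "sum f A\<in>S" if "\<And>a. a\<in>A ==> f a\<in>S" for f :: "nat=>'r" and A
  using that by (induction A rule: infinite_finite_induct) (auto simp: zero add)
 show ?case
 proof (cases "i = 0")
  case True
  thus ?thesis using S(1) by simp
 next
  case False
  have "0 = (\<Sum>k=0..i. g $ k * fps_right_inverse g 1 $ (i - k))"
   using fps_right_inverse_one[OF g(1)] False by (metis fps_mult_nth fps_one_nth)
  also have "\<dots> = fps_right_inverse g 1 $ i + (\<Sum>k=1..i. g $ k * fps_right_inverse g 1 $ (i - k))"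
   using g(1) by (simp add: sum.atLeast_Suc_atMost)
  finally have "fps_right_inverse g 1 $ i = 0 - (\<Sum>k=1..i. g $ k * fps_right_inverse g 1 $ (i - k))"
   by (simp add: eq_neg_iff_add_eq_0)
  moreover have "(\<Sum>k=1..i. g $ k * fps_right_inverse g 1 $ (i - k))\<in>S" using less g S by (intro sum S(2)) auto
  ultimately show ?thesis using S(3) zero by metis
 qed
qed

text \<open>Self-reciprocal polynomials of formal degree d; the value 0 beyond d encodes the degree
  bound, and d may exceed the true degree.\<close>

definition palindromic :: "nat=>'r::comm_ring_1 fps=>bool" where
 "palindromic d g \<longleftrightarrow> (\<forall>j. g $ j = (if j\<le>d then g $ (d - j) else 0))"

lemma palindromic_mult:
 fixes f g :: "'r::comm_ring_1 fps" assumes f: "palindromic d f" and g: "palindromic d' g"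
 shows "palindromic (d + d') (f * g)" unfolding palindromic_def
proof
 fix j
 define S where "S = (\<lambda>j. {(a, b). a\<le>d \<and> b\<le>d' \<and> a + b = j})"
 have fin: "finite (S j)" for j unfolding S_def by (rule finite_subset[of _ "{..d} \<times> {..d'}"]) auto
 have f0: "f $ i = 0" if "d < i" for i using f that unfolding palindromic_def by (metis not_le)
 have g0: "g $ i = 0" if "d' < i" for i using g that unfolding palindromic_def by (metis not_le)
 have coeff: "(f * g) $ j = (\<Sum>(a,b)\<in>S j. f $ a * g $ b)" for j
 proof -
  have "(f * g) $ j = (\<Sum>i\<in>{0..j}. f $ i * g $ (j - i))" by (simp add: fps_mult_nth)
  also have "\<dots> = (\<Sum>i\<in>{i\<in>{0..j}. i\<le>d \<and> j - i\<le>d'}. f $ i * g $ (j - i))"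
   by (intro sum.mono_neutral_right) (auto, (metis f0 g0 mult_zero_left mult_zero_right not_le)+)
  also have "\<dots> = (\<Sum>(a,b)\<in>S j. f $ a * g $ b)"
   by (rule sum.reindex_bij_witness[where i = "\<lambda>(a,b). a" and j = "\<lambda>a. (a, j - a)"]) (auto simp: S_def)
  finally show ?thesis .
 qed
 show "(f * g) $ j = (if j\<le>d + d' then (f * g) $ (d + d' - j) else 0)"
 proof (cases "j\<le>d + d'")
  case True
  have "(f * g) $ j = (\<Sum>(a,b)\<in>S (d + d' - j). f $ a * g $ b)" unfolding coeff
  \<comment> \<open>Reflecting both indices is an involution between the pairs of sum j and those of
    sum d + d' - j, and it preserves both factors.\<close>
  proof (rule sum.reindex_bij_witness[where i = "\<lambda>(a,b). (d - a, d' - b)" and j = "\<lambda>(a,b). (d - a, d' - b)"])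
   fix x assume "x\<in>S j"
   moreover obtain a b where "x = (a, b)" by fastforce
   moreover have "a\<le>d ==> f $ a = f $ (d - a)" "b\<le>d' ==> g $ b = g $ (d' - b)"
    using f g unfolding palindromic_def by metis+
   ultimately show "(case (case x of (a, b)=>(d - a, d' - b)) of (a, b)=>f $ a * g $ b) =
     (case x of (a, b)=>f $ a * g $ b)" by (auto simp: S_def)
  qed (use True in \<open>auto simp: S_def\<close>)
  thus ?thesis using True coeff by simp
 next
  case False
  hence "S j = {}" unfolding S_def by auto
  thus ?thesis using False coeff by simp
 qed
qed

lemma palindromic_power:
 fixes g :: "'r::comm_ring_1 fps" assumes "palindromic d g" shows "palindromic (n * d) (g ^ n)"
proof (induction n)
 case 0
 thus ?case by (simp add: palindromic_def)
next
 case (Suc n)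
 thus ?case using palindromic_mult[OF assms Suc] by (simp add: add.commute)
qed

section \<open>Kernels over a monoid with finite decompositions\<close>

text \<open>A kernel \<open>K\<close> stands for the linear map \<open>z\<^sup>m \<mapsto> \<Sum>q. K m q z\<^bsup>m+q\<^esup>\<close>.\<close>

locale toric_monoid =
 fixes P :: "'a::euclidean_space set" and ht :: 'a and kap :: real
 assumes zero_mem: "0\<in>P" and add_mem: "\<And>p q. p\<in>P ==> q\<in>P ==> p + q\<in>P"
  and kap_pos: "0 < kap" and ht_ge: "\<And>p. p\<in>P ==> p\<noteq>0 ==> kap\<le>ht\<bullet>p" and finite_ht: "\<And>c. finite {p\<in>P. ht\<bullet>p\<le>c}"
begin

definition dec :: "'a=>'a set" where "dec q = {p. p\<in>P \<and> q - p\<in>P}"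

lemma ht_nonneg: "p\<in>P ==> 0\<le>ht\<bullet>p" using ht_ge[of p] kap_pos by (cases "p = 0") auto

text \<open>The height is nonnegative on \<open>P\<close>, so no summand of q is higher than q; this
  makes all convolution sums finite.\<close>

lemma finite_dec [simp]: "finite (dec q)"
proof (rule finite_subset[OF _ finite_ht[of "ht\<bullet>q"]])
 show "dec q\<subseteq>{p\<in>P. ht\<bullet>p\<le>ht\<bullet>q}" unfolding dec_def using ht_nonneg by (auto simp: inner_diff_right dest: ht_nonneg)
qed

lemma pointed: "p\<in>P ==> - p\<in>P ==> p = 0" using ht_ge[of p] ht_nonneg[of "- p"] kap_pos by (cases "p = 0") auto

lemma dec_0: "dec 0 = {0}" unfolding dec_def using zero_mem pointed by auto

lemma dec_memD: "p\<in>dec q ==> q\<in>P" unfolding dec_def using add_mem[of p "q - p"] by auto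

lemma dec_empty: "q\<notin>P ==> dec q = {}" using dec_memD by blast

lemma dec_ends: "q\<in>P ==> 0\<in>dec q \<and> q\<in>dec q" unfolding dec_def using zero_mem by auto

lemma nat_scale_mem: "v\<in>P ==> of_nat j *\<^sub>R v\<in>P"
proof (induction j)
 case (Suc j)
 hence "of_nat j *\<^sub>R v + v\<in>P" using add_mem by blast
 thus ?case by (simp add: scaleR_add_left add.commute)
qed (simp add: zero_mem)

text \<open>Composition of the maps in path order: \<open>K1\<close> acts first, and
  \<open>K2\<close> then acts on the monomial of exponent m + p that it produced.\<close>

definition kstar :: "('a=>'a=>'r::comm_ring_1)=>('a=>'a=>'r)=>'a=>'a=>'r"
  (infixl \<open>\<star>\<close> 70) where "(K1\<star>K2) m q = (\<Sum>p\<in>dec q. K1 m p * K2 (m + p) (q - p))"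

definition kone :: "'a=>'a=>'r::comm_ring_1" where "kone m q = (if q = 0 then 1 else 0)"

definition ksupp :: "('a=>'a=>'r::comm_ring_1)=>bool" where "ksupp K \<longleftrightarrow> (\<forall>m q. K m q\<noteq>0 --> q\<in>P)"

lemma kstar_assoc: "(K1\<star>K2)\<star>K3 = K1\<star>(K2\<star>K3)"
proof (intro ext)
 fix m q
 have "((K1\<star>K2)\<star>K3) m q =
   (\<Sum>p\<in>dec q. \<Sum>r\<in>dec p. K1 m r * K2 (m + r) (p - r) * K3 (m + p) (q - p))"
  by (simp add: kstar_def sum_distrib_right)
 also have "\<dots> = (\<Sum>(p,r)\<in>(SIGMA p:dec q. dec p). K1 m r * K2 (m + r) (p - r) * K3 (m + p) (q - p))"
  by (rule sum.Sigma) auto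
 also have "\<dots> = (\<Sum>(r,p)\<in>(SIGMA r:dec q. dec (q - r)). K1 m r * (K2 (m + r) p * K3 (m + r + p) (q - r - p)))"
 proof (rule sum.reindex_bij_witness[where i = "\<lambda>(r,p). (r + p, r)" and j = "\<lambda>(p,r). (r, p - r)"])
  fix x assume x: "x\<in>(SIGMA p:dec q. dec p)"
  then obtain p r where [simp]: "x = (p, r)" and m: "p\<in>P" "q - p\<in>P" "r\<in>P" "p - r\<in>P" by (auto simp: dec_def)
  have "q - r\<in>P" using add_mem[OF m(2) m(4)] by simp
  thus "(case x of (p, r)=>(r, p - r))\<in>(SIGMA r:dec q. dec (q - r))" using m by (auto simp: dec_def)
  have "m + r + (p - r) = m + p" "q - r - (p - r) = q - p" by (simp_all add: algebra_simps)
  thus "(case case x of (p, r)=>(r, p - r) of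
     (r, p)=>K1 m r * (K2 (m + r) p * K3 (m + r + p) (q - r - p))) =
    (case x of (p, r)=>K1 m r * K2 (m + r) (p - r) * K3 (m + p) (q - p))"
   by (simp only: \<open>x = (p, r)\<close> split_conv mult.assoc)
 next
  fix x assume x: "x\<in>(SIGMA r:dec q. dec (q - r))"
  then obtain p r where [simp]: "x = (r, p)" and m: "r\<in>P" "q - r\<in>P" "p\<in>P" "q - r - p\<in>P" by (auto simp: dec_def)
  thus "(case x of (r, p)=>(r + p, r))\<in>(SIGMA p:dec q. dec p)"
   using add_mem[OF m(1) m(3)] by (auto simp: dec_def diff_diff_eq)
 qed auto
 also have "\<dots> = (\<Sum>r\<in>dec q. \<Sum>p\<in>dec (q - r). K1 m r * (K2 (m + r) p * K3 (m + r + p) (q - r - p)))"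
  by (rule sum.Sigma[symmetric]) auto
 also have "\<dots> = (K1\<star>(K2\<star>K3)) m q" by (simp add: kstar_def sum_distrib_left)
 finally show "((K1\<star>K2)\<star>K3) m q = (K1\<star>(K2\<star>K3)) m q" .
qed

lemma ksupp_kone [simp]: "ksupp kone" using zero_mem by (auto simp: ksupp_def kone_def)

lemma ksupp_kstar: "ksupp (K1\<star>K2)" unfolding ksupp_def kstar_def by (metis dec_empty sum.empty)

lemma kstar_kone_left [simp]: "ksupp K ==> kone\<star>K = K"
proof (intro ext)
 fix m q assume K: "ksupp K"
 have "(kone\<star>K) m q = (\<Sum>p\<in>dec q. if p = 0 then K (m + p) (q - p) else 0)"
  unfolding kstar_def kone_def by (intro sum.cong) auto
 also have "\<dots> = (if 0\<in>dec q then K m q else 0)" by simp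
 also have "\<dots> = K m q" using K zero_mem by (auto simp: dec_def ksupp_def)
 finally show "(kone\<star>K) m q = K m q" .
qed

lemma kstar_kone_right [simp]: "ksupp K ==> K\<star>kone = K"
proof (intro ext)
 fix m q assume K: "ksupp K"
 have "(K\<star>kone) m q = (\<Sum>p\<in>dec q. if p = q then K m p else 0)" unfolding kstar_def kone_def by (intro sum.cong) auto
 also have "\<dots> = (if q\<in>dec q then K m q else 0)" by simp
 also have "\<dots> = K m q" using K zero_mem by (auto simp: dec_def ksupp_def)
 finally show "(K\<star>kone) m q = K m q" .
qed

definition klist :: "('a=>'a=>'r::comm_ring_1) list=>'a=>'a=>'r" where "klist Ks = foldr (\<star>) Ks kone"

lemma klist_simps [simp]: "klist [] = kone" "klist (K # Ks) = K\<star>klist Ks" by (simp_all add: klist_def)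

lemma ksupp_klist [simp]: "ksupp (klist Ks)" by (cases Ks) (auto simp: ksupp_kstar)

lemma klist_append: "klist (Ks @ Ks') = klist Ks\<star>klist Ks'" by (induction Ks) (auto simp: kstar_assoc)

lemma kstar_0: "K1 m 0 = 1 ==> K2 m 0 = 1 ==> (K1\<star>K2) m 0 = 1" by (simp add: kstar_def dec_0)

lemma klist_0: "(\<And>K. K\<in>set Ks ==> K m 0 = 1) ==> klist Ks m 0 = 1" by (induction Ks) (auto simp: kone_def kstar_0)

text \<open>Complements of monomial ideals. Values of a product on such a set involve only values of
  the factors on the same set, which is what computing modulo an ideal power means for
  kernels.\<close>

definition down_closed :: "'a set=>bool" where "down_closed A \<longleftrightarrow> (\<forall>q\<in>A. dec q\<subseteq>A)"

lemma down_closedD: "down_closed A ==> q\<in>A ==> p\<in>dec q ==> p\<in>A \<and> q - p\<in>A"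
proof -
 assume A: "down_closed A" "q\<in>A" "p\<in>dec q"
 hence "q - p\<in>dec q" by (simp add: dec_def)
 thus ?thesis using A unfolding down_closed_def by blast
qed

lemma kstar_cong_on: assumes "down_closed A" "q\<in>A" and "\<And>m p. m\<in>M ==> p\<in>A ==> K1 m p = K1' m p"
  and "\<And>m p. m\<in>M ==> p\<in>A ==> K2 m p = K2' m p" and "m\<in>M" "\<And>p. p\<in>P ==> m + p\<in>M" shows "(K1\<star>K2) m q = (K1'\<star>K2') m q"
 unfolding kstar_def
proof (rule sum.cong)
 fix p assume p: "p\<in>dec q"
 hence "p\<in>A" "q - p\<in>A" using down_closedD assms by blast+
 thus "K1 m p * K2 (m + p) (q - p) = K1' m p * K2' (m + p) (q - p)" using assms p by (auto simp: dec_def)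
qed simp

lemma klist_cong_on: assumes "down_closed A" "q\<in>A" and "list_all2 (\<lambda>K K'. \<forall>m\<in>M. \<forall>p\<in>A. K m p = K' m p) Ks Ks'"
  and "m\<in>M" "\<And>m p. m\<in>M ==> p\<in>P ==> m + p\<in>M" shows "klist Ks m q = klist Ks' m q" using assms(3,2,4)
proof (induction Ks Ks' arbitrary: m q rule: list_all2_induct)
 case (Cons K Ks K' Ks')
 show ?case unfolding klist_simps
  by (rule kstar_cong_on[OF assms(1) Cons.prems(1), where M = M]) (use Cons assms(5) in auto)
qed simp

text \<open>The map of K respects products of monomials: the image of z^(m+m') is the product of the
  images of z^m and z^m'.\<close>

definition kmult :: "'a set=>('a=>'a=>'r::comm_ring_1)=>bool" where
 "kmult M K \<longleftrightarrow> (\<forall>m\<in>M. \<forall>m'\<in>M. \<forall>q. K (m + m') q = (\<Sum>p\<in>dec q. K m p * K m' (q - p)))"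

lemma kmult_kstar: assumes K1: "kmult M K1" and K2: "kmult M K2" and M: "\<And>m p. m\<in>M ==> p\<in>P ==> m + p\<in>M"
 shows "kmult M (K1\<star>K2)" unfolding kmult_def
proof (intro ballI allI)
 fix m m' q assume m: "m\<in>M" "m'\<in>M"
 define f where "f = (\<lambda>s p r. K1 m p * K1 m' (s - p) * K2 (m + p) r * K2 (m' + (s - p)) (q - s - r))"
 have "(K1\<star>K2) (m + m') q = (\<Sum>s\<in>dec q. \<Sum>p\<in>dec s. \<Sum>r\<in>dec (q - s). f s p r)" unfolding kstar_def
 proof (rule sum.cong)
  fix s assume "s\<in>dec q"
  have "K1 (m + m') s = (\<Sum>p\<in>dec s. K1 m p * K1 m' (s - p))" using K1 m unfolding kmult_def by blast
  moreover have "K2 (m + m' + s) (q - s) =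
    (\<Sum>r\<in>dec (q - s). K2 (m + p) r * K2 (m' + (s - p)) (q - s - r))" if "p\<in>dec s" for p
  proof -
   have "m + m' + s = (m + p) + (m' + (s - p))" by (simp add: algebra_simps)
   moreover have "m + p\<in>M" "m' + (s - p)\<in>M" using that m M by (auto simp: dec_def)
   ultimately show ?thesis using K2 unfolding kmult_def by metis
  qed
  ultimately have "K1 (m + m') s * K2 (m + m' + s) (q - s) =
    (\<Sum>p\<in>dec s. K1 m p * K1 m' (s - p) * (\<Sum>r\<in>dec (q - s). K2 (m + p) r * K2 (m' + (s - p)) (q - s - r)))"
   by (simp add: sum_distrib_right)
  also have "\<dots> = (\<Sum>p\<in>dec s. \<Sum>r\<in>dec (q - s). f s p r)" unfolding f_def by (simp add: sum_distrib_left mult.assoc)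
  finally show "K1 (m + m') s * K2 (m + m' + s) (q - s) = (\<Sum>p\<in>dec s. \<Sum>r\<in>dec (q - s). f s p r)" .
 qed simp
 also have "\<dots> = (\<Sum>(s,p,r)\<in>(SIGMA s:dec q. dec s \<times> dec (q - s)). f s p r)"
  by (simp add: sum.cartesian_product sum.Sigma)
 also have "\<dots> = (\<Sum>(a,p,p')\<in>(SIGMA a:dec q. dec a \<times> dec (q - a)).
   (K1 m p * K2 (m + p) (a - p)) * (K1 m' p' * K2 (m' + p') (q - a - p')))"
 \<comment> \<open>Here s is the shift that the first map makes on the product monomial, p the part
   of it due to m, and r the shift of the m-factor under the second map. Regrouped, a = p + r is the
   total shift of the m-factor and p' = s - p the first shift of the other factor.\<close>
 proof (rule sum.reindex_bij_witness[where i = "\<lambda>(a,p,p'). (p + p', p, a - p)"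
    and j = "\<lambda>(s,p,r). (p + r, p, s - p)"])
  fix x assume "x\<in>(SIGMA s:dec q. dec s \<times> dec (q - s))"
  then obtain s p r where [simp]: "x = (s, p, r)" and
   m: "s\<in>P" "q - s\<in>P" "p\<in>P" "s - p\<in>P" "r\<in>P" "q - s - r\<in>P" by (auto simp: dec_def)
  have "q - (p + r) = (q - s - r) + (s - p)" by simp
  hence "q - (p + r)\<in>P" using add_mem m by metis
  moreover have "q - (p + r) - (s - p) = q - s - r" "p + r - p = r" by (simp_all add: algebra_simps)
  ultimately show "(case x of (s, p, r)=>(p + r, p, s - p))\<in>(SIGMA a:dec q. dec a \<times> dec (q - a))"
   using m add_mem[of p r] by (simp only: dec_def split_conv mem_Sigma_iff mem_Times_iff mem_Collect_eq fst_conv snd_conv \<open>x = (s, p, r)\<close>)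
  show "(case case x of (s, p, r)=>(p + r, p, s - p) of
     (a, p, p')=>(K1 m p * K2 (m + p) (a - p)) * (K1 m' p' * K2 (m' + p') (q - a - p'))) =
     (case x of (s, p, r)=>f s p r)" unfolding f_def by (simp add: algebra_simps)
 next
  fix x assume "x\<in>(SIGMA a:dec q. dec a \<times> dec (q - a))"
  then obtain a p p' where [simp]: "x = (a, p, p')" and
   m: "a\<in>P" "q - a\<in>P" "p\<in>P" "a - p\<in>P" "p'\<in>P" "q - a - p'\<in>P" by (auto simp: dec_def)
  have "q - (p + p') = (q - a - p') + (a - p)" by simp
  hence "q - (p + p')\<in>P" using add_mem m by metis
  moreover have "q - (p + p') - (a - p) = q - a - p'" "p + p' - p = p'" by (simp_all add: algebra_simps)
  ultimately show "(case x of (a, p, p')=>(p + p', p, a - p))\<in>(SIGMA s:dec q. dec s \<times> dec (q - s))"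
   using m add_mem[of p p'] by (simp only: dec_def split_conv mem_Sigma_iff mem_Times_iff mem_Collect_eq fst_conv snd_conv \<open>x = (a, p, p')\<close>)
 qed auto
 also have "\<dots> = (\<Sum>a\<in>dec q. \<Sum>p\<in>dec a. \<Sum>p'\<in>dec (q - a).
   (K1 m p * K2 (m + p) (a - p)) * (K1 m' p' * K2 (m' + p') (q - a - p')))"
  by (simp add: sum.cartesian_product sum.Sigma)
 also have "\<dots> = (\<Sum>a\<in>dec q. (K1\<star>K2) m a * (K1\<star>K2) m' (q - a))" by (simp add: kstar_def sum_product)
 finally show "(K1\<star>K2) (m + m') q = (\<Sum>a\<in>dec q. (K1\<star>K2) m a * (K1\<star>K2) m' (q - a))" .
qed

lemma kmult_kone [simp]: "kmult M kone" unfolding kmult_def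
proof (intro ballI allI)
 fix m m' q
 have "(\<Sum>p\<in>dec q. kone m p * kone m' (q - p)) = (kone\<star>kone) m q" unfolding kstar_def kone_def by (rule refl)
 also have "\<dots> = kone m q" by (simp only: kstar_kone_left[OF ksupp_kone])
 finally show "kone (m + m') q = (\<Sum>p\<in>dec q. kone m p * kone m' (q - p))" unfolding kone_def by (rule sym)
qed

lemma kmult_klist: assumes "\<And>K. K\<in>set Ks ==> kmult M K" "\<And>m p. m\<in>M ==> p\<in>P ==> m + p\<in>M" shows "kmult M (klist Ks)"
 using assms(1)
proof (induction Ks)
 case (Cons K Ks)
 have "kmult M (K\<star>klist Ks)" by (rule kmult_kstar) (use Cons assms(2) in auto)
 thus ?case by simp
qed simp

text \<open>Consistency only controls kernels at \<open>m \<in> P\<close>; multiplicativity in \<open>m\<close> extends this to the whole lattice.\<close>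

lemma kmult_extend: assumes K: "kmult M K" "kmult M K'" and one: "\<And>m. K m 0 = 1" "\<And>m. K' m 0 = 1"
  and A: "down_closed A" and eq: "\<And>m q. m\<in>P ==> q\<in>A ==> K m q = K' m q" and M: "P\<subseteq>M" "m\<in>M" "p'\<in>P" "m + p'\<in>P"
  and q: "q\<in>A" "q\<in>P" shows "K m q = K' m q" using q
proof (induction "card (dec q)" arbitrary: q rule: less_induct)
 case less
 \<comment> \<open>Splitting off p = q, whose second factor is \<open>L p' 0 = 1\<close>, expresses
   \<open>L m q\<close> by a value at m + p' in \<open>P\<close> and by exponents with fewer
   decompositions.\<close>
 have *: "L (m + p') q = L m q + (\<Sum>p\<in>dec q - {q}. L m p * L p' (q - p))"
  if "kmult M L" "\<And>m. L m 0 = 1" for L :: "'a=>'a=>'b"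
 proof -
  have "L (m + p') q = (\<Sum>p\<in>dec q. L m p * L p' (q - p))" using that M unfolding kmult_def by blast
  also have "\<dots> = L m q * L p' (q - q) + (\<Sum>p\<in>dec q - {q}. L m p * L p' (q - p))"
   using dec_ends[OF less(3)] by (intro sum.remove) auto
  finally show ?thesis using that by simp
 qed
 have "K m p * K p' (q - p) = K' m p * K' p' (q - p)" if p: "p\<in>dec q - {q}" for p
 proof -
  have pA: "p\<in>A" "q - p\<in>A" using down_closedD[OF A less(2)] p by auto
  have sub: "dec p\<subseteq>dec q"
  proof
   fix r assume "r\<in>dec p"
   hence "r\<in>P" "p - r\<in>P" by (auto simp: dec_def)
   moreover have "q - r = (q - p) + (p - r)" by simp
   ultimately show "r\<in>dec q" using p add_mem unfolding dec_def by (metis (mono_tags, lifting) Diff_iff mem_Collect_eq)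
  qed
  have "q\<notin>dec p" using p pointed[of "q - p"] by (auto simp: dec_def)
  hence "dec p \<subset> dec q" using sub dec_ends[OF less(3)] by blast
  hence "card (dec p) < card (dec q)" by (intro psubset_card_mono) auto
  hence "K m p = K' m p" using less pA p by (auto simp: dec_def)
  thus ?thesis using eq[OF M(3) pA(2)] by simp
 qed
 hence "(\<Sum>p\<in>dec q - {q}. K m p * K p' (q - p)) = (\<Sum>p\<in>dec q - {q}. K' m p * K' p' (q - p))" by (intro sum.cong) auto
 moreover have "K (m + p') q = K' (m + p') q" using eq M less by blast
 ultimately show ?case using *[OF K(1) one(1)] *[OF K(2) one(2)] by simp
qed

section \<open>Powers of the maximal ideal\<close>

text \<open>Each of the l nonzero summands has height at least \<open>kap\<close>. Consequently
  every exponent lies outside some power of the ideal.\<close>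

lemma ideal_power_ht: "q\<in>ideal_power P l ==> real l * kap\<le>ht\<bullet>q"
proof -
 have *: "real (length ms) * kap\<le>ht\<bullet>sum_list ms" if "set ms\<subseteq>P - {0}" for ms using that
 proof (induction ms)
  case (Cons a ms)
  hence "kap\<le>ht\<bullet>a" using ht_ge by auto
  thus ?case using Cons by (simp add: inner_add_right algebra_simps)
 qed simp
 assume "q\<in>ideal_power P l"
 then obtain p ms where "q = p + sum_list ms" "p\<in>P" "length ms = l" "set ms\<subseteq>P - {0}"
  unfolding ideal_power_def by auto
 thus ?thesis using *[of ms] ht_nonneg[of p] by (simp add: inner_add_right)
qed

lemma ideal_power_escape: "\<exists>L. q\<notin>ideal_power P L"
proof -
 obtain L where "ht\<bullet>q < real L * kap" using kap_pos reals_Archimedean3 by blast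
 thus ?thesis using ideal_power_ht[of q L] by force
qed

lemma ideal_power_mem: "q\<in>ideal_power P l ==> q\<in>P"
proof -
 have *: "sum_list ms\<in>P" if "set ms\<subseteq>P - {0}" for ms using that by (induction ms) (auto simp: zero_mem add_mem)
 show "q\<in>ideal_power P l ==> q\<in>P" unfolding ideal_power_def using * add_mem by blast
qed

lemma ideal_power_add: "q\<in>ideal_power P l ==> p\<in>P ==> q + p\<in>ideal_power P l"
proof -
 assume "q\<in>ideal_power P l" "p\<in>P"
 then obtain q' ms where "q = q' + sum_list ms" "q'\<in>P" "length ms = l" "set ms\<subseteq>P - {0}"
  unfolding ideal_power_def by auto
 moreover from this have "q + p = (q' + p) + sum_list ms" "q' + p\<in>P"
  using add_mem \<open>p\<in>P\<close> by (auto simp: algebra_simps)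
 ultimately show ?thesis unfolding ideal_power_def by blast
qed

lemma ideal_power_antimono: "l\<le>l' ==> ideal_power P l'\<subseteq>ideal_power P l"
proof
 fix q assume l: "l\<le>l'" and "q\<in>ideal_power P l'"
 then obtain p ms where q: "q = p + sum_list ms" "p\<in>P" "length ms = l'" "set ms\<subseteq>P - {0}"
  unfolding ideal_power_def by auto
 have drop: "sum_list (drop l ms)\<in>P"
  using ideal_power_mem[of "0 + sum_list (drop l ms)" "length (drop l ms)"] q zero_mem
  unfolding ideal_power_def by (fastforce dest: in_set_dropD)
 have "q = (p + sum_list (drop l ms)) + sum_list (take l ms)"
  using q by (metis add.commute add.left_commute append_take_drop_id sum_list.append)
 moreover have "length (take l ms) = l" "set (take l ms)\<subseteq>P - {0}" using q l by (auto dest: in_set_takeD)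
 ultimately show "q\<in>ideal_power P l" unfolding ideal_power_def using drop add_mem q(2) by blast
qed

lemma down_closed_ideal_power: "down_closed (- ideal_power P l)"
proof -
 have "q\<in>ideal_power P l" if "p\<in>ideal_power P l" "p\<in>dec q" for p q
  using ideal_power_add[OF that(1), of "q - p"] that(2) by (auto simp: dec_def)
 thus ?thesis unfolding down_closed_def by auto
qed

lemma nat_scale_ideal_power: assumes "v\<in>P" "v\<noteq>0" "l\<le>j" shows "of_nat j *\<^sub>R v\<in>ideal_power P l"
proof -
 have "sum_list (replicate l v) = of_nat l *\<^sub>R v" by (induction l) (auto simp: scaleR_add_left)
 hence "of_nat j *\<^sub>R v = of_nat (j - l) *\<^sub>R v + sum_list (replicate l v)"
  using assms by (simp add: of_nat_diff flip: scaleR_add_left)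
 thus ?thesis unfolding ideal_power_def using assms nat_scale_mem by fastforce
qed

end

section \<open>The completed ring and functions supported on a ray\<close>

text \<open>The one-variable series g evaluated at z^v. The description operator is well defined for
  nonzero v, where a multiple of v determines its factor.\<close>

definition ray :: "'a::real_vector=>'r::comm_ring_1 fps=>'a=>'r" where
 "ray v g q = (if \<exists>j::nat. q = of_nat j *\<^sub>R v then g $ (THE j::nat. q = of_nat j *\<^sub>R v) else 0)"

definition ray_series :: "'a::real_vector=>('a=>'r::comm_ring_1)=>'r fps" where
 "ray_series v f = Abs_fps (\<lambda>j. f (of_nat j *\<^sub>R v))"

lemma ray_nth [simp]: assumes "v\<noteq>0" shows "ray v g (of_nat j *\<^sub>R v) = g $ j"
proof -
 have "(THE i::nat. of_nat j *\<^sub>R v = of_nat i *\<^sub>R v) = j" using assms by (intro the_equality) auto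
 thus ?thesis by (auto simp: ray_def)
qed

lemma ray_0 [simp]: "v\<noteq>0 ==> ray v g 0 = g $ 0" using ray_nth[of v g 0] by simp

lemma ray_off: "(\<And>j::nat. q\<noteq>of_nat j *\<^sub>R v) ==> ray v g q = 0" by (auto simp: ray_def)

lemma ray_nonzeroD: "ray v g q\<noteq>0 ==> \<exists>j::nat. q = of_nat j *\<^sub>R v" using ray_off by metis

lemma ray_series_nth [simp]: "ray_series v f $ j = f (of_nat j *\<^sub>R v)" by (simp add: ray_series_def)

lemma ray_ray_series: assumes "v\<noteq>0" "\<And>m. f m\<noteq>0 ==> \<exists>j::nat. m = of_nat j *\<^sub>R v" shows "ray v (ray_series v f) = f"
proof
 fix q
 show "ray v (ray_series v f) q = f q"
 proof (cases "\<exists>j::nat. q = of_nat j *\<^sub>R v")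
  case True
  thus ?thesis using assms(1) by auto
 next
  case False
  thus ?thesis using assms(2) ray_off by metis
 qed
qed

lemma ray_one: "v\<noteq>0 ==> ray v 1 q = (if q = 0 then 1 else 0)"
proof (cases "\<exists>j::nat. q = of_nat j *\<^sub>R v")
 case True
 assume "v\<noteq>0"
 with True show ?thesis by auto
next
 case False
 hence "q\<noteq>0" by (metis of_nat_0 scale_zero_left)
 thus ?thesis using False ray_off by metis
qed

lemma ray_linear_image: assumes "linear f" "inj f" "v\<noteq>0" shows "ray (f v) g (f q) = ray v g q"
proof -
 have fv: "f v\<noteq>0" using assms by (metis injD linear_0)
 have sc: "f (of_nat j *\<^sub>R v) = of_nat j *\<^sub>R f v" for j using assms by (simp add: linear_scale)
 show ?thesis
 proof (cases "\<exists>j::nat. q = of_nat j *\<^sub>R v")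
  case True
  thus ?thesis using fv assms(3) sc by auto
 next
  case False
  hence "\<And>j::nat. f q\<noteq>of_nat j *\<^sub>R f v" using sc assms(2) by (metis injD)
  thus ?thesis using False ray_off by metis
 qed
qed

text \<open>Kernel of the wall-crossing automorphism z^m -> z^m f^<n,m> with f = g(z^v). The pairing
  is an integer for the lattice vectors concerned, and the floor only converts its type.\<close>

definition wk :: "'a::euclidean_space=>'a=>'r::comm_ring_1 fps=>'a=>'a=>'r" where
 "wk n v g m q = ray v (fpow g \<lfloor>n\<bullet>m\<rfloor>) q"

lemma coeff_ring_closed: shows coeff_ring_0: "0\<in>coeff_ring Fd" and coeff_ring_1: "1\<in>coeff_ring Fd"
  and coeff_ring_add: "x\<in>coeff_ring Fd ==> y\<in>coeff_ring Fd ==> x + y\<in>coeff_ring Fd"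
  and coeff_ring_diff: "x\<in>coeff_ring Fd ==> y\<in>coeff_ring Fd ==> x - y\<in>coeff_ring Fd"
  and coeff_ring_mult: "x\<in>coeff_ring Fd ==> y\<in>coeff_ring Fd ==> x * y\<in>coeff_ring Fd"
proof -
 show "0\<in>coeff_ring Fd" by (simp add: coeff_ring_def)
 show "1\<in>coeff_ring Fd" by (simp add: coeff_ring_def)
 show "x\<in>coeff_ring Fd ==> y\<in>coeff_ring Fd ==> x + y\<in>coeff_ring Fd"
  unfolding coeff_ring_def using Poly_Mapping.keys_add[of x y] by blast
 show "x\<in>coeff_ring Fd ==> y\<in>coeff_ring Fd ==> x - y\<in>coeff_ring Fd"
  unfolding coeff_ring_def using keys_diff[of x y] by blast
 show "x * y\<in>coeff_ring Fd" if xy: "x\<in>coeff_ring Fd" "y\<in>coeff_ring Fd" unfolding coeff_ring_def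
 proof (intro CollectI ballI)
  fix u assume "u\<in>Poly_Mapping.keys (x * y)"
  then obtain a b where "u = a + b" "a\<in>Poly_Mapping.keys x" "b\<in>Poly_Mapping.keys y" using keys_mult[of x y] by blast
  thus "Poly_Mapping.keys u\<subseteq>{fd_a Fd i j |i j. i\<in>fd_I Fd \<and> j\<in>{0<..<fd_r Fd i}}"
   using xy Poly_Mapping.keys_add[of a b] unfolding coeff_ring_def by fast
 qed
qed

lemma coeff_ring_sum: "(\<And>a. a\<in>A ==> f a\<in>coeff_ring Fd) ==> sum f A\<in>coeff_ring Fd"
 by (induction A rule: infinite_finite_induct) (auto simp: coeff_ring_0 coeff_ring_add)

lemma coeff_ring_power: "(\<And>j. g $ j\<in>coeff_ring Fd) ==> (g ^ n) $ j\<in>coeff_ring Fd"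
proof (induction n arbitrary: j)
 case 0
 thus ?case by (simp add: coeff_ring_0 coeff_ring_1)
next
 case (Suc n)
 thus ?case by (auto simp: fps_mult_nth intro!: coeff_ring_sum coeff_ring_mult)
qed

lemma coeff_ring_inverse: "(\<And>j. g $ j\<in>coeff_ring Fd) ==> g $ 0 = 1 ==> fps_right_inverse g 1 $ j\<in>coeff_ring Fd"
 by (rule fps_right_inverse_closed) (auto intro: coeff_ring_1 coeff_ring_mult coeff_ring_diff)

context toric_monoid
begin

lemma completed_ring_sel [simp]: "mult (completed_ring Fd P) F G = (\<lambda>m. \<Sum>p\<in>dec m. F p * G (m - p))"
 "one (completed_ring Fd P) = (\<lambda>m. if m = 0 then 1 else 0)"
 "F\<in>carrier (completed_ring Fd P) \<longleftrightarrow> (\<forall>m. F m\<in>coeff_ring Fd) \<and> (\<forall>m. m\<notin>P --> F m = 0)"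
 by (simp_all add: completed_ring_def dec_def)

lemma comm_monoid_completed_ring: "Group.comm_monoid (completed_ring Fd P)"
proof (rule comm_monoidI)
 let ?R = "completed_ring Fd P"
 show "F \<otimes>\<^bsub>?R\<^esub> G\<in>carrier ?R" if "F\<in>carrier ?R" "G\<in>carrier ?R" for F G
  using that by (auto simp: dec_empty intro!: coeff_ring_sum coeff_ring_mult)
 show "\<one>\<^bsub>?R\<^esub>\<in>carrier ?R" using zero_mem by (auto simp: coeff_ring_0 coeff_ring_1)
 show "F \<otimes>\<^bsub>?R\<^esub> G \<otimes>\<^bsub>?R\<^esub> H = F \<otimes>\<^bsub>?R\<^esub> (G \<otimes>\<^bsub>?R\<^esub> H)" for F G H
 proof
  fix m
  have "((\<lambda>_. (\<lambda>m. ((\<lambda>_. F)\<star>(\<lambda>_. G)) 0 m))\<star>(\<lambda>_. H)) 0 m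
    = ((\<lambda>_. F)\<star>(\<lambda>_. (\<lambda>m. ((\<lambda>_. G)\<star>(\<lambda>_. H)) 0 m))) 0 m" using kstar_assoc[of "\<lambda>_. F" "\<lambda>_. G" "\<lambda>_. H"]
   by (simp add: kstar_def fun_eq_iff)
  thus "(F \<otimes>\<^bsub>?R\<^esub> G \<otimes>\<^bsub>?R\<^esub> H) m = (F \<otimes>\<^bsub>?R\<^esub> (G \<otimes>\<^bsub>?R\<^esub> H)) m" by (simp add: kstar_def)
 qed
 show "\<one>\<^bsub>?R\<^esub> \<otimes>\<^bsub>?R\<^esub> F = F" if "F\<in>carrier ?R" for F
 proof
  fix m
  have "ksupp (\<lambda>_. F)" using that by (auto simp: ksupp_def)
  hence "(kone\<star>(\<lambda>_. F)) 0 m = F m" by simp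
  thus "(\<one>\<^bsub>?R\<^esub> \<otimes>\<^bsub>?R\<^esub> F) m = F m" unfolding kstar_def kone_def by simp
 qed
 show "F \<otimes>\<^bsub>?R\<^esub> G = G \<otimes>\<^bsub>?R\<^esub> F" for F G
 proof
  fix m
  show "(F \<otimes>\<^bsub>?R\<^esub> G) m = (G \<otimes>\<^bsub>?R\<^esub> F) m" unfolding completed_ring_sel
   by (rule sum.reindex_bij_witness[where i = "\<lambda>p. m - p" and j = "\<lambda>p. m - p"]) (auto simp: dec_def mult.commute)
 qed
qed

text \<open>Decompositions of a point of the ray into elements off the ray contribute nothing, so
  the multiplication of the completed ring restricts to the product of power series.\<close>

lemma conv_ray: assumes v: "v\<in>P" "v\<noteq>0" shows "(\<Sum>p\<in>dec q. ray v g p * ray v h (q - p)) = ray v (g * h) q"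
proof (cases "\<exists>j::nat. q = of_nat j *\<^sub>R v")
 case False
 have "ray v g p * ray v h (q - p) = 0" for p
 proof (rule ccontr)
  assume "ray v g p * ray v h (q - p)\<noteq>0"
  then obtain i j :: nat where "p = of_nat i *\<^sub>R v" "q - p = of_nat j *\<^sub>R v"
   by (metis mult_zero_left mult_zero_right ray_nonzeroD)
  hence "q = of_nat (i + j) *\<^sub>R v"
   by (metis add_diff_cancel_left' diff_add_cancel of_nat_add scaleR_add_left add.commute)
  with False show False by blast
 qed
 thus ?thesis using False by (simp add: ray_off)
next
 case True
 then obtain j :: nat where q: "q = of_nat j *\<^sub>R v" by blast
 have diff: "q - of_nat i *\<^sub>R v = of_nat (j - i) *\<^sub>R v" if "i\<le>j" for i
  using that q by (simp add: of_nat_diff scaleR_diff_left)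
 have inj: "inj_on (\<lambda>i::nat. of_nat i *\<^sub>R v) A" for A using v by (auto simp: inj_on_def)
 have "(\<Sum>p\<in>dec q. ray v g p * ray v h (q - p)) =
   (\<Sum>p\<in>(\<lambda>i::nat. of_nat i *\<^sub>R v) ` {0..j}. ray v g p * ray v h (q - p))"
 proof (rule sum.mono_neutral_right)
  show "(\<lambda>i::nat. of_nat i *\<^sub>R v) ` {0..j}\<subseteq>dec q"
   using nat_scale_mem[OF v(1)] by (auto simp: dec_def diff simp del: of_nat_diff)
  show "\<forall>p\<in>dec q - (\<lambda>i::nat. of_nat i *\<^sub>R v) ` {0..j}. ray v g p * ray v h (q - p) = 0"
  proof (rule ballI, rule ccontr)
   fix p assume p: "p\<in>dec q - (\<lambda>i::nat. of_nat i *\<^sub>R v) ` {0..j}" and "ray v g p * ray v h (q - p)\<noteq>0"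
   then obtain i i' :: nat where i: "p = of_nat i *\<^sub>R v" "q - p = of_nat i' *\<^sub>R v"
    by (metis mult_zero_left mult_zero_right ray_nonzeroD)
   hence "of_nat j *\<^sub>R v = of_nat (i + i') *\<^sub>R v"
    by (metis q add_diff_cancel_left' diff_add_cancel of_nat_add scaleR_add_left add.commute)
   hence "j = i + i'" using v by (metis of_nat_eq_iff scaleR_cancel_right)
   thus False using p i by auto
  qed
 qed simp
 also have "\<dots> = (\<Sum>i\<in>{0..j}. g $ i * h $ (j - i))" unfolding sum.reindex[OF inj] o_def
  by (rule sum.cong) (simp_all add: v(2) diff del: of_nat_diff)
 also have "\<dots> = ray v (g * h) q" using v q by (simp add: fps_mult_nth)
 finally show ?thesis .
qed

lemma ray_carrier: assumes "v\<in>P" "\<And>j. g $ j\<in>coeff_ring Fd" shows "ray v g\<in>carrier (completed_ring Fd P)"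
 unfolding completed_ring_sel
proof (intro conjI allI impI)
 show "ray v g m\<in>coeff_ring Fd" for m using assms by (simp add: ray_def coeff_ring_0)
 show "ray v g m = 0" if "m\<notin>P" for m using that nat_scale_mem[OF assms(1)] ray_nonzeroD by metis
qed

lemma ray_nat_pow: assumes "v\<in>P" "v\<noteq>0" shows "ray v g [^]\<^bsub>completed_ring Fd P\<^esub> (n::nat) = ray v (g ^ n)"
proof (induction n)
 case 0
 thus ?case by (simp add: fun_eq_iff ray_one[OF assms(2)])
next
 case (Suc n)
 thus ?case by (simp add: fun_eq_iff conv_ray[OF assms] power_Suc2 del: power_Suc)
qed

text \<open>A negative power in the ring is defined through the inverse in its multiplicative
  monoid; uniqueness of inverses identifies it with the series built from
  \<open>fps_right_inverse\<close>.\<close>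

lemma ray_int_pow: assumes v: "v\<in>P" "v\<noteq>0" and g: "g $ 0 = 1" "\<And>j. g $ j\<in>coeff_ring Fd"
 shows "ray v g [^]\<^bsub>completed_ring Fd P\<^esub> (N::int) = ray v (fpow g N)"
proof (cases "N < 0")
 case False
 thus ?thesis by (simp add: int_pow_def2 fpow_def ray_nat_pow[OF v])
next
 case True
 let ?R = "completed_ring Fd P"
 interpret R: Group.comm_monoid ?R by (rule comm_monoid_completed_ring)
 define n where "n = nat (- N)"
 have gn: "(g ^ n) $ j\<in>coeff_ring Fd" for j by (rule coeff_ring_power) (rule g)
 have hn: "(fps_right_inverse g 1 ^ n) $ j\<in>coeff_ring Fd" for j by (intro coeff_ring_power coeff_ring_inverse g)
 have one: "g ^ n * fps_right_inverse g 1 ^ n = 1"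
  using fps_right_inverse_one[OF g(1)] by (simp flip: power_mult_distrib)
 have "inv\<^bsub>?R\<^esub> (ray v (g ^ n)) = ray v (fps_right_inverse g 1 ^ n)"
 proof (rule R.comm_inv_char)
  show "ray v (g ^ n) \<otimes>\<^bsub>?R\<^esub> ray v (fps_right_inverse g 1 ^ n) = \<one>\<^bsub>?R\<^esub>"
   by (simp add: fun_eq_iff conv_ray[OF v] one ray_one[OF v(2)])
 qed (intro ray_carrier v gn hn)+
 thus ?thesis using True by (simp add: int_pow_def2 fpow_def n_def ray_nat_pow[OF v])
qed

lemma ray_finprod: assumes v: "v\<in>P" "v\<noteq>0" and "finite S"
  and "\<And>w j. w\<in>S ==> g w $ j\<in>coeff_ring Fd" "\<And>w. w\<in>S ==> F w = ray v (g w)"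
 shows "finprod (completed_ring Fd P) F S = ray v (\<Prod>w\<in>S. g w)" using assms(3-5)
proof (induction S rule: finite_induct)
 case empty
 interpret R: Group.comm_monoid "completed_ring Fd P" by (rule comm_monoid_completed_ring)
 show ?case by (simp add: fun_eq_iff ray_one[OF v(2)])
next
 case (insert w S)
 interpret R: Group.comm_monoid "completed_ring Fd P" by (rule comm_monoid_completed_ring)
 have "F x\<in>carrier (completed_ring Fd P)" if "x\<in>insert w S" for x
  using insert.prems that ray_carrier[OF v(1)] by metis
 hence "finprod (completed_ring Fd P) F (insert w S) =
   F w \<otimes>\<^bsub>completed_ring Fd P\<^esub> finprod (completed_ring Fd P) F S" using insert.hyps by (intro R.finprod_insert) auto
 also have "\<dots> = ray v (g w * (\<Prod>w\<in>S. g w))" using insert by (simp add: fun_eq_iff conv_ray[OF v])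
 finally show ?case using insert.hyps by simp
qed

lemma ksupp_wk: "v\<in>P ==> ksupp (wk n v g)" unfolding ksupp_def wk_def using ray_nonzeroD nat_scale_mem by blast

lemma wk_0: "v\<noteq>0 ==> g $ 0 = 1 ==> wk n v g m 0 = 1" by (simp add: wk_def fpow_nth_0)

lemma wk_one: "v\<noteq>0 ==> wk n v 1 = kone" by (simp add: wk_def kone_def fun_eq_iff ray_one)

lemma kmult_wk: assumes v: "v\<in>P" "v\<noteq>0" and g: "g $ 0 = 1" and n: "\<And>m. m\<in>M ==> n\<bullet>m\<in>\<int>" shows "kmult M (wk n v g)"
 unfolding kmult_def wk_def
proof (intro ballI allI)
 fix m m' q assume "m\<in>M" "m'\<in>M"
 hence "\<lfloor>n\<bullet>(m + m')\<rfloor> = \<lfloor>n\<bullet>m\<rfloor> + \<lfloor>n\<bullet>m'\<rfloor>" using n[of m] by (auto simp: inner_add_right elim!: Ints_cases)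
 thus "ray v (fpow g \<lfloor>n\<bullet>(m + m')\<rfloor>) q =
   (\<Sum>p\<in>dec q. ray v (fpow g \<lfloor>n\<bullet>m\<rfloor>) p * ray v (fpow g \<lfloor>n\<bullet>m'\<rfloor>) (q - p))" by (simp add: conv_ray[OF v] fpow_add[OF g])
qed

text \<open>As n is orthogonal to v, the first crossing moves m by multiples of v only and leaves
  the exponent of the second crossing unchanged. Walls in a common hyperplane therefore compose by
  multiplying their functions.\<close>

lemma kstar_wk: assumes v: "v\<in>P" "v\<noteq>0" and g: "g $ 0 = 1" "h $ 0 = 1" and n: "n\<bullet>v = 0"
 shows "wk n v g\<star>wk n v h = wk n v (g * h)"
proof (intro ext)
 fix m q
 have "(wk n v g\<star>wk n v h) m q =
   (\<Sum>p\<in>dec q. ray v (fpow g \<lfloor>n\<bullet>m\<rfloor>) p * ray v (fpow h \<lfloor>n\<bullet>m\<rfloor>) (q - p))" unfolding kstar_def wk_def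
 proof (rule sum.cong)
  fix p
  show "ray v (fpow g \<lfloor>n\<bullet>m\<rfloor>) p * ray v (fpow h \<lfloor>n\<bullet>(m + p)\<rfloor>) (q - p) =
    ray v (fpow g \<lfloor>n\<bullet>m\<rfloor>) p * ray v (fpow h \<lfloor>n\<bullet>m\<rfloor>) (q - p)"
  proof (cases "ray v (fpow g \<lfloor>n\<bullet>m\<rfloor>) p = 0")
   case False
   then obtain j :: nat where "p = of_nat j *\<^sub>R v" using ray_nonzeroD by blast
   thus ?thesis using n by (simp add: inner_add_right)
  qed simp
 qed simp
 also have "\<dots> = wk n v (g * h) m q" by (simp add: wk_def conv_ray[OF v] fpow_mult[OF g])
 finally show "(wk n v g\<star>wk n v h) m q = wk n v (g * h) m q" .
qed

text \<open>A series F is treated as the constant kernel \<open>\<lambda>_. F\<close> evaluated at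
  0, so that applying automorphisms and composing them share one product and its
  associativity.\<close>

lemma wall_aut_eq: assumes v: "v\<in>P" "v\<noteq>0" and f: "f\<in>carrier (completed_ring Fd P)" "f 0 = 1"
  "\<And>m. f m\<noteq>0 ==> \<exists>j::nat. m = of_nat j *\<^sub>R v" shows "wall_aut Fd P n f F = ((\<lambda>_. F)\<star>wk n v (ray_series v f)) 0"
proof -
 have "ray v (ray_series v f) = f" by (rule ray_ray_series) (use v f in auto)
 moreover have "ray v (ray_series v f) [^]\<^bsub>completed_ring Fd P\<^esub> N = ray v (fpow (ray_series v f) N)" for N :: int
  by (rule ray_int_pow) (use v f in auto)
 ultimately have "f [^]\<^bsub>completed_ring Fd P\<^esub> N = ray v (fpow (ray_series v f) N)" for N :: int by simp
 thus ?thesis by (simp add: wall_aut_def fun_eq_iff kstar_def wk_def dec_def)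
qed

end

section \<open>Lattices\<close>

lemma lattice_basis_span:
 fixes b :: "'i=>'a::euclidean_space" assumes "lattice_basis I b L" "card I = DIM('a)" shows "span (b ` I) = UNIV"
proof -
 have "card (b ` I) = DIM('a)" using assms unfolding lattice_basis_def by (simp add: card_image)
 hence "UNIV\<subseteq>span (b ` I)" using assms unfolding lattice_basis_def by (intro card_ge_dim_independent) auto
 thus ?thesis by blast
qed

lemma lattice_basis_dual:
 fixes b :: "'i=>'a::euclidean_space" assumes "lattice_basis I b L"
 shows "\<exists>w. \<forall>i\<in>I. \<forall>j\<in>I. b j\<bullet>w i = (if j = i then 1 else 0)"
proof -
 have "\<exists>w. \<forall>j\<in>I. b j\<bullet>w = (if j = i then 1 else 0)" if i: "i\<in>I" for i
 proof -
  have ind: "independent (b ` I)" and inj: "inj_on b I" using assms by (auto simp: lattice_basis_def)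
  obtain g :: "'a=>real" where g: "linear g" "\<forall>x\<in>b ` I. g x = (if x = b i then 1 else 0)"
   using linear_independent_extend[OF ind, of "\<lambda>x. if x = b i then (1::real) else 0"] by blast
  define w where "w = (\<Sum>c\<in>Basis. g c *\<^sub>R c)"
  have "x\<bullet>w = g x" for x
  proof -
   have "g x = g (\<Sum>c\<in>Basis. (x\<bullet>c) *\<^sub>R c)" by (simp add: euclidean_representation)
   also have "\<dots> = (\<Sum>c\<in>Basis. (x\<bullet>c) * g c)" using g(1) by (simp add: linear_sum linear_scale)
   finally show ?thesis by (simp add: w_def inner_sum_right mult.commute)
  qed
  hence "\<forall>j\<in>I. b j\<bullet>w = (if j = i then 1 else 0)" using g(2) inj i by (auto simp: inj_on_def)
  thus ?thesis by blast
 qed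
 thus ?thesis by metis
qed

lemma lattice_basis_mem:
 fixes b :: "'i=>'a::real_vector" assumes "lattice_basis I b L"
 shows lattice_basis_0: "0\<in>L" and lattice_basis_diff: "x\<in>L ==> y\<in>L ==> x - y\<in>L"
  and lattice_basis_vec: "i\<in>I ==> b i\<in>L"
proof -
 have L: "L = {(\<Sum>i\<in>I. of_int (c i) *\<^sub>R b i) | c :: 'i=>int. True}" and fin: "finite I"
  using assms by (auto simp: lattice_basis_def)
 show "0\<in>L" unfolding L by (intro CollectI exI[of _ "\<lambda>_. 0"]) simp
 show "x - y\<in>L" if "x\<in>L" "y\<in>L"
 proof -
  obtain c d where "x = (\<Sum>i\<in>I. of_int (c i) *\<^sub>R b i)" "y = (\<Sum>i\<in>I. of_int (d i) *\<^sub>R b i)"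
   using \<open>x\<in>L\<close> \<open>y\<in>L\<close> unfolding L by blast
  hence "x - y = (\<Sum>i\<in>I. of_int (c i - d i) *\<^sub>R b i)" by (simp add: sum_subtractf scaleR_diff_left)
  thus ?thesis unfolding L by (intro CollectI exI[of _ "\<lambda>i. c i - d i"]) simp
 qed
 show "b i\<in>L" if "i\<in>I"
 proof -
  have "(\<Sum>j\<in>I. of_int (if j = i then 1 else 0) *\<^sub>R b j) = (\<Sum>j\<in>I. if j = i then b j else 0)" by (rule sum.cong) auto
  hence "b i = (\<Sum>j\<in>I. of_int (if j = i then 1 else 0) *\<^sub>R b j)" using fin that by simp
  thus ?thesis unfolding L by (intro CollectI exI[of _ "\<lambda>j. if j = i then 1 else 0"]) simp
 qed
qed

locale real_subgroup =
 fixes L :: "'a::real_vector set" assumes zero: "0\<in>L" and diff: "x\<in>L ==> y\<in>L ==> x - y\<in>L"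
begin

lemma uminus: "x\<in>L ==> - x\<in>L" using diff[OF zero] by simp

lemma add: "x\<in>L ==> y\<in>L ==> x + y\<in>L" using diff[of x "- y"] uminus by simp

lemma scale_nat: "x\<in>L ==> of_nat n *\<^sub>R x\<in>L" by (induction n) (auto simp: zero add scaleR_add_left)

lemma scale_int: "x\<in>L ==> of_int z *\<^sub>R x\<in>L"
proof (cases "0\<le>z")
 case True
 thus "x\<in>L ==> of_int z *\<^sub>R x\<in>L" using scale_nat[of x "nat z"] by simp
next
 case False
 hence "of_int z *\<^sub>R x = - (of_nat (nat (- z)) *\<^sub>R x)" by simp
 thus "x\<in>L ==> of_int z *\<^sub>R x\<in>L" using scale_nat[of x "nat (- z)"] uminus by metis
qed

lemma scale_Ints: "x\<in>L ==> r\<in>\<int> ==> r *\<^sub>R x\<in>L" using scale_int by (auto elim!: Ints_cases)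

lemma sum: "(\<And>i. i\<in>A ==> f i\<in>L) ==> sum f A\<in>L" by (induction A rule: infinite_finite_induct) (auto simp: zero add)

end

lemma real_subgroup_lattice_basis: "lattice_basis I b L ==> real_subgroup L"
 using lattice_basis_0 lattice_basis_diff by unfold_locales

lemma real_subgroup_dual_lattice: "real_subgroup (dual_lattice L)"
 by unfold_locales (auto simp: dual_lattice_def inner_diff_right)

text \<open>A vector is determined by its pairings with the basis, and on a ball these are integers
  in a bounded range.\<close>

lemma finite_dual_lattice_norm:
 fixes b :: "'i=>'a::euclidean_space" assumes "lattice_basis I b L" "card I = DIM('a)"
 shows "finite {x\<in>dual_lattice L. norm x\<le>R}"
proof -
 have fin: "finite I" using assms by (simp add: lattice_basis_def)
 define f where "f = (\<lambda>x. restrict (\<lambda>i. \<lfloor>b i\<bullet>x\<rfloor>) I)"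
 define c where "c = \<lceil>(\<Sum>i\<in>I. norm (b i)) * \<bar>R\<bar>\<rceil> + 1"
 let ?S = "{x\<in>dual_lattice L. norm x\<le>R}"
 have int: "b i\<bullet>x\<in>\<int>" if "x\<in>?S" "i\<in>I" for x i
  using that lattice_basis_vec[OF assms(1)] by (auto simp: dual_lattice_def)
 have "f ` ?S\<subseteq>PiE I (\<lambda>_. {-c..c})"
 proof
  fix y assume "y\<in>f ` ?S"
  then obtain x where x: "x\<in>?S" "y = f x" by blast
  have "\<lfloor>b i\<bullet>x\<rfloor>\<in>{-c..c}" if i: "i\<in>I" for i
  proof -
   have "\<bar>b i\<bullet>x\<bar>\<le>norm (b i) * norm x" by (rule Cauchy_Schwarz_ineq2)
   also have "\<dots>\<le>(\<Sum>i\<in>I. norm (b i)) * \<bar>R\<bar>" using x i fin by (intro mult_mono member_le_sum) (auto intro: sum_nonneg)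
   finally have "\<bar>b i\<bullet>x\<bar>\<le>(\<Sum>i\<in>I. norm (b i)) * \<bar>R\<bar>" .
   thus ?thesis unfolding c_def by (auto; linarith)
  qed
  thus "y\<in>PiE I (\<lambda>_. {-c..c})" using x by (auto simp: f_def)
 qed
 hence "finite (f ` ?S)" using fin by (rule finite_subset[OF _ finite_PiE]) auto
 moreover have "inj_on f ?S"
 proof (rule inj_onI)
  fix x y assume xy: "x\<in>?S" "y\<in>?S" "f x = f y"
  have "b i\<bullet>(x - y) = 0" if i: "i\<in>I" for i
  proof -
   have "\<lfloor>b i\<bullet>x\<rfloor> = \<lfloor>b i\<bullet>y\<rfloor>" using xy(3) i by (metis f_def restrict_apply')
   thus ?thesis using int[OF xy(1) i] int[OF xy(2) i] by (auto simp: inner_diff_right elim!: Ints_cases)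
  qed
  hence o: "orthogonal (x - y) u" if "u\<in>b ` I" for u using that by (auto simp: orthogonal_def inner_commute)
  have "x - y\<in>span (b ` I)" unfolding lattice_basis_span[OF assms] by simp
  hence "orthogonal (x - y) (x - y)" using o orthogonal_to_span by blast
  thus "x = y" by (simp add: orthogonal_self)
 qed
 ultimately show ?thesis by (rule finite_imageD)
qed

lemma countable_dual_lattice:
 fixes b :: "'i=>'a::euclidean_space" assumes "lattice_basis I b L" "card I = DIM('a)"
 shows "countable (dual_lattice L)"
proof -
 have "dual_lattice L = (\<Union>k::nat. {x\<in>dual_lattice L. norm x\<le>real k})" using real_arch_simple by auto
 moreover have "countable (\<Union>k::nat. {x\<in>dual_lattice L. norm x\<le>real k})"
  using finite_dual_lattice_norm[OF assms] by (intro countable_UN) (auto intro: countable_finite)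
 ultimately show ?thesis by simp
qed

lemma countable_lattice: assumes "lattice_basis I b L" shows "countable L"
proof -
 have fin: "finite I" and L: "L = {(\<Sum>i\<in>I. of_int (c i) *\<^sub>R b i) | c :: _=>int. True}"
  using assms by (auto simp: lattice_basis_def)
 have "L\<subseteq>(\<lambda>c. \<Sum>i\<in>I. of_int (c i) *\<^sub>R b i) ` (PiE I (\<lambda>_. UNIV :: int set))"
 proof
  fix x assume "x\<in>L"
  then obtain c :: "_=>int" where "x = (\<Sum>i\<in>I. of_int (c i) *\<^sub>R b i)" unfolding L by blast
  hence "x = (\<Sum>i\<in>I. of_int (restrict c I i) *\<^sub>R b i)" by simp
  thus "x\<in>(\<lambda>c. \<Sum>i\<in>I. of_int (c i) *\<^sub>R b i) ` (PiE I (\<lambda>_. UNIV :: int set))"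
   by (intro image_eqI[where x = "restrict c I"]) auto
 qed
 thus ?thesis using fin by (rule countable_subset[OF _ countable_image[OF countable_PiE]]) auto
qed

text \<open>A lattice meets a line in a cyclic group. Some coordinate functional is nonzero on n and
  integral on the lattice, so a shortest positive multiple of n in the lattice exists; division with
  remainder shows that it generates.\<close>

lemma lattice_line_generator:
 fixes b :: "'i=>'a::euclidean_space"
 assumes L: "lattice_basis I b L" and t0: "t0 *\<^sub>R n\<in>L" "0 < (t0::real)" and n: "n\<noteq>0"
 obtains g t where "g\<in>L" "g = t *\<^sub>R n" "0 < (t::real)" "primitive_in L g"
  "\<And>r::real. r *\<^sub>R n\<in>L ==> \<exists>z::int. r *\<^sub>R n = of_int z *\<^sub>R g"
proof -
 interpret real_subgroup L by (rule real_subgroup_lattice_basis[OF L])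
 obtain w where w: "\<forall>i\<in>I. \<forall>j\<in>I. b j\<bullet>w i = (if j = i then 1 else 0)" using lattice_basis_dual[OF L] by blast
 have fin: "finite I" and Leq: "L = {(\<Sum>i\<in>I. of_int (c i) *\<^sub>R b i) | c :: 'i=>int. True}"
  using L by (auto simp: lattice_basis_def)
 have coord: "(\<Sum>i\<in>I. of_int (c i) *\<^sub>R b i)\<bullet>w j = of_int (c j)" if "j\<in>I" for c :: "'i=>int" and j
 proof -
  have "(\<Sum>i\<in>I. of_int (c i) *\<^sub>R b i)\<bullet>w j = (\<Sum>i\<in>I. if i = j then of_int (c i) else 0)"
   unfolding inner_sum_left using w that by (intro sum.cong) auto
  thus ?thesis using fin that by simp
 qed
 obtain c where c: "t0 *\<^sub>R n = (\<Sum>i\<in>I. of_int (c i) *\<^sub>R b i)" using t0(1) unfolding Leq by blast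
 have "\<exists>i\<in>I. c i\<noteq>0"
 proof (rule ccontr)
  assume "\<not> (\<exists>i\<in>I. c i\<noteq>0)"
  hence "t0 *\<^sub>R n = 0" unfolding c by simp
  thus False using t0 n by simp
 qed
 then obtain j where j: "j\<in>I" "c j\<noteq>0" by blast
 define k where "k = n\<bullet>w j"
 have k: "k\<noteq>0" using coord[OF j(1), of c] j(2) unfolding c[symmetric] k_def by auto
 have int: "r * k\<in>\<int>" if rL: "r *\<^sub>R n\<in>L" for r
 proof -
  obtain d where "r *\<^sub>R n = (\<Sum>i\<in>I. of_int (d i) *\<^sub>R b i)" using rL unfolding Leq by blast
  hence "r * k = of_int (d j)" using coord[OF j(1), of d] by (metis inner_scaleR_left k_def)
  thus ?thesis by simp
 qed
 define Q where "Q = (\<lambda>m::nat. 0 < m \<and> (\<exists>t>0. t *\<^sub>R n\<in>L \<and> \<bar>t * k\<bar> = real m))"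
 have ex: "\<exists>m. m > 0 \<and> \<bar>t * k\<bar> = real m" if tL: "t *\<^sub>R n\<in>L" "t > 0" for t
 proof -
  obtain z where z: "t * k = of_int z" using int[OF tL(1)] by (auto elim: Ints_cases)
  have "z\<noteq>0" using z tL k by auto
  thus ?thesis using z by (intro exI[of _ "nat \<bar>z\<bar>"]) auto
 qed
 hence "\<exists>m. Q m" unfolding Q_def using t0 by blast
 define m where "m = (LEAST m. Q m)"
 have Qm: "Q m" unfolding m_def using \<open>\<exists>m. Q m\<close> LeastI_ex by metis
 have least: "m\<le>m'" if "Q m'" for m' unfolding m_def using that by (rule Least_le)
 obtain t where t: "t > 0" "t *\<^sub>R n\<in>L" "\<bar>t * k\<bar> = real m" using Qm unfolding Q_def by blast
 have min: "t\<le>t'" if t': "t' > 0" "t' *\<^sub>R n\<in>L" for t'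
 proof -
  obtain m' where m': "m' > 0" "\<bar>t' * k\<bar> = real m'" using ex[OF t'(2,1)] by blast
  hence "m\<le>m'" using t' by (intro least) (auto simp: Q_def)
  hence "\<bar>t * k\<bar>\<le>\<bar>t' * k\<bar>" using m' t(3) by simp
  thus ?thesis using k t(1) t'(1) by (simp add: abs_mult)
 qed
 define g where "g = t *\<^sub>R n"
 have gen: "\<exists>z::int. r *\<^sub>R n = of_int z *\<^sub>R g" if r: "r *\<^sub>R n\<in>L" for r
 proof -
  define z where "z = \<lfloor>r / t\<rfloor>"
  define r' where "r' = r - of_int z * t"
  have "r' *\<^sub>R n = r *\<^sub>R n - of_int z *\<^sub>R (t *\<^sub>R n)" by (simp add: r'_def scaleR_diff_left)
  hence "r' *\<^sub>R n\<in>L" using diff[OF r scale_int[OF t(2)]] by metis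
  moreover have "0\<le>r'" "r' < t"
  proof -
   have "of_int z\<le>r / t" "r / t < of_int z + 1" unfolding z_def by linarith+
   thus "0\<le>r'" "r' < t" using t(1) by (auto simp: r'_def field_simps)
  qed
  ultimately have "r' = 0" using min[of r'] by fastforce
  hence "r *\<^sub>R n = of_int z *\<^sub>R g" by (simp add: r'_def g_def)
  thus ?thesis by blast
 qed
 have "primitive_in L g" unfolding primitive_in_def
 proof (intro conjI ballI allI impI)
  show "g\<in>L" "g\<noteq>0" using t n by (auto simp: g_def)
  fix x and c :: nat assume x: "x\<in>L" "g = of_nat c *\<^sub>R x"
  have c0: "c > 0" using x \<open>g\<noteq>0\<close> by (cases c) auto
  have "(1 / real c) *\<^sub>R g = x" using x(2) c0 by simp
  hence xn: "x = (t / real c) *\<^sub>R n" by (auto simp: g_def)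
  hence "t\<le>t / real c" using min[of "t / real c"] x(1) t(1) c0 by simp
  hence "real c\<le>1" using t(1) c0 by (simp add: field_simps)
  thus "c = 1" using c0 by linarith
 qed
 thus ?thesis using that[of g t] gen t g_def by blast
qed

lemma primitive_in_unique:
 fixes b :: "'i=>'a::euclidean_space"
 assumes L: "lattice_basis I b L" and g: "primitive_in L g" and h: "primitive_in L h"
  and gh: "h = r *\<^sub>R g" "0 < (r::real)" shows "h = g"
proof -
 have gL: "1 *\<^sub>R g\<in>L" "g\<noteq>0" and hL: "h\<in>L" "h\<noteq>0" using g h by (auto simp: primitive_in_def)
 obtain a t where a: "a\<in>L" "a = t *\<^sub>R g" "0 < t" "primitive_in L a"
  "\<And>r::real. r *\<^sub>R g\<in>L ==> \<exists>z::int. r *\<^sub>R g = of_int z *\<^sub>R a"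
  using lattice_line_generator[OF L gL(1) _ gL(2)] by auto
 have "x = a" if x: "primitive_in L x" "x = r *\<^sub>R g" "0 < r" for x r
 proof -
  have "r *\<^sub>R g\<in>L" using x by (simp add: primitive_in_def)
  then obtain z :: int where z: "r *\<^sub>R g = of_int z *\<^sub>R a" using a(5) by blast
  have "r = of_int z * t" using z a(2) gL(2) by simp
  hence "z > 0" using x(3) a(3) by (metis of_int_0_less_iff zero_less_mult_pos2)
  hence "x = of_nat (nat z) *\<^sub>R a" using z x(2) by simp
  hence "nat z = 1" using x(1) a(1) unfolding primitive_in_def by blast
  thus ?thesis using \<open>x = of_nat (nat z) *\<^sub>R a\<close> by simp
 qed
 from this[OF g, of 1] this[OF h gh] show ?thesis by simp
qed

section \<open>Finitely generated cones\<close>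

lemma convex_cone_hull_finite:
 fixes U :: "'a::real_vector set" assumes "finite U"
 shows "convex_cone hull U = {(\<Sum>u\<in>U. c u *\<^sub>R u) | c. \<forall>u\<in>U. 0\<le>c u}" (is "_ = ?S")
proof
 have "convex_cone ?S" unfolding convex_cone_iff
 proof (intro conjI ballI allI impI)
  show "0\<in>?S" by (intro CollectI exI[of _ "\<lambda>_. 0"]) simp
  fix x y assume "x\<in>?S" "y\<in>?S"
  then obtain c d where "\<forall>u\<in>U. 0\<le>c u" "\<forall>u\<in>U. 0\<le>d u" "x = (\<Sum>u\<in>U. c u *\<^sub>R u)" "y = (\<Sum>u\<in>U. d u *\<^sub>R u)" by blast
  thus "x + y\<in>?S" by (intro CollectI exI[of _ "\<lambda>u. c u + d u"]) (auto simp: scaleR_add_left sum.distrib)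
 next
  fix x and r :: real assume "x\<in>?S" "0\<le>r"
  then obtain c where "\<forall>u\<in>U. 0\<le>c u" "x = (\<Sum>u\<in>U. c u *\<^sub>R u)" by blast
  thus "r *\<^sub>R x\<in>?S" using \<open>0\<le>r\<close>
   by (intro CollectI exI[of _ "\<lambda>u. r * c u"]) (auto simp: scaleR_sum_right)
 qed
 moreover have "U\<subseteq>?S"
 proof
  fix u assume "u\<in>U"
  have "(\<Sum>w\<in>U. (if w = u then 1 else 0) *\<^sub>R w) = (\<Sum>w\<in>U. if w = u then w else 0)" by (rule sum.cong) auto
  hence "u = (\<Sum>w\<in>U. (if w = u then 1 else 0) *\<^sub>R w)" using assms \<open>u\<in>U\<close> by simp
  thus "u\<in>?S" by (intro CollectI exI[of _ "\<lambda>w. if w = u then 1 else 0"]) auto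
 qed
 ultimately show "convex_cone hull U\<subseteq>?S" by (metis (no_types, lifting) hull_minimal)
 show "?S\<subseteq>convex_cone hull U"
 proof
  fix x assume "x\<in>?S"
  then obtain c where c: "\<forall>u\<in>U. 0\<le>c u" "x = (\<Sum>u\<in>U. c u *\<^sub>R u)" by blast
  have "(\<Sum>u\<in>V. c u *\<^sub>R u)\<in>convex_cone hull U" if "V\<subseteq>U" for V using finite_subset[OF that assms] that
  proof (induction V rule: finite_induct)
   case (insert u V)
   hence "c u *\<^sub>R u\<in>convex_cone hull U" using c(1) by (intro convex_cone_hull_mul hull_inc) auto
   thus ?case using insert by (simp add: convex_cone_hull_add)
  qed (simp add: convex_cone_hull_contains_0)
  thus "x\<in>convex_cone hull U" using c by blast
 qed
qed

text \<open>Pointedness forbids a nontrivial vanishing nonnegative combination of the nonzero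
  generators, so 0 is separated from their convex hull. The separating functional bounds the sum of
  the coefficients of x, and thereby its norm.\<close>

lemma pointed_cone_functional:
 fixes U :: "'a::euclidean_space set"
 assumes fin: "finite U" and pt: "convex_cone hull U \<inter> uminus ` (convex_cone hull U) = {0}"
 obtains h k where "0 < (k::real)" "\<And>x. x\<in>convex_cone hull U ==> k * norm x\<le>h\<bullet>x"
proof -
 define V where "V = U - {0}"
 have finV: "finite V" using fin by (simp add: V_def)
 let ?C = "convex_cone hull U"
 have "0\<notin>convex hull V"
 proof
  assume "0\<in>convex hull V"
  then obtain c where c: "\<forall>x\<in>V. 0\<le>c x" "sum c V = 1" "(\<Sum>x\<in>V. c x *\<^sub>R x) = 0"
   unfolding convex_hull_finite[OF finV] by auto
  then obtain x where x: "x\<in>V" "c x\<noteq>0" by (metis sum.neutral zero_neq_one)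
  hence cx: "0 < c x" using c(1) by force
  have "c x *\<^sub>R x + (\<Sum>y\<in>V - {x}. c y *\<^sub>R y) = 0" using c(3) x(1) finV by (simp add: sum.remove)
  hence eq: "- (c x *\<^sub>R x) = (\<Sum>y\<in>V - {x}. c y *\<^sub>R y)" by (simp add: add_eq_0_iff)
  have "(\<Sum>y\<in>W. c y *\<^sub>R y)\<in>?C" if "W\<subseteq>V" for W using finite_subset[OF that finV] that
  proof (induction W rule: finite_induct)
   case (insert u W)
   hence "c u *\<^sub>R u\<in>?C" using c(1) by (intro convex_cone_hull_mul hull_inc) (auto simp: V_def)
   thus ?case using insert by (simp add: convex_cone_hull_add)
  qed (simp add: convex_cone_hull_contains_0)
  hence "- (c x *\<^sub>R x)\<in>?C" unfolding eq by blast
  moreover have "c x *\<^sub>R x\<in>?C" using x cx by (intro convex_cone_hull_mul hull_inc) (auto simp: V_def)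
  ultimately have "c x *\<^sub>R x\<in>?C \<inter> uminus ` ?C" by force
  thus False using pt x cx by (auto simp: V_def)
 qed
 then obtain h b where hb: "0 < b" "\<forall>x\<in>convex hull V. b < h\<bullet>x"
  using separating_hyperplane_closed_0[of "convex hull V"] finV
  by (meson compact_imp_closed convex_convex_hull finite_imp_compact_convex_hull)
 \<comment> \<open>The summand 1 keeps B positive even if there are no nonzero generators.\<close>
 define B where "B = 1 + (\<Sum>u\<in>V. norm u)"
 have B: "0 < B" unfolding B_def by (simp add: add_pos_nonneg sum_nonneg)
 have "b / B * norm x\<le>h\<bullet>x" if x: "x\<in>?C" for x
 proof -
  obtain c where c: "\<forall>u\<in>U. 0\<le>c u" "x = (\<Sum>u\<in>U. c u *\<^sub>R u)" using x unfolding convex_cone_hull_finite[OF fin] by blast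
  have xV: "x = (\<Sum>u\<in>V. c u *\<^sub>R u)" unfolding c(2) V_def using fin by (intro sum.mono_neutral_right) auto
  have cV: "0\<le>c u" if "u\<in>V" for u using c(1) that by (simp add: V_def)
  have "norm x\<le>(\<Sum>u\<in>V. norm (c u *\<^sub>R u))" unfolding xV by (rule norm_sum)
  also have "\<dots>\<le>(\<Sum>u\<in>V. c u * B)"
  proof (rule sum_mono)
   fix u assume u: "u\<in>V"
   have "norm u\<le>(\<Sum>u\<in>V. norm u)" using u finV by (intro member_le_sum) auto
   thus "norm (c u *\<^sub>R u)\<le>c u * B" using cV[OF u] by (auto simp: B_def intro!: mult_left_mono)
  qed
  finally have 1: "norm x\<le>(\<Sum>u\<in>V. c u) * B" by (simp add: sum_distrib_right)
  have "(\<Sum>u\<in>V. c u) * b = (\<Sum>u\<in>V. c u * b)" by (simp add: sum_distrib_right)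
  also have "\<dots>\<le>(\<Sum>u\<in>V. c u * (h\<bullet>u))"
   using cV hb(2) by (intro sum_mono mult_left_mono) (auto intro: less_imp_le hull_inc)
  also have "\<dots> = h\<bullet>x" unfolding xV by (simp add: inner_sum_right)
  finally have 2: "(\<Sum>u\<in>V. c u) * b\<le>h\<bullet>x" .
  have "b / B * norm x\<le>b / B * ((\<Sum>u\<in>V. c u) * B)" using 1 hb(1) B by (intro mult_left_mono) auto
  also have "\<dots> = (\<Sum>u\<in>V. c u) * b" using B by simp
  finally show ?thesis using 2 by simp
 qed
 thus ?thesis using that[of "b / B" h] hb(1) B by simp
qed

lemma orth_dim:
 fixes n :: "'a::euclidean_space" assumes "n\<noteq>0" shows "subspace (orth n)" "dim (orth n) = DIM('a) - 1"
proof -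
 have eq: "orth n = {x. n\<bullet>x = 0}" by (simp add: orth_def)
 show "subspace (orth n)" unfolding eq by (rule subspace_hyperplane)
 show "dim (orth n) = DIM('a) - 1" unfolding eq using dim_hyperplane[OF assms] by simp
qed

lemma closed_convex_cone_hull_finite:
 fixes U :: "'a::euclidean_space set" assumes "finite U" shows "closed (convex_cone hull U)"
 using closed_convex_cone_hull[OF assms] by simp

text \<open>Caratheodory's argument for cones: a smallest set of generators that still represents x
  is independent, since a linear relation would remove one more generator.\<close>

lemma cone_reduction:
 fixes U :: "'a::euclidean_space set" assumes fin: "finite U" and x: "x\<in>convex_cone hull U"
 obtains S c where "S\<subseteq>U" "independent S" "\<forall>u\<in>S. 0 < c u" "x = (\<Sum>u\<in>S. c u *\<^sub>R u)"
proof -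
 define Q where "Q = (\<lambda>S. S\<subseteq>U \<and> x\<in>convex_cone hull S)"
 define S where "S = (ARG_MIN card S. Q S)"
 have "Q U" using x by (simp add: Q_def)
 hence QS: "Q S" and min: "\<And>T. Q T ==> card S\<le>card T" unfolding S_def using arg_min_nat_lemma[of Q U card] by auto
 have finS: "finite S" using QS fin finite_subset by (auto simp: Q_def)
 obtain c where c: "\<forall>u\<in>S. 0\<le>c u" "x = (\<Sum>u\<in>S. c u *\<^sub>R u)"
  using QS unfolding Q_def convex_cone_hull_finite[OF finS] by blast
 have drop: False if v: "v\<in>S" and d: "\<forall>u\<in>S. 0\<le>d u" "x = (\<Sum>u\<in>S. d u *\<^sub>R u)" "d v = 0" for v d
 proof -
  have "x = (\<Sum>u\<in>S - {v}. d u *\<^sub>R u)" unfolding d(2) using v d(3) finS by (simp add: sum.remove)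
  hence "x\<in>convex_cone hull (S - {v})"
   unfolding convex_cone_hull_finite[OF finite_Diff[OF finS]] using d(1) by blast
  hence "Q (S - {v})" using QS by (auto simp: Q_def)
  hence "card S\<le>card (S - {v})" by (rule min)
  thus False using v finS by (metis card_Diff1_less not_le)
 qed
 have pos: "\<forall>u\<in>S. 0 < c u" using drop[OF _ c] c(1) by (metis less_eq_real_def)
 have "independent S"
 proof (rule notI)
  assume "dependent S"
  then obtain d0 where d0: "(\<Sum>u\<in>S. d0 u *\<^sub>R u) = 0" "\<exists>u\<in>S. d0 u\<noteq>0" unfolding dependent_finite[OF finS] by blast
  define d where "d = (if \<exists>u\<in>S. 0 < d0 u then d0 else (\<lambda>u. - d0 u))"
  have d: "(\<Sum>u\<in>S. d u *\<^sub>R u) = 0" "\<exists>u\<in>S. 0 < d u"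
   using d0 by (auto simp: d_def sum_negf) (metis linorder_neqE_linordered_idom)
  define T where "T = {u\<in>S. 0 < d u}"
  have T: "finite T" "T\<noteq>{}" using finS d(2) by (auto simp: T_def)
  \<comment> \<open>The largest multiple of the relation that can be subtracted while all
    coefficients stay nonnegative; at the minimising generator the coefficient becomes zero.\<close>
  define l where "l = Min ((\<lambda>u. c u / d u) ` T)"
  have "l\<in>(\<lambda>u. c u / d u) ` T" unfolding l_def using T by (intro Min_in) auto
  then obtain v where v: "v\<in>T" "l = c v / d v" by blast
  have lmin: "l\<le>c u / d u" if "u\<in>T" for u unfolding l_def using that T by (intro Min_le) auto
  have l0: "0\<le>l" using v pos by (auto simp: T_def)
  show False
  proof (rule drop[of v "\<lambda>u. c u - l * d u"])
   show "v\<in>S" using v by (simp add: T_def)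
   show "c v - l * d v = 0" using v by (simp add: T_def)
   show "x = (\<Sum>u\<in>S. (c u - l * d u) *\<^sub>R u)"
    using c(2) d(1) by (simp add: scaleR_diff_left sum_subtractf flip: scaleR_scaleR scaleR_sum_right)
   show "\<forall>u\<in>S. 0\<le>c u - l * d u"
   proof
    fix u assume u: "u\<in>S"
    show "0\<le>c u - l * d u"
    proof (cases "u\<in>T")
     case True
     thus ?thesis using lmin[OF True] by (simp add: T_def pos_le_divide_eq)
    next
     case False
     hence "d u\<le>0" using u by (simp add: T_def)
     hence "l * d u\<le>0" using l0 by (simp add: mult_nonneg_nonpos)
     thus ?thesis using pos u by force
    qed
   qed
  qed
 qed
 thus ?thesis using that[of S c] QS pos c(2) by (simp add: Q_def)
qed

text \<open>By \<open>cone_reduction\<close>, x is a positive combination of independent generators.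
  Small sets of generators are excluded by \<open>gen\<close>, so these span the whole hyperplane,
  and small moves of x inside it keep the coefficients nonnegative.\<close>

lemma cone_rel_interior:
 fixes U :: "'a::euclidean_space set" assumes fin: "finite U" and C: "C = convex_cone hull U" "C\<subseteq>orth n" and n: "n\<noteq>0"
  and x: "x\<in>C" and gen: "\<And>S. S\<subseteq>U ==> card S + 2\<le>DIM('a) ==> x\<notin>span S" shows "x\<in>rel_interior C"
proof -
 obtain S c where S: "S\<subseteq>U" "independent S" "\<forall>u\<in>S. 0 < c u" "x = (\<Sum>u\<in>S. c u *\<^sub>R u)"
  using cone_reduction[OF fin, of x] x C(1) by blast
 have finS: "finite S" using S(1) fin finite_subset by blast
 have "x\<in>span S" unfolding S(4) by (intro span_sum span_scale span_base)
 hence card: "DIM('a) < card S + 2" using gen[OF S(1)] by linarith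
 have UC: "U\<subseteq>C" unfolding C(1) by (rule hull_subset)
 have So: "S\<subseteq>orth n" using S(1) UC C(2) by blast
 have "dim (orth n)\<le>card S" using orth_dim(2)[OF n] card by simp
 hence "orth n\<subseteq>span S" using card_ge_dim_independent[OF So S(2)] by blast
 have Cne: "C\<noteq>{}" "convex C" using x C(1) convex_convex_cone_hull by blast+
 show ?thesis unfolding convex_rel_interior_iff[OF Cne(2) Cne(1)]
 proof
  fix y assume "y\<in>C"
  hence "y\<in>span S" using C(2) \<open>orth n\<subseteq>span S\<close> by blast
  then obtain b where b: "y = (\<Sum>u\<in>S. b u *\<^sub>R u)" unfolding span_finite[OF finS] by auto
  \<comment> \<open>Chosen so small that prolonging the segment from y beyond x by the factor 1 + d
    keeps all coefficients nonnegative.\<close>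
  have "\<exists>d>0. \<forall>u\<in>S. d * \<bar>b u\<bar>\<le>c u" using finS S(3)
  proof (induction S rule: finite_induct)
   case (insert u S)
   then obtain d where d: "d > 0" "\<forall>u\<in>S. d * \<bar>b u\<bar>\<le>c u" by auto
   define d' where "d' = min d (c u / (1 + \<bar>b u\<bar>))"
   have "d' > 0" using d insert.prems by (simp add: d'_def)
   moreover have "d' * \<bar>b u\<bar>\<le>c u"
   proof -
    have "d' * \<bar>b u\<bar>\<le>c u / (1 + \<bar>b u\<bar>) * (1 + \<bar>b u\<bar>)"
     using \<open>d' > 0\<close> insert.prems by (intro mult_mono) (auto simp: d'_def)
    thus ?thesis by (simp add: add_pos_nonneg less_imp_neq[symmetric])
   qed
   moreover have "d' * \<bar>b w\<bar>\<le>c w" if "w\<in>S" for w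
   proof -
    have "d' * \<bar>b w\<bar>\<le>d * \<bar>b w\<bar>" by (intro mult_right_mono) (auto simp: d'_def)
    thus ?thesis using d(2) that by fastforce
   qed
   ultimately show ?case by (intro exI[of _ d']) auto
  qed (auto intro: exI[of _ 1])
  then obtain d where d: "d > 0" "\<forall>u\<in>S. d * \<bar>b u\<bar>\<le>c u" by blast
  have "(1 - (1 + d)) *\<^sub>R y + (1 + d) *\<^sub>R x = (\<Sum>u\<in>S. ((1 + d) * c u - d * b u) *\<^sub>R u)"
   unfolding b S(4) by (simp add: scaleR_sum_right sum.distrib[symmetric] scaleR_diff_left)
  also have "\<dots>\<in>convex_cone hull S"
  proof -
   have "0\<le>(1 + d) * c u - d * b u" if u: "u\<in>S" for u
   proof -
    have "d * b u\<le>d * \<bar>b u\<bar>" using d(1) by (intro mult_left_mono) auto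
    also have "\<dots>\<le>c u" using d(2) u by blast
    also have "\<dots>\<le>(1 + d) * c u" using d(1) S(3) u by (simp add: algebra_simps less_imp_le)
    finally show ?thesis by simp
   qed
   thus ?thesis unfolding convex_cone_hull_finite[OF finS]
    by (intro CollectI exI[of _ "\<lambda>u. (1 + d) * c u - d * b u"]) auto
  qed
  also have "\<dots>\<subseteq>C" unfolding C(1) by (rule hull_mono[OF S(1)])
  finally show "\<exists>e>1. (1 - e) *\<^sub>R y + e *\<^sub>R x\<in>C" using d(1) by (intro exI[of _ "1 + d"]) auto
 qed
qed

text \<open>Proper subspaces are null sets, and countably many null sets do not cover a nonempty
  open set.\<close>

lemma escape_subspaces:
 fixes \<W> :: "'a::euclidean_space set set" assumes "countable \<W>" "\<And>W. W\<in>\<W> ==> dim W < DIM('a)" "open S" "S\<noteq>{}"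
 obtains x where "x\<in>S" "x\<notin>\<Union>\<W>"
proof -
 have "negligible (\<Union>\<W>)" using assms(1,2) by (intro negligible_countable_Union negligible_lowdim)
 hence "\<not> S\<subseteq>\<Union>\<W>" using open_not_negligible[OF assms(3,4)] negligible_subset by blast
 thus ?thesis using that by blast
qed

lemma lattice_basis_primitive:
 fixes b :: "'i=>'a::euclidean_space" assumes L: "lattice_basis I b L" and i: "i\<in>I" shows "primitive_in L (b i)"
 unfolding primitive_in_def
proof (intro conjI ballI allI impI)
 obtain w where w: "\<forall>i\<in>I. \<forall>j\<in>I. b j\<bullet>w i = (if j = i then 1 else 0)" using lattice_basis_dual[OF L] by blast
 show "b i\<in>L" by (rule lattice_basis_vec[OF L i])
 show "b i\<noteq>0" using w i by force
 fix x and c :: nat assume x: "x\<in>L" "b i = of_nat c *\<^sub>R x"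
 obtain a :: "'i=>int" where a: "x = (\<Sum>j\<in>I. of_int (a j) *\<^sub>R b j)" using x(1) L unfolding lattice_basis_def by blast
 have "x\<bullet>w i = (\<Sum>j\<in>I. if j = i then of_int (a j) else 0)"
  unfolding a inner_sum_left using w i by (intro sum.cong) auto
 hence "x\<bullet>w i = of_int (a i)" using L i by (simp add: lattice_basis_def)
 hence "1 = of_nat c * (of_int (a i) :: real)" using w i x(2) by (metis inner_scaleR_left)
 hence "1 = int c * a i" by (metis of_int_1 of_int_eq_iff of_int_mult of_int_of_nat_eq)
 hence "int c dvd 1" by (rule dvdI)
 thus "c = 1" by simp
qed

lemma orth_subset_parallel: assumes "orth n\<subseteq>orth g" "n\<noteq>(0::'a::euclidean_space)" shows "\<exists>r. g = r *\<^sub>R n"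
proof -
 define r where "r = (g\<bullet>n) / (n\<bullet>n)"
 have "n\<bullet>(g - r *\<^sub>R n) = 0" using assms by (simp add: r_def inner_diff_right inner_commute)
 hence "g - r *\<^sub>R n\<in>orth n" by (simp add: orth_def)
 moreover from this have "g - r *\<^sub>R n\<in>orth g" using assms by blast
 ultimately have "(g - r *\<^sub>R n)\<bullet>(g - r *\<^sub>R n) = 0" by (simp add: orth_def inner_diff_left)
 thus ?thesis by (intro exI[of _ r]) simp
qed

section \<open>Seeds\<close>

text \<open>A height vector and a gap chosen as a function of \<open>P\<close> alone, so that the
  monoid structure adds no parameters to the locales that follow.\<close>

definition tm_pair :: "'a::euclidean_space set=>'a \<times> real" where
 "tm_pair P = (SOME hk. toric_monoid P (fst hk) (snd hk))"

text \<open>For \<open>fd_Ncirc\<close> only some basis is demanded instead of the multiples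
  \<open>d_i e_i\<close>; the mutated seed then qualifies with the basis that comes from the
  original seed.\<close>

locale seed_data =
 fixes Fd :: "('i, 'a::euclidean_space, 'x) fixed_data" and e :: "'i=>'a" and P :: "'a set"
 assumes gfd: "generalized_fixed_data Fd" and basN: "lattice_basis (fd_I Fd) e (fd_N Fd)"
  and basU: "lattice_basis (fd_Iuf Fd) e (fd_Nuf Fd)" and basC: "\<exists>b. lattice_basis (fd_I Fd) b (fd_Ncirc Fd)"
  and injp: "injectivity_assumption Fd" and sm: "seed_monoid Fd e P" and ufne: "fd_Iuf Fd\<noteq>{}"
begin

abbreviation "N \<equiv> fd_N Fd"
abbreviation "Nu \<equiv> fd_Nuf Fd"
abbreviation "Nc \<equiv> fd_Ncirc Fd"
abbreviation "M \<equiv> fd_M Fd"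
abbreviation "Mc \<equiv> fd_Mcirc Fd"

lemma cardI: "card (fd_I Fd) = DIM('a)" and finI: "finite (fd_I Fd)" and IufI: "fd_Iuf Fd\<subseteq>fd_I Fd"
 and NcN: "Nc\<subseteq>N" and NuN: "Nu\<subseteq>N" and bil: "bilinear (fd_form Fd)"
 using gfd unfolding generalized_fixed_data_def sublattice_def by (simp_all only: simp_thms)

lemma skew: "fd_form Fd x y = - fd_form Fd y x"
proof -
 have "\<forall>x y. fd_form Fd x y = - fd_form Fd y x"
  using gfd unfolding generalized_fixed_data_def by (elim conjE) assumption
 thus ?thesis by blast
qed

lemma finIuf: "finite (fd_Iuf Fd)" using finI IufI finite_subset by blast

sublocale N: real_subgroup N by (rule real_subgroup_lattice_basis[OF basN])

sublocale Nu: real_subgroup Nu by (rule real_subgroup_lattice_basis[OF basU])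

sublocale Nc: real_subgroup Nc using basC real_subgroup_lattice_basis by blast

sublocale Mc: real_subgroup Mc unfolding fd_Mcirc_def by (rule real_subgroup_dual_lattice)

sublocale M: real_subgroup M unfolding fd_M_def by (rule real_subgroup_dual_lattice)

lemma MMc: "M\<subseteq>Mc" using NcN by (auto simp: fd_M_def fd_Mcirc_def dual_lattice_def)

lemma form_self: "fd_form Fd x x = 0" using skew[of x x] by simp

lemma linear_p1: "linear (p1 Fd)"
proof (rule linearI)
 show "p1 Fd (x + y) = p1 Fd x + p1 Fd y" for x y
  by (simp add: p1_def bilinear_ladd[OF bil] scaleR_add_left sum.distrib)
 show "p1 Fd (c *\<^sub>R x) = c *\<^sub>R p1 Fd x" for c x by (simp add: p1_def bilinear_lmul[OF bil] scaleR_sum_right)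
qed

lemma p1_inner: "x\<bullet>p1 Fd n = fd_form Fd n x"
proof -
 have lin: "linear (fd_form Fd n)" using bil by (simp add: bilinear_def)
 have "fd_form Fd n x = fd_form Fd n (\<Sum>c\<in>Basis. (x\<bullet>c) *\<^sub>R c)" by (simp add: euclidean_representation)
 also have "\<dots> = (\<Sum>c\<in>Basis. (x\<bullet>c) * fd_form Fd n c)" using lin by (simp add: linear_sum linear_scale)
 finally show ?thesis by (simp add: p1_def inner_sum_right mult.commute)
qed

lemma p1_self: "n\<bullet>p1 Fd n = 0" by (simp add: p1_inner form_self)

lemma p1_0 [simp]: "p1 Fd 0 = 0" using linear_p1 linear_0 by blast

lemma p1_inj: "n\<in>Nu ==> n'\<in>Nu ==> p1 Fd n = p1 Fd n' ==> n = n'"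
 using injp by (auto simp: injectivity_assumption_def inj_on_def)

lemma p1_nonzero: "n\<in>Nu ==> n\<noteq>0 ==> p1 Fd n\<noteq>0" using p1_inj[of n 0] Nu.zero by auto

lemma sm_cone: "\<exists>C. rational_cone Fd C \<and> C \<inter> uminus ` C = {0} \<and> aff_dim C = int DIM('a) \<and> P = C \<inter> Mc"
 using sm unfolding seed_monoid_def by (rule conjunct1)

text \<open>The height is a functional positive on the pointed cone. Nonzero vectors of the lattice
  have norm at least r, hence height at least k r on the cone, and bounded height means bounded
  norm, which leaves finitely many lattice points.\<close>

lemma toric: "toric_monoid P (fst (tm_pair P)) (snd (tm_pair P))"
proof -
 obtain C where C: "rational_cone Fd C" "C \<inter> uminus ` C = {0}" "P = C \<inter> Mc"
  using sm_cone by (elim exE conjE) (rule that; assumption)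
 obtain U where U: "finite U" "C = convex_cone hull U"
  using C(1) unfolding rational_cone_def by (elim exE conjE) (rule that; assumption)
 obtain h k where hk: "0 < k" "\<And>x. x\<in>C ==> k * norm x\<le>h\<bullet>x" using pointed_cone_functional[OF U(1)] C(2) U(2) by metis
 obtain b where b: "lattice_basis (fd_I Fd) b Nc" using basC by blast
 have fin: "finite {x\<in>Mc. norm x\<le>R}" for R unfolding fd_Mcirc_def by (rule finite_dual_lattice_norm[OF b cardI])
 \<comment> \<open>The element 1 makes the minimum meaningful when the unit ball contains no nonzero
   lattice vector.\<close>
 define A where "A = insert 1 (norm ` ({x\<in>Mc. norm x\<le>1} - {0}))"
 define r where "r = Min A"
 have A: "finite A" "A\<noteq>{}" using fin[of 1] by (auto simp: A_def)
 have r: "0 < r" unfolding r_def using A by (subst Min_gr_iff) (auto simp: A_def)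
 have rle: "r\<le>norm x" if "x\<in>Mc" "x\<noteq>0" for x
 proof (cases "norm x\<le>1")
  case True
  hence "norm x\<in>A" using that by (auto simp: A_def)
  thus ?thesis unfolding r_def using A by (intro Min_le)
 next
  case False
  have "r\<le>1" unfolding r_def using A by (intro Min_le) (auto simp: A_def)
  thus ?thesis using False by simp
 qed
 have "toric_monoid P h (k * r)"
 proof
  show "0\<in>P" using C(3) U(2) convex_cone_hull_contains_0 Mc.zero by blast
  show "p + q\<in>P" if "p\<in>P" "q\<in>P" for p q using that C(3) U(2) convex_cone_hull_add Mc.add by blast
  show "0 < k * r" using hk(1) r by simp
  show "k * r\<le>h\<bullet>p" if "p\<in>P" "p\<noteq>0" for p
  proof -
   have "k * r\<le>k * norm p" using that C(3) rle hk(1) by (intro mult_left_mono) auto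
   thus ?thesis using hk(2)[of p] that C(3) by simp
  qed
  show "finite {p\<in>P. h\<bullet>p\<le>c}" for c
  proof (rule finite_subset[OF _ fin[of "c / k"]])
   show "{p\<in>P. h\<bullet>p\<le>c}\<subseteq>{x\<in>Mc. norm x\<le>c / k}"
   proof clarify
    fix p assume p: "p\<in>P" "h\<bullet>p\<le>c"
    hence "k * norm p\<le>c" using hk(2)[of p] C(3) by auto
    thus "p\<in>Mc \<and> norm p\<le>c / k" using p C(3) hk(1) by (auto simp: field_simps)
   qed
  qed
 qed
 thus ?thesis unfolding tm_pair_def by (intro someI[of "\<lambda>hk. toric_monoid P (fst hk) (snd hk)" "(h, k * r)"]) simp
qed

sublocale toric_monoid P "fst (tm_pair P)" "snd (tm_pair P)" by (rule toric)

lemma PMc: "P\<subseteq>Mc" using sm_cone by auto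

text \<open>The cone has full dimension, so its generators span the space; a large multiple of their
  sum, added to m, makes all coefficients nonnegative.\<close>

lemma Mc_diff_P: assumes "m\<in>Mc" shows "\<exists>p\<in>P. m + p\<in>P"
proof -
 obtain C where C: "rational_cone Fd C" "aff_dim C = int DIM('a)" "P = C \<inter> Mc"
  using sm_cone by (elim exE conjE) (rule that; assumption)
 obtain U where U: "finite U" "U\<subseteq>M" "C = convex_cone hull U"
  using C(1) unfolding rational_cone_def by (elim exE conjE) (rule that; assumption)
 have "C\<subseteq>span U" unfolding U(3) convex_cone_hull_finite[OF U(1)] by (auto intro: span_sum span_scale span_base)
 hence "int DIM('a)\<le>aff_dim (span U)" using aff_dim_subset[of C "span U"] C(2) by simp
 hence "DIM('a)\<le>dim (span U)" using aff_dim_subspace[OF subspace_span, of U] by simp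
 hence "dim (span U) = DIM('a)" using dim_subset_UNIV[of "span U"] by linarith
 hence "span U = UNIV" by (metis dim_eq_full dim_span span_span)
 hence "m\<in>span U" by simp
 then obtain a where a: "m = (\<Sum>u\<in>U. a u *\<^sub>R u)" unfolding span_finite[OF U(1)] by auto
 obtain k :: nat where k: "(\<Sum>u\<in>U. \<bar>a u\<bar>)\<le>real k" using real_arch_simple by blast
 define p where "p = (\<Sum>u\<in>U. real k *\<^sub>R u)"
 have "p\<in>M" unfolding p_def using U(2) M.scale_nat by (intro M.sum) auto
 moreover have "p\<in>C"
  unfolding p_def U(3) convex_cone_hull_finite[OF U(1)] by (intro CollectI exI[of _ "\<lambda>_. real k"]) auto
 ultimately have "p\<in>P" using C(3) MMc by blast
 moreover have "m + p\<in>C"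
 proof -
  have "m + p = (\<Sum>u\<in>U. (a u + real k) *\<^sub>R u)" unfolding a p_def by (simp add: scaleR_add_left sum.distrib)
  moreover have "0\<le>a u + real k" if u: "u\<in>U" for u
  proof -
   have "\<bar>a u\<bar>\<le>(\<Sum>u\<in>U. \<bar>a u\<bar>)" using u U(1) by (intro member_le_sum) auto
   thus ?thesis using k by linarith
  qed
  ultimately show ?thesis unfolding U(3) convex_cone_hull_finite[OF U(1)]
   by (intro CollectI exI[of _ "\<lambda>u. a u + real k"]) auto
 qed
 hence "m + p\<in>P" using C(3) Mc.add[OF assms] \<open>p\<in>P\<close> PMc by blast
 ultimately show ?thesis by blast
qed

lemma Mc_add_P: "m\<in>Mc ==> p\<in>P ==> m + p\<in>Mc" using Mc.add PMc by blast

text \<open>The basis dual to the seed. Its vectors are coordinates on \<open>N\<close> and later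
  the test exponents m for comparing wall crossings.\<close>

definition ed :: "'i=>'a" where "ed = (SOME w. \<forall>i\<in>fd_I Fd. \<forall>j\<in>fd_I Fd. e j\<bullet>w i = (if j = i then 1 else 0))"

lemma ed: "i\<in>fd_I Fd ==> j\<in>fd_I Fd ==> e j\<bullet>ed i = (if j = i then 1 else 0)"
 unfolding ed_def using someI_ex[OF lattice_basis_dual[OF basN]] by blast

lemma e_mem: "i\<in>fd_I Fd ==> e i\<in>N" "i\<in>fd_Iuf Fd ==> e i\<in>Nu"
 using lattice_basis_vec[OF basN] lattice_basis_vec[OF basU] by blast+

lemma e_nonzero: "i\<in>fd_I Fd ==> e i\<noteq>0" using ed[of i i] by auto

lemma ed_uf_sum: assumes "j\<in>fd_I Fd" shows "(\<Sum>i\<in>fd_Iuf Fd. c i *\<^sub>R e i)\<bullet>ed j = (if j\<in>fd_Iuf Fd then c j else 0)"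
proof -
 have "(\<Sum>i\<in>fd_Iuf Fd. c i *\<^sub>R e i)\<bullet>ed j = (\<Sum>i\<in>fd_Iuf Fd. if i = j then c i else 0)"
  unfolding inner_sum_left using ed[OF assms] IufI by (intro sum.cong) auto
 thus ?thesis using finIuf by simp
qed

lemma Nu_expand: assumes "n\<in>Nu" shows "n = (\<Sum>i\<in>fd_Iuf Fd. (n\<bullet>ed i) *\<^sub>R e i)" and "i\<in>fd_I Fd ==> n\<bullet>ed i\<in>\<int>"
proof -
 obtain c :: "'i=>int" where c: "n = (\<Sum>i\<in>fd_Iuf Fd. of_int (c i) *\<^sub>R e i)"
  using assms basU unfolding lattice_basis_def by blast
 have "n\<bullet>ed i = (if i\<in>fd_Iuf Fd then of_int (c i) else 0)" if "i\<in>fd_I Fd" for i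
  unfolding c by (rule ed_uf_sum[OF that])
 thus "i\<in>fd_I Fd ==> n\<bullet>ed i\<in>\<int>" "n = (\<Sum>i\<in>fd_Iuf Fd. (n\<bullet>ed i) *\<^sub>R e i)" using IufI c by (auto intro!: sum.cong)
qed

lemma Nplus_iff: "n\<in>Nplus Fd e \<longleftrightarrow> n\<in>Nu \<and> n\<noteq>0 \<and> (\<forall>i\<in>fd_Iuf Fd. 0\<le>n\<bullet>ed i)"
proof
 assume "n\<in>Nplus Fd e"
 then obtain c :: "'i=>nat" where c: "n = (\<Sum>i\<in>fd_Iuf Fd. of_nat (c i) *\<^sub>R e i)" "n\<noteq>0" unfolding Nplus_def by blast
 have "n\<in>Nu" unfolding c(1) by (intro Nu.sum Nu.scale_nat e_mem)
 moreover have "0\<le>n\<bullet>ed i" if "i\<in>fd_Iuf Fd" for i using ed_uf_sum[of i "\<lambda>i. of_nat (c i)"] that IufI c(1) by auto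
 ultimately show "n\<in>Nu \<and> n\<noteq>0 \<and> (\<forall>i\<in>fd_Iuf Fd. 0\<le>n\<bullet>ed i)" using c(2) by blast
next
 assume n: "n\<in>Nu \<and> n\<noteq>0 \<and> (\<forall>i\<in>fd_Iuf Fd. 0\<le>n\<bullet>ed i)"
 have "n = (\<Sum>i\<in>fd_Iuf Fd. of_nat (nat \<lfloor>n\<bullet>ed i\<rfloor>) *\<^sub>R e i)"
 proof (subst Nu_expand(1)[of n])
  show "n\<in>Nu" using n by blast
  show "(\<Sum>i\<in>fd_Iuf Fd. (n\<bullet>ed i) *\<^sub>R e i) = (\<Sum>i\<in>fd_Iuf Fd. of_nat (nat \<lfloor>n\<bullet>ed i\<rfloor>) *\<^sub>R e i)"
  proof (rule sum.cong)
   fix i assume i: "i\<in>fd_Iuf Fd"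
   hence "n\<bullet>ed i\<in>\<int>" "0\<le>n\<bullet>ed i" using n Nu_expand(2) IufI by blast+
   thus "(n\<bullet>ed i) *\<^sub>R e i = of_nat (nat \<lfloor>n\<bullet>ed i\<rfloor>) *\<^sub>R e i" by (auto elim!: Ints_cases)
  qed simp
 qed
 thus "n\<in>Nplus Fd e" unfolding Nplus_def using n by (intro DiffI CollectI exI[of _ "\<lambda>i. nat \<lfloor>n\<bullet>ed i\<rfloor>"]) auto
qed

lemma Nplus_Nu: "n\<in>Nplus Fd e ==> n\<in>Nu" and Nplus_nonzero: "n\<in>Nplus Fd e ==> n\<noteq>0" and Nplus_N: "n\<in>Nplus Fd e ==> n\<in>N"
 using Nplus_iff NuN by blast+

lemma Nplus_pos: assumes "n\<in>Nplus Fd e" shows "\<exists>i\<in>fd_Iuf Fd. 0 < n\<bullet>ed i"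
proof (rule ccontr)
 assume "\<not> ?thesis"
 hence "\<forall>i\<in>fd_Iuf Fd. n\<bullet>ed i = 0" using assms Nplus_iff by force
 hence "n = 0" using Nu_expand(1)[OF Nplus_Nu[OF assms]] by simp
 thus False using assms Nplus_nonzero by blast
qed

lemma Nplus_scale: "n\<in>Nplus Fd e ==> 0 < j ==> of_nat j *\<^sub>R n\<in>Nplus Fd e" using Nu.scale_nat by (simp add: Nplus_iff)

lemma p1_Nplus: assumes "n\<in>Nplus Fd e" shows "p1 Fd n\<in>P" "p1 Fd n\<noteq>0"
proof -
 obtain c :: "'i=>nat" where c: "n = (\<Sum>i\<in>fd_Iuf Fd. of_nat (c i) *\<^sub>R e i)" using assms unfolding Nplus_def by blast
 have "p1 Fd n = (\<Sum>i\<in>fd_Iuf Fd. of_nat (c i) *\<^sub>R p1 Fd (e i))"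
  unfolding c using linear_p1 by (simp add: linear_sum linear_scale)
 moreover have "(\<Sum>i\<in>A. of_nat (c i) *\<^sub>R p1 Fd (e i))\<in>P" if "A\<subseteq>fd_Iuf Fd" for A
  using finite_subset[OF that finIuf] that
 proof (induction A rule: finite_induct)
  case (insert i A)
  hence "p1 Fd (e i)\<in>P" using sm unfolding seed_monoid_def by auto
  thus ?case using insert nat_scale_mem add_mem by simp
 qed (simp add: zero_mem)
 ultimately show "p1 Fd n\<in>P" by simp
 show "p1 Fd n\<noteq>0" using p1_nonzero Nplus_Nu[OF assms] Nplus_nonzero[OF assms] by blast
qed

lemma e_Nplus: "i\<in>fd_Iuf Fd ==> e i\<in>Nplus Fd e" using e_mem(2) e_nonzero ed IufI by (auto simp: Nplus_iff subset_iff)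

lemma primitive_e: "i\<in>fd_I Fd ==> primitive_in N (e i)" by (rule lattice_basis_primitive[OF basN])

lemma Nplus_primitive_eq: assumes "n\<in>Nplus Fd e" "n'\<in>Nplus Fd e" "primitive_in N n" "primitive_in N n'" "n' = r *\<^sub>R n"
 shows "n' = n"
proof -
 obtain i where i: "i\<in>fd_Iuf Fd" "0 < n\<bullet>ed i" using Nplus_pos[OF assms(1)] by blast
 have "0\<le>r * (n\<bullet>ed i)" using assms(2,5) i(1) Nplus_iff by (metis inner_scaleR_left)
 hence "0\<le>r" using i(2) by (simp add: zero_le_mult_iff)
 moreover have "r\<noteq>0" using assms(5) Nplus_nonzero[OF assms(2)] by auto
 ultimately have "0 < r" by simp
 thus ?thesis using primitive_in_unique[OF basN assms(3,4,5)] by simp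
qed

section \<open>Normal vectors in the sublattice\<close>

text \<open>The primitive vector of \<open>fd_Ncirc\<close> on the ray of n, which is the one that
  enters the wall-crossing exponent.\<close>

definition pc :: "'a=>'a" where "pc n = (SOME g. primitive_in Nc g \<and> (\<exists>t>0. g = t *\<^sub>R n))"

text \<open>Pigeonhole principle: two of the multiples of n lie in the same of the finitely many
  cosets.\<close>

lemma N_multiple: assumes "n\<in>N" shows "\<exists>c>0. of_nat c *\<^sub>R n\<in>Nc"
proof -
 have fi: "finite ((\<lambda>x. (+) x ` Nc) ` N)"
  using gfd unfolding generalized_fixed_data_def finite_index_def by (elim conjE) assumption
 have "range (\<lambda>j::nat. (+) (of_nat j *\<^sub>R n) ` Nc)\<subseteq>(\<lambda>x. (+) x ` Nc) ` N" using N.scale_nat[OF assms] by auto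
 hence "finite (range (\<lambda>j::nat. (+) (of_nat j *\<^sub>R n) ` Nc))" using fi finite_subset by blast
 hence "\<not> inj (\<lambda>j::nat. (+) (of_nat j *\<^sub>R n) ` Nc)" using finite_imageD by fastforce
 then obtain i j :: nat where ij: "i < j" "(+) (of_nat i *\<^sub>R n) ` Nc = (+) (of_nat j *\<^sub>R n) ` Nc"
  unfolding inj_def by (metis linorder_neqE_nat)
 have "of_nat j *\<^sub>R n + 0\<in>(+) (of_nat j *\<^sub>R n) ` Nc" using Nc.zero by blast
 hence "of_nat j *\<^sub>R n\<in>(+) (of_nat i *\<^sub>R n) ` Nc" using ij(2) by simp
 then obtain y where y: "y\<in>Nc" "of_nat j *\<^sub>R n = of_nat i *\<^sub>R n + y" by blast
 have "of_nat (j - i) *\<^sub>R n = y" using y(2) ij(1) by (simp add: of_nat_diff scaleR_diff_left)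
 thus ?thesis using y(1) ij(1) by (intro exI[of _ "j - i"]) auto
qed

lemma pc_ex: assumes "n\<in>N" "n\<noteq>0" shows "\<exists>g. primitive_in Nc g \<and> (\<exists>t>0. g = t *\<^sub>R n)"
proof -
 obtain c :: nat where c: "c > 0" "of_nat c *\<^sub>R n\<in>Nc" using N_multiple[OF assms(1)] by blast
 obtain b where b: "lattice_basis (fd_I Fd) b Nc" using basC by blast
 show ?thesis using lattice_line_generator[OF b c(2) _ assms(2)] c(1) by (metis of_nat_0_less_iff)
qed

lemma pc: assumes "n\<in>N" "n\<noteq>0" shows "primitive_in Nc (pc n)" "\<exists>t>0. pc n = t *\<^sub>R n"
 using someI_ex[OF pc_ex[OF assms]] unfolding pc_def by blast+

lemma pc_unique: assumes "n\<in>N" "n\<noteq>0" "primitive_in Nc g" "g = r *\<^sub>R n" "0 < r" shows "g = pc n"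
proof -
 obtain b where b: "lattice_basis (fd_I Fd) b Nc" using basC by blast
 obtain t where t: "t > 0" "pc n = t *\<^sub>R n" using pc(2)[OF assms(1,2)] by blast
 have "g = (r / t) *\<^sub>R pc n" using t assms(4) by simp
 moreover have "0 < r / t" using t(1) assms(5) by simp
 ultimately show ?thesis by (rule primitive_in_unique[OF b pc(1)[OF assms(1,2)] assms(3)])
qed

lemma pc_int: assumes "n\<in>N" "n\<noteq>0" "m\<in>Mc" shows "pc n\<bullet>m\<in>\<int>"
 using pc(1)[OF assms(1,2)] assms(3) by (auto simp: primitive_in_def fd_Mcirc_def dual_lattice_def)

lemma primitive_in_uminus: assumes "primitive_in Nc g" shows "primitive_in Nc (- g)" unfolding primitive_in_def
proof (intro conjI ballI allI impI)
 show "- g\<in>Nc" "- g\<noteq>0" using assms Nc.uminus by (auto simp: primitive_in_def)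
 fix x and c :: nat assume "x\<in>Nc" "- g = of_nat c *\<^sub>R x"
 hence "- x\<in>Nc" "g = of_nat c *\<^sub>R (- x)" using Nc.uminus by (auto simp flip: \<open>- g = of_nat c *\<^sub>R x\<close>)
 thus "c = 1" using assms unfolding primitive_in_def by blast
qed

lemma pc_uminus: assumes "n\<in>N" "n\<noteq>0" shows "pc (- n) = - pc n"
proof -
 obtain t where t: "t > 0" "pc n = t *\<^sub>R n" using pc(2)[OF assms] by blast
 have "- pc n = pc (- n)" by (rule pc_unique[where r = t])
   (use assms N.uminus primitive_in_uminus pc(1)[OF assms] t in auto)
 thus ?thesis by simp
qed

lemma pc_p1: assumes "n\<in>N" "n\<noteq>0" shows "pc n\<bullet>p1 Fd n = 0" using pc(2)[OF assms] p1_self by auto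

definition cnorm :: "'a=>'a=>'a" where "cnorm n u = (if n\<bullet>u < 0 then pc n else - pc n)"

text \<open>The wall spans the hyperplane, so every candidate is a multiple of n; primitivity fixes
  its length and the velocity its sign.\<close>

lemma crossing_normal_eq: assumes n: "n\<in>N" "n\<noteq>0" and d: "span d = orth n" and u: "n\<bullet>u\<noteq>0"
 shows "crossing_normal Fd d u = cnorm n u" unfolding crossing_normal_def
proof (rule the_equality)
 obtain t where t: "t > 0" "pc n = t *\<^sub>R n" using pc(2)[OF n] by blast
 have "d\<subseteq>orth n" using d span_superset by blast
 thus "primitive_in Nc (cnorm n u) \<and> d\<subseteq>orth (cnorm n u) \<and> cnorm n u\<bullet>u < 0"
  using pc(1)[OF n] primitive_in_uminus t u by (auto simp: cnorm_def orth_def mult_less_0_iff zero_less_mult_iff)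
 fix g assume g: "primitive_in Nc g \<and> d\<subseteq>orth g \<and> g\<bullet>u < 0"
 have "orth n\<subseteq>orth g" unfolding d[symmetric]
  using g by (intro span_minimal) (auto simp: orth_def subspace_hyperplane)
 have "\<exists>r. g = r *\<^sub>R n" using orth_subset_parallel \<open>orth n\<subseteq>orth g\<close> n(2) by blast
 then obtain r where r: "g = r *\<^sub>R n" by blast
 have "r\<noteq>0" using g r by (auto simp: primitive_in_def)
 then consider "r > 0" | "- r > 0" by linarith
 thus "g = cnorm n u"
 proof cases
  case 1
  hence "g = pc n" using pc_unique[OF n _ r] g by blast
  moreover have "n\<bullet>u < 0" using g r 1 by (auto simp: mult_less_0_iff)
  ultimately show ?thesis by (simp add: cnorm_def)
 next
  case 2
  have "- g = pc n" by (rule pc_unique[OF n, where r = "- r"]) (use g r 2 primitive_in_uminus in auto)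
  moreover have "\<not> n\<bullet>u < 0" using g r 2 by (auto simp: mult_less_0_iff)
  ultimately show ?thesis by (simp add: cnorm_def flip: \<open>- g = pc n\<close>)
 qed
qed

lemma cnorm_int: "n\<in>N ==> n\<noteq>0 ==> m\<in>Mc ==> cnorm n u\<bullet>m\<in>\<int>" using pc_int by (auto simp: cnorm_def)

lemma cnorm_p1: "n\<in>N ==> n\<noteq>0 ==> cnorm n u\<bullet>p1 Fd n = 0" using pc_p1 by (auto simp: cnorm_def)

end

section \<open>Generic points and generic paths\<close>

text \<open>
  The bad set is independent of the diagram: a countable union of rational subspaces of codimension
  two that contains the singular locus of every scattering diagram.
\<close>

definition bad_spaces :: "('i, 'a::euclidean_space, 'x) fixed_data=>'a set set" where
 "bad_spaces Fd = {span U |U. finite U \<and> U\<subseteq>fd_M Fd \<and> card U + 2\<le>DIM('a)} \<union>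
   {{x. n\<bullet>x = 0 \<and> n'\<bullet>x = 0} |n n'. n\<in>fd_N Fd \<and> n'\<in>fd_N Fd \<and> n\<noteq>0 \<and> n'\<notin>span {n}}"

definition generic :: "('i, 'a::euclidean_space, 'x) fixed_data=>'a=>bool" where "generic Fd x \<longleftrightarrow> x\<notin>\<Union>(bad_spaces Fd)"

definition regular :: "('i, 'a::euclidean_space, 'x) fixed_data=>'a=>bool" where
 "regular Fd x \<longleftrightarrow> generic Fd x \<and> (\<forall>n\<in>fd_N Fd. n\<noteq>0 --> n\<bullet>x\<noteq>0)"

text \<open>Refers to the lattices and not to a diagram, so that one path serves several diagrams;
  it is admissible for each of them by \<open>generic_path_admissible\<close>.\<close>

definition generic_path :: "('i, 'a::euclidean_space, 'x) fixed_data=>(real=>'a)=>bool" where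
 "generic_path Fd ga \<longleftrightarrow> smooth_immersion ga \<and> (\<forall>t\<in>{0..1}. generic Fd (ga t)) \<and>
   regular Fd (ga 0) \<and> regular Fd (ga 1) \<and>
   (\<forall>n\<in>fd_N Fd. \<forall>t\<in>{0..1}. n\<noteq>0 \<and> n\<bullet>ga t = 0 --> n\<bullet>velocity ga t\<noteq>0)"

section \<open>Segments and quadratic curves in general position\<close>

definition quad :: "'a::real_vector=>'a=>'a=>real=>'a" where "quad a b u t = a + t *\<^sub>R (b - a) + (t * (1 - t)) *\<^sub>R u"

abbreviation "seg a b \<equiv> quad a b 0"

lemma dim_orth_pair:
 fixes n :: "'a::euclidean_space" assumes "n\<noteq>0" "n'\<notin>span {n}" shows "dim {x. n\<bullet>x = 0 \<and> n'\<bullet>x = 0} + 2 = DIM('a)"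
proof -
 have ind: "independent {n', n}" using assms by (simp add: independent_insert)
 have ne: "n\<noteq>n'" using assms(2) span_base by auto
 have "dim {y\<in>UNIV. \<forall>x\<in>span {n', n}. orthogonal x y} + dim (span {n', n}) = dim (UNIV :: 'a set)"
  by (rule dim_subspace_orthogonal_to_vectors) auto
 moreover have "dim (span {n', n}) = 2" using dim_span_eq_card_independent[OF ind] ne by auto
 moreover have "{y\<in>UNIV. \<forall>x\<in>span {n', n}. orthogonal x y} = {x. n\<bullet>x = 0 \<and> n'\<bullet>x = 0}"
 proof (intro Set.set_eqI iffI)
  fix y assume "y\<in>{x. n\<bullet>x = 0 \<and> n'\<bullet>x = 0}"
  hence "orthogonal y x" if "x\<in>{n', n}" for x using that by (auto simp: orthogonal_def inner_commute)
  hence "orthogonal y x" if "x\<in>span {n', n}" for x using that orthogonal_to_span by blast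
  thus "y\<in>{y\<in>UNIV. \<forall>x\<in>span {n', n}. orthogonal x y}" by (auto simp: orthogonal_commute)
 qed (auto simp: orthogonal_def span_base)
 ultimately show ?thesis by simp
qed

lemma bad_space_subspace: "W\<in>bad_spaces Fd ==> subspace W"
proof -
 have "subspace {x. n\<bullet>x = 0 \<and> n'\<bullet>x = 0}" for n n' :: 'a by (auto simp: subspace_def inner_simps)
 thus "W\<in>bad_spaces Fd ==> subspace W" unfolding bad_spaces_def by auto
qed

lemma bad_space_dim:
 fixes Fd :: "('i, 'a::euclidean_space, 'x) fixed_data" shows "W\<in>bad_spaces Fd ==> dim W + 2\<le>DIM('a)"
 unfolding bad_spaces_def
proof (elim UnE)
 assume "W\<in>{span U |U. finite U \<and> U\<subseteq>fd_M Fd \<and> card U + 2\<le>DIM('a)}"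
 then obtain U where "W = span U" "finite U" "card U + 2\<le>DIM('a)" by blast
 thus ?thesis using dim_le_card'[of U] by simp
next
 assume "W\<in>{{x. n\<bullet>x = 0 \<and> n'\<bullet>x = 0} |n n'. n\<in>fd_N Fd \<and> n'\<in>fd_N Fd \<and> n\<noteq>0 \<and> n'\<notin>span {n}}"
 thus ?thesis using dim_orth_pair by force
qed

text \<open>Bad subspaces have codimension at least two, so adding one vector still leaves a proper
  subspace that can be avoided.\<close>

lemma dim_insert_bad:
 fixes Fd :: "('i, 'a::euclidean_space, 'x) fixed_data"
 assumes "W\<in>bad_spaces Fd" shows "dim (span (insert a W)) < DIM('a)"
 using bad_space_dim[OF assms] by (simp add: dim_insert split: if_splits)

lemma notin_span_swap: assumes "subspace W" "a\<notin>W" "b\<notin>span (insert a W)" shows "a\<notin>span (insert b W)"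
proof
 assume "a\<in>span (insert b W)"
 then obtain k where k: "a - k *\<^sub>R b\<in>span W" by (auto simp: span_insert)
 hence kW: "a - k *\<^sub>R b\<in>W" using assms(1) by (metis span_eq_iff)
 show False
 proof (cases "k = 0")
  case True
  thus False using kW assms(2) by simp
 next
  case False
  have "b = (1 / k) *\<^sub>R a - (1 / k) *\<^sub>R (a - k *\<^sub>R b)" using False by (simp add: scaleR_diff_right)
  also have "\<dots>\<in>span (insert a W)"
  proof (intro span_diff[OF span_scale span_scale])
   show "a\<in>span (insert a W)" "a - k *\<^sub>R b\<in>span (insert a W)" using kW by (auto intro: span_base)
  qed
  finally show False using assms(3) by blast
 qed
qed

lemma quad_vector_derivative: "(quad a b u has_vector_derivative (b - a) + (1 - 2 * t) *\<^sub>R u) (at t within S)"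
proof -
 have "((\<lambda>t. t *\<^sub>R (b - a)) has_vector_derivative (1 *\<^sub>R (b - a))) (at t within S)"
  by (intro derivative_eq_intros) auto
 moreover have "((\<lambda>t. (t * (1 - t)) *\<^sub>R u) has_vector_derivative ((1 - 2 * t) *\<^sub>R u)) (at t within S)"
 proof -
  have "((\<lambda>t. t * (1 - t)) has_real_derivative (1 - 2 * t)) (at t within S)" by (auto intro!: derivative_eq_intros)
  thus ?thesis using has_vector_derivative_scaleR[OF _ has_vector_derivative_const] by fastforce
 qed
 ultimately show ?thesis
  unfolding quad_def using has_vector_derivative_add[OF has_vector_derivative_add[OF has_vector_derivative_const]]
  by fastforce
qed

lemma velocity_eq: assumes "(ga has_vector_derivative v) (at t within {0..1})" "t\<in>{0..1}" shows "velocity ga t = v"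
 unfolding velocity_def using vector_derivative_within_cbox[of 0 1 t ga v] assms by simp

lemma velocity_quad: "t\<in>{0..1} ==> velocity (quad a b u) t = (b - a) + (1 - 2 * t) *\<^sub>R u"
 using velocity_eq quad_vector_derivative by blast

lemma smooth_immersion_quad: assumes "\<And>t. t\<in>{0..1} ==> (b - a) + (1 - 2 * t) *\<^sub>R u\<noteq>0"
 shows "smooth_immersion (quad a b u)"
proof -
 let ?g = "\<lambda>j::nat. if j = 0 then quad a b u else if j = 1 then (\<lambda>t. (b - a) + (1 - 2 * t) *\<^sub>R u)
  else if j = 2 then (\<lambda>t. (- 2) *\<^sub>R u) else (\<lambda>t. 0)"
 show ?thesis unfolding smooth_immersion_def
proof (intro exI[of _ ?g] conjI allI ballI)
 show "?g 0 = quad a b u" by simp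
 show "?g 1 t\<noteq>0" if "t\<in>{0..1}" for t using assms[OF that] by simp
 fix j :: nat and t assume "t\<in>{0..1::real}"
 consider "j = 0" | "j = 1" | "j \<ge> 2" by linarith
 thus "(?g j has_vector_derivative ?g (Suc j) t) (at t within {0..1})"
 proof cases
  case 1
  thus ?thesis using quad_vector_derivative by simp
 next
  case 2
  have "((\<lambda>t. 1 - 2 * t) has_real_derivative (- 2)) (at t within {0..1})" by (auto intro!: derivative_eq_intros)
  hence "((\<lambda>t. (1 - 2 * t) *\<^sub>R u) has_vector_derivative (- 2) *\<^sub>R u) (at t within {0..1})"
   using has_vector_derivative_scaleR[OF _ has_vector_derivative_const] by fastforce
  hence "((\<lambda>t. (b - a) + (1 - 2 * t) *\<^sub>R u) has_vector_derivative (- 2) *\<^sub>R u) (at t within {0..1})"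
   using has_vector_derivative_add[OF has_vector_derivative_const] by fastforce
  thus ?thesis using 2 by simp
 next
  case 3
  thus ?thesis by (auto intro: has_vector_derivative_const)
 qed
qed
qed

lemma quad_ends [simp]: "quad a b u 0 = a" "quad a b u 1 = b" by (simp_all add: quad_def)

lemma seg_inner: "n\<bullet>seg a b t = (1 - t) * (n\<bullet>a) + t * (n\<bullet>b)"
 by (simp add: quad_def inner_add_right inner_diff_right algebra_simps)

lemma seg_convex: "convex B ==> a\<in>B ==> b\<in>B ==> t\<in>{0..1} ==> seg a b t\<in>B"
proof -
 assume "convex B" "a\<in>B" "b\<in>B" "t\<in>{0..1}"
 hence "(1 - t) *\<^sub>R a + t *\<^sub>R b\<in>B" by (intro convexD) auto
 moreover have "seg a b t = (1 - t) *\<^sub>R a + t *\<^sub>R b" by (simp add: quad_def algebra_simps)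
 ultimately show ?thesis by simp
qed

lemma quadratic_roots_finite: "A\<noteq>0 ==> finite {t::real. A + B * t + C * t\<^sup>2 = 0}"
proof -
 assume "A\<noteq>0"
 hence "finite {t. poly [:A, B, C:] t = 0}" by (intro poly_roots_finite) auto
 moreover have "{t. poly [:A, B, C:] t = 0} = {t::real. A + B * t + C * t\<^sup>2 = 0}"
  by (auto simp: algebra_simps power2_eq_square)
 ultimately show ?thesis by simp
qed

lemma generic_path_quad: assumes "smooth_immersion (quad a b u)" "regular Fd a" "regular Fd b"
  and "\<And>W t. W\<in>bad_spaces Fd ==> 0 < t ==> t < 1 ==> quad a b u t\<notin>W"
  and "\<And>n t. n\<in>fd_N Fd ==> n\<noteq>0 ==> 0 < t ==> t < 1 ==> n\<bullet>quad a b u t = 0 ==>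
   n\<bullet>((b - a) + (1 - 2 * t) *\<^sub>R u)\<noteq>0" shows "generic_path Fd (quad a b u)"
proof -
 have ends: "t = 0 \<or> t = 1 \<or> (0 < t \<and> t < 1)" if "t\<in>{0..1::real}" for t using that by auto
 have "generic Fd (quad a b u t)" if "t\<in>{0..1}" for t
  using ends[OF that] assms(2,3,4) by (auto simp: regular_def generic_def)
 moreover have "n\<bullet>velocity (quad a b u) t\<noteq>0"
  if n: "n\<in>fd_N Fd" "t\<in>{0..1}" "n\<noteq>0 \<and> n\<bullet>quad a b u t = 0" for n t
 proof -
  have "t\<noteq>0" "t\<noteq>1" using assms(2,3) n by (auto simp: regular_def)
  thus ?thesis using ends[OF n(2)] assms(5)[OF n(1)] n by (simp add: velocity_quad)
 qed
 ultimately show ?thesis using assms(1-3) unfolding generic_path_def by auto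
qed

text \<open>The last condition keeps the whole segment off the bad subspaces: an interior point in W
  would put b into the span of a and W.\<close>

definition seg_ok :: "('i, 'a::euclidean_space, 'x) fixed_data=>'a=>'a=>bool" where
 "seg_ok Fd a b \<longleftrightarrow> regular Fd a \<and> regular Fd b \<and> a\<noteq>b \<and> (\<forall>W\<in>bad_spaces Fd. b\<notin>span (insert a W))"

lemma regularD_bad: "regular Fd a ==> W\<in>bad_spaces Fd ==> a\<notin>W" by (auto simp: regular_def generic_def)

lemma seg_ok_sym: "seg_ok Fd a b ==> seg_ok Fd b a"
 unfolding seg_ok_def using notin_span_swap bad_space_subspace regularD_bad by metis

lemma seg_ok_generic_path: assumes "seg_ok Fd a b" shows "generic_path Fd (seg a b)"
proof (rule generic_path_quad)
 show "smooth_immersion (seg a b)" using assms by (intro smooth_immersion_quad) (auto simp: seg_ok_def)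
 show "regular Fd a" "regular Fd b" using assms by (auto simp: seg_ok_def)
 show "seg a b t\<notin>W" if W: "W\<in>bad_spaces Fd" and t: "0 < t" "t < 1" for W t
 proof
  assume "seg a b t\<in>W"
  hence "seg a b t\<in>span (insert a W)" by (auto intro: span_base)
  hence "(1 / t) *\<^sub>R (seg a b t - (1 - t) *\<^sub>R a)\<in>span (insert a W)"
   by (intro span_scale span_diff) (auto intro: span_base)
  moreover have "seg a b t - (1 - t) *\<^sub>R a = t *\<^sub>R b" by (simp add: quad_def algebra_simps)
  ultimately have "b\<in>span (insert a W)" using t by simp
  thus False using assms W by (auto simp: seg_ok_def)
 qed
 show "n\<bullet>(b - a + (1 - 2 * t) *\<^sub>R 0)\<noteq>0"
  if "n\<in>fd_N Fd" "n\<noteq>0" "0 < t" "t < 1" "n\<bullet>seg a b t = 0" for n t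
 proof
  assume "n\<bullet>(b - a + (1 - 2 * t) *\<^sub>R 0) = 0"
  hence "n\<bullet>b = n\<bullet>a" by (simp add: inner_diff_right)
  hence "n\<bullet>a = 0" using that(5) by (simp add: seg_inner algebra_simps)
  thus False using assms that by (auto simp: seg_ok_def regular_def)
 qed
qed

lemma orthogonal_functional:
 fixes W :: "'a::euclidean_space set" assumes "a\<notin>span W" obtains n where "\<And>x. x\<in>span W ==> n\<bullet>x = 0" "n\<bullet>a\<noteq>0"
proof -
 obtain y z where yz: "y\<in>span W" "\<And>w. w\<in>span W ==> orthogonal z w" "a = y + z"
  using orthogonal_subspace_decomp_exists[of W a] by blast
 have "z\<noteq>0" using yz assms by auto
 have "z\<bullet>a = z\<bullet>z" using yz(2)[OF yz(1)] yz(3) by (simp add: inner_add_right orthogonal_def)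
 thus ?thesis using that[of z] yz(2) \<open>z\<noteq>0\<close> by (simp add: orthogonal_def)
qed

text \<open>The curve is bumped in the direction w. Each bad subspace and each rational hyperplane
  excludes only finitely many parameters s, and there are countably many of them.\<close>

lemma quad_bad_countable:
 fixes Fd :: "('i, 'a::euclidean_space, 'x) fixed_data" assumes a: "regular Fd a" and b: "regular Fd b" and ab: "a\<noteq>b"
  and w1: "\<And>W. W\<in>bad_spaces Fd ==> w\<notin>span (insert a W)" and w2: "\<And>n. n\<in>fd_N Fd ==> n\<noteq>0 ==> n\<bullet>w\<noteq>0"
  and w3: "w\<notin>span {b - a}" and cZ: "countable (bad_spaces Fd)" and cN: "countable (fd_N Fd)"
 shows "countable {s. \<not> generic_path Fd (quad a b (u0 + s *\<^sub>R w))}"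
proof -
 define SW where "SW = (\<lambda>W. {s. \<exists>t. 0 < t \<and> t < 1 \<and> quad a b (u0 + s *\<^sub>R w) t\<in>W})"
 define Sn where "Sn = (\<lambda>n. {s. \<exists>t. 0 < t \<and> t < 1 \<and> n\<bullet>quad a b (u0 + s *\<^sub>R w) t = 0 \<and>
  n\<bullet>((b - a) + (1 - 2 * t) *\<^sub>R (u0 + s *\<^sub>R w)) = 0})"
 define S0 where "S0 = {s. \<exists>t\<in>{0..1}. (b - a) + (1 - 2 * t) *\<^sub>R (u0 + s *\<^sub>R w) = 0}"
 have shift: "quad a b (u0 + s *\<^sub>R w) t = quad a b u0 t + (t * (1 - t) * s) *\<^sub>R w" for s t
  by (simp add: quad_def scaleR_add_right)
 have fW: "finite (SW W)" if W: "W\<in>bad_spaces Fd" for W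
 proof -
  have sub: "subspace W" using bad_space_subspace[OF W] .
  have aW: "a\<notin>W" using regularD_bad[OF a W] .
  have wW: "w\<notin>W" using w1[OF W] by (meson insertI2 span_base)
  \<comment> \<open>A functional that kills w and W but not a makes the incidence condition
    independent of s: the curve can meet W only at the roots of a quadratic in t, and at each such
    time for a single s, because w is not in W.\<close>
  have "a\<notin>span (insert w W)" using notin_span_swap[OF sub aW w1[OF W]] .
  then obtain n where n: "\<And>x. x\<in>span (insert w W) ==> n\<bullet>x = 0" "n\<bullet>a\<noteq>0" using orthogonal_functional by blast
  define T where "T = {t. n\<bullet>a + (n\<bullet>(b - a) + n\<bullet>u0) * t + (- (n\<bullet>u0)) * t\<^sup>2 = 0}"
  have finT: "finite T" unfolding T_def by (rule quadratic_roots_finite[OF n(2)])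
  define h where "h = (\<lambda>t. SOME s. quad a b (u0 + s *\<^sub>R w) t\<in>W)"
  have "SW W\<subseteq>h ` T"
  proof
   fix s assume "s\<in>SW W"
   then obtain t where t: "0 < t" "t < 1" "quad a b (u0 + s *\<^sub>R w) t\<in>W" unfolding SW_def by blast
   have "n\<bullet>quad a b (u0 + s *\<^sub>R w) t = 0" using n(1) t(3) by (meson insertI2 span_base)
   moreover have "n\<bullet>w = 0" using n(1) by (meson insertI1 span_base)
   ultimately have "n\<bullet>quad a b u0 t = 0" by (simp add: shift inner_add_right)
   hence "t\<in>T" by (simp add: T_def quad_def inner_add_right algebra_simps power2_eq_square)
   have "quad a b (u0 + h t *\<^sub>R w) t\<in>W" unfolding h_def using t(3) by (rule someI)
   hence "quad a b (u0 + s *\<^sub>R w) t - quad a b (u0 + h t *\<^sub>R w) t\<in>W" using subspace_diff[OF sub t(3)] by blast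
   hence "(t * (1 - t) * (s - h t)) *\<^sub>R w\<in>W" by (simp add: shift algebra_simps flip: scaleR_diff_left)
   hence "(1 / (t * (1 - t) * (s - h t))) *\<^sub>R (t * (1 - t) * (s - h t)) *\<^sub>R w\<in>W" by (rule subspace_scale[OF sub])
   hence "t * (1 - t) * (s - h t) = 0" using wW by (cases "t * (1 - t) * (s - h t) = 0") auto
   hence "s = h t" using t by simp
   thus "s\<in>h ` T" using \<open>t\<in>T\<close> by blast
  qed
  thus ?thesis using finT finite_subset by blast
 qed
 have fn: "finite (Sn n)" if n: "n\<in>fd_N Fd" "n\<noteq>0" for n
 proof -
  define A where "A = n\<bullet>a"
  define B where "B = n\<bullet>(b - a)"
  define c where "c = n\<bullet>u0"
  define d where "d = n\<bullet>w"
  have A0: "A\<noteq>0" using a n by (auto simp: A_def regular_def)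
  have d0: "d\<noteq>0" using w2 n by (auto simp: d_def)
  \<comment> \<open>Tangency gives two equations in s and t. Eliminating c + s d leaves this
    quadratic in t, with constant term A, which is nonzero because a is regular.\<close>
  define T where "T = {t. A + (- 2 * A) * t + (- B) * t\<^sup>2 = 0}"
  have finT: "finite T" unfolding T_def by (rule quadratic_roots_finite[OF A0])
  define h where "h = (\<lambda>t. - (A + t * B + t * (1 - t) * c) / (t * (1 - t) * d))"
  have "Sn n\<subseteq>h ` T"
  proof
   fix s assume "s\<in>Sn n"
   then obtain t where t: "0 < t" "t < 1" "n\<bullet>quad a b (u0 + s *\<^sub>R w) t = 0"
    "n\<bullet>((b - a) + (1 - 2 * t) *\<^sub>R (u0 + s *\<^sub>R w)) = 0" unfolding Sn_def by blast
   have 1: "A + t * B + t * (1 - t) * (c + s * d) = 0"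
    using t(3) by (simp add: quad_def inner_add_right A_def B_def c_def d_def)
   have 2: "B + (1 - 2 * t) * (c + s * d) = 0" using t(4) by (simp add: inner_add_right B_def c_def d_def)
   have "(A + t * B + t * (1 - t) * (c + s * d)) * (1 - 2 * t) - (B + (1 - 2 * t) * (c + s * d)) * (t * (1 - t)) = 0"
    unfolding 1 2 by simp
   hence "t\<in>T" unfolding T_def by (simp add: algebra_simps power2_eq_square)
   moreover have "t * (1 - t) * d\<noteq>0" using t d0 by simp
   hence "s = h t" unfolding h_def using 1 by (simp add: divide_simps) (simp add: algebra_simps)
   ultimately show "s\<in>h ` T" by blast
  qed
  thus ?thesis using finT finite_subset by blast
 qed
 \<comment> \<open>At a time of zero velocity u0 + s w is parallel to b - a, which determines s
   because w is not.\<close>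
 have f0: "finite S0"
 proof (rule finite_subset)
  show "S0\<subseteq>{SOME s. u0 + s *\<^sub>R w\<in>span {b - a}}"
  proof
   fix s assume "s\<in>S0"
   then obtain t where t: "(b - a) + (1 - 2 * t) *\<^sub>R (u0 + s *\<^sub>R w) = 0" unfolding S0_def by blast
   have "1 - 2 * t\<noteq>0" using t ab by auto
   have "(1 - 2 * t) *\<^sub>R (u0 + s *\<^sub>R w) = - (b - a)" using t by (simp add: add_eq_0_iff)
   hence "(1 / (1 - 2 * t)) *\<^sub>R (1 - 2 * t) *\<^sub>R (u0 + s *\<^sub>R w)\<in>span {b - a}"
    by (metis span_mul span_neg span_base insertI1)
   hence s: "u0 + s *\<^sub>R w\<in>span {b - a}" using \<open>1 - 2 * t\<noteq>0\<close> by simp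
   define s' where "s' = (SOME s. u0 + s *\<^sub>R w\<in>span {b - a})"
   have "u0 + s' *\<^sub>R w\<in>span {b - a}" unfolding s'_def using s by (rule someI)
   hence "(s - s') *\<^sub>R w\<in>span {b - a}" using span_diff[OF s, of "u0 + s' *\<^sub>R w"] by (simp add: scaleR_diff_left)
   hence "(1 / (s - s')) *\<^sub>R (s - s') *\<^sub>R w\<in>span {b - a}" by (rule span_scale)
   hence "s = s'" using w3 by (cases "s = s'") auto
   thus "s\<in>{SOME s. u0 + s *\<^sub>R w\<in>span {b - a}}" by (simp add: s'_def)
  qed
 qed simp
 have "{s. \<not> generic_path Fd (quad a b (u0 + s *\<^sub>R w))} \<subseteq>
   (\<Union>W\<in>bad_spaces Fd. SW W) \<union> (\<Union>n\<in>fd_N Fd - {0}. Sn n) \<union> S0"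
 proof (rule subsetI, rule ccontr)
  fix s assume s: "s\<in>{s. \<not> generic_path Fd (quad a b (u0 + s *\<^sub>R w))}"
   and no: "s\<notin>(\<Union>W\<in>bad_spaces Fd. SW W) \<union> (\<Union>n\<in>fd_N Fd - {0}. Sn n) \<union> S0"
  have "generic_path Fd (quad a b (u0 + s *\<^sub>R w))"
  proof (rule generic_path_quad[OF smooth_immersion_quad a b])
   show "b - a + (1 - 2 * t) *\<^sub>R (u0 + s *\<^sub>R w)\<noteq>0" if "t\<in>{0..1}" for t using no that by (auto simp: S0_def)
   show "quad a b (u0 + s *\<^sub>R w) t\<notin>W" if "W\<in>bad_spaces Fd" "0 < t" "t < 1" for W t
    using no that by (auto simp: SW_def)
   show "n\<bullet>(b - a + (1 - 2 * t) *\<^sub>R (u0 + s *\<^sub>R w))\<noteq>0"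
    if "n\<in>fd_N Fd" "n\<noteq>0" "0 < t" "t < 1" "n\<bullet>quad a b (u0 + s *\<^sub>R w) t = 0" for n t
    using no that by (auto simp: Sn_def)
  qed
  thus False using s by simp
 qed
 moreover have "countable ((\<Union>W\<in>bad_spaces Fd. SW W) \<union> (\<Union>n\<in>fd_N Fd - {0}. Sn n) \<union> S0)"
  using fW fn f0 cZ cN by (intro countable_Un countable_UN) (auto intro: countable_finite)
 ultimately show ?thesis using countable_subset by blast
qed

lemma smooth_immersion_reparam: assumes "smooth_immersion ga" "0\<le>c" "0 < d" "c + d\<le>1"
 shows "smooth_immersion (\<lambda>t. ga (c + d * t))"
  and "t\<in>{0..1} ==> velocity (\<lambda>t. ga (c + d * t)) t = d *\<^sub>R velocity ga (c + d * t)"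
proof -
 obtain g where g: "g 0 = ga" "\<And>j t. t\<in>{0..1} ==> (g j has_vector_derivative g (Suc j) t) (at t within {0..1})"
  "\<And>t. t\<in>{0..1} ==> g 1 t\<noteq>0" using assms(1) unfolding smooth_immersion_def by blast
 have rng: "c + d * t\<in>{0..1}" if "t\<in>{0..1}" for t
 proof -
  have "d * t\<le>d" "0\<le>d * t" using that assms by (simp_all add: mult_left_le)
  hence "0\<le>c + d * t" "c + d * t\<le>1" using assms by linarith+
  thus ?thesis by simp
 qed
 have der: "((\<lambda>t. g j (c + d * t)) has_vector_derivative d *\<^sub>R g (Suc j) (c + d * t)) (at t within {0..1})"
  if t: "t\<in>{0..1}" for j t
 proof -
  have 1: "((\<lambda>t. c + d * t) has_vector_derivative d) (at t within {0..1})"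
   by (auto intro!: derivative_eq_intros simp flip: has_real_derivative_iff_has_vector_derivative)
  have "(\<lambda>t. c + d * t) ` {0..1}\<subseteq>{0..1}" using rng by blast
  hence 2: "(g j has_vector_derivative g (Suc j) (c + d * t)) (at (c + d * t) within (\<lambda>t. c + d * t) ` {0..1})"
   using g(2)[OF rng[OF t]] has_vector_derivative_within_subset by blast
  show ?thesis using vector_diff_chain_within[OF 1 2] by (simp add: o_def)
 qed
 show "smooth_immersion (\<lambda>t. ga (c + d * t))" unfolding smooth_immersion_def
 proof (intro exI[of _ "\<lambda>j t. d ^ j *\<^sub>R g j (c + d * t)"] conjI allI ballI)
  show "(\<lambda>t. d ^ 0 *\<^sub>R g 0 (c + d * t)) = (\<lambda>t. ga (c + d * t))" using g(1) by simp
  fix j t assume t: "t\<in>{0..1::real}"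
  have "((\<lambda>t. d ^ j *\<^sub>R g j (c + d * t)) has_vector_derivative d ^ j *\<^sub>R (d *\<^sub>R g (Suc j) (c + d * t))) (at t within {0..1})"
   by (rule bounded_linear.has_vector_derivative[OF bounded_linear_scaleR_right der[OF t]])
  thus "((\<lambda>t. d ^ j *\<^sub>R g j (c + d * t)) has_vector_derivative d ^ Suc j *\<^sub>R g (Suc j) (c + d * t)) (at t within {0..1})"
   by (simp add: mult.commute)
 next
  fix t assume "t\<in>{0..1::real}"
  thus "d ^ 1 *\<^sub>R g 1 (c + d * t)\<noteq>0" using g(3)[OF rng] assms by simp
 qed
 show "velocity (\<lambda>t. ga (c + d * t)) t = d *\<^sub>R velocity ga (c + d * t)" if t: "t\<in>{0..1}"
 proof -
  have "velocity ga (c + d * t) = g 1 (c + d * t)"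
   using velocity_eq[OF _ rng[OF t]] g(1,2) rng[OF t] by (metis One_nat_def)
  moreover have "velocity (\<lambda>t. ga (c + d * t)) t = d *\<^sub>R g 1 (c + d * t)"
   using velocity_eq[OF _ t] der[OF t, of 0] g(1) by (metis One_nat_def)
  ultimately show ?thesis by simp
 qed
qed

lemma generic_path_reparam:
 assumes "generic_path Fd ga" "0\<le>c" "0 < d" "c + d\<le>1" "regular Fd (ga c)" "regular Fd (ga (c + d))"
 shows "generic_path Fd (\<lambda>t. ga (c + d * t))"
proof -
 have im: "smooth_immersion ga" using assms(1) by (simp add: generic_path_def)
 have rng: "c + d * t\<in>{0..1}" if "t\<in>{0..1}" for t
 proof -
  have "d * t\<le>d" "0\<le>d * t" using that assms by (simp_all add: mult_left_le)
  hence "0\<le>c + d * t" "c + d * t\<le>1" using assms by linarith+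
  thus ?thesis by simp
 qed
 show ?thesis using assms rng smooth_immersion_reparam[OF im assms(2-4)] unfolding generic_path_def by auto
qed

section \<open>Vectors and points in general position\<close>

context seed_data
begin

text \<open>By injectivity, \<open>p1 Fd (e i)\<close> is a nonzero vector, and it is orthogonal to
  \<open>e i\<close> by skew-symmetry.\<close>

lemma DIM2: "2\<le>DIM('a)"
proof -
 obtain i where i: "i\<in>fd_Iuf Fd" using ufne by blast
 have n: "e i\<noteq>0" "p1 Fd (e i)\<noteq>0" "e i\<bullet>p1 Fd (e i) = 0"
  using e_nonzero i IufI p1_Nplus(2)[OF e_Nplus[OF i]] p1_self by auto
 hence "p1 Fd (e i)\<in>orth (e i)" by (simp add: orth_def)
 hence "\<not> orth (e i)\<subseteq>{0}" using n(2) by auto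
 hence "dim (orth (e i))\<noteq>0" by (simp add: dim_eq_0)
 thus ?thesis using orth_dim(2)[OF n(1)] by linarith
qed

lemma countable_N: "countable N" by (rule countable_lattice[OF basN])

lemma countable_bad: "countable (bad_spaces Fd)"
proof -
 have "countable M" unfolding fd_M_def by (rule countable_dual_lattice[OF basN cardI])
 hence "countable {U. finite U \<and> U\<subseteq>M}" by (rule countable_Collect_finite_subset)
 hence "countable (span ` {U. finite U \<and> U\<subseteq>M})" by (rule countable_image)
 hence 1: "countable {span U |U. finite U \<and> U\<subseteq>M \<and> card U + 2\<le>DIM('a)}" by (rule countable_subset[rotated]) auto
 have "countable ((\<lambda>(n, n'). {x. n\<bullet>x = 0 \<and> n'\<bullet>x = 0}) ` (N \<times> N))"
  using countable_N by (intro countable_image countable_SIGMA)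
 hence 2: "countable {{x. n\<bullet>x = 0 \<and> n'\<bullet>x = 0} |n n'. n\<in>N \<and> n'\<in>N \<and> n\<noteq>0 \<and> n'\<notin>span {n}}"
  by (rule countable_subset[rotated]) auto
 show ?thesis unfolding bad_spaces_def using 1 2 by (rule countable_Un)
qed

lemma escape: assumes "finite A" "finite B" "open S" "S\<noteq>{}"
 obtains w where "w\<in>S" "\<And>a W. a\<in>A ==> W\<in>bad_spaces Fd ==> w\<notin>span (insert a W)"
  "\<And>n. n\<in>N ==> n\<noteq>0 ==> n\<bullet>w\<noteq>0" "\<And>b. b\<in>B ==> w\<notin>span {b}"
proof -
 define \<W> where "\<W> = (\<lambda>(a, W). span (insert a W)) ` (A \<times> bad_spaces Fd) \<union> orth ` (N - {0}) \<union> (\<lambda>b. span {b}) ` B"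
 have "countable \<W>" unfolding \<W>_def using assms countable_bad countable_N
  by (intro countable_Un countable_image countable_SIGMA) (auto intro: countable_finite)
 moreover have "dim W < DIM('a)" if "W\<in>\<W>" for W
 proof -
  have "dim (span {b}) < DIM('a)" for b :: 'a using DIM2 by (simp add: dim_insert)
  moreover have "dim (orth n) < DIM('a)" if "n\<noteq>0" for n :: 'a using orth_dim(2)[OF that] DIM2 by linarith
  ultimately show ?thesis using that dim_insert_bad unfolding \<W>_def by fastforce
 qed
 ultimately obtain w where w: "w\<in>S" "w\<notin>\<Union>\<W>" using escape_subspaces assms(3,4) by metis
 show ?thesis
 proof (rule that[OF w(1)])
  show "w\<notin>span (insert a W)" if "a\<in>A" "W\<in>bad_spaces Fd" for a W using w(2) that unfolding \<W>_def by blast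
  show "n\<bullet>w\<noteq>0" if "n\<in>N" "n\<noteq>0" for n using w(2) that unfolding \<W>_def by (auto simp: orth_def)
  show "w\<notin>span {b}" if "b\<in>B" for b using w(2) that unfolding \<W>_def by blast
 qed
qed

lemma regular_escape: assumes "finite A" "\<And>a. a\<in>A ==> regular Fd a" "open S" "S\<noteq>{}"
 obtains b where "b\<in>S" "regular Fd b" "\<And>a. a\<in>A ==> seg_ok Fd a b"
proof -
 \<comment> \<open>The additional element 0 makes b avoid the bad subspaces themselves.\<close>
 obtain b where b: "b\<in>S" "\<And>a W. a\<in>insert 0 A ==> W\<in>bad_spaces Fd ==> b\<notin>span (insert a W)"
  "\<And>n. n\<in>N ==> n\<noteq>0 ==> n\<bullet>b\<noteq>0" "\<And>a. a\<in>A ==> b\<notin>span {a}" using escape[of "insert 0 A" A S] assms by blast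
 have "b\<notin>W" if "W\<in>bad_spaces Fd" for W using b(2)[of 0 W] that by (meson insertI1 insertI2 span_base)
 hence reg: "regular Fd b" using b(3) by (auto simp: regular_def generic_def)
 moreover have "seg_ok Fd a b" if "a\<in>A" for a
 proof -
  have "a\<noteq>b" using b(4)[OF that] span_base[of a "{a}"] by auto
  thus ?thesis unfolding seg_ok_def using assms(2) reg b(2) that by simp
 qed
 ultimately show ?thesis using that b(1) by blast
qed

text \<open>A point outside the span of n with any bad subspace projects orthogonally to a generic
  point of the hyperplane, and close to x the projection stays in S.\<close>

lemma generic_on_hyperplane: assumes n: "n\<noteq>0" and x: "n\<bullet>x = 0" "x\<in>S" and S: "open S"
 obtains y where "y\<in>S" "n\<bullet>y = 0" "generic Fd y"
proof -
 define f where "f = (\<lambda>z. z - ((n\<bullet>z) / (n\<bullet>n)) *\<^sub>R n)"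
 have cont: "continuous_on UNIV f" unfolding f_def using n by (intro continuous_intros) auto
 have "open (f -` S)" using open_vimage[OF S cont] .
 moreover have "f x = x" using x by (simp add: f_def)
 hence "f -` S\<noteq>{}" using x by auto
 ultimately obtain z where z: "z\<in>f -` S" "\<And>W. W\<in>bad_spaces Fd ==> z\<notin>span (insert n W)"
  using escape[of "{n}" "{}" "f -` S"] by (metis finite.emptyI finite_insert insertI1)
 have "n\<bullet>f z = 0" using n by (simp add: f_def inner_diff_right)
 moreover have "f z\<notin>W" if W: "W\<in>bad_spaces Fd" for W
 proof
  assume "f z\<in>W"
  hence "f z + ((n\<bullet>z) / (n\<bullet>n)) *\<^sub>R n\<in>span (insert n W)" by (intro span_add span_scale) (auto intro: span_base)
  thus False using z(2)[OF W] by (simp add: f_def)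
 qed
 ultimately show ?thesis using that[of "f z"] z(1) by (auto simp: generic_def)
qed

lemma generic_parallel: assumes "generic Fd x" "n\<in>N" "n'\<in>N" "n\<noteq>0" "n\<bullet>x = 0" "n'\<bullet>x = 0" shows "\<exists>r. n' = r *\<^sub>R n"
proof -
 have "n'\<in>span {n}" using assms unfolding generic_def bad_spaces_def by blast
 thus ?thesis by (auto simp: span_singleton)
qed

end

section \<open>Walls of a scattering diagram\<close>

locale scat = seed_data Fd e P
 for Fd :: "('i, 'a::euclidean_space, 'x) fixed_data" and e and P +
 fixes D :: "('w, 'a, ('x, 'k::field_char_0) coeff_poly) diagram" assumes sd: "scattering_diagram Fd e P D"
begin

definition wn :: "'w=>'a" where "wn w = (SOME n0. wall_for Fd e P n0 (sd_supp D w) (sd_fun D w))"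

lemma wall: assumes "w\<in>sd_index D" shows "wall_for Fd e P (wn w) (sd_supp D w) (sd_fun D w)"
proof -
 have "\<exists>n0. wall_for Fd e P n0 (sd_supp D w) (sd_fun D w)" using sd assms unfolding scattering_diagram_def by blast
 thus ?thesis unfolding wn_def by (rule someI_ex)
qed

lemma wn_facts: assumes "w\<in>sd_index D" shows wn_Nplus: "wn w\<in>Nplus Fd e" and wn_prim: "primitive_in N (wn w)"
  and supp_cone: "rational_cone Fd (sd_supp D w)" and supp_dim: "aff_dim (sd_supp D w) = int DIM('a) - 1"
  and supp_orth: "sd_supp D w\<subseteq>orth (wn w)"
  and fun_carrier: "sd_fun D w\<in>carrier (completed_ring Fd P)" and fun_0: "sd_fun D w 0 = 1"
  and fun_ray: "sd_fun D w m\<noteq>0 ==> \<exists>j::nat. m = of_nat j *\<^sub>R p1 Fd (wn w)"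
 using wall[OF assms] unfolding wall_for_def by (simp_all only: simp_thms)

lemma wn_N: "w\<in>sd_index D ==> wn w\<in>N" and wn_nonzero: "w\<in>sd_index D ==> wn w\<noteq>0"
 using wn_Nplus Nplus_N Nplus_nonzero by blast+

lemma supp_hull: assumes "w\<in>sd_index D"
 obtains U where "finite U" "U\<subseteq>M" "sd_supp D w = convex_cone hull U"
 using supp_cone[OF assms] unfolding rational_cone_def by (elim exE conjE) (rule that; assumption)

lemma supp_props: assumes w: "w\<in>sd_index D"
 shows supp_closed: "closed (sd_supp D w)" and supp_convex: "convex (sd_supp D w)"
  and supp_0: "0\<in>sd_supp D w" and supp_scale: "x\<in>sd_supp D w ==> 0\<le>c ==> c *\<^sub>R x\<in>sd_supp D w"
proof -
 obtain U where U: "finite U" "U\<subseteq>M" "sd_supp D w = convex_cone hull U" by (rule supp_hull[OF w])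
 show "closed (sd_supp D w)" "convex (sd_supp D w)" "0\<in>sd_supp D w"
  unfolding U(3) by (simp_all add: closed_convex_cone_hull_finite[OF U(1)] convex_convex_cone_hull convex_cone_hull_contains_0)
 show "x\<in>sd_supp D w ==> 0\<le>c ==> c *\<^sub>R x\<in>sd_supp D w" unfolding U(3) by (rule convex_cone_hull_mul)
qed

lemma supp_span: assumes w: "w\<in>sd_index D" shows "span (sd_supp D w) = orth (wn w)"
proof -
 note o = orth_dim[OF wn_nonzero[OF w]]
 have sub: "span (sd_supp D w)\<subseteq>orth (wn w)" by (rule span_minimal[OF supp_orth[OF w] o(1)])
 have "0\<in>affine hull (sd_supp D w)" using supp_0[OF w] hull_inc by metis
 hence "int (dim (sd_supp D w)) = int DIM('a) - 1" using supp_dim[OF w] aff_dim_zero[of "sd_supp D w"] by simp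
 hence "dim (span (sd_supp D w)) = dim (orth (wn w))" using o(2) DIM2 by simp
 thus ?thesis using sub o(1) subspace_dim_equal[OF subspace_span o(1) sub] by simp
qed

lemma supp_affine: "w\<in>sd_index D ==> affine hull (sd_supp D w) = orth (wn w)"
 using supp_span supp_0 affine_hull_span_0[of "sd_supp D w"] by (metis hull_inc)

lemma rel_interior_ball: assumes w: "w\<in>sd_index D" and x: "x\<in>rel_interior (sd_supp D w)"
 shows "\<exists>\<rho>>0. ball x \<rho> \<inter> orth (wn w)\<subseteq>sd_supp D w" using x unfolding mem_rel_interior_ball supp_affine[OF w] by blast

text \<open>Spans of few generators of the cone are bad subspaces, which is the hypothesis of
  \<open>cone_rel_interior\<close>.\<close>

lemma generic_rel_interior: assumes w: "w\<in>sd_index D" and x: "x\<in>sd_supp D w" "generic Fd x"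
 shows "x\<in>rel_interior (sd_supp D w)"
proof -
 obtain U where U: "finite U" "U\<subseteq>M" "sd_supp D w = convex_cone hull U" by (rule supp_hull[OF w])
 show ?thesis
 proof (rule cone_rel_interior[OF U(1,3) supp_orth[OF w] wn_nonzero[OF w] x(1)])
  fix S assume S: "S\<subseteq>U" "card S + 2\<le>DIM('a)"
  hence "finite S" "S\<subseteq>M" using U finite_subset by auto
  hence "span S\<in>bad_spaces Fd" using S(2) unfolding bad_spaces_def by blast
  thus "x\<notin>span S" using x(2) unfolding generic_def by blast
 qed
qed

lemma rel_interior_both_dim: assumes w: "w\<in>sd_index D" "w'\<in>sd_index D"
  and x: "x\<in>rel_interior (sd_supp D w)" "x\<in>rel_interior (sd_supp D w')"
 shows "aff_dim (orth (wn w) \<inter> orth (wn w'))\<le>aff_dim (sd_supp D w \<inter> sd_supp D w')"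
proof -
 obtain r r' where r: "r > 0" "ball x r \<inter> orth (wn w)\<subseteq>sd_supp D w" "r' > 0" "ball x r' \<inter> orth (wn w')\<subseteq>sd_supp D w'"
  using rel_interior_ball[OF w(1) x(1)] rel_interior_ball[OF w(2) x(2)] by blast
 let ?W = "orth (wn w) \<inter> orth (wn w')"
 have sub: "subspace ?W" by (intro subspace_inter orth_dim(1) wn_nonzero w)
 have xW: "x\<in>?W" using x rel_interior_subset supp_orth w by blast
 have "aff_dim (?W \<inter> ball x (min r r')) = aff_dim ?W"
  using sub xW r by (intro aff_dim_convex_Int_open) (auto simp: subspace_imp_convex)
 moreover have "?W \<inter> ball x (min r r')\<subseteq>sd_supp D w \<inter> sd_supp D w'" using r by auto
 ultimately show ?thesis using aff_dim_subset by metis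
qed

text \<open>Two walls through a generic point have parallel, hence equal, normal vectors. Both
  contain a neighbourhood of the point in their hyperplane, so they do not meet in codimension
  two.\<close>

lemma generic_not_sing: assumes x: "generic Fd x" shows "x\<notin>sd_sing D"
proof
 assume "x\<in>sd_sing D"
 then consider w where "w\<in>sd_index D" "x\<in>rel_frontier (sd_supp D w)" |
  w w' where "w\<in>sd_index D" "w'\<in>sd_index D" "x\<in>sd_supp D w" "x\<in>sd_supp D w'"
   "aff_dim (sd_supp D w \<inter> sd_supp D w') = int DIM('a) - 2" unfolding sd_sing_def by blast
 thus False
 proof cases
  case (1 w)
  hence "x\<in>sd_supp D w" using supp_closed[OF 1(1)] by (simp add: rel_frontier_def)
  thus False using generic_rel_interior[OF 1(1) _ x] 1(2) by (simp add: rel_frontier_def)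
 next
  case (2 w w')
  have "wn w\<bullet>x = 0" "wn w'\<bullet>x = 0" using 2 supp_orth by (auto simp: orth_def)
  then obtain r where "wn w' = r *\<^sub>R wn w"
   using generic_parallel[OF x wn_N[OF 2(1)] wn_N[OF 2(2)] wn_nonzero[OF 2(1)]] by blast
  hence "wn w' = wn w" using Nplus_primitive_eq wn_Nplus wn_prim 2 by blast
  hence "aff_dim (orth (wn w))\<le>aff_dim (sd_supp D w \<inter> sd_supp D w')"
   using rel_interior_both_dim[OF 2(1,2) generic_rel_interior[OF 2(1,3) x] generic_rel_interior[OF 2(2,4) x]] by simp
  moreover have "aff_dim (orth (wn w)) = int DIM('a) - 1"
   using aff_dim_subspace[OF orth_dim(1)] orth_dim(2) wn_nonzero[OF 2(1)] DIM2 by fastforce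
  ultimately show False using 2(5) by simp
 qed
qed

lemma nonsing_rel_interior: assumes "x\<notin>sd_sing D" "w\<in>sd_index D" "x\<in>sd_supp D w" shows "x\<in>rel_interior (sd_supp D w)"
proof (rule ccontr)
 assume "x\<notin>rel_interior (sd_supp D w)"
 hence "x\<in>rel_frontier (sd_supp D w)" using assms(3) closure_subset by (auto simp: rel_frontier_def)
 thus False using assms(1,2) unfolding sd_sing_def by blast
qed

text \<open>Different normals would make walls through a point of both relative interiors meet in
  codimension exactly two, which is singular by definition. This serves admissible paths that are
  not generic.\<close>

lemma nonsing_same_wn: assumes x: "x\<notin>sd_sing D" and w: "w\<in>sd_index D" "w'\<in>sd_index D" "x\<in>sd_supp D w" "x\<in>sd_supp D w'"
 shows "wn w' = wn w"
proof (rule ccontr)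
 assume ne: "wn w'\<noteq>wn w"
 have "wn w'\<notin>span {wn w}"
  using ne Nplus_primitive_eq[OF wn_Nplus[OF w(1)] wn_Nplus[OF w(2)] wn_prim[OF w(1)] wn_prim[OF w(2)]]
  by (auto simp: span_singleton)
 hence "dim (orth (wn w) \<inter> orth (wn w')) + 2 = DIM('a)"
  using dim_orth_pair[OF wn_nonzero[OF w(1)]] by (simp add: orth_def Collect_conj_eq)
 moreover have "subspace (orth (wn w) \<inter> orth (wn w'))" by (intro subspace_inter orth_dim(1) wn_nonzero w)
 ultimately have dim: "aff_dim (orth (wn w) \<inter> orth (wn w')) = int DIM('a) - 2" using aff_dim_subspace by fastforce
 have "int DIM('a) - 2\<le>aff_dim (sd_supp D w \<inter> sd_supp D w')"
  using rel_interior_both_dim[OF w(1,2) nonsing_rel_interior[OF x w(1,3)] nonsing_rel_interior[OF x w(2,4)]] dim by simp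
 moreover have "aff_dim (sd_supp D w \<inter> sd_supp D w')\<le>int DIM('a) - 2"
  using aff_dim_subset[of "sd_supp D w \<inter> sd_supp D w'" "orth (wn w) \<inter> orth (wn w')"] supp_orth w dim by auto
 ultimately have "aff_dim (sd_supp D w \<inter> sd_supp D w') = int DIM('a) - 2" by simp
 hence "x\<in>sd_sing D" using w unfolding sd_sing_def by blast
 thus False using x by blast
qed

lemma generic_path_admissible: assumes "generic_path Fd ga" shows "admissible_path D ga" unfolding admissible_path_def
proof (intro conjI ballI impI)
 note g = assms[unfolded generic_path_def]
 show "smooth_immersion ga" using g by blast
 show "ga ` {0..1} \<inter> sd_sing D = {}" using g generic_not_sing by blast
 have "x\<notin>sd_support D" if "regular Fd x" for x
  using that supp_orth wn_N wn_nonzero unfolding sd_support_def regular_def orth_def by blast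
 thus "ga 0\<notin>sd_support D" "ga 1\<notin>sd_support D" using g by blast+
 fix w t assume w: "w\<in>sd_index D" and t: "t\<in>{0..1}" "ga t\<in>sd_supp D w"
 have "wn w\<bullet>ga t = 0" using supp_orth[OF w] t by (auto simp: orth_def)
 hence "wn w\<bullet>velocity ga t\<noteq>0" using g wn_N[OF w] wn_nonzero[OF w] t(1) by blast
 thus "velocity ga t\<notin>span (sd_supp D w)" using supp_span[OF w] by (simp add: orth_def)
qed

section \<open>Path kernels\<close>

definition walls_at :: "nat=>'a=>'w set" where "walls_at L x = {w\<in>sd_walls_mod Fd P L D. x\<in>sd_supp D w}"

lemma finite_walls: "finite (sd_walls_mod Fd P L D)" using sd unfolding scattering_diagram_def by blast

lemma walls_mod_index: "w\<in>sd_walls_mod Fd P L D ==> w\<in>sd_index D" unfolding sd_walls_mod_def by blast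

lemma walls_at_finite [simp]: "finite (walls_at L x)" unfolding walls_at_def using finite_walls by simp

lemma walls_at_index: "w\<in>walls_at L x ==> w\<in>sd_index D \<and> x\<in>sd_supp D w"
 unfolding walls_at_def using walls_mod_index by blast

lemma walls_mod_mono: "L\<le>L' ==> sd_walls_mod Fd P L D\<subseteq>sd_walls_mod Fd P L' D"
 unfolding sd_walls_mod_def cong_mod_def using ideal_power_antimono[of L L'] by blast

lemma walls_at_mono: "L\<le>L' ==> walls_at L x\<subseteq>walls_at L' x" unfolding walls_at_def using walls_mod_mono by blast

text \<open>The local function at x in direction n up to the L-th power of the ideal; only finitely
  many walls enter.\<close>

definition gs :: "nat=>'a=>'a=>('x, 'k) coeff_poly fps" where
 "gs L n x = (\<Prod>w\<in>walls_at L x. ray_series (p1 Fd n) (sd_fun D w))"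

definition Kw :: "'w=>'a=>'a=>'a=>('x, 'k) coeff_poly" where
 "Kw w u = wk (crossing_normal Fd (sd_supp D w) u) (p1 Fd (wn w)) (ray_series (p1 Fd (wn w)) (sd_fun D w))"

text \<open>The kernel of passing x with velocity u. The chosen order of the walls is immaterial if
  x is nonsingular and u transversal, by \<open>LocK_any\<close>.\<close>

definition LocK :: "nat=>'a=>'a=>'a=>'a=>('x, 'k) coeff_poly" where
 "LocK L x u = klist (map (\<lambda>w. Kw w u) (SOME ws. distinct ws \<and> set ws = walls_at L x))"

lemma series_0: "w\<in>sd_index D ==> ray_series v (sd_fun D w) $ 0 = 1" using fun_0 by simp

lemma prod_series_0: "(\<And>w. w\<in>A ==> w\<in>sd_index D) ==> (\<Prod>w\<in>A. ray_series v (sd_fun D w)) $ 0 = 1"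
 by (induction A rule: infinite_finite_induct) (auto simp: fun_0)

lemma gs_0: "gs L n x $ 0 = 1" unfolding gs_def using walls_at_index by (intro prod_series_0) blast

lemma klist_Kw: assumes "distinct ws" "\<And>w. w\<in>set ws ==> w\<in>sd_index D \<and> wn w = n" "n\<bullet>u\<noteq>0" "n\<in>Nu" "n\<noteq>0"
 shows "klist (map (\<lambda>w. Kw w u) ws) = wk (cnorm n u) (p1 Fd n) (\<Prod>w\<in>set ws. ray_series (p1 Fd n) (sd_fun D w))"
 using assms(1,2)
proof (induction ws)
 case Nil
 thus ?case by (simp add: wk_one[OF p1_nonzero[OF assms(4,5)]])
next
 case (Cons w ws)
 have w: "w\<in>sd_index D" "wn w = n" using Cons.prems by auto
 have n: "n\<in>Nplus Fd e" using wn_Nplus[OF w(1)] w(2) by simp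
 have nN: "n\<in>N" using Nplus_N[OF n] .
 have "crossing_normal Fd (sd_supp D w) u = cnorm n u"
  using crossing_normal_eq[OF nN assms(5) _ assms(3)] supp_span[OF w(1)] w(2) by simp
 hence "Kw w u = wk (cnorm n u) (p1 Fd n) (ray_series (p1 Fd n) (sd_fun D w))" by (simp add: Kw_def w(2))
 moreover have "wk (cnorm n u) (p1 Fd n) (ray_series (p1 Fd n) (sd_fun D w)) \<star>
   wk (cnorm n u) (p1 Fd n) (\<Prod>w\<in>set ws. ray_series (p1 Fd n) (sd_fun D w)) =
   wk (cnorm n u) (p1 Fd n) (ray_series (p1 Fd n) (sd_fun D w) * (\<Prod>w\<in>set ws. ray_series (p1 Fd n) (sd_fun D w)))"
 proof (rule kstar_wk)
  show "(\<Prod>w\<in>set ws. ray_series (p1 Fd n) (sd_fun D w)) $ 0 = 1" using Cons.prems by (intro prod_series_0) auto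
 qed (use p1_Nplus[OF n] series_0[OF w(1)] cnorm_p1[OF nN assms(5)] in auto)
 ultimately show ?case using Cons by simp
qed

lemma LocK_list: obtains ws where "distinct ws" "set ws = walls_at L x" "LocK L x u = klist (map (\<lambda>w. Kw w u) ws)"
proof -
 have "\<exists>ws. distinct ws \<and> set ws = walls_at L x" using finite_distinct_list[of "walls_at L x"] by auto
 from someI_ex[OF this] show ?thesis using that unfolding LocK_def by blast
qed

lemma LocK_eq: assumes "\<And>w. w\<in>walls_at L x ==> wn w = n" "n\<bullet>u\<noteq>0" "n\<in>Nu" "n\<noteq>0"
 shows "LocK L x u = wk (cnorm n u) (p1 Fd n) (gs L n x)"
proof -
 obtain ws where ws: "distinct ws" "set ws = walls_at L x" "LocK L x u = klist (map (\<lambda>w. Kw w u) ws)"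
  by (rule LocK_list)
 show ?thesis unfolding ws(3) gs_def ws(2)[symmetric]
 proof (rule klist_Kw[OF ws(1) _ assms(2-4)])
  show "w\<in>sd_index D \<and> wn w = n" if "w\<in>set ws" for w using that ws(2) assms(1) walls_at_index by blast
 qed
qed

lemma LocK_kone: "walls_at L x = {} ==> LocK L x u = kone" using LocK_list[of L x u] by force

definition transv :: "nat=>'a=>'a=>bool" where "transv L x u \<longleftrightarrow> x\<notin>sd_sing D \<and> (\<forall>w\<in>walls_at L x. wn w\<bullet>u\<noteq>0)"

lemma Kw_props: assumes "w\<in>sd_index D" "wn w\<bullet>u\<noteq>0" shows "ksupp (Kw w u)" "Kw w u m 0 = 1" "kmult Mc (Kw w u)"
proof -
 note n = wn_N[OF assms(1)] wn_nonzero[OF assms(1)]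
 note v = p1_Nplus[OF wn_Nplus[OF assms(1)]]
 have eq: "Kw w u = wk (cnorm (wn w) u) (p1 Fd (wn w)) (ray_series (p1 Fd (wn w)) (sd_fun D w))"
  using crossing_normal_eq[OF n supp_span[OF assms(1)] assms(2)] by (simp add: Kw_def)
 show "ksupp (Kw w u)" "Kw w u m 0 = 1" "kmult Mc (Kw w u)"
  unfolding eq using v series_0[OF assms(1)] cnorm_int[OF n] by (blast intro: ksupp_wk wk_0 kmult_wk)+
qed

lemma LocK_props: assumes "transv L x u" shows "ksupp (LocK L x u)" "LocK L x u m 0 = 1" "kmult Mc (LocK L x u)"
proof -
 obtain ws where ws: "distinct ws" "set ws = walls_at L x" "LocK L x u = klist (map (\<lambda>w. Kw w u) ws)"
  by (rule LocK_list)
 have *: "w\<in>sd_index D \<and> wn w\<bullet>u\<noteq>0" if "w\<in>set ws" for w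
  using that ws(2) assms walls_at_index unfolding transv_def by blast
 show "ksupp (LocK L x u)" unfolding ws(3) by simp
 show "LocK L x u m 0 = 1" unfolding ws(3) using Kw_props(2) * by (intro klist_0) auto
 show "kmult Mc (LocK L x u)" unfolding ws(3) using Kw_props(3) * Mc_add_P by (intro kmult_klist) auto
qed

lemma prod_series_trivial:
 assumes "\<And>w. w\<in>A ==> g w $ 0 = (1::'r::comm_ring_1)" "\<And>w i. w\<in>A ==> 0 < i ==> i\<le>j ==> g w $ i = 0"
 shows "i\<le>j ==> (\<Prod>w\<in>A. g w) $ i = (1 :: 'r fps) $ i" using assms
proof (induction A arbitrary: i rule: infinite_finite_induct)
 case (insert w A)
 have "(g w * (\<Prod>w\<in>A. g w)) $ i = (1 * 1 :: 'r fps) $ i"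
 proof (rule fps_mult_nth_cong[where j = j])
  show "g w $ i = (1::'r fps) $ i" if "i\<le>j" for i
  proof (cases "i = 0")
   case True
   thus ?thesis using insert.prems(2) by simp
  next
   case False
   thus ?thesis using insert.prems(3)[of w i] that by simp
  qed
  show "(\<Prod>w\<in>A. g w) $ i = (1::'r fps) $ i" if "i\<le>j" for i by (rule insert.IH[OF that]) (use insert.prems in blast)+
  show "i\<le>j" by fact
 qed
 thus ?case using insert.hyps by simp
qed auto

text \<open>If the multiple j of \<open>p1 Fd n\<close> is outside the ideal power, so are all
  smaller ones. A wall trivial modulo that power therefore has a series equal to 1 up to degree
  j.\<close>

lemma prod_series_mod: assumes A: "finite A" "A\<subseteq>sd_index D" "B\<subseteq>A" "A - B\<subseteq>- sd_walls_mod Fd P L D"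
  and n: "n\<in>Nplus Fd e" and j: "of_nat j *\<^sub>R p1 Fd n\<notin>ideal_power P L" and i: "i\<le>j"
 shows "(\<Prod>w\<in>A. ray_series (p1 Fd n) (sd_fun D w)) $ i = (\<Prod>w\<in>B. ray_series (p1 Fd n) (sd_fun D w)) $ i"
proof -
 let ?g = "\<lambda>w. ray_series (p1 Fd n) (sd_fun D w)"
 note v = p1_Nplus[OF n]
 have iv: "of_nat i *\<^sub>R p1 Fd n\<notin>ideal_power P L" if "i\<le>j" for i
 proof
  assume "of_nat i *\<^sub>R p1 Fd n\<in>ideal_power P L"
  hence "of_nat i *\<^sub>R p1 Fd n + of_nat (j - i) *\<^sub>R p1 Fd n\<in>ideal_power P L"
   using ideal_power_add nat_scale_mem[OF v(1)] by blast
  thus False using j that by (simp add: of_nat_diff flip: scaleR_add_left)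
 qed
 have triv: "(\<Prod>w\<in>A - B. ?g w) $ i = (1 :: ('x, 'k) coeff_poly fps) $ i" if "i\<le>j" for i
 proof (rule prod_series_trivial[OF _ _ that])
  show "?g w $ 0 = 1" if "w\<in>A - B" for w using that A(2) series_0 by blast
  show "?g w $ i = 0" if w: "w\<in>A - B" and i: "0 < i" "i\<le>j" for w i
  proof -
   have "cong_mod P L (sd_fun D w) \<one>\<^bsub>completed_ring Fd P\<^esub>" using w A unfolding sd_walls_mod_def by blast
   hence "sd_fun D w (of_nat i *\<^sub>R p1 Fd n) = \<one>\<^bsub>completed_ring Fd P\<^esub> (of_nat i *\<^sub>R p1 Fd n)"
    using iv[OF i(2)] nat_scale_mem[OF v(1)] unfolding cong_mod_def by blast
   thus ?thesis using v(2) i(1) by simp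
  qed
 qed
 have "(\<Prod>w\<in>A. ?g w) = (\<Prod>w\<in>B. ?g w) * (\<Prod>w\<in>A - B. ?g w)"
  using prod.subset_diff[OF A(3,1), of ?g] by (simp only: mult.commute)
 moreover have "((\<Prod>w\<in>B. ?g w) * (\<Prod>w\<in>A - B. ?g w)) $ i = ((\<Prod>w\<in>B. ?g w) * 1) $ i"
  by (rule fps_mult_nth_cong[where j = j]) (use triv i in auto)
 ultimately show ?thesis by simp
qed

lemma gs_mod: assumes "L\<le>L'" "n\<in>Nplus Fd e" "of_nat j *\<^sub>R p1 Fd n\<notin>ideal_power P L" "i\<le>j"
 shows "gs L' n x $ i = gs L n x $ i" unfolding gs_def
proof (rule prod_series_mod[OF _ _ _ _ assms(2-4)])
 show "finite (walls_at L' x)" by simp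
 show "walls_at L' x\<subseteq>sd_index D" using walls_at_index by blast
 show "walls_at L x\<subseteq>walls_at L' x" by (rule walls_at_mono[OF assms(1)])
 show "walls_at L' x - walls_at L x\<subseteq>- sd_walls_mod Fd P L D" unfolding walls_at_def by blast
qed

lemma LocK_mod: assumes L: "L\<le>L'" and tr: "transv L' x u" and q: "q\<notin>ideal_power P L"
 shows "LocK L' x u m q = LocK L x u m q"
proof (cases "walls_at L' x = {}")
 case True
 moreover from this have "walls_at L x = {}" using walls_at_mono[OF L, of x] by blast
 ultimately show ?thesis by (simp add: LocK_kone)
next
 case False
 then obtain w where w: "w\<in>walls_at L' x" by blast
 define n where "n = wn w"
 have wi: "w\<in>sd_index D" "x\<in>sd_supp D w" using walls_at_index[OF w] by auto
 have n: "n\<in>Nplus Fd e" using wn_Nplus[OF wi(1)] by (simp add: n_def)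
 have same: "wn w' = n" if "w'\<in>walls_at L' x" for w'
  unfolding n_def using nonsing_same_wn[OF _ wi(1) _ wi(2)] walls_at_index[OF that] tr unfolding transv_def by blast
 have u: "n\<bullet>u\<noteq>0" using tr w unfolding transv_def n_def by blast
 note nn = Nplus_Nu[OF n] Nplus_nonzero[OF n]
 have e1: "LocK L' x u = wk (cnorm n u) (p1 Fd n) (gs L' n x)" by (rule LocK_eq[OF same u nn])
 have e2: "LocK L x u = wk (cnorm n u) (p1 Fd n) (gs L n x)"
  by (rule LocK_eq[OF _ u nn]) (use same walls_at_mono[OF L] in blast)
 show ?thesis
 proof (cases "\<exists>j::nat. q = of_nat j *\<^sub>R p1 Fd n")
  case True
  then obtain j :: nat where j: "q = of_nat j *\<^sub>R p1 Fd n" by blast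
  have "fpow (gs L' n x) N $ j = fpow (gs L n x) N $ j" for N
   by (rule fpow_nth_cong) (use gs_0 gs_mod[OF L n] q j in auto)
  thus ?thesis unfolding e1 e2 wk_def j using p1_Nplus[OF n] by simp
 next
  case False
  thus ?thesis unfolding e1 e2 wk_def by (simp add: ray_off)
 qed
qed

definition pkl :: "nat=>(real=>'a)=>real list=>'a=>'a=>('x, 'k) coeff_poly" where
 "pkl L ga ts = klist (map (\<lambda>t. LocK L (ga t) (velocity ga t)) ts)"

text \<open>The list may contain times without walls, whose local kernel is \<open>kone\<close>; two
  diagrams can thus be evaluated along one list.\<close>

definition good_ts :: "nat=>(real=>'a)=>real list=>bool" where
 "good_ts L ga ts \<longleftrightarrow> sorted_wrt (<) ts \<and> set ts\<subseteq>{0..1} \<and> (\<forall>t\<in>{0..1}. walls_at L (ga t)\<noteq>{} --> t\<in>set ts)"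

lemma admissible_wn: assumes "admissible_path D ga" "t\<in>{0..1}" "w\<in>sd_index D" "ga t\<in>sd_supp D w"
 shows "wn w\<bullet>velocity ga t\<noteq>0"
proof -
 have "velocity ga t\<notin>span (sd_supp D w)" using assms unfolding admissible_path_def by blast
 thus ?thesis unfolding supp_span[OF assms(3)] by (simp add: orth_def)
qed

lemma admissible_transv: assumes "admissible_path D ga" "t\<in>{0..1}" shows "transv L (ga t) (velocity ga t)"
 unfolding transv_def
proof
 show "ga t\<notin>sd_sing D" using assms unfolding admissible_path_def by blast
 show "\<forall>w\<in>walls_at L (ga t). wn w\<bullet>velocity ga t\<noteq>0" using admissible_wn[OF assms] walls_at_index by blast
qed

end

section \<open>Finiteness of crossings and path kernels\<close>

lemma derivative_sign:
 fixes f :: "real=>real" assumes "(f has_real_derivative d) (at t within S)" "f t = 0" "d\<noteq>0"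
 shows "eventually (\<lambda>s. 0 < f s * d * (s - t)) (at t within S)"
proof -
 have "((\<lambda>s. (f s - f t) / (s - t)) \<longlongrightarrow> d) (at t within S)" using assms(1) by (simp add: has_field_derivative_iff)
 hence "((\<lambda>s. (f s - f t) / (s - t) * d) \<longlongrightarrow> d * d) (at t within S)" by (intro tendsto_intros)
 moreover have "0 < d * d" using assms(3) by (simp add: zero_less_mult_iff) linarith
 ultimately have "eventually (\<lambda>s. 0 < (f s - f t) / (s - t) * d) (at t within S)" by (rule order_tendstoD)
 moreover have "eventually (\<lambda>s. s\<noteq>t) (at t within S)" by (simp add: eventually_at_filter)
 ultimately show ?thesis
 proof eventually_elim
  case (elim s)
  hence "0 < (s - t)\<^sup>2 * (f s / (s - t) * d)" using assms(2) by (intro mult_pos_pos[where a = "(s - t)\<^sup>2"]) simp_all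
  also have "\<dots> = f s * d * (s - t)" using elim by (simp add: power2_eq_square field_simps)
  finally show ?case .
 qed
qed

lemma smooth_immersion_deriv:
 fixes ga :: "real=>'a::real_normed_vector" assumes "smooth_immersion ga" "t\<in>{0..1}"
 shows "(ga has_vector_derivative velocity ga t) (at t within {0..1})"
proof -
 obtain g :: "nat=>real=>'a" where g: "g 0 = ga"
  "\<forall>j. \<forall>t\<in>{0..1}. (g j has_vector_derivative g (Suc j) t) (at t within {0..1})"
  using assms(1) unfolding smooth_immersion_def by (elim exE conjE) (rule that; assumption)
 hence "(ga has_vector_derivative g (Suc 0) t) (at t within {0..1})" using assms(2) by blast
 moreover from velocity_eq[OF this assms(2)] have "velocity ga t = g (Suc 0) t" .
 ultimately show ?thesis by simp
qed

lemma smooth_immersion_continuous: "smooth_immersion ga ==> continuous_on {0..1} ga"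
 unfolding continuous_on_eq_continuous_within using smooth_immersion_deriv has_vector_derivative_continuous by blast

lemma inner_deriv: assumes "smooth_immersion ga" "t\<in>{0..1}"
 shows "((\<lambda>t. n\<bullet>ga t) has_real_derivative (n\<bullet>velocity ga t)) (at t within {0..1})"
 using bounded_linear.has_vector_derivative[OF bounded_linear_inner_right smooth_immersion_deriv[OF assms]]
 by (simp add: has_real_derivative_iff_has_vector_derivative)

context scat
begin

text \<open>An accumulation point of crossing times would itself be a crossing; there transversality
  forces the path off the hyperplane at all nearby other times.\<close>

lemma finite_crossing: assumes ad: "admissible_path D ga" and w: "w\<in>sd_index D"
 shows "finite {t\<in>{0..1}. ga t\<in>sd_supp D w}" (is "finite ?T")
proof (rule ccontr)
 assume "infinite ?T"
 have im: "smooth_immersion ga" using ad by (simp add: admissible_path_def)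
 have "?T\<subseteq>{0..1}" by blast
 with \<open>infinite ?T\<close> have "\<exists>t\<in>{0..1}. t islimpt ?T"
  using compact_Icc[of "0::real" 1] unfolding compact_eq_Bolzano_Weierstrass by metis
 then obtain t where t: "t\<in>{0..1}" "t islimpt ?T" by blast
 have "closed ({0..1} \<inter> ga -` sd_supp D w)"
  using continuous_closed_preimage[OF smooth_immersion_continuous[OF im] _ supp_closed[OF w]] by simp
 moreover have "?T = {0..1} \<inter> ga -` sd_supp D w" by auto
 ultimately have tw: "ga t\<in>sd_supp D w" using t(2) unfolding closed_limpt by auto
 have "wn w\<bullet>ga t = 0" using supp_orth[OF w] tw by (auto simp: orth_def)
 hence "eventually (\<lambda>s. 0 < wn w\<bullet>ga s * (wn w\<bullet>velocity ga t) * (s - t)) (at t within {0..1})"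
  using derivative_sign[OF inner_deriv[OF im t(1)]] admissible_wn[OF ad t(1) w tw] by blast
 then obtain d where d: "d > 0" "\<And>s. s\<in>{0..1} ==> s\<noteq>t ==> dist s t < d ==>
   0 < wn w\<bullet>ga s * (wn w\<bullet>velocity ga t) * (s - t)" unfolding eventually_at by blast
 obtain s where s: "s\<in>?T" "s\<noteq>t" "dist s t < d" using t(2) d(1) unfolding islimpt_approachable by blast
 have "wn w\<bullet>ga s = 0" using supp_orth[OF w] s by (auto simp: orth_def)
 thus False using d(2)[of s] s by auto
qed

lemma finite_times: assumes ad: "admissible_path D ga" shows "finite {t\<in>{0..1}. walls_at L (ga t)\<noteq>{}}"
proof -
 have "{t\<in>{0..1}. walls_at L (ga t)\<noteq>{}} = (\<Union>w\<in>sd_walls_mod Fd P L D. {t\<in>{0..1}. ga t\<in>sd_supp D w})"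
  unfolding walls_at_def by blast
 thus ?thesis using finite_walls finite_crossing[OF ad] walls_mod_index by auto
qed

definition times :: "nat=>(real=>'a)=>real list" where
 "times L ga = sorted_list_of_set {t\<in>{0..1}. walls_at L (ga t)\<noteq>{}}"

lemma set_times: "admissible_path D ga ==> set (times L ga) = {t\<in>{0..1}. walls_at L (ga t)\<noteq>{}}"
 unfolding times_def by (rule set_sorted_list_of_set[OF finite_times])

lemma good_times: "admissible_path D ga ==> good_ts L ga (times L ga)"
proof -
 assume ad: "admissible_path D ga"
 have "sorted_wrt (<) (times L ga)" by (simp add: times_def)
 thus ?thesis unfolding good_ts_def set_times[OF ad] by auto
qed

lemma crossing_list_ex: assumes ad: "admissible_path D ga" shows "\<exists>xs. crossing_list Fd P L D ga xs"
proof -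
 let ?A = "{(t, w). t\<in>{0..1} \<and> w\<in>sd_walls_mod Fd P L D \<and> ga t\<in>sd_supp D w}"
 have "?A\<subseteq>{t\<in>{0..1}. walls_at L (ga t)\<noteq>{}} \<times> sd_walls_mod Fd P L D" unfolding walls_at_def by blast
 hence "finite ?A" using finite_times[OF ad] finite_walls finite_subset by blast
 then obtain xs where xs: "set xs = ?A" "distinct xs" using finite_distinct_list by blast
 hence "crossing_list Fd P L D ga (sort_key fst xs)" unfolding crossing_list_def by (simp add: distinct_sort)
 thus ?thesis by blast
qed

lemma LocK_any: assumes tr: "transv L x u" and ws: "distinct ws" "set ws = walls_at L x"
 shows "klist (map (\<lambda>w. Kw w u) ws) = LocK L x u"
proof (cases "ws = []")
 case True
 hence "walls_at L x = {}" using ws by simp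
 thus ?thesis using True by (simp add: LocK_kone)
next
 case False
 then obtain w where w: "w\<in>walls_at L x" using ws(2) by (metis all_not_in_conv set_empty)
 define n where "n = wn w"
 have wi: "w\<in>sd_index D" "x\<in>sd_supp D w" using walls_at_index[OF w] by auto
 have n: "n\<in>Nplus Fd e" using wn_Nplus[OF wi(1)] by (simp add: n_def)
 have same: "wn w' = n" if "w'\<in>walls_at L x" for w'
  unfolding n_def using nonsing_same_wn[OF _ wi(1) _ wi(2)] walls_at_index[OF that] tr unfolding transv_def by blast
 have u: "n\<bullet>u\<noteq>0" using tr w unfolding transv_def n_def by blast
 note nn = Nplus_Nu[OF n] Nplus_nonzero[OF n]
 have "klist (map (\<lambda>w. Kw w u) ws) = wk (cnorm n u) (p1 Fd n) (\<Prod>w\<in>set ws. ray_series (p1 Fd n) (sd_fun D w))"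
  by (rule klist_Kw[OF ws(1) _ u nn]) (use same ws(2) walls_at_index in blast)
 also have "\<dots> = LocK L x u" unfolding ws(2) using LocK_eq[OF same u nn] by (simp add: gs_def)
 finally show ?thesis .
qed

lemma sorted_filter_split: assumes "sorted (map fst xs)" "\<And>x. x\<in>set xs ==> t\<le>fst x"
 shows "xs = filter (\<lambda>x. fst x = t) xs @ filter (\<lambda>x. fst x\<noteq>t) xs" using assms
proof (induction xs)
 case (Cons x xs)
 show ?case
 proof (cases "fst x = t")
  case True
  thus ?thesis using Cons by simp
 next
  case False
  hence "t < fst x" using Cons.prems(2)[of x] by simp
  hence gt: "fst y\<noteq>t" if "y\<in>set xs" for y using that Cons.prems(1) by (auto simp: not_le)
  hence "filter (\<lambda>x. fst x = t) xs = []" "filter (\<lambda>x. fst x\<noteq>t) xs = xs"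
   by (auto simp: filter_empty_conv filter_id_conv)
  thus ?thesis using False by simp
 qed
qed simp

text \<open>The definition of the path product leaves the order of simultaneous crossings open.
  Grouping by time turns any such list into local kernels, where the order is irrelevant.\<close>

lemma klist_group: assumes "sorted (map fst xs)" "distinct xs" "fst ` set xs\<subseteq>set ts" "sorted_wrt (<) ts"
  and "\<And>t. t\<in>set ts ==> {w. (t, w)\<in>set xs} = walls_at L (ga t)"
  and "\<And>t. t\<in>set ts ==> transv L (ga t) (velocity ga t)"
 shows "klist (map (\<lambda>(t, w). Kw w (velocity ga t)) xs) = pkl L ga ts" using assms
proof (induction ts arbitrary: xs)
 case Nil
 thus ?case by (simp add: pkl_def)
next
 case (Cons t ts)
 define ys zs where "ys = filter (\<lambda>x. fst x = t) xs" and "zs = filter (\<lambda>x. fst x\<noteq>t) xs"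
 have tmin: "t < s" if "s\<in>set ts" for s using Cons.prems(4) that by simp
 have le: "t\<le>fst x" if "x\<in>set xs" for x using that Cons.prems(3) tmin by (force intro: less_imp_le)
 have xs: "xs = ys @ zs" unfolding ys_def zs_def by (rule sorted_filter_split[OF Cons.prems(1) le])
 define ws where "ws = map snd ys"
 have ys: "ys = map (Pair t) ws" unfolding ws_def ys_def by (induction xs) auto
 have "distinct (map (Pair t) ws)" using Cons.prems(2) ys xs by (metis distinct_append)
 hence dws: "distinct ws" by (simp add: distinct_map)
 have "set ws = {w. (t, w)\<in>set xs}" unfolding ws_def ys_def by force
 hence sws: "set ws = walls_at L (ga t)" using Cons.prems(5)[of t] by simp
 have "map (\<lambda>(t, w). Kw w (velocity ga t)) ys = map (\<lambda>w. Kw w (velocity ga t)) ws" unfolding ys by simp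
 hence 1: "klist (map (\<lambda>(t, w). Kw w (velocity ga t)) ys) = LocK L (ga t) (velocity ga t)"
  using LocK_any[OF Cons.prems(6) dws sws] by simp
 have 2: "klist (map (\<lambda>(t, w). Kw w (velocity ga t)) zs) = pkl L ga ts"
 proof (rule Cons.IH)
  show "sorted (map fst zs)" using Cons.prems(1) xs by (metis map_append sorted_append)
  show "distinct zs" using Cons.prems(2) by (simp add: zs_def)
  show "fst ` set zs\<subseteq>set ts" using Cons.prems(3) by (auto simp: zs_def)
  show "sorted_wrt (<) ts" using Cons.prems(4) by simp
  show "{w. (s, w)\<in>set zs} = walls_at L (ga s)" if "s\<in>set ts" for s
   using Cons.prems(5)[of s] tmin[OF that] that by (auto simp: zs_def)
  show "transv L (ga s) (velocity ga s)" if "s\<in>set ts" for s using Cons.prems(6) that by simp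
 qed
 show ?case unfolding xs map_append klist_append 1 2 by (simp add: pkl_def)
qed

lemma crossing_list_pkl:
 assumes ad: "admissible_path D ga" and xs: "crossing_list Fd P L D ga xs" and ts: "good_ts L ga ts"
 shows "klist (map (\<lambda>(t, w). Kw w (velocity ga t)) xs) = pkl L ga ts"
proof (rule klist_group)
 have set: "set xs = {(t, w). t\<in>{0..1} \<and> w\<in>sd_walls_mod Fd P L D \<and> ga t\<in>sd_supp D w}"
  and "distinct xs" "sorted (map fst xs)" using xs unfolding crossing_list_def by blast+
 thus "distinct xs" "sorted (map fst xs)" by blast+
 show "sorted_wrt (<) ts" using ts unfolding good_ts_def by blast
 show "fst ` set xs\<subseteq>set ts" using ts unfolding good_ts_def set walls_at_def by force
 show "{w. (t, w)\<in>set xs} = walls_at L (ga t)" if "t\<in>set ts" for t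
  using that ts unfolding good_ts_def set walls_at_def by blast
 show "transv L (ga t) (velocity ga t)" if "t\<in>set ts" for t
  using that ts admissible_transv[OF ad] unfolding good_ts_def by blast
qed

lemma pkl_ts_indep: "admissible_path D ga ==> good_ts L ga ts ==> good_ts L ga ts' ==> pkl L ga ts = pkl L ga ts'"
proof -
 assume a: "admissible_path D ga" "good_ts L ga ts" "good_ts L ga ts'"
 obtain xs where "crossing_list Fd P L D ga xs" using crossing_list_ex[OF a(1)] by blast
 thus ?thesis using crossing_list_pkl[OF a(1)] a(2,3) by metis
qed

lemma kstar_at_0: "((\<lambda>_. (\<lambda>q. (X\<star>Y) 0 q))\<star>Z) 0 = (X\<star>(Y\<star>Z)) 0"
proof -
 have "((\<lambda>_. (\<lambda>q. (X\<star>Y) 0 q))\<star>Z) 0 = ((X\<star>Y)\<star>Z) 0" unfolding kstar_def[of "\<lambda>_. _" Z] kstar_def[of "X\<star>Y" Z] by simp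
 thus ?thesis by (simp add: kstar_assoc)
qed

lemma path_product_mod_eq:
 assumes ad: "admissible_path D ga" and F: "F\<in>carrier (completed_ring Fd P)" and ts: "good_ts L ga ts"
 shows "path_product_mod Fd P L D ga F = ((\<lambda>_. F)\<star>pkl L ga ts) 0"
proof -
 define xs where "xs = (SOME xs. crossing_list Fd P L D ga xs)"
 have xs: "crossing_list Fd P L D ga xs" unfolding xs_def using crossing_list_ex[OF ad] by (rule someI_ex)
 define stp where "stp = (\<lambda>(t, w) (g :: ('a=>('x, 'k) coeff_poly)=>('a=>('x, 'k) coeff_poly)). wall_aut Fd P (crossing_normal Fd (sd_supp D w) (velocity ga t)) (sd_fun D w) \<circ> g)"
 have idx: "\<forall>(t, w)\<in>set xs. w\<in>sd_index D" using xs walls_mod_index unfolding crossing_list_def by blast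
 \<comment> \<open>Generalised over the map h accumulated so far, which changes in the
   induction.\<close>
 have fold: "fold stp xs h F = ((\<lambda>_. h F)\<star>klist (map (\<lambda>(t, w). Kw w (velocity ga t)) xs)) 0"
  if "ksupp (\<lambda>_::'a. h F)" for h :: "('a=>('x, 'k) coeff_poly)=>('a=>('x, 'k) coeff_poly)" using idx that
 proof (induction xs arbitrary: h)
  case Nil
  thus ?case by simp
 next
  case (Cons x xs)
  obtain t w where x: "x = (t, w)" by fastforce
  have w: "w\<in>sd_index D" using Cons.prems(1) x by auto
  have K: "wall_aut Fd P (crossing_normal Fd (sd_supp D w) (velocity ga t)) (sd_fun D w) G = ((\<lambda>_. G)\<star>Kw w (velocity ga t)) 0" for G
   unfolding Kw_def
   by (rule wall_aut_eq[OF p1_Nplus[OF wn_Nplus[OF w]] fun_carrier[OF w] fun_0[OF w] fun_ray[OF w]])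
  have hF: "stp x h F = ((\<lambda>_. h F)\<star>Kw w (velocity ga t)) 0" by (simp add: stp_def x K)
  have "fold stp (x # xs) h F = fold stp xs (stp x h) F" by simp
  also have "\<dots> = ((\<lambda>_. stp x h F)\<star>klist (map (\<lambda>(t, w). Kw w (velocity ga t)) xs)) 0"
  proof (rule Cons.IH)
   show "\<forall>(t, w)\<in>set xs. w\<in>sd_index D" using Cons.prems(1) by simp
   show "ksupp (\<lambda>_::'a. stp x h F)"
    unfolding hF using ksupp_kstar[of "\<lambda>_. h F" "Kw w (velocity ga t)"] by (simp add: ksupp_def)
  qed
  also have "\<dots> = ((\<lambda>_. h F)\<star>(Kw w (velocity ga t)\<star>klist (map (\<lambda>(t, w). Kw w (velocity ga t)) xs))) 0"
   unfolding hF by (rule kstar_at_0)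
  finally show ?case by (simp add: x)
 qed
 have "ksupp (\<lambda>_::'a. id F)" using F by (auto simp: ksupp_def)
 hence "fold stp xs id F = ((\<lambda>_. F)\<star>pkl L ga ts) 0" using fold[of id] crossing_list_pkl[OF ad xs ts] by simp
 thus ?thesis unfolding path_product_mod_def xs_def[symmetric] stp_def by simp
qed

lemma pkl_mod: assumes ad: "admissible_path D ga" and L: "L\<le>L'" and ts: "set ts\<subseteq>{0..1}" and q: "q\<notin>ideal_power P L"
 shows "pkl L' ga ts m q = pkl L ga ts m q" unfolding pkl_def
proof (rule klist_cong_on[OF down_closed_ideal_power, where M = UNIV])
 show "q\<in>- ideal_power P L" using q by simp
 show "list_all2 (\<lambda>K K'. \<forall>m\<in>UNIV. \<forall>p\<in>- ideal_power P L. K m p = K' m p)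
   (map (\<lambda>t. LocK L' (ga t) (velocity ga t)) ts) (map (\<lambda>t. LocK L (ga t) (velocity ga t)) ts)"
  unfolding list_all2_map1 list_all2_map2
 proof (rule list.rel_refl_strong, intro ballI)
  fix t m p assume "t\<in>set ts" "p\<in>- ideal_power P L"
  thus "LocK L' (ga t) (velocity ga t) m p = LocK L (ga t) (velocity ga t) m p"
   using LocK_mod[OF L admissible_transv[OF ad]] ts by blast
 qed
qed auto

text \<open>A truncation level at which the coefficient at q is already final.\<close>

definition Lof :: "'a=>nat" where "Lof q = (SOME L. q\<notin>ideal_power P L)"

lemma Lof: "q\<notin>ideal_power P (Lof q)" unfolding Lof_def using ideal_power_escape by (rule someI_ex)

definition pk :: "(real=>'a)=>'a=>'a=>('x, 'k) coeff_poly" where "pk ga m q = pkl (Lof q) ga (times (Lof q) ga) m q"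

lemma good_ts_mono: "L\<le>L' ==> good_ts L' ga ts ==> good_ts L ga ts" unfolding good_ts_def using walls_at_mono by blast

lemma pk_eq: assumes ad: "admissible_path D ga" and q: "q\<notin>ideal_power P L" and ts: "good_ts L ga ts"
 shows "pk ga m q = pkl L ga ts m q"
proof -
 \<comment> \<open>The two truncations are compared at a common finer level, with one list of times
   that is good for all of them.\<close>
 define L' where "L' = max L (Lof q)"
 let ?ts = "times L' ga"
 have g: "good_ts L' ga ?ts" by (rule good_times[OF ad])
 have gg: "good_ts L ga ?ts" "good_ts (Lof q) ga ?ts" using good_ts_mono[OF _ g] by (auto simp: L'_def)
 have sub: "set ?ts\<subseteq>{0..1}" using g unfolding good_ts_def by blast
 have "pk ga m q = pkl (Lof q) ga ?ts m q" unfolding pk_def using pkl_ts_indep[OF ad good_times[OF ad] gg(2)] by simp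
 also have "\<dots> = pkl L' ga ?ts m q" by (rule pkl_mod[OF ad _ sub Lof, symmetric]) (simp add: L'_def)
 also have "\<dots> = pkl L ga ?ts m q" by (rule pkl_mod[OF ad _ sub q]) (simp add: L'_def)
 also have "\<dots> = pkl L ga ts m q" using pkl_ts_indep[OF ad gg(1) ts] by simp
 finally show ?thesis .
qed

lemma ksupp_pk: "ksupp (pk ga)"
proof -
 have "pk ga m q\<noteq>0 --> q\<in>P" for m q unfolding pk_def pkl_def using ksupp_klist unfolding ksupp_def by blast
 thus ?thesis unfolding ksupp_def by blast
qed

text \<open>From the level \<open>Lof q\<close> on, the coefficient at q of the truncated products
  is constant, so the limit exists and equals the entry of the kernel.\<close>

lemma path_product_eq: assumes ad: "admissible_path D ga" and F: "F\<in>carrier (completed_ring Fd P)"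
 shows "path_product Fd P D ga F = ((\<lambda>_. F)\<star>pk ga) 0"
proof
 fix q
 have ev: "\<forall>\<^sub>F L in sequentially. path_product_mod Fd P L D ga F q = ((\<lambda>_. F)\<star>pk ga) 0 q"
  unfolding eventually_sequentially
 proof (intro exI allI impI)
  fix L assume "Lof q\<le>L"
  hence q: "q\<notin>ideal_power P L" using Lof ideal_power_antimono by blast
  have "path_product_mod Fd P L D ga F q = ((\<lambda>_. F)\<star>pkl L ga (times L ga)) 0 q"
   using path_product_mod_eq[OF ad F good_times[OF ad]] by simp
  also have "\<dots> = ((\<lambda>_. F)\<star>pk ga) 0 q" by (rule kstar_cong_on[OF down_closed_ideal_power[of L], where M = UNIV])
    (use q pk_eq[OF ad _ good_times[OF ad]] in auto)
  finally show "path_product_mod Fd P L D ga F q = ((\<lambda>_. F)\<star>pk ga) 0 q" .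
 qed
 show "path_product Fd P D ga F q = ((\<lambda>_. F)\<star>pk ga) 0 q" unfolding path_product_def
 proof (rule the_equality)
  show "\<forall>\<^sub>F L in sequentially. path_product_mod Fd P L D ga F q = ((\<lambda>_. F)\<star>pk ga) 0 q" by (rule ev)
  fix c assume "\<forall>\<^sub>F L in sequentially. path_product_mod Fd P L D ga F q = c"
  with ev have "\<forall>\<^sub>F L in sequentially. c = ((\<lambda>_. F)\<star>pk ga) 0 q" by eventually_elim simp
  thus "c = ((\<lambda>_. F)\<star>pk ga) 0 q" by simp
 qed
qed

lemma pkl_props: assumes "admissible_path D ga" "set ts\<subseteq>{0..1}" shows "pkl L ga ts m 0 = 1" "kmult Mc (pkl L ga ts)"
proof -
 have tr: "transv L (ga t) (velocity ga t)" if "t\<in>set ts" for t using that assms admissible_transv by blast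
 show "pkl L ga ts m 0 = 1" unfolding pkl_def using LocK_props(2) tr by (intro klist_0) auto
 show "kmult Mc (pkl L ga ts)" unfolding pkl_def using LocK_props(3) tr Mc_add_P by (intro kmult_klist) auto
qed

lemma path_product_monomial: assumes ad: "admissible_path D ga" and m: "m\<in>P" and q: "q\<in>P"
 shows "path_product Fd P D ga (\<lambda>p. if p = m then 1 else 0) (m + q) = pk ga m q"
proof -
 let ?F = "\<lambda>p. if p = m then 1 else (0 :: ('x, 'k) coeff_poly)"
 have F: "?F\<in>carrier (completed_ring Fd P)" using m by (auto simp: coeff_ring_0 coeff_ring_1)
 have "((\<lambda>_. ?F)\<star>pk ga) 0 (m + q) = (\<Sum>p\<in>dec (m + q). if p = m then pk ga p (m + q - p) else 0)"
  unfolding kstar_def by (rule sum.cong) auto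
 also have "\<dots> = pk ga m q"
 proof -
  have "m\<in>dec (m + q)" using m q by (simp add: dec_def)
  thus ?thesis by (simp add: sum.delta)
 qed
 finally show ?thesis using path_product_eq[OF ad F] by simp
qed

lemma pk_path_indep: assumes ad: "admissible_path D ga" "admissible_path D ga'" and cons: "consistent_diagram Fd P D"
  and ends: "ga 0 = ga' 0" "ga 1 = ga' 1" and m: "m\<in>Mc" shows "pk ga m q = pk ga' m q"
proof (cases "q\<in>P")
 case False
 hence "pk ga m q = 0" "pk ga' m q = 0" using ksupp_pk unfolding ksupp_def by blast+
 thus ?thesis by simp
next
 case True
 define L where "L = Lof q"
 have onP: "pk ga m q = pk ga' m q" if "m\<in>P" "q\<in>P" for m q
 proof -
  let ?F = "\<lambda>p. if p = m then 1 else (0 :: ('x, 'k) coeff_poly)"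
  have "?F\<in>carrier (completed_ring Fd P)" using that by (auto simp: coeff_ring_0 coeff_ring_1)
  hence "path_product Fd P D ga ?F = path_product Fd P D ga' ?F"
   using cons ad ends unfolding consistent_diagram_def by blast
  thus ?thesis using path_product_monomial[OF ad(1) that] path_product_monomial[OF ad(2) that] by metis
 qed
 let ?K = "pkl L ga (times L ga)" and ?K' = "pkl L ga' (times L ga')"
 have g: "good_ts L ga (times L ga)" "good_ts L ga' (times L ga')" using good_times ad by blast+
 hence s: "set (times L ga)\<subseteq>{0..1}" "set (times L ga')\<subseteq>{0..1}" unfolding good_ts_def by blast+
 obtain p where p: "p\<in>P" "m + p\<in>P" using Mc_diff_P[OF m] by blast
 have "?K m q = ?K' m q"
 proof (rule kmult_extend[OF pkl_props(2)[OF ad(1) s(1)] pkl_props(2)[OF ad(2) s(2)]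
    pkl_props(1)[OF ad(1) s(1)] pkl_props(1)[OF ad(2) s(2)] down_closed_ideal_power[of L] _ PMc m p])
  show "q\<in>- ideal_power P L" unfolding L_def using Lof by simp
  show "q\<in>P" by (rule True)
  show "?K m' q' = ?K' m' q'" if "m'\<in>P" "q'\<in>- ideal_power P L" for m' q'
  proof (cases "q'\<in>P")
   case True
   thus ?thesis using onP[OF that(1) True] pk_eq[OF ad(1) _ g(1)] pk_eq[OF ad(2) _ g(2)] that(2) by simp
  next
   case False
   moreover have "ksupp ?K" "ksupp ?K'" unfolding pkl_def by simp_all
   ultimately show ?thesis unfolding ksupp_def by metis
  qed
 qed
 thus ?thesis unfolding L_def pk_def .
qed

end

section \<open>The cocycle of a consistent diagram\<close>

context seed_data
begin

lemma countable_notin_interval: assumes "countable S" "(0::real) < r" obtains s where "0 < s" "s < r" "s\<notin>S"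
proof -
 have "uncountable {0<..<r}" using assms(2) by (rule uncountable_open_interval[THEN iffD2])
 hence "\<not> {0<..<r}\<subseteq>S" using assms(1) countable_subset by blast
 thus ?thesis using that by (meson greaterThanLessThan_iff subsetI)
qed

lemma generic_path_ex: assumes "regular Fd a" "regular Fd b" "a\<noteq>b"
 shows "\<exists>ga. generic_path Fd ga \<and> ga 0 = a \<and> ga 1 = b"
proof -
 obtain w where w: "w\<in>(UNIV::'a set)" "\<And>a' W. a'\<in>{a} ==> W\<in>bad_spaces Fd ==> w\<notin>span (insert a' W)"
  "\<And>n. n\<in>N ==> n\<noteq>0 ==> n\<bullet>w\<noteq>0" "\<And>b'. b'\<in>{b - a} ==> w\<notin>span {b'}" by (rule escape[of "{a}" "{b - a}" UNIV]) auto
 have "countable {s. \<not> generic_path Fd (quad a b (0 + s *\<^sub>R w))}"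
  by (rule quad_bad_countable[OF assms]) (use w countable_bad countable_N in auto)
 then obtain s where "s\<notin>{s. \<not> generic_path Fd (quad a b (0 + s *\<^sub>R w))}"
  using countable_notin_interval[of _ 1] by (metis zero_less_one)
 thus ?thesis by (intro exI[of _ "quad a b (0 + s *\<^sub>R w)"]) auto
qed

lemma shift_regular_countable: assumes w: "\<And>W. W\<in>bad_spaces Fd ==> w\<notin>W" "\<And>n. n\<in>N ==> n\<noteq>0 ==> n\<bullet>w\<noteq>0"
 shows "countable {s. \<not> regular Fd (b + s *\<^sub>R w)}"
proof -
 define f where "f = (\<lambda>W. SOME s. b + s *\<^sub>R w\<in>W)"
 have 1: "s = f W" if W: "W\<in>bad_spaces Fd" and s: "b + s *\<^sub>R w\<in>W" for s W
 proof -
  have "b + f W *\<^sub>R w\<in>W" unfolding f_def using s by (rule someI)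
  hence "(b + s *\<^sub>R w) - (b + f W *\<^sub>R w)\<in>W" using subspace_diff[OF bad_space_subspace[OF W] s] by blast
  hence "(s - f W) *\<^sub>R w\<in>W" by (simp add: scaleR_diff_left)
  hence "(1 / (s - f W)) *\<^sub>R (s - f W) *\<^sub>R w\<in>W" by (rule subspace_scale[OF bad_space_subspace[OF W]])
  thus ?thesis using w(1)[OF W] by (cases "s = f W") auto
 qed
 have 2: "s = - (n\<bullet>b) / (n\<bullet>w)" if "n\<in>N" "n\<noteq>0" "n\<bullet>(b + s *\<^sub>R w) = 0" for s n
  using w(2)[OF that(1,2)] that(3) by (simp add: inner_add_right field_simps)
 have "{s. \<not> regular Fd (b + s *\<^sub>R w)}\<subseteq>f ` bad_spaces Fd \<union> (\<lambda>n. - (n\<bullet>b) / (n\<bullet>w)) ` N"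
  unfolding regular_def generic_def using 1 2 by blast
 moreover have "countable (f ` bad_spaces Fd \<union> (\<lambda>n. - (n\<bullet>b) / (n\<bullet>w)) ` N)"
  using countable_bad countable_N by (intro countable_Un countable_image)
 ultimately show ?thesis using countable_subset by blast
qed

end

lemma crossing_normal_scale: "0 < c ==> crossing_normal Fd d (c *\<^sub>R u) = crossing_normal Fd d u"
 unfolding crossing_normal_def by (simp add: mult_less_0_iff)

context scat
begin

lemma LocK_scale: "0 < c ==> LocK L x (c *\<^sub>R u) = LocK L x u"
 unfolding LocK_def Kw_def by (simp add: crossing_normal_scale)

lemma walls_at_regular: "regular Fd x ==> walls_at L x = {}"
 using walls_at_index supp_orth wn_N wn_nonzero unfolding regular_def orth_def by blast

lemma pkl_reparam: assumes im: "smooth_immersion ga" and c: "0\<le>c" "0 < d" "c + d\<le>1" and ts: "set ts\<subseteq>{0..1}"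
 shows "pkl L (\<lambda>t. ga (c + d * t)) ts = pkl L ga (map (\<lambda>t. c + d * t) ts)" unfolding pkl_def
proof (rule arg_cong[where f = klist])
 show "map (\<lambda>t. LocK L (ga (c + d * t)) (velocity (\<lambda>t. ga (c + d * t)) t)) ts =
   map (\<lambda>t. LocK L (ga t) (velocity ga t)) (map (\<lambda>t. c + d * t) ts)"
  using smooth_immersion_reparam(2)[OF im c] ts c(2) by (auto simp: LocK_scale)
qed

text \<open>No wall passes through the regular cut point, so the rescaled crossing times of the two
  halves concatenate to a good list. Rescaling changes the velocity by a positive factor, which does
  not affect \<open>LocK\<close>.\<close>

lemma pk_split: assumes g: "generic_path Fd ga" and c: "0 < c" "c < 1" and reg: "regular Fd (ga c)"
 shows "pk ga m q = (pk (\<lambda>t. ga (0 + c * t))\<star>pk (\<lambda>t. ga (c + (1 - c) * t))) m q"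
proof -
 let ?g1 = "\<lambda>t. ga (0 + c * t)" and ?g2 = "\<lambda>t. ga (c + (1 - c) * t)"
 have im: "smooth_immersion ga" and r01: "regular Fd (ga 0)" "regular Fd (ga 1)"
  using g by (auto simp: generic_path_def)
 have g1: "generic_path Fd ?g1" by (rule generic_path_reparam[OF g]) (use c reg r01 in auto)
 have g2: "generic_path Fd ?g2" by (rule generic_path_reparam[OF g]) (use c reg r01 in auto)
 note ad = generic_path_admissible[OF g] generic_path_admissible[OF g1] generic_path_admissible[OF g2]
 define L where "L = Lof q"
 have q: "q\<notin>ideal_power P L" unfolding L_def by (rule Lof)
 define t1 t2 where "t1 = times L ?g1" and "t2 = times L ?g2"
 have gt: "good_ts L ?g1 t1" "good_ts L ?g2 t2" unfolding t1_def t2_def using good_times ad by blast+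
 have s1: "set t1 = {t\<in>{0..1}. walls_at L (?g1 t)\<noteq>{}}" "set t2 = {t\<in>{0..1}. walls_at L (?g2 t)\<noteq>{}}"
  unfolding t1_def t2_def using set_times[OF ad(2)] set_times[OF ad(3)] by blast+
 define ts where "ts = map (\<lambda>t. 0 + c * t) t1 @ map (\<lambda>t. c + (1 - c) * t) t2"
 have lt1: "0 + c * t < c" if "t\<in>set t1" for t
 proof -
  have "t\<noteq>1" using that s1(1) walls_at_regular[OF reg] by auto
  hence "t < 1" using that s1(1) by auto
  thus ?thesis using c by simp
 qed
 have gt2: "c < c + (1 - c) * t" if "t\<in>set t2" for t
 proof -
  have "t\<noteq>0" using that s1(2) walls_at_regular[OF reg] by auto
  hence "0 < t" using that s1(2) by auto
  thus ?thesis using c by simp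
 qed
 have "good_ts L ga ts" unfolding good_ts_def
 proof (intro conjI ballI impI)
  have "sorted_wrt (<) t1" "sorted_wrt (<) t2" using gt unfolding good_ts_def by blast+
  hence "sorted_wrt (<) (map (\<lambda>t. 0 + c * t) t1)" "sorted_wrt (<) (map (\<lambda>t. c + (1 - c) * t) t2)"
   using c by (simp_all add: sorted_wrt_map)
  moreover have "x < y" if "x\<in>set (map (\<lambda>t. 0 + c * t) t1)" "y\<in>set (map (\<lambda>t. c + (1 - c) * t) t2)" for x y
   using that lt1 gt2 by fastforce
  ultimately show "sorted_wrt (<) ts" unfolding ts_def sorted_wrt_append by blast
  have "0 + c * t\<in>{0..1}" if "t\<in>{0..1}" for t using that c mult_le_one[of c t] by auto
  moreover have "c + (1 - c) * t\<in>{0..1}" if "t\<in>{0..1}" for t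
  proof -
   have "(1 - c) * t\<le>1 - c" "0\<le>(1 - c) * t" using that c by (simp_all add: mult_left_le)
   hence "0\<le>c + (1 - c) * t" "c + (1 - c) * t\<le>1" using c by linarith+
   thus ?thesis by simp
  qed
  ultimately show "set ts\<subseteq>{0..1}" unfolding ts_def using s1 by auto
  fix t assume t: "t\<in>{0..1}" "walls_at L (ga t)\<noteq>{}"
  hence "t\<noteq>c" using walls_at_regular[OF reg] by auto
  then consider "t < c" | "c < t" by linarith
  thus "t\<in>set ts"
  proof cases
   case 1
   hence "t / c\<in>set t1" unfolding s1 using t c by auto
   hence "0 + c * (t / c)\<in>set ts" unfolding ts_def set_append set_map by blast
   thus ?thesis using c by simp
  next
   case 2
   define s where "s = (t - c) / (1 - c)"
   have tse: "c + (1 - c) * s = t" using c by (simp add: s_def)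
   have "s\<in>{0..1}" unfolding s_def using t c 2 by auto
   hence "s\<in>set t2" unfolding s1 using t(2) tse by simp
   hence "c + (1 - c) * s\<in>set ts" unfolding ts_def set_append set_map by blast
   thus ?thesis unfolding tse .
  qed
 qed
 hence "pk ga m q = pkl L ga ts m q" by (rule pk_eq[OF ad(1) q])
 also have "pkl L ga ts = pkl L ?g1 t1\<star>pkl L ?g2 t2"
 proof -
  have "pkl L ?g1 t1 = pkl L ga (map (\<lambda>t. 0 + c * t) t1)" by (rule pkl_reparam[OF im]) (use c s1 in auto)
  moreover have "pkl L ?g2 t2 = pkl L ga (map (\<lambda>t. c + (1 - c) * t) t2)"
   by (rule pkl_reparam[OF im]) (use c s1 in auto)
  ultimately show ?thesis unfolding ts_def by (simp add: pkl_def klist_append)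
 qed
 also have "(pkl L ?g1 t1\<star>pkl L ?g2 t2) m q = (pk ?g1\<star>pk ?g2) m q"
 proof (rule kstar_cong_on[OF down_closed_ideal_power[of L], where M = UNIV])
  show "pkl L ?g1 t1 m p = pk ?g1 m p" if "p\<in>- ideal_power P L" for m p using pk_eq[OF ad(2) _ gt(1)] that by simp
  show "pkl L ?g2 t2 m p = pk ?g2 m p" if "p\<in>- ideal_power P L" for m p using pk_eq[OF ad(3) _ gt(2)] that by simp
 qed (use q in auto)
 finally show ?thesis .
qed

definition region_clear :: "nat=>'a set=>bool" where "region_clear L B \<longleftrightarrow> (\<forall>x\<in>B. walls_at L x = {})"

lemma pk_clear: assumes "admissible_path D ga" "\<And>t. t\<in>{0..1} ==> walls_at L (ga t) = {}" "q\<notin>ideal_power P L"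
 shows "pk ga m q = kone m q"
proof -
 have "good_ts L ga []" using assms(2) by (auto simp: good_ts_def)
 thus ?thesis using pk_eq[OF assms(1,3)] by (simp add: pkl_def)
qed

lemma closed_walls: "closed (\<Union>w\<in>sd_walls_mod Fd P L D. sd_supp D w)"
 using finite_walls supp_closed walls_mod_index by (intro closed_UN) auto

lemma walls_at_empty_iff: "walls_at L x = {} \<longleftrightarrow> x\<notin>(\<Union>w\<in>sd_walls_mod Fd P L D. sd_supp D w)"
 unfolding walls_at_def by blast

lemma clear_ball: assumes "walls_at L x = {}" shows "\<exists>r>0. region_clear L (ball x r)"
proof -
 have "open (- (\<Union>w\<in>sd_walls_mod Fd P L D. sd_supp D w))" by (rule open_Compl[OF closed_walls])
 moreover have "x\<in>- (\<Union>w\<in>sd_walls_mod Fd P L D. sd_supp D w)" using assms walls_at_empty_iff by blast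
 ultimately obtain r where "r > 0" "ball x r\<subseteq>- (\<Union>w\<in>sd_walls_mod Fd P L D. sd_supp D w)" by (rule openE)
 thus ?thesis unfolding region_clear_def walls_at_empty_iff by (intro exI[of _ r]) auto
qed

end

locale cscat = scat Fd e P D
 for Fd :: "('i, 'a::euclidean_space, 'x) fixed_data" and e and P
  and D :: "('w, 'a, ('x, 'k::field_char_0) coeff_poly) diagram" + assumes cons: "consistent_diagram Fd P D"
begin

text \<open>The path kernel between two regular points; by consistency it is independent of the
  chosen path on exponents m in \<open>Mc\<close>.\<close>

definition phi :: "'a=>'a=>'a=>'a=>('x, 'k) coeff_poly" where
 "phi a b = pk (SOME ga. generic_path Fd ga \<and> ga 0 = a \<and> ga 1 = b)"

lemma phi_eq: assumes "admissible_path D ga" "ga 0 = a" "ga 1 = b" "regular Fd a" "regular Fd b" "a\<noteq>b" "m\<in>Mc"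
 shows "phi a b m q = pk ga m q"
proof -
 let ?g = "SOME ga. generic_path Fd ga \<and> ga 0 = a \<and> ga 1 = b"
 have "generic_path Fd ?g \<and> ?g 0 = a \<and> ?g 1 = b" using someI_ex[OF generic_path_ex[OF assms(4-6)]] .
 thus ?thesis unfolding phi_def using assms generic_path_admissible by (intro pk_path_indep[OF _ _ cons]) auto
qed

lemma phi_seg: "seg_ok Fd a b ==> m\<in>Mc ==> phi a b m q = pk (seg a b) m q"
 using generic_path_admissible[OF seg_ok_generic_path] by (intro phi_eq) (auto simp: seg_ok_def)

lemma ksupp_phi: "ksupp (phi a b)" unfolding phi_def by (rule ksupp_pk)

lemma phi_seg_clear: assumes "seg_ok Fd a b" "a\<in>B" "b\<in>B" "convex B" "region_clear L B" "q\<notin>ideal_power P L" "m\<in>Mc"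
 shows "phi a b m q = kone m q"
proof -
 have "pk (seg a b) m q = kone m q"
  by (rule pk_clear[OF generic_path_admissible[OF seg_ok_generic_path[OF assms(1)]] _ assms(6)])
   (use seg_convex[OF assms(4,2,3)] assms(5) in \<open>auto simp: region_clear_def\<close>)
 thus ?thesis using phi_seg[OF assms(1,7)] by simp
qed

text \<open>The bump u is the one that places the midpoint of the curve at b: a + (c - a)/2 + u/4 =
  b.\<close>

lemma phi_comp_quad: assumes a: "regular Fd a" and c: "regular Fd c" and b: "regular Fd b" and ne: "a\<noteq>b" "b\<noteq>c" "a\<noteq>c"
  and g: "generic_path Fd (quad a c u)" and u: "u = 4 *\<^sub>R b - 2 *\<^sub>R a - 2 *\<^sub>R c" and m: "m\<in>Mc"
 shows "phi a c m q = (phi a b\<star>phi b c) m q"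
proof -
 let ?g = "quad a c u"
 have mid: "?g (1 / 2) = b" unfolding quad_def u by (simp add: algebra_simps flip: scaleR_add_left)
 let ?g1 = "\<lambda>t. ?g (0 + 1 / 2 * t)" and ?g2 = "\<lambda>t. ?g (1 / 2 + (1 - 1 / 2) * t)"
 have reg: "regular Fd (?g (1 / 2))" using mid b by simp
 have r01: "regular Fd (?g 0)" "regular Fd (?g 1)" using a c by simp_all
 have g1: "generic_path Fd ?g1" by (rule generic_path_reparam[OF g]) (use reg r01 in auto)
 have g2: "generic_path Fd ?g2" by (rule generic_path_reparam[OF g]) (use reg r01 in auto)
 have p1: "phi a b m' q' = pk ?g1 m' q'" if "m'\<in>Mc" for m' q'
  by (rule phi_eq[OF generic_path_admissible[OF g1]]) (use mid a b ne that in auto)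
 have p2: "phi b c m' q' = pk ?g2 m' q'" if "m'\<in>Mc" for m' q'
  by (rule phi_eq[OF generic_path_admissible[OF g2]]) (use mid b c ne that in auto)
 have "phi a c m q = pk ?g m q" by (rule phi_eq[OF generic_path_admissible[OF g]]) (use a c ne m in auto)
 also have "\<dots> = (pk ?g1\<star>pk ?g2) m q" by (rule pk_split[OF g _ _ reg]) auto
 also have "\<dots> = (phi a b\<star>phi b c) m q"
  unfolding kstar_def by (rule sum.cong) (use p1 p2 m Mc_add_P in \<open>auto simp: dec_def\<close>)
 finally show ?thesis .
qed

lemma kstar_kone_right_on:
 assumes "q\<notin>ideal_power P L" "ksupp K" "\<And>m p. m\<in>Mc ==> p\<notin>ideal_power P L ==> K2 m p = kone m p" "m\<in>Mc"
 shows "(K\<star>K2) m q = K m q"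
proof -
 have "(K\<star>K2) m q = (K\<star>kone) m q"
  by (rule kstar_cong_on[OF down_closed_ideal_power[of L], where M = Mc]) (use assms Mc_add_P in auto)
 thus ?thesis using assms(2) by simp
qed

lemma kstar_kone_left_on:
 assumes "q\<notin>ideal_power P L" "ksupp K" "\<And>m p. m\<in>Mc ==> p\<notin>ideal_power P L ==> K2 m p = kone m p" "m\<in>Mc"
 shows "(K2\<star>K) m q = K m q"
proof -
 have "(K2\<star>K) m q = (kone\<star>K) m q"
  by (rule kstar_cong_on[OF down_closed_ideal_power[of L], where M = Mc]) (use assms Mc_add_P in auto)
 thus ?thesis using assms(2) by simp
qed

text \<open>
  Smooth paths cannot be concatenated at corners, but a quadratic curve from \<open>a\<close> to \<open>c\<close> can be made
  to pass through a generic point near \<open>b\<close>.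
\<close>

lemma phi_comp: assumes a: "regular Fd a" and b: "regular Fd b" and c: "regular Fd c" and ne: "a\<noteq>b" "b\<noteq>c" "a\<noteq>c"
  and m: "m\<in>Mc" shows "phi a c m q = (phi a b\<star>phi b c) m q"
proof -
 define L where "L = Lof q"
 have q: "q\<notin>ideal_power P L" unfolding L_def by (rule Lof)
 obtain r where r: "r > 0" "region_clear L (ball b r)" using clear_ball[OF walls_at_regular[OF b]] by blast
 obtain w where w: "w\<in>(UNIV::'a set)" "\<And>a' W. a'\<in>{0, a, b} ==> W\<in>bad_spaces Fd ==> w\<notin>span (insert a' W)"
  "\<And>n. n\<in>N ==> n\<noteq>0 ==> n\<bullet>w\<noteq>0" "\<And>b'. b'\<in>{c - a, b - a, c - b} ==> w\<notin>span {b'}"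
  by (rule escape[of "{0, a, b}" "{c - a, b - a, c - b}" UNIV]) auto
 have wW: "w\<notin>W" if "W\<in>bad_spaces Fd" for W using w(2)[of 0 W] that by (auto intro: span_base)
 note cb = countable_bad countable_N
 \<comment> \<open>One parameter s must serve three curves, from a to c, from a to b and from b to
   c, all passing through the displaced point b', and must make b' regular. The factor 4 comes from
   u/4 at the midpoint.\<close>
 define S where "S = {s. \<not> generic_path Fd (quad a c ((4 *\<^sub>R b - 2 *\<^sub>R a - 2 *\<^sub>R c) + s *\<^sub>R w))} \<union>
  {s. \<not> generic_path Fd (quad a b ((4 *\<^sub>R b - 2 *\<^sub>R a - 2 *\<^sub>R b) + s *\<^sub>R w))} \<union>
  {s. \<not> generic_path Fd (quad b c ((4 *\<^sub>R b - 2 *\<^sub>R b - 2 *\<^sub>R c) + s *\<^sub>R w))} \<union>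
  (\<lambda>s. 4 * s) ` {s. \<not> regular Fd (b + s *\<^sub>R w)}"
 have "countable S" unfolding S_def
  by (intro countable_Un countable_image quad_bad_countable shift_regular_countable) (use a b c ne w wW cb in auto)
 \<comment> \<open>Small enough that b' stays in the clear ball around b and differs from a and c;
   the summand 1 keeps the denominator positive.\<close>
 define r' where "r' = min r (min (dist a b) (dist b c)) / (norm w + 1)"
 have r': "r' > 0" using r(1) ne by (simp add: r'_def add_nonneg_pos)
 obtain s where s: "0 < s" "s < 4 * r'" "s\<notin>S" using countable_notin_interval[OF \<open>countable S\<close>, of "4 * r'"] r' by auto
 define b' where "b' = b + (s / 4) *\<^sub>R w"
 have d: "dist b b' < r' * (norm w + 1)"
 proof -
  have "dist b b' = s / 4 * norm w" using s by (simp add: b'_def dist_norm)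
  also have "\<dots>\<le>r' * norm w" using s by (intro mult_right_mono) auto
  also have "\<dots> < r' * (norm w + 1)" using r' by simp
  finally show ?thesis .
 qed
 have "r' * (norm w + 1) = min r (min (dist a b) (dist b c))" unfolding r'_def by (simp add: add_nonneg_eq_0_iff)
 hence d': "dist b b' < r" "dist b b' < dist a b" "dist b b' < dist b c" using d by linarith+
 have neb: "a\<noteq>b'" "b'\<noteq>c" using d' by (auto simp: dist_commute)
 have w0: "w\<noteq>0" using w(4)[of "c - a"] span_zero[of "{c - a}"] by auto
 have bb': "b\<noteq>b'" using s w0 by (simp add: b'_def)
 have reg: "regular Fd b'"
 proof -
  have "s / 4\<notin>{s. \<not> regular Fd (b + s *\<^sub>R w)}" using s(3) unfolding S_def by force
  thus ?thesis by (simp add: b'_def)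
 qed
 have so: "seg_ok Fd b b'" unfolding seg_ok_def
 proof (intro conjI ballI b reg bb')
  fix W assume W: "W\<in>bad_spaces Fd"
  show "b'\<notin>span (insert b W)"
  proof
   assume "b'\<in>span (insert b W)"
   hence "b' - b\<in>span (insert b W)" by (intro span_diff) (auto intro: span_base)
   hence "(4 / s) *\<^sub>R (b' - b)\<in>span (insert b W)" by (rule span_scale)
   thus False using w(2)[of b W] W s(1) by (simp add: b'_def)
  qed
 qed
 have e: "4 *\<^sub>R b' = 4 *\<^sub>R b + s *\<^sub>R w" unfolding b'_def by (simp add: scaleR_add_right)
 have 1: "phi a c m q = (phi a b'\<star>phi b' c) m q"
  by (rule phi_comp_quad[OF a c reg neb(1,2) ne(3) _ _ m, where u = "(4 *\<^sub>R b - 2 *\<^sub>R a - 2 *\<^sub>R c) + s *\<^sub>R w"])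
   (use s(3) e in \<open>auto simp: S_def\<close>)
 have 2: "phi a b m' q' = (phi a b'\<star>phi b' b) m' q'" if "m'\<in>Mc" for m' q'
  by (rule phi_comp_quad[OF a b reg neb(1) bb'[symmetric] ne(1) _ _ that, where u = "(4 *\<^sub>R b - 2 *\<^sub>R a - 2 *\<^sub>R b) + s *\<^sub>R w"])
   (use s(3) e in \<open>auto simp: S_def\<close>)
 have 3: "phi b c m' q' = (phi b b'\<star>phi b' c) m' q'" if "m'\<in>Mc" for m' q'
  by (rule phi_comp_quad[OF b c reg bb' neb(2) ne(2) _ _ that, where u = "(4 *\<^sub>R b - 2 *\<^sub>R b - 2 *\<^sub>R c) + s *\<^sub>R w"])
   (use s(3) e in \<open>auto simp: S_def\<close>)
 have inb: "b\<in>ball b r" "b'\<in>ball b r" using r(1) d' by auto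
 have k1: "phi b b' m' p = kone m' p" if "m'\<in>Mc" "p\<notin>ideal_power P L" for m' p
  by (rule phi_seg_clear[OF so inb convex_ball r(2) that(2,1)])
 have k2: "phi b' b m' p = kone m' p" if "m'\<in>Mc" "p\<notin>ideal_power P L" for m' p
  by (rule phi_seg_clear[OF seg_ok_sym[OF so] inb(2,1) convex_ball r(2) that(2,1)])
 have 4: "phi a b m' p = phi a b' m' p" if "m'\<in>Mc" "p\<notin>ideal_power P L" for m' p
  unfolding 2[OF that(1)] by (rule kstar_kone_right_on[OF that(2) ksupp_phi k2 that(1)])
 have 5: "phi b c m' p = phi b' c m' p" if "m'\<in>Mc" "p\<notin>ideal_power P L" for m' p
  unfolding 3[OF that(1)] by (rule kstar_kone_left_on[OF that(2) ksupp_phi k1 that(1)])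
 have "(phi a b'\<star>phi b' c) m q = (phi a b\<star>phi b c) m q"
  by (rule kstar_cong_on[OF down_closed_ideal_power[of L], where M = Mc]) (use q 4 5 m Mc_add_P in auto)
 thus ?thesis using 1 by simp
qed

end

section \<open>Local functions determine path products\<close>

lemma finite_radius:
 fixes Q :: "'w=>real=>bool" assumes "finite W" "\<And>w. w\<in>W ==> \<exists>r>0. Q w r" "\<And>w r r'. Q w r ==> r'\<le>r ==> Q w r'"
 shows "\<exists>r>0. \<forall>w\<in>W. Q w r" using assms(1,2)
proof (induction W rule: finite_induct)
 case (insert w W)
 obtain r where r: "r > 0" "\<forall>w\<in>W. Q w r" using insert by blast
 obtain r' where r': "r' > 0" "Q w r'" using insert.prems by blast
 have "\<forall>w'\<in>insert w W. Q w' (min r r')" using r r' assms(3)[of _ r "min r r'"] assms(3)[of w r' "min r r'"] by auto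
 thus ?case using r(1) r'(1) by (intro exI[of _ "min r r'"]) auto
qed (auto intro: exI[of _ 1])

lemma sorted_filter_interval: assumes "sorted_wrt (<) ts" "(s::real) < c" "c < s'" "c\<notin>set ts"
 shows "filter (\<lambda>t. s < t \<and> t < s') ts = filter (\<lambda>t. s < t \<and> t < c) ts @ filter (\<lambda>t. c < t \<and> t < s') ts" using assms
proof (induction ts)
 case (Cons t ts)
 show ?case
 proof (cases "c < t")
  case True
  hence "\<forall>x\<in>set ts. c < x" using Cons.prems(1) by auto
  hence "filter (\<lambda>t. s < t \<and> t < c) ts = []" by (auto simp: filter_empty_conv)
  thus ?thesis using True Cons by auto
 next
  case False
  hence "t < c" using Cons.prems(4) by auto
  thus ?thesis using Cons by auto
 qed
qed simp

lemma distinct_singleton: assumes "distinct xs" "set xs = {t}" shows "xs = [t]"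
proof -
 have "length xs = 1" using distinct_card[OF assms(1)] assms(2) by simp
 then obtain y where "xs = [y]" by (metis One_nat_def length_0_conv length_Suc_conv)
 thus ?thesis using assms(2) by simp
qed

context scat
begin

text \<open>The local function for all truncations at once: each coefficient is taken at a level
  where its exponent lies outside the ideal power.\<close>

definition G :: "'a=>'a=>('x, 'k) coeff_poly fps" where
 "G x n = Abs_fps (\<lambda>j. gs (Lof (of_nat j *\<^sub>R p1 Fd n)) n x $ j)"

lemma G_nth: assumes "n\<in>Nplus Fd e" "of_nat j *\<^sub>R p1 Fd n\<notin>ideal_power P L" shows "G x n $ j = gs L n x $ j"
proof -
 define L0 where "L0 = Lof (of_nat j *\<^sub>R p1 Fd n)"
 have "gs (max L L0) n x $ j = gs L n x $ j" "gs (max L L0) n x $ j = gs L0 n x $ j"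
  using gs_mod[OF max.cobounded1 assms order_refl] gs_mod[OF max.cobounded2 assms(1) Lof order_refl]
  unfolding L0_def by blast+
 thus ?thesis by (simp add: G_def L0_def)
qed

lemma G_0: "G x n $ 0 = 1" by (simp add: G_def gs_0)

lemma multiple_ideal_power: assumes "n\<in>Nplus Fd e" "of_nat j *\<^sub>R p1 Fd n\<notin>ideal_power P L" "i\<le>j"
 shows "of_nat i *\<^sub>R p1 Fd n\<notin>ideal_power P L"
proof
 assume "of_nat i *\<^sub>R p1 Fd n\<in>ideal_power P L"
 hence "of_nat i *\<^sub>R p1 Fd n + of_nat (j - i) *\<^sub>R p1 Fd n\<in>ideal_power P L"
  using ideal_power_add nat_scale_mem[OF p1_Nplus(1)[OF assms(1)]] by blast
 thus False using assms by (simp add: of_nat_diff flip: scaleR_add_left)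
qed

lemma wk_gs_G: assumes "n\<in>Nplus Fd e" "q\<notin>ideal_power P L"
 shows "wk c (p1 Fd n) (gs L n x) m q = wk c (p1 Fd n) (G x n) m q"
proof (cases "\<exists>j::nat. q = of_nat j *\<^sub>R p1 Fd n")
 case True
 then obtain j :: nat where j: "q = of_nat j *\<^sub>R p1 Fd n" by blast
 have "fpow (gs L n x) K $ j = fpow (G x n) K $ j" for K
 proof (rule fpow_nth_cong[OF gs_0 G_0])
  show "gs L n x $ i = G x n $ i" if "i\<le>j" for i
   using G_nth[OF assms(1) multiple_ideal_power[OF assms(1) _ that]] assms(2) j by simp
 qed
 thus ?thesis unfolding wk_def j using p1_Nplus[OF assms(1)] by simp
next
 case False
 thus ?thesis unfolding wk_def by (simp add: ray_off)
qed

lemma generic_same_wn: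
 assumes "generic Fd x" "n\<in>Nplus Fd e" "primitive_in N n" "n\<bullet>x = 0" "w\<in>sd_index D" "x\<in>sd_supp D w" shows "wn w = n"
proof -
 have "wn w\<bullet>x = 0" using supp_orth[OF assms(5)] assms(6) by (auto simp: orth_def)
 then obtain r where "wn w = r *\<^sub>R n"
  using generic_parallel[OF assms(1) Nplus_N[OF assms(2)] wn_N[OF assms(5)] Nplus_nonzero[OF assms(2)] assms(4)] by blast
 thus ?thesis using Nplus_primitive_eq[OF assms(2) wn_Nplus[OF assms(5)] assms(3) wn_prim[OF assms(5)]] by blast
qed

lemma LocK_G: assumes "generic Fd x" "n\<in>Nplus Fd e" "primitive_in N n" "n\<bullet>x = 0" "n\<bullet>u\<noteq>0" "q\<notin>ideal_power P L"
 shows "LocK L x u m q = wk (cnorm n u) (p1 Fd n) (G x n) m q"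
proof -
 have "LocK L x u = wk (cnorm n u) (p1 Fd n) (gs L n x)"
  by (rule LocK_eq[OF _ assms(5) Nplus_Nu[OF assms(2)] Nplus_nonzero[OF assms(2)]])
   (use generic_same_wn[OF assms(1-4)] walls_at_index in blast)
 thus ?thesis using wk_gs_G[OF assms(2,6)] by simp
qed

text \<open>Walls not through x are closed and stay away from it; those through x contain a piece of
  the hyperplane around x, which is in their relative interiors. Finitely many walls matter, so one
  radius serves all.\<close>

lemma near_structure: assumes "\<And>w. w\<in>walls_at L x ==> x\<in>rel_interior (sd_supp D w) \<and> wn w = n"
 shows "\<exists>r>0. (\<forall>y\<in>ball x r. walls_at L y\<subseteq>walls_at L x \<and> (n\<bullet>y = 0 --> walls_at L y = walls_at L x))"
proof -
 have "\<exists>r>0. \<forall>w\<in>sd_walls_mod Fd P L D. (if w\<in>walls_at L x then ball x r \<inter> orth n\<subseteq>sd_supp D w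
   else ball x r \<inter> sd_supp D w = {})"
 proof (rule finite_radius[OF finite_walls])
  fix w assume w: "w\<in>sd_walls_mod Fd P L D"
  note wi = walls_mod_index[OF w]
  show "\<exists>r>0. if w\<in>walls_at L x then ball x r \<inter> orth n\<subseteq>sd_supp D w else ball x r \<inter> sd_supp D w = {}"
  proof (cases "w\<in>walls_at L x")
   case True
   thus ?thesis using rel_interior_ball[OF wi] assms[OF True] by auto
  next
   case False
   hence "x\<in>- sd_supp D w" using w by (simp add: walls_at_def)
   moreover have "open (- sd_supp D w)" by (rule open_Compl[OF supp_closed[OF wi]])
   ultimately obtain r where "r > 0" "ball x r\<subseteq>- sd_supp D w" by (metis openE)
   thus ?thesis using False by (intro exI[of _ r]) auto
  qed
 next
  fix w r r' assume "if w\<in>walls_at L x then ball x r \<inter> orth n\<subseteq>sd_supp D w else ball x r \<inter> sd_supp D w = {}" "r'\<le>r"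
  moreover have "ball x r'\<subseteq>ball x r" using \<open>r'\<le>r\<close> by (rule subset_ball)
  ultimately show "if w\<in>walls_at L x then ball x r' \<inter> orth n\<subseteq>sd_supp D w else ball x r' \<inter> sd_supp D w = {}"
   by (auto split: if_splits)
 qed
 then obtain r where r: "r > 0" "\<forall>w\<in>sd_walls_mod Fd P L D. (if w\<in>walls_at L x then ball x r \<inter> orth n\<subseteq>sd_supp D w
   else ball x r \<inter> sd_supp D w = {})" by blast
 have "walls_at L y\<subseteq>walls_at L x" if "y\<in>ball x r" for y
 proof
  fix w assume w: "w\<in>walls_at L y"
  hence wm: "w\<in>sd_walls_mod Fd P L D" "y\<in>sd_supp D w" by (auto simp: walls_at_def)
  show "w\<in>walls_at L x"
  proof (rule ccontr)
   assume "w\<notin>walls_at L x"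
   hence "ball x r \<inter> sd_supp D w = {}" using r(2) wm(1) by auto
   thus False using that wm(2) by blast
  qed
 qed
 moreover have "walls_at L x\<subseteq>walls_at L y" if "y\<in>ball x r" "n\<bullet>y = 0" for y
 proof
  fix w assume w: "w\<in>walls_at L x"
  hence wm: "w\<in>sd_walls_mod Fd P L D" by (simp add: walls_at_def)
  hence "ball x r \<inter> orth n\<subseteq>sd_supp D w" using r(2) w by auto
  hence "y\<in>sd_supp D w" using that by (auto simp: orth_def)
  thus "w\<in>walls_at L y" using wm by (simp add: walls_at_def)
 qed
 ultimately show ?thesis using r(1) by blast
qed

end

text \<open>Consistency is assumed of \<open>D2\<close>; that of \<open>D1\<close> becomes a
  conclusion, \<open>consistent_D1\<close>.\<close>

locale scat_pair = A: scat Fd e P D1 + B: cscat Fd e P D2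
 for Fd :: "('i, 'a::euclidean_space, 'x) fixed_data" and e and P
  and D1 :: "('w, 'a, ('x, 'k::field_char_0) coeff_poly) diagram"
  and D2 :: "('v, 'a, ('x, 'k) coeff_poly) diagram" +
 assumes eqG: "\<And>x n. generic Fd x ==> n\<in>Nplus Fd e ==> primitive_in (fd_N Fd) n ==> n\<bullet>x = 0 ==> A.G x n = B.G x n"
begin

lemma LocK_pair:
 assumes x: "generic Fd x" and u: "\<And>n. n\<in>fd_N Fd ==> n\<noteq>0 ==> n\<bullet>x = 0 ==> n\<bullet>u\<noteq>0" and q: "q\<notin>ideal_power P L"
 shows "B.LocK L x u m q = A.LocK L x u m q"
proof -
 have *: "B.LocK L x u m q = A.LocK L x u m q" if n: "n\<in>Nplus Fd e" "primitive_in (fd_N Fd) n" "n\<bullet>x = 0" for n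
  using A.LocK_G[OF x n _ q] B.LocK_G[OF x n _ q] u[OF A.Nplus_N[OF n(1)] A.Nplus_nonzero[OF n(1)] n(3)] eqG[OF x n] by simp
 consider w where "w\<in>A.walls_at L x" | w where "w\<in>B.walls_at L x" | "A.walls_at L x = {}" "B.walls_at L x = {}"
  by blast
 thus ?thesis
 proof cases
  case (1 w)
  hence w: "w\<in>sd_index D1" "x\<in>sd_supp D1 w" using A.walls_at_index by auto
  hence "A.wn w\<bullet>x = 0" using A.supp_orth by (auto simp: orth_def)
  thus ?thesis using * A.wn_Nplus A.wn_prim w by blast
 next
  case (2 w)
  hence w: "w\<in>sd_index D2" "x\<in>sd_supp D2 w" using B.walls_at_index by auto
  hence "B.wn w\<bullet>x = 0" using B.supp_orth by (auto simp: orth_def)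
  thus ?thesis using * B.wn_Nplus B.wn_prim w by blast
 next
  case 3
  thus ?thesis by (simp add: A.LocK_kone B.LocK_kone)
 qed
qed

lemma pk_pair: assumes g: "generic_path Fd ga" shows "B.pk ga m q = A.pk ga m q"
proof -
 define L where "L = A.Lof q"
 have q: "q\<notin>ideal_power P L" unfolding L_def by (rule A.Lof)
 note adA = A.generic_path_admissible[OF g] and adB = B.generic_path_admissible[OF g]
 define ts where "ts = sorted_list_of_set ({t\<in>{0..1}. A.walls_at L (ga t)\<noteq>{}} \<union> {t\<in>{0..1}. B.walls_at L (ga t)\<noteq>{}})"
 have set: "set ts = {t\<in>{0..1}. A.walls_at L (ga t)\<noteq>{}} \<union> {t\<in>{0..1}. B.walls_at L (ga t)\<noteq>{}}"
  unfolding ts_def using A.finite_times[OF adA] B.finite_times[OF adB] by (intro set_sorted_list_of_set) simp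
 have srt: "sorted_wrt (<) ts" unfolding ts_def by simp
 have good: "A.good_ts L ga ts" "B.good_ts L ga ts" unfolding A.good_ts_def B.good_ts_def using srt set by auto
 have "B.pkl L ga ts m q = A.pkl L ga ts m q" unfolding A.pkl_def B.pkl_def
 proof (rule A.klist_cong_on[OF A.down_closed_ideal_power[of L], where M = UNIV])
  show "list_all2 (\<lambda>K K'. \<forall>m\<in>UNIV. \<forall>p\<in>- ideal_power P L. K m p = K' m p)
    (map (\<lambda>t. B.LocK L (ga t) (velocity ga t)) ts) (map (\<lambda>t. A.LocK L (ga t) (velocity ga t)) ts)"
   unfolding list_all2_map1 list_all2_map2
  proof (rule list.rel_refl_strong, intro ballI)
   fix t m p assume t: "t\<in>set ts" and p: "p\<in>- ideal_power P L"
   have "t\<in>{0..1}" using t set by blast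
   thus "B.LocK L (ga t) (velocity ga t) m p = A.LocK L (ga t) (velocity ga t) m p"
    using g p unfolding generic_path_def by (intro LocK_pair) auto
  qed
 qed (use q in auto)
 thus ?thesis using A.pk_eq[OF adA q good(1)] B.pk_eq[OF adB q good(2)] by simp
qed

lemma phi_seg_pair: "seg_ok Fd a b ==> m\<in>fd_Mcirc Fd ==> B.phi a b m q = A.pk (seg a b) m q"
 using B.phi_seg pk_pair[OF seg_ok_generic_path] by simp

text \<open>The segment from a to b need not be generic, so the comparison goes through an auxiliary
  point c of the region, joined to both by generic segments.\<close>

lemma phi_clear_pair:
 assumes ab: "regular Fd a" "regular Fd b" "a\<noteq>b" "a\<in>B" "b\<in>B" and B: "convex B" "open B" "A.region_clear L B"
  and q: "q\<notin>ideal_power P L" and m: "m\<in>fd_Mcirc Fd" shows "B.phi a b m q = A.kone m q"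
proof -
 have seg: "B.phi a' b' m' q' = A.kone m' q'"
  if "seg_ok Fd a' b'" "a'\<in>B" "b'\<in>B" "m'\<in>fd_Mcirc Fd" "q'\<notin>ideal_power P L" for a' b' m' q'
 proof -
  have "A.pk (seg a' b') m' q' = A.kone m' q'"
   by (rule A.pk_clear[OF A.generic_path_admissible[OF seg_ok_generic_path[OF that(1)]] _ that(5)])
    (use seg_convex[OF B(1) that(2,3)] B(3) in \<open>auto simp: A.region_clear_def\<close>)
  thus ?thesis using phi_seg_pair[OF that(1,4)] by simp
 qed
 obtain c where c: "c\<in>B" "regular Fd c" "seg_ok Fd a c" "seg_ok Fd b c"
  using A.regular_escape[of "{a, b}" B] ab B by (metis empty_iff finite.emptyI finite_insert insert_iff)
 have ne: "a\<noteq>c" "c\<noteq>b" using c by (auto simp: seg_ok_def)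
 have "B.phi a b m q = A.kstar (B.phi a c) (B.phi c b) m q" by (rule B.phi_comp) (use ab c ne m in auto)
 also have "\<dots> = B.phi a c m q"
  by (rule B.kstar_kone_right_on[OF q B.ksupp_phi _ m]) (use seg[OF seg_ok_sym[OF c(4)] c(1) ab(5)] in blast)
 also have "\<dots> = A.kone m q" by (rule seg[OF c(3) ab(4) c(1) m q])
 finally show ?thesis .
qed

text \<open>An auxiliary point c on the side of a reduces the passage to a generic segment that
  meets the hyperplane at one time \<open>t0\<close>. At that time exactly the walls of
  \<open>D1\<close> through x are crossed.\<close>

lemma phi_cross_pair:
 assumes near: "\<And>y. y\<in>ball x r ==> A.walls_at L y\<subseteq>A.walls_at L x \<and> (n\<bullet>y = 0 --> A.walls_at L y = A.walls_at L x)"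
  and wn: "\<And>w. w\<in>A.walls_at L x ==> A.wn w = n" and n: "n\<in>fd_Nuf Fd" "n\<noteq>0"
  and ab: "regular Fd a" "regular Fd b" "a\<in>ball x r" "b\<in>ball x r" "(n\<bullet>a) * (n\<bullet>b) < 0"
  and q: "q\<notin>ideal_power P L" and m: "m\<in>fd_Mcirc Fd"
 shows "B.phi a b m q = wk (A.cnorm n (b - a)) (p1 Fd n) (A.gs L n x) m q"
proof -
 define H where "H = ball x r \<inter> {y. 0 < (n\<bullet>a) * (n\<bullet>y)}"
 have na: "n\<bullet>a\<noteq>0" and ne: "a\<noteq>b" using ab(5) by (auto simp: mult_less_0_iff)
 have Heq: "{y. 0 < (n\<bullet>a) * (n\<bullet>y)} = {y. ((n\<bullet>a) *\<^sub>R n)\<bullet>y > 0}" by simp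
 have H: "convex H" "open H" unfolding H_def Heq
  by (rule convex_Int[OF convex_ball convex_halfspace_gt], rule open_Int[OF open_ball open_halfspace_gt])
 have wo: "n\<bullet>y = 0" if "y\<in>ball x r" "w\<in>A.walls_at L y" for y w
 proof -
  have "A.wn w = n" using near[OF that(1)] wn that(2) by blast
  thus ?thesis using A.supp_orth A.walls_at_index[OF that(2)] by (auto simp: orth_def)
 qed
 have Hc: "A.region_clear L H" unfolding A.region_clear_def
 proof
  fix y assume y: "y\<in>H"
  hence "n\<bullet>y\<noteq>0" "y\<in>ball x r" by (auto simp: H_def)
  thus "A.walls_at L y = {}" using wo by blast
 qed
 have aH: "a\<in>H" using ab(3) na by (simp add: H_def zero_less_mult_iff linorder_neq_iff) linarith
 obtain c where c: "c\<in>H" "regular Fd c" "seg_ok Fd a c" "seg_ok Fd b c"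
  using A.regular_escape[of "{a, b}" H] ab H aH by (metis empty_iff finite.emptyI finite_insert insert_iff)
 have ne': "a\<noteq>c" "c\<noteq>b" using c by (auto simp: seg_ok_def)
 have so: "seg_ok Fd c b" by (rule seg_ok_sym[OF c(4)])
 have opp: "(n\<bullet>c) * (n\<bullet>b) < 0" using c(1) ab(5) by (auto simp: H_def mult_less_0_iff zero_less_mult_iff)
 have cin: "c\<in>ball x r" using c(1) by (simp add: H_def)
 have 1: "B.phi a b m q = A.kstar (B.phi a c) (B.phi c b) m q" by (rule B.phi_comp) (use ab ne c ne' m in auto)
 have 2: "\<dots> = B.phi c b m q" by (rule B.kstar_kone_left_on[OF q B.ksupp_phi _ m])
   (rule phi_clear_pair[OF ab(1) c(2) ne'(1) aH c(1) H Hc])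
 define t0 where "t0 = (n\<bullet>c) / (n\<bullet>c - n\<bullet>b)"
 have den: "n\<bullet>c - n\<bullet>b\<noteq>0" using opp by (auto simp: mult_less_0_iff)
 have t0: "t0\<in>{0..1}" using opp by (auto simp: t0_def mult_less_0_iff divide_simps)
 have zero: "n\<bullet>seg c b t = 0 \<longleftrightarrow> t = t0" for t
 proof -
  have "n\<bullet>seg c b t = n\<bullet>c - t * (n\<bullet>c - n\<bullet>b)" by (simp add: seg_inner algebra_simps)
  thus ?thesis using den by (auto simp: t0_def field_simps)
 qed
 have inball: "seg c b t\<in>ball x r" if "t\<in>{0..1}" for t by (rule seg_convex[OF convex_ball cin ab(4) that])
 have good: "A.good_ts L (seg c b) [t0]" unfolding A.good_ts_def
 proof (intro conjI ballI impI)
  show "t\<in>set [t0]" if "t\<in>{0..1}" "A.walls_at L (seg c b t)\<noteq>{}" for t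
   using wo[OF inball[OF that(1)]] that(2) zero by auto
 qed (use t0 in auto)
 have "A.pk (seg c b) m q = A.pkl L (seg c b) [t0] m q"
  by (rule A.pk_eq[OF A.generic_path_admissible[OF seg_ok_generic_path[OF so]] q good])
 also have "A.pkl L (seg c b) [t0] = A.LocK L (seg c b t0) (b - c)"
  using A.LocK_props(1)[OF A.admissible_transv[OF A.generic_path_admissible[OF seg_ok_generic_path[OF so]] t0]]
  by (simp add: A.pkl_def velocity_quad[OF t0])
 also have "\<dots> = wk (A.cnorm n (b - c)) (p1 Fd n) (A.gs L n x)"
 proof -
  have w: "A.walls_at L (seg c b t0) = A.walls_at L x" using near[OF inball[OF t0]] zero by blast
  have "A.LocK L (seg c b t0) (b - c) = wk (A.cnorm n (b - c)) (p1 Fd n) (A.gs L n (seg c b t0))"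
   by (rule A.LocK_eq[OF _ _ n]) (use w wn den in \<open>auto simp: inner_diff_right\<close>)
  thus ?thesis by (simp add: A.gs_def w)
 qed
 also have "A.cnorm n (b - c) = A.cnorm n (b - a)"
  using opp ab(5) c(1) by (auto simp: A.cnorm_def H_def inner_diff_right mult_less_0_iff zero_less_mult_iff)
 finally have 3: "A.pk (seg c b) m q = wk (A.cnorm n (b - a)) (p1 Fd n) (A.gs L n x) m q" .
 show ?thesis using 1 2 3 phi_seg_pair[OF so m] by simp
qed

end

section \<open>Comparison along arbitrary admissible paths\<close>

context scat_pair
begin

text \<open>Points of an admissible path need not be regular, even off all walls. Regular
  substitutes a are taken from a convex region around x that is free of walls modulo the ideal
  power.\<close>

definition cl :: "nat=>'a=>'a=>bool" where "cl L x a \<longleftrightarrow> (\<exists>B. open B \<and> convex B \<and> A.region_clear L B \<and> x\<in>B \<and> a\<in>B)"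

lemma phi_left: assumes "regular Fd a" "regular Fd b" "regular Fd c" "a\<noteq>b" "c\<noteq>b" "a\<in>B" "c\<in>B" "convex B" "open B"
  "A.region_clear L B" "q\<notin>ideal_power P L" "m\<in>fd_Mcirc Fd" shows "B.phi a b m q = B.phi c b m q"
proof (cases "a = c")
 case False
 have "B.phi a b m q = A.kstar (B.phi a c) (B.phi c b) m q" by (rule B.phi_comp) (use assms False in auto)
 also have "\<dots> = B.phi c b m q" by (rule B.kstar_kone_left_on[OF assms(11) B.ksupp_phi _ assms(12)])
   (rule phi_clear_pair[OF assms(1,3) False assms(6-10)])
 finally show ?thesis .
qed simp

lemma phi_right: assumes "regular Fd a" "regular Fd b" "regular Fd d" "a\<noteq>b" "a\<noteq>d" "b\<in>B" "d\<in>B" "convex B" "open B"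
  "A.region_clear L B" "q\<notin>ideal_power P L" "m\<in>fd_Mcirc Fd" shows "B.phi a b m q = B.phi a d m q"
proof (cases "b = d")
 case False
 have "B.phi a b m q = A.kstar (B.phi a d) (B.phi d b) m q" by (rule B.phi_comp) (use assms False in auto)
 also have "\<dots> = B.phi a d m q" by (rule B.kstar_kone_right_on[OF assms(11) B.ksupp_phi _ assms(12)])
   (rule phi_clear_pair[OF assms(3,2) False[symmetric] assms(7,6,8-10)])
 finally show ?thesis .
qed simp

lemma phi_replace: assumes ab: "regular Fd a" "regular Fd b" "a\<noteq>b" "cl L x a" "cl L y b"
  and O: "open Ox" "x\<in>Ox" "open Oy" "y\<in>Oy"
 obtains c d where "regular Fd c" "regular Fd d" "c\<noteq>d" "c\<in>Ox" "d\<in>Oy"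
  "\<And>m q. q\<notin>ideal_power P L ==> m\<in>fd_Mcirc Fd ==> B.phi a b m q = B.phi c d m q"
proof -
 obtain Ba where Ba: "open Ba" "convex Ba" "A.region_clear L Ba" "x\<in>Ba" "a\<in>Ba" using ab(4) unfolding cl_def by blast
 obtain Bb where Bb: "open Bb" "convex Bb" "A.region_clear L Bb" "y\<in>Bb" "b\<in>Bb" using ab(5) unfolding cl_def by blast
 obtain c where c: "c\<in>Ba \<inter> Ox" "regular Fd c" "\<And>z. z\<in>{a, b} ==> seg_ok Fd z c"
  by (rule A.regular_escape[of "{a, b}" "Ba \<inter> Ox"]) (use ab Ba O in auto)
 have cne: "c\<noteq>a" "c\<noteq>b" using c(3)[of a] c(3)[of b] by (auto simp: seg_ok_def)
 obtain d where d: "d\<in>Bb \<inter> Oy" "regular Fd d" "\<And>z. z\<in>{a, b, c} ==> seg_ok Fd z d"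
  by (rule A.regular_escape[of "{a, b, c}" "Bb \<inter> Oy"]) (use ab Bb O c in auto)
 have dne: "d\<noteq>c" using d(3)[of c] by (auto simp: seg_ok_def)
 have "B.phi a b m q = B.phi c d m q" if q: "q\<notin>ideal_power P L" and m: "m\<in>fd_Mcirc Fd" for m q
 proof -
  have "B.phi a b m q = B.phi c b m q"
   by (rule phi_left[OF ab(1,2) c(2) ab(3) cne(2) Ba(5) _ Ba(2,1,3) q m]) (use c in auto)
  also have "\<dots> = B.phi c d m q"
   by (rule phi_right[OF c(2) ab(2) d(2) cne(2) dne[symmetric] Bb(5) _ Bb(2,1,3) q m]) (use d in auto)
  finally show ?thesis .
 qed
 thus ?thesis using that[of c d] c d dne by blast
qed

lemma clear_side: assumes near: "\<And>y. y\<in>ball x r ==> A.walls_at L y\<subseteq>A.walls_at L x"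
  and wn: "\<And>w. w\<in>A.walls_at L x ==> A.wn w = n" and y: "y\<in>ball x r" "n\<bullet>y\<noteq>0" shows "A.walls_at L y = {}"
proof (rule ccontr)
 assume "A.walls_at L y\<noteq>{}"
 then obtain w where w: "w\<in>A.walls_at L y" by blast
 hence "A.wn w = n" using near[OF y(1)] wn by blast
 hence "n\<bullet>y = 0" using A.supp_orth A.walls_at_index[OF w] by (auto simp: orth_def)
 thus False using y by blast
qed

definition seg_kernel :: "nat=>(real=>'a)=>real=>real=>'a=>'a=>('x, 'k) coeff_poly" where
 "seg_kernel L ga s s' = A.pkl L ga (filter (\<lambda>t. s < t \<and> t < s') (A.times L ga))"

text \<open>A path admissible for \<open>D1\<close> need not be admissible for \<open>D2\<close>;
  its pieces are therefore compared with the cocycle of \<open>D2\<close> between regular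
  substitutes of their end points.\<close>

definition match :: "nat=>(real=>'a)=>real=>real=>bool" where
 "match L ga s s' \<longleftrightarrow> (\<forall>a b m q. regular Fd a \<and> regular Fd b \<and> a\<noteq>b \<and> cl L (ga s) a \<and> cl L (ga s') b \<and>
   m\<in>fd_Mcirc Fd \<and> q\<notin>ideal_power P L --> B.phi a b m q = seg_kernel L ga s s' m q)"

lemma cl_ball: "A.walls_at L x = {} ==> \<exists>r>0. \<forall>a\<in>ball x r. cl L x a"
 using A.clear_ball[of L x] unfolding cl_def by (meson centre_in_ball convex_ball open_ball)

text \<open>The walls at time t share one hyperplane, and by transversality the path is on opposite
  sides of it before and after t. A short interval containing t thus gives one crossing, and a short
  interval on one side of t gives none.\<close>

lemma match_local: assumes ad: "admissible_path D1 ga" and t: "t\<in>{0..1}"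
 shows "\<exists>d>0. \<forall>s s'. s\<in>{0..1} \<and> s'\<in>{0..1} \<and> s < s' \<and> \<bar>s - t\<bar> < d \<and> \<bar>s' - t\<bar> < d \<and>
  A.walls_at L (ga s) = {} \<and> A.walls_at L (ga s') = {} --> match L ga s s'"
proof -
 have im: "smooth_immersion ga" using ad by (simp add: admissible_path_def)
 have cont: "\<exists>d>0. \<forall>s\<in>{0..1}. \<bar>s - t\<bar> < d --> ga s\<in>ball (ga t) r" if "r > 0" for r
  using smooth_immersion_continuous[OF im] t that unfolding continuous_on_iff
  by (metis dist_commute dist_real_def mem_ball)
 note set = A.set_times[OF ad, of L]
 have srt: "sorted_wrt (<) (A.times L ga)" by (simp add: A.times_def)
 have nofilter: "seg_kernel L ga s s' = A.kone"
  if "\<And>x. s < x ==> x < s' ==> x\<in>{0..1} ==> A.walls_at L (ga x) = {}" for s s'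
 proof -
  have "filter (\<lambda>t. s < t \<and> t < s') (A.times L ga) = []" unfolding filter_empty_conv set using that by blast
  thus ?thesis by (simp add: seg_kernel_def A.pkl_def)
 qed
 show ?thesis
 proof (cases "A.walls_at L (ga t) = {}")
  case True
  then obtain r where r: "r > 0" "A.region_clear L (ball (ga t) r)" using A.clear_ball by blast
  obtain d where d: "d > 0" "\<forall>s\<in>{0..1}. \<bar>s - t\<bar> < d --> ga s\<in>ball (ga t) r" using cont[OF r(1)] by blast
  have "match L ga s s'" if s: "s\<in>{0..1}" "s'\<in>{0..1}" "s < s'" "\<bar>s - t\<bar> < d" "\<bar>s' - t\<bar> < d" for s s'
   unfolding match_def
  proof (intro allI impI, elim conjE)
   fix a b m q assume ab: "regular Fd a" "regular Fd b" "a\<noteq>b" "cl L (ga s) a" "cl L (ga s') b"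
    and m: "m\<in>fd_Mcirc Fd" and q: "q\<notin>ideal_power P L"
   have K: "seg_kernel L ga s s' = A.kone" by (rule nofilter) (use d(2) r(2) s in \<open>auto simp: A.region_clear_def\<close>)
   obtain c d' where cd: "regular Fd c" "regular Fd d'" "c\<noteq>d'" "c\<in>ball (ga t) r" "d'\<in>ball (ga t) r"
    "\<And>m q. q\<notin>ideal_power P L ==> m\<in>fd_Mcirc Fd ==> B.phi a b m q = B.phi c d' m q"
    by (rule phi_replace[OF ab open_ball _ open_ball _, of "ga t" r "ga t" r]) (use d(2) s in auto)
   have "B.phi c d' m q = A.kone m q" by (rule phi_clear_pair[OF cd(1-5) convex_ball open_ball r(2) q m])
   thus "B.phi a b m q = seg_kernel L ga s s' m q" using cd(6)[OF q m] K by simp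
  qed
  thus ?thesis using d(1) by blast
 next
  case False
  then obtain w where w: "w\<in>A.walls_at L (ga t)" by blast
  define n where "n = A.wn w"
  have wi: "w\<in>sd_index D1" "ga t\<in>sd_supp D1 w" using A.walls_at_index[OF w] by auto
  have ns: "ga t\<notin>sd_sing D1" using ad t unfolding admissible_path_def by blast
  have same: "A.wn w' = n" if "w'\<in>A.walls_at L (ga t)" for w'
   unfolding n_def using A.nonsing_same_wn[OF ns wi(1) _ wi(2)] A.walls_at_index[OF that] by blast
  have nN: "n\<in>fd_Nuf Fd" "n\<noteq>0" unfolding n_def using A.wn_Nplus[OF wi(1)] A.Nplus_Nu A.Nplus_nonzero by blast+
  have "\<exists>r>0. \<forall>y\<in>ball (ga t) r. A.walls_at L y\<subseteq>A.walls_at L (ga t) \<and> (n\<bullet>y = 0 --> A.walls_at L y = A.walls_at L (ga t))"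
   by (rule A.near_structure) (use same A.nonsing_rel_interior[OF ns] A.walls_at_index in blast)
  then obtain r where r: "r > 0" and near: "\<And>y. y\<in>ball (ga t) r ==>
    A.walls_at L y\<subseteq>A.walls_at L (ga t) \<and> (n\<bullet>y = 0 --> A.walls_at L y = A.walls_at L (ga t))" by blast
  obtain d1 where d1: "d1 > 0" "\<forall>s\<in>{0..1}. \<bar>s - t\<bar> < d1 --> ga s\<in>ball (ga t) r" using cont[OF r] by blast
  define v where "v = n\<bullet>velocity ga t"
  have v0: "v\<noteq>0" unfolding v_def n_def by (rule A.admissible_wn[OF ad t wi])
  have "n\<bullet>ga t = 0" using A.supp_orth[OF wi(1)] wi(2) by (auto simp: orth_def n_def)
  hence "eventually (\<lambda>s. 0 < n\<bullet>ga s * v * (s - t)) (at t within {0..1})"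
   using derivative_sign[OF inner_deriv[OF im t, of n]] v0 unfolding v_def by blast
  then obtain d2 where d2: "d2 > 0" "\<And>s. s\<in>{0..1} ==> s\<noteq>t ==> dist s t < d2 ==> 0 < n\<bullet>ga s * v * (s - t)"
   unfolding eventually_at by blast
  define d where "d = min d1 d2"
  have near1: "\<And>y. y\<in>ball (ga t) r ==> A.walls_at L y\<subseteq>A.walls_at L (ga t)" using near by blast
  have clear: "A.walls_at L y = {}" if "y\<in>ball (ga t) r" "n\<bullet>y\<noteq>0" for y by (rule clear_side[OF near1 same that])
  have "match L ga s s'" if s: "s\<in>{0..1}" "s'\<in>{0..1}" "s < s'" "\<bar>s - t\<bar> < d" "\<bar>s' - t\<bar> < d"
   and nc: "A.walls_at L (ga s) = {}" "A.walls_at L (ga s') = {}" for s s' unfolding match_def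
  proof (intro allI impI, elim conjE)
   fix a b m q assume ab: "regular Fd a" "regular Fd b" "a\<noteq>b" "cl L (ga s) a" "cl L (ga s') b"
    and m: "m\<in>fd_Mcirc Fd" and q: "q\<notin>ideal_power P L"
   have st: "s\<noteq>t" "s'\<noteq>t" using nc w by auto
   have inb: "ga x\<in>ball (ga t) r" if "x\<in>{0..1}" "\<bar>x - t\<bar> < d" for x using d1(2) that by (simp add: d_def)
   have sg: "0 < n\<bullet>ga x * v * (x - t)" if "x\<in>{0..1}" "\<bar>x - t\<bar> < d" "x\<noteq>t" for x
    using d2(2)[of x] that by (simp add: d_def dist_real_def)
   \<comment> \<open>The part of the ball on the same side of the hyperplane as the given path
     point; it is free of walls modulo the ideal power.\<close>
   define Os where "Os = (\<lambda>x. ball (ga t) r \<inter> {y. 0 < (n\<bullet>ga x) * (n\<bullet>y)})"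
   have Oseq: "{y. 0 < (n\<bullet>ga x) * (n\<bullet>y)} = {y. ((n\<bullet>ga x) *\<^sub>R n)\<bullet>y > 0}" for x by simp
   have Oc: "convex (Os x)" "open (Os x)" for x unfolding Os_def Oseq
    by (rule convex_Int[OF convex_ball convex_halfspace_gt], rule open_Int[OF open_ball open_halfspace_gt])
   have Omem: "ga x\<in>Os x" if "x\<in>{0..1}" "\<bar>x - t\<bar> < d" "x\<noteq>t" for x
   proof -
    have "n\<bullet>ga x\<noteq>0" using sg[OF that] by auto
    hence "0 < (n\<bullet>ga x) * (n\<bullet>ga x)" using not_square_less_zero by (metis linorder_neqE_linordered_idom mult_neg_neg mult_pos_pos)
    thus ?thesis using inb[OF that(1,2)] by (simp add: Os_def)
   qed
   have Oclear: "A.region_clear L (Os x)" for x unfolding A.region_clear_def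
   proof
    fix y assume "y\<in>Os x"
    hence "y\<in>ball (ga t) r" "n\<bullet>y\<noteq>0" by (auto simp: Os_def)
    thus "A.walls_at L y = {}" by (rule clear)
   qed
   obtain c d' where cd: "regular Fd c" "regular Fd d'" "c\<noteq>d'" "c\<in>Os s" "d'\<in>Os s'"
    "\<And>m q. q\<notin>ideal_power P L ==> m\<in>fd_Mcirc Fd ==> B.phi a b m q = B.phi c d' m q"
    by (rule phi_replace[OF ab Oc(2) Omem[OF s(1,4) st(1)] Oc(2) Omem[OF s(2,5) st(2)]]) auto
   have cb: "c\<in>ball (ga t) r" "d'\<in>ball (ga t) r" using cd(4,5) by (auto simp: Os_def)
   have ss: "0 < n\<bullet>ga s * v * (s - t)" "0 < n\<bullet>ga s' * v * (s' - t)" using sg s st by auto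
   have cs: "0 < (n\<bullet>ga s) * (n\<bullet>c)" "0 < (n\<bullet>ga s') * (n\<bullet>d')" using cd(4,5) by (auto simp: Os_def)
   show "B.phi a b m q = seg_kernel L ga s s' m q"
   proof (cases "s < t \<and> t < s'")
    case True
    have opp: "n\<bullet>c * v < 0" "0 < n\<bullet>d' * v" using ss cs True by (auto simp: zero_less_mult_iff mult_less_0_iff)
    have opp': "(n\<bullet>c) * (n\<bullet>d') < 0" using opp by (auto simp: zero_less_mult_iff mult_less_0_iff)
    have "set (filter (\<lambda>t. s < t \<and> t < s') (A.times L ga)) = {t}"
    proof -
     have "x = t" if "s < x" "x < s'" "x\<in>{0..1}" "A.walls_at L (ga x)\<noteq>{}" for x
     proof (rule ccontr)
      assume ne: "x\<noteq>t"
      have "\<bar>x - t\<bar> < d" using that s(4,5) by linarith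
      hence "n\<bullet>ga x\<noteq>0" "ga x\<in>ball (ga t) r" using sg[OF that(3) _ ne] inb[OF that(3)] by auto
      thus False using clear that(4) by blast
     qed
     thus ?thesis using set True t False by auto
    qed
    hence "filter (\<lambda>t. s < t \<and> t < s') (A.times L ga) = [t]"
     using srt by (intro distinct_singleton distinct_filter) (simp_all add: A.times_def)
    hence K: "seg_kernel L ga s s' = A.LocK L (ga t) (velocity ga t)"
     using A.LocK_props(1)[OF A.admissible_transv[OF ad t]] by (simp add: seg_kernel_def A.pkl_def)
    have "B.phi c d' m q = wk (A.cnorm n (d' - c)) (p1 Fd n) (A.gs L n (ga t)) m q"
     by (rule phi_cross_pair[OF near same nN cd(1,2) cb opp' q m])
    also have "A.cnorm n (d' - c) = A.cnorm n (velocity ga t)"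
     using opp by (auto simp: A.cnorm_def inner_diff_right v_def[symmetric] mult_less_0_iff zero_less_mult_iff)
    also have "wk (A.cnorm n (velocity ga t)) (p1 Fd n) (A.gs L n (ga t)) = A.LocK L (ga t) (velocity ga t)"
     by (rule A.LocK_eq[OF same _ nN, symmetric]) (use v0 in \<open>simp_all add: v_def\<close>)
    finally show ?thesis using cd(6)[OF q m] K by simp
   next
    case False
    have K: "seg_kernel L ga s s' = A.kone"
    proof (rule nofilter)
     fix x assume x: "s < x" "x < s'" "x\<in>{0..1}"
     have "\<bar>x - t\<bar> < d" "x\<noteq>t" using x s(4,5) False by auto
     hence "n\<bullet>ga x\<noteq>0" "ga x\<in>ball (ga t) r" using sg[OF x(3)] inb[OF x(3)] by auto
     thus "A.walls_at L (ga x) = {}" using clear by blast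
    qed
    have "0 < (s - t) * (s' - t)" using False st s(3) by (auto simp: zero_less_mult_iff)
    hence "0 < (n\<bullet>ga s) * (n\<bullet>ga s')" using ss by (auto simp: zero_less_mult_iff mult_less_0_iff)
    hence "d'\<in>Os s" using cs cb by (auto simp: Os_def zero_less_mult_iff)
    hence "B.phi c d' m q = A.kone m q" by (intro phi_clear_pair[OF cd(1-4) _ Oc Oclear q m])
    thus ?thesis using cd(6)[OF q m] K by simp
   qed
  qed
  moreover have "d > 0" using d1(1) d2(1) by (simp add: d_def)
  ultimately show ?thesis by blast
 qed
qed

lemma match_trans:
 assumes ad: "admissible_path D1 ga" and s: "s < c" "c < s'" "c\<in>{0..1}" and nc: "A.walls_at L (ga c) = {}"
  and m1: "match L ga s c" and m2: "match L ga c s'" shows "match L ga s s'" unfolding match_def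
proof (intro allI impI, elim conjE)
 fix a b m q assume ab: "regular Fd a" "regular Fd b" "a\<noteq>b" "cl L (ga s) a" "cl L (ga s') b"
  and m: "m\<in>fd_Mcirc Fd" and q: "q\<notin>ideal_power P L"
 obtain r where r: "r > 0" "\<forall>a\<in>ball (ga c) r. cl L (ga c) a" using cl_ball[OF nc] by blast
 obtain x where x: "x\<in>ball (ga c) r" "regular Fd x" "\<And>z. z\<in>{a, b} ==> seg_ok Fd z x"
  by (rule A.regular_escape[of "{a, b}" "ball (ga c) r"]) (use ab r in auto)
 have ne: "a\<noteq>x" "x\<noteq>b" using x(3)[of a] x(3)[of b] by (auto simp: seg_ok_def)
 have clx: "cl L (ga c) x" using r x by blast
 have cn: "c\<notin>set (A.times L ga)" using A.set_times[OF ad] nc by blast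
 have "B.phi a b m q = A.kstar (B.phi a x) (B.phi x b) m q" by (rule B.phi_comp) (use ab x ne m in auto)
 also have "\<dots> = A.kstar (seg_kernel L ga s c) (seg_kernel L ga c s') m q"
  by (rule A.kstar_cong_on[OF A.down_closed_ideal_power[of L], where M = "fd_Mcirc Fd"])
   (use m1 m2 ab x ne clx m q A.Mc_add_P in \<open>auto simp: match_def\<close>)
 also have "A.kstar (seg_kernel L ga s c) (seg_kernel L ga c s') = seg_kernel L ga s s'"
  using sorted_filter_interval[of "A.times L ga" s c s'] s cn
  by (simp add: seg_kernel_def A.pkl_def A.klist_append[symmetric] A.times_def)
 finally show "B.phi a b m q = seg_kernel L ga s s' m q" .
qed

lemma clear_end: "admissible_path D1 ga ==> A.walls_at L (ga 0) = {} \<and> A.walls_at L (ga 1) = {}"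
 using A.walls_at_index unfolding admissible_path_def sd_support_def by fast

text \<open>Compactness gives a Lebesgue number e for the local statements. Longer intervals are cut
  at a wall-free time between e/2 and e after their start, which exists because crossings are finite
  in number; hence the induction in steps of e/2.\<close>

lemma match_all: assumes ad: "admissible_path D1 ga" shows "match L ga 0 1"
proof -
 define Q where "Q = (\<lambda>t d. d > 0 \<and> (\<forall>s s'. s\<in>{0..1} \<and> s'\<in>{0..1} \<and> s < s' \<and> \<bar>s - t\<bar> < d \<and> \<bar>s' - t\<bar> < d \<and>
  A.walls_at L (ga s) = {} \<and> A.walls_at L (ga s') = {} --> match L ga s s'))"
 have "\<forall>t\<in>{0..1}. \<exists>d. Q t d" unfolding Q_def using match_local[OF ad] by blast
 then obtain d where d: "\<And>t. t\<in>{0..1} ==> Q t (d t)" by metis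
 obtain e where e: "e > 0" "\<And>x. x\<in>{0..1} ==> \<exists>S\<in>(\<lambda>t. ball t (d t)) ` {0..1}. ball x e\<subseteq>S"
 proof (rule Heine_Borel_lemma[of "{0..1::real}" "(\<lambda>t. ball t (d t)) ` {0..1}"])
  show "{0..1}\<subseteq>\<Union> ((\<lambda>t. ball t (d t)) ` {0..1})" 
  proof
   fix t assume t: "t\<in>{0..1::real}"
   have "0 < d t" using d[OF t] unfolding Q_def by (rule conjunct1)
   thus "t\<in>\<Union> ((\<lambda>t. ball t (d t)) ` {0..1})" using t by (intro UN_I[of t]) simp_all
  qed
 qed auto
 define nc where "nc = (\<lambda>s. s\<in>{0..1} \<and> A.walls_at L (ga s) = {})"
 have small: "match L ga s s'" if "nc s" "nc s'" "s < s'" "s' - s < e" for s s'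
 proof -
  have "s\<in>{0..1}" using that by (simp add: nc_def)
  then obtain t where t: "t\<in>{0..1}" "ball s e\<subseteq>ball t (d t)" using e(2) by blast
  have "s\<in>ball s e" "s'\<in>ball s e" using that e(1) by (auto simp: dist_real_def)
  hence "s\<in>ball t (d t)" "s'\<in>ball t (d t)" using t(2) by blast+
  hence "\<bar>s - t\<bar> < d t" "\<bar>s' - t\<bar> < d t" by (auto simp: dist_real_def)
  thus ?thesis using d[OF t(1)] that unfolding Q_def nc_def by blast
 qed
 have *: "\<forall>s s'. nc s \<and> nc s' \<and> s < s' \<and> s' - s < real (Suc k) * (e / 2) --> match L ga s s'" for k
 proof (induction k)
  case 0
  thus ?case using small e(1) by auto
 next
  case (Suc k)
  show ?case
  proof (intro allI impI, elim conjE)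
   fix s s' assume s: "nc s" "nc s'" "s < s'" "s' - s < real (Suc (Suc k)) * (e / 2)"
   show "match L ga s s'"
   proof (cases "s' - s < e")
    case True
    thus ?thesis using small s by blast
   next
    case False
    have "infinite {s + e / 2<..<s + e}" using e(1) by simp
    hence "\<not> {s + e / 2<..<s + e}\<subseteq>{t\<in>{0..1}. A.walls_at L (ga t)\<noteq>{}}"
     using A.finite_times[OF ad] finite_subset by blast
    then obtain c where c0: "c\<in>{s + e / 2<..<s + e}" "c\<notin>{t\<in>{0..1}. A.walls_at L (ga t)\<noteq>{}}" by blast
    hence c: "s + e / 2 < c" "c < s + e" "\<not> (c\<in>{0..1} \<and> A.walls_at L (ga c)\<noteq>{})" by auto
    have cc: "s < c" "c < s'" "c\<in>{0..1}" using c s False e(1) by (auto simp: nc_def)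
    hence ncc: "nc c" using c(3) by (simp add: nc_def)
    have "match L ga s c" by (rule small[OF s(1) ncc cc(1)]) (use c in simp)
    moreover have "s' - c < real (Suc k) * (e / 2)" using s(4) c(1) by (simp add: algebra_simps)
    hence "match L ga c s'" using Suc ncc s(2) cc(2) by blast
    ultimately show ?thesis using match_trans[OF ad cc] ncc by (simp add: nc_def)
   qed
  qed
 qed
 obtain k :: nat where "2 / e < real k" using reals_Archimedean2 by blast
 hence "1 - 0 < real (Suc k) * (e / 2)" using e(1) by (simp add: field_simps)
 moreover have "nc 0" "nc 1" using clear_end[OF ad] by (simp_all add: nc_def)
 ultimately show ?thesis using *[of k] by simp
qed

lemma transfer:
 assumes ad: "admissible_path D1 ga" and ab: "regular Fd a" "regular Fd b" "a\<noteq>b" "cl L (ga 0) a" "cl L (ga 1) b"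
  and q: "q\<notin>ideal_power P L" and m: "m\<in>fd_Mcirc Fd" shows "B.phi a b m q = A.pk ga m q"
proof -
 have "0\<notin>set (A.times L ga)" "1\<notin>set (A.times L ga)" using clear_end[OF ad] unfolding A.set_times[OF ad] by auto
 hence "0 < t \<and> t < 1" if "t\<in>set (A.times L ga)" for t
  using that A.set_times[OF ad] by (metis (no_types, lifting) atLeastAtMost_iff less_eq_real_def mem_Collect_eq)
 hence "filter (\<lambda>t. 0 < t \<and> t < 1) (A.times L ga) = A.times L ga" by (simp add: filter_id_conv)
 hence "seg_kernel L ga 0 1 m q = A.pk ga m q"
  using A.pk_eq[OF ad q A.good_times[OF ad]] by (simp add: seg_kernel_def)
 thus ?thesis using match_all[OF ad, of L] ab q m unfolding match_def by simp
qed

lemma end_points: assumes "\<And>x. x\<in>{x0, x1} ==> A.walls_at L x = {}" "r0 > 0" "r1 > 0"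
 obtains a b where "regular Fd a" "regular Fd b" "a\<noteq>b" "cl L x0 a" "cl L x1 b" "a\<in>ball x0 r0" "b\<in>ball x1 r1"
proof -
 obtain r where r: "r > 0" "\<forall>a\<in>ball x0 r. cl L x0 a" using cl_ball[of L x0] assms by blast
 obtain r' where r': "r' > 0" "\<forall>a\<in>ball x1 r'. cl L x1 a" using cl_ball[of L x1] assms by blast
 obtain a where a: "a\<in>ball x0 (min r r0)" "regular Fd a" "\<And>z. z\<in>{} ==> seg_ok Fd z a"
  by (rule A.regular_escape[of "{}" "ball x0 (min r r0)"]) (use r assms in auto)
 obtain b where b: "b\<in>ball x1 (min r' r1)" "regular Fd b" "\<And>z. z\<in>{a} ==> seg_ok Fd z b"
  by (rule A.regular_escape[of "{a}" "ball x1 (min r' r1)"]) (use r' assms a in auto)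
 have "a\<noteq>b" using b(3)[of a] by (auto simp: seg_ok_def)
 thus ?thesis using that[of a b] a b r r' by auto
qed

lemma consistent_D1: "consistent_diagram Fd P D1" unfolding consistent_diagram_def
proof (intro allI impI ballI, elim conjE)
 fix ga ga' and F :: "'a=>('x, 'k) coeff_poly"
 assume ad: "admissible_path D1 ga" "admissible_path D1 ga'" and ends: "ga 0 = ga' 0" "ga 1 = ga' 1"
  and F: "F\<in>carrier (completed_ring Fd P)"
 have "A.pk ga m q = A.pk ga' m q" if m: "m\<in>fd_Mcirc Fd" for m q
 proof -
  define L where "L = A.Lof q"
  have q: "q\<notin>ideal_power P L" unfolding L_def by (rule A.Lof)
  obtain a b where ab: "regular Fd a" "regular Fd b" "a\<noteq>b" "cl L (ga 0) a" "cl L (ga 1) b"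
   by (rule end_points[of "ga 0" "ga 1" L 1 1]) (use clear_end[OF ad(1)] in auto)
  show ?thesis using transfer[OF ad(1) ab q m] transfer[OF ad(2) ab(1-3) _ _ q m] ab ends by simp
 qed
 hence "A.kstar (\<lambda>_. F) (A.pk ga) 0 q = A.kstar (\<lambda>_. F) (A.pk ga') 0 q" for q
  unfolding A.kstar_def using A.PMc by (intro sum.cong) (auto simp: A.dec_def)
 thus "path_product Fd P D1 ga F = path_product Fd P D1 ga' F"
  using A.path_product_eq[OF ad(1) F] A.path_product_eq[OF ad(2) F] by auto
qed

end

lemma scat_pair_self: "cscat Fd e P D ==> scat_pair Fd e P D D"
 unfolding scat_pair_def scat_pair_axioms_def cscat_def by auto

text \<open>A path admissible for both diagrams is compared with the cocycle of \<open>D2\<close>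
  twice, once through \<open>D1\<close> and once through the pair of \<open>D2\<close> with
  itself.\<close>

lemma (in scat_pair) equivalent: "equivalent_diagrams Fd P D2 D1" unfolding equivalent_diagrams_def
proof (intro allI impI ballI, elim conjE)
 interpret S: scat_pair Fd e P D2 D2 by (rule scat_pair_self[OF B.cscat_axioms])
 fix ga and F :: "'a=>('x, 'k) coeff_poly"
 assume ad2: "admissible_path D2 ga" and ad1: "admissible_path D1 ga" and F: "F\<in>carrier (completed_ring Fd P)"
 have "B.pk ga m q = A.pk ga m q" if m: "m\<in>fd_Mcirc Fd" for m q
 proof -
  define L where "L = A.Lof q"
  have q: "q\<notin>ideal_power P L" unfolding L_def by (rule A.Lof)
  obtain r where r: "r > 0" "\<forall>a\<in>ball (ga 0) r. S.cl L (ga 0) a" using S.cl_ball[of L "ga 0"] S.clear_end[OF ad2] by blast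
  obtain r' where r': "r' > 0" "\<forall>a\<in>ball (ga 1) r'. S.cl L (ga 1) a" using S.cl_ball[of L "ga 1"] S.clear_end[OF ad2] by blast
  obtain a b where ab: "regular Fd a" "regular Fd b" "a\<noteq>b" "cl L (ga 0) a" "cl L (ga 1) b"
    "a\<in>ball (ga 0) r" "b\<in>ball (ga 1) r'"
   by (rule end_points[of "ga 0" "ga 1" L r r']) (use clear_end[OF ad1] r r' in auto)
  have "S.cl L (ga 0) a" "S.cl L (ga 1) b" using ab r r' by blast+
  thus ?thesis using transfer[OF ad1 ab(1-5) q m] S.transfer[OF ad2 ab(1-3) _ _ q m] by simp
 qed
 hence "A.kstar (\<lambda>_. F) (B.pk ga) 0 q = A.kstar (\<lambda>_. F) (A.pk ga) 0 q" for q
  unfolding A.kstar_def using A.PMc by (intro sum.cong) (auto simp: A.dec_def)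
 thus "path_product Fd P D2 ga F = path_product Fd P D1 ga F"
  using A.path_product_eq[OF ad1 F] B.path_product_eq[OF ad2 F] by auto
qed

section \<open>Initial walls\<close>

text \<open>A nonzero integer is invertible in the field, so a constant polynomial cancels
  it.\<close>

lemma coeff_poly_torsion_free:
 fixes c :: "('x, 'k::field_char_0) coeff_poly" assumes "of_int N * c = 0" "N\<noteq>0" shows "c = 0"
proof -
 have "Poly_Mapping.single 0 (inverse (of_int N :: 'k)) * (of_int N * c) = 0" using assms(1) by simp
 hence "(Poly_Mapping.single 0 (inverse (of_int N :: 'k)) * Poly_Mapping.single 0 (of_int N)) * c = 0"
  unfolding single_of_int by (simp only: mult.assoc)
 moreover have "Poly_Mapping.single (0::'x \<Rightarrow>\<^sub>0 nat) (inverse (of_int N :: 'k)) * Poly_Mapping.single 0 (of_int N) = 1"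
  using assms(2) by (simp add: mult_single del: single_of_int)
 ultimately show ?thesis by simp
qed

definition ecoeff :: "('i, 'a, 'x) fixed_data=>'i=>nat=>('x, 'k::field_char_0) coeff_poly" where
 "ecoeff Fd i j = (if j\<le>fd_r Fd i then exchange_coeff Fd i j else 0)"

lemma exchange_fun_nth:
 fixes Fd :: "('i, 'a::euclidean_space, 'x) fixed_data"
 assumes "v\<noteq>0" shows "exchange_fun Fd i v (of_nat j *\<^sub>R v) = ecoeff Fd i j"
proof -
 have "exchange_fun Fd i v (of_nat j *\<^sub>R v) = (\<Sum>j'\<le>fd_r Fd i. if j = j' then exchange_coeff Fd i j' else 0)"
  unfolding exchange_fun_def using assms by (intro sum.cong) auto
 thus ?thesis by (simp add: ecoeff_def)
qed

context scat
begin

lemma wn_unique: assumes w: "w\<in>sd_index D" and n: "n\<in>Nplus Fd e" "primitive_in N n" "sd_supp D w\<subseteq>orth n"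
 shows "wn w = n"
proof -
 have "span (sd_supp D w)\<subseteq>orth n" by (rule span_minimal[OF n(3) orth_dim(1)[OF Nplus_nonzero[OF n(1)]]])
 hence "orth (wn w)\<subseteq>orth n" using supp_span[OF w] by simp
 then obtain r where "n = r *\<^sub>R wn w" using orth_subset_parallel wn_nonzero[OF w] by blast
 hence "n = wn w" by (rule Nplus_primitive_eq[OF wn_Nplus[OF w] n(1) wn_prim[OF w] n(2)])
 thus ?thesis by simp
qed

end

locale clus = cscat Fd e P D
 for Fd :: "('i, 'a::euclidean_space, 'x) fixed_data" and e and P
  and D :: "('w, 'a, ('x, 'k::field_char_0) coeff_poly) diagram" +
 assumes csd: "cluster_scattering_diagram Fd e P D"
begin

definition w0 :: "'i=>'w" where "w0 = (SOME w0. inj_on w0 (fd_Iuf Fd) \<and> w0 ` fd_Iuf Fd\<subseteq>sd_index D \<and>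
    (\<forall>i\<in>fd_Iuf Fd. is_initial_wall Fd e i D (w0 i)) \<and>
    (\<forall>w\<in>sd_index D - w0 ` fd_Iuf Fd. outgoing_wall Fd e P D w))"

lemma w0: "w0 ` fd_Iuf Fd\<subseteq>sd_index D" "i\<in>fd_Iuf Fd ==> is_initial_wall Fd e i D (w0 i)"
 "w\<in>sd_index D ==> w\<notin>w0 ` fd_Iuf Fd ==> outgoing_wall Fd e P D w"
proof -
 have "\<exists>w0. inj_on w0 (fd_Iuf Fd) \<and> w0 ` fd_Iuf Fd\<subseteq>sd_index D \<and>
    (\<forall>i\<in>fd_Iuf Fd. is_initial_wall Fd e i D (w0 i)) \<and>
    (\<forall>w\<in>sd_index D - w0 ` fd_Iuf Fd. outgoing_wall Fd e P D w)"
  using csd unfolding cluster_scattering_diagram_def by (elim conjE) assumption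
 from someI_ex[OF this, folded w0_def]
 show "w0 ` fd_Iuf Fd\<subseteq>sd_index D" "i\<in>fd_Iuf Fd ==> is_initial_wall Fd e i D (w0 i)"
  "w\<in>sd_index D ==> w\<notin>w0 ` fd_Iuf Fd ==> outgoing_wall Fd e P D w" by blast+
qed

lemma w0_facts: assumes i: "i\<in>fd_Iuf Fd"
 shows "w0 i\<in>sd_index D" "sd_supp D (w0 i) = orth (e i)" "sd_fun D (w0 i) = exchange_fun Fd i (p1 Fd (e i))" "wn (w0 i) = e i"
proof -
 show 1: "w0 i\<in>sd_index D" using w0(1) i by blast
 show 2: "sd_supp D (w0 i) = orth (e i)" and "sd_fun D (w0 i) = exchange_fun Fd i (p1 Fd (e i))"
  using w0(2)[OF i] unfolding is_initial_wall_def by blast+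
 show "wn (w0 i) = e i" by (rule wn_unique[OF 1 e_Nplus[OF i] primitive_e]) (use 2 i IufI in auto)
qed

text \<open>Supports are cones, so excluding \<open>p1 Fd (wn w)\<close> excludes its positive
  multiples as well.\<close>

lemma outgoing: assumes w: "w\<in>sd_index D" "w\<notin>w0 ` fd_Iuf Fd" and j: "0 < (j::nat)"
 shows "of_nat j *\<^sub>R p1 Fd (wn w)\<notin>sd_supp D w"
proof
 assume "of_nat j *\<^sub>R p1 Fd (wn w)\<in>sd_supp D w"
 hence "(1 / of_nat j) *\<^sub>R (of_nat j *\<^sub>R p1 Fd (wn w))\<in>sd_supp D w" by (rule supp_scale[OF w(1)]) simp
 hence in_supp: "p1 Fd (wn w)\<in>sd_supp D w" using j by simp
 obtain n0 where n0: "wall_for Fd e P n0 (sd_supp D w) (sd_fun D w)" "p1 Fd n0\<notin>sd_supp D w"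
  using w0(3)[OF w] unfolding outgoing_wall_def by blast
 have "wn w = n0" by (rule wn_unique[OF w(1)]) (use n0(1) in \<open>simp_all only: wall_for_def simp_thms\<close>)
 thus False using in_supp n0(2) by simp
qed

text \<open>For j > 0 this is the coefficient that the initial walls alone give to the local
  function in direction n.\<close>

definition init :: "'a=>nat=>('x, 'k) coeff_poly" where
 "init n j = (if \<exists>i\<in>fd_Iuf Fd. e i = n then ecoeff Fd (THE i. i\<in>fd_Iuf Fd \<and> e i = n) j else 0)"

lemma e_inj: "i\<in>fd_I Fd ==> i'\<in>fd_I Fd ==> e i = e i' ==> i = i'"
 using basN by (auto simp: lattice_basis_def inj_on_def)

lemma init_e: "i\<in>fd_Iuf Fd ==> init (e i) j = ecoeff Fd i j"
proof -
 assume i: "i\<in>fd_Iuf Fd"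
 have "(THE i'. i'\<in>fd_Iuf Fd \<and> e i' = e i) = i" using i e_inj IufI by (intro the_equality) auto
 thus ?thesis using i by (auto simp: init_def)
qed

text \<open>Outgoing walls with normal n are closed and miss the multiples of p1(n), and generic
  points of n^perp lie on no walls with another normal. Truncation leaves finitely many walls, hence
  a radius, which may depend on j.\<close>

lemma near_init: assumes n: "n\<in>Nplus Fd e" "primitive_in N n" and j: "0 < j" "of_nat j *\<^sub>R p1 Fd n\<notin>ideal_power P L"
 shows "\<exists>r>0. \<forall>y\<in>ball (of_nat j *\<^sub>R p1 Fd n) r. generic Fd y \<and> n\<bullet>y = 0 --> G y n $ j = init n j"
proof -
 let ?p = "of_nat j *\<^sub>R p1 Fd n"
 have "\<exists>r>0. \<forall>w\<in>sd_walls_mod Fd P L D. w\<notin>w0 ` fd_Iuf Fd \<and> wn w = n --> ball ?p r \<inter> sd_supp D w = {}"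
 proof (rule finite_radius[OF finite_walls])
  fix w assume w: "w\<in>sd_walls_mod Fd P L D"
  note wi = walls_mod_index[OF w]
  show "\<exists>r>0. w\<notin>w0 ` fd_Iuf Fd \<and> wn w = n --> ball ?p r \<inter> sd_supp D w = {}"
  proof (cases "w\<notin>w0 ` fd_Iuf Fd \<and> wn w = n")
   case True
   hence "?p\<in>- sd_supp D w" using outgoing[OF wi _ j(1)] by auto
   moreover have "open (- sd_supp D w)" by (rule open_Compl[OF supp_closed[OF wi]])
   ultimately obtain r where "r > 0" "ball ?p r\<subseteq>- sd_supp D w" by (metis openE)
   thus ?thesis by (intro exI[of _ r]) auto
  qed (auto intro: exI[of _ 1])
 next
  fix w r r' assume "w\<notin>w0 ` fd_Iuf Fd \<and> wn w = n --> ball ?p r \<inter> sd_supp D w = {}" "r'\<le>r"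
  moreover have "ball ?p r'\<subseteq>ball ?p r" using \<open>r'\<le>r\<close> by (rule subset_ball)
  ultimately show "w\<notin>w0 ` fd_Iuf Fd \<and> wn w = n --> ball ?p r' \<inter> sd_supp D w = {}" by blast
 qed
 then obtain r where r: "r > 0" "\<forall>w\<in>sd_walls_mod Fd P L D. w\<notin>w0 ` fd_Iuf Fd \<and> wn w = n --> ball ?p r \<inter> sd_supp D w = {}"
  by blast
 have "G y n $ j = init n j" if y: "y\<in>ball ?p r" "generic Fd y" "n\<bullet>y = 0" for y
 proof -
  have same: "wn w = n" if "w\<in>walls_at L y" for w
   using generic_same_wn[OF y(2) n y(3)] walls_at_index[OF that] by blast
  have ini: "w\<in>w0 ` fd_Iuf Fd" if w: "w\<in>walls_at L y" for w
  proof (rule ccontr)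
   assume "w\<notin>w0 ` fd_Iuf Fd"
   hence "ball ?p r \<inter> sd_supp D w = {}" using r(2) same[OF w] w by (simp add: walls_at_def)
   thus False using y(1) walls_at_index[OF w] by blast
  qed
  have Gj: "G y n $ j = gs L n y $ j" by (rule G_nth[OF n(1) j(2)])
  show ?thesis
  proof (cases "\<exists>i\<in>fd_Iuf Fd. e i = n")
   case True
   then obtain i where i: "i\<in>fd_Iuf Fd" "e i = n" by blast
   have sub: "walls_at L y\<subseteq>{w0 i}"
   proof
    fix w assume w: "w\<in>walls_at L y"
    then obtain i' where i': "i'\<in>fd_Iuf Fd" "w = w0 i'" using ini by blast
    hence "e i' = e i" using same[OF w] w0_facts(4)[OF i'(1)] i(2) by simp
    thus "w\<in>{w0 i}" using e_inj i' i(1) IufI by auto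
   qed
   have fj: "ray_series (p1 Fd n) (sd_fun D (w0 i)) $ j = ecoeff Fd i j"
    using w0_facts(3)[OF i(1)] i(2) exchange_fun_nth[OF p1_Nplus(2)[OF n(1)]] by simp
   show ?thesis
   proof (cases "w0 i\<in>sd_walls_mod Fd P L D")
    case True
    hence "walls_at L y = {w0 i}" using sub w0_facts(2)[OF i(1)] y(3) i(2) by (auto simp: walls_at_def orth_def)
    thus ?thesis using Gj fj init_e[OF i(1)] i(2) by (simp add: gs_def)
   next
    case False
    hence "walls_at L y = {}" using sub by (auto simp: walls_at_def)
    hence "G y n $ j = 0" using Gj j(1) by (simp add: gs_def)
    moreover have "cong_mod P L (sd_fun D (w0 i)) \<one>\<^bsub>completed_ring Fd P\<^esub>"
     using False w0_facts(1)[OF i(1)] unfolding sd_walls_mod_def by blast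
    hence "sd_fun D (w0 i) ?p = \<one>\<^bsub>completed_ring Fd P\<^esub> ?p"
     using j(2) nat_scale_mem[OF p1_Nplus(1)[OF n(1)]] unfolding cong_mod_def by blast
    hence "ecoeff Fd i j = (0 :: ('x, 'k) coeff_poly)" using fj p1_Nplus(2)[OF n(1)] j(1) by simp
    ultimately show ?thesis using init_e[OF i(1)] i(2) by simp
   qed
  next
   case False
   have "walls_at L y = {}"
   proof (rule ccontr)
    assume "walls_at L y\<noteq>{}"
    then obtain w where w: "w\<in>walls_at L y" by blast
    then obtain i where i: "i\<in>fd_Iuf Fd" "w = w0 i" using ini by blast
    thus False using False same[OF w] w0_facts(4)[OF i(1)] by auto
   qed
   hence "G y n $ j = 0" using Gj j(1) by (simp add: gs_def)
   thus ?thesis using False by (simp add: init_def)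
  qed
 qed
 thus ?thesis using r(1) by blast
qed

end

section \<open>The local function along an initial wall\<close>

context cscat
begin

lemma self_pair: "scat_pair Fd e P D D" by (rule scat_pair_self[OF cscat_axioms])

definition crosses :: "nat=>'a=>'a=>('x, 'k) coeff_poly fps=>real=>bool" where
 "crosses L x n g r \<longleftrightarrow> 0 < r \<and> (\<forall>a\<in>ball x r. \<forall>b\<in>ball x r. \<forall>q m. regular Fd a \<and> regular Fd b \<and>
   (n\<bullet>a) * (n\<bullet>b) < 0 \<and> q\<notin>ideal_power P L \<and> m\<in>Mc --> phi a b m q = wk (cnorm n (b - a)) (p1 Fd n) g m q)"

lemma crossesD:
 assumes "crosses L x n g r" "a\<in>ball x r" "b\<in>ball x r" "regular Fd a" "regular Fd b" "(n\<bullet>a) * (n\<bullet>b) < 0"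
  "q\<notin>ideal_power P L" "m\<in>Mc" shows "phi a b m q = wk (cnorm n (b - a)) (p1 Fd n) g m q"
 using assms unfolding crosses_def by blast

lemma phi_cross: assumes x: "generic Fd x" "n\<bullet>x = 0" and n: "n\<in>Nu" "n\<noteq>0"
  and wn: "\<And>w. w\<in>sd_index D ==> x\<in>sd_supp D w ==> wn w = n" shows "\<exists>r. crosses L x n (gs L n x) r"
proof -
 interpret S: scat_pair Fd e P D D by (rule self_pair)
 have same: "wn w = n" if "w\<in>walls_at L x" for w using wn walls_at_index[OF that] by blast
 have "\<exists>r>0. \<forall>y\<in>ball x r. walls_at L y\<subseteq>walls_at L x \<and> (n\<bullet>y = 0 --> walls_at L y = walls_at L x)"
  by (rule near_structure) (use same generic_rel_interior[OF _ _ x(1)] walls_at_index in blast)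
 then obtain r where r: "r > 0" and near: "\<And>y. y\<in>ball x r ==>
   walls_at L y\<subseteq>walls_at L x \<and> (n\<bullet>y = 0 --> walls_at L y = walls_at L x)" by blast
 show ?thesis
  unfolding crosses_def by (intro exI[of _ r] conjI ballI allI impI r, elim conjE, rule S.phi_cross_pair[OF near same n])
qed

end

text \<open>Identity plus terms of positive level: the unipotent kernels for the grading of the
  exponents p1(n) by the pairing of n with \<open>lam\<close>.\<close>

definition posk :: "('i, 'a::euclidean_space, 'x) fixed_data=>'a=>('a=>'a=>'r::comm_ring_1)=>bool" where
 "posk Fd lam K \<longleftrightarrow> (\<forall>m\<in>fd_Mcirc Fd. K m 0 = 1 \<and>
   (\<forall>q. K m q\<noteq>0 --> q = 0 \<or> (\<exists>n\<in>fd_Nuf Fd. q = p1 Fd n \<and> 0 < n\<bullet>lam)))"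

lemma poskD: assumes "posk Fd lam K" "m\<in>fd_Mcirc Fd"
 shows "K m 0 = 1" "K m q\<noteq>0 ==> q = 0 \<or> (\<exists>n\<in>fd_Nuf Fd. q = p1 Fd n \<and> 0 < n\<bullet>lam)"
proof -
 have "K m 0 = 1 \<and> (\<forall>q. K m q\<noteq>0 --> q = 0 \<or> (\<exists>n\<in>fd_Nuf Fd. q = p1 Fd n \<and> 0 < n\<bullet>lam))"
  using assms unfolding posk_def by (rule bspec)
 thus "K m 0 = 1" "K m q\<noteq>0 ==> q = 0 \<or> (\<exists>n\<in>fd_Nuf Fd. q = p1 Fd n \<and> 0 < n\<bullet>lam)" by simp_all
qed

lemma posk_cong: assumes "posk Fd l K" "\<And>m q. m\<in>fd_Mcirc Fd ==> K' m q = K m q" shows "posk Fd l K'"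
 using assms unfolding posk_def by simp

context seed_data
begin

lemma posk_kone: "posk Fd lam kone" by (simp add: posk_def kone_def)

lemma posk_kstar: assumes "posk Fd lam K1" "posk Fd lam K2" shows "posk Fd lam (K1\<star>K2)" unfolding posk_def
proof (intro ballI conjI allI impI)
 fix m assume m: "m\<in>Mc"
 show "(K1\<star>K2) m 0 = 1" using assms m unfolding posk_def by (intro kstar_0) auto
 fix q assume "(K1\<star>K2) m q\<noteq>0"
 then obtain p where p: "p\<in>dec q" "K1 m p * K2 (m + p) (q - p)\<noteq>0" unfolding kstar_def by (meson sum.neutral)
 have mp: "m + p\<in>Mc" using p(1) m Mc_add_P by (simp add: dec_def)
 have "K1 m p\<noteq>0" "K2 (m + p) (q - p)\<noteq>0" using p(2) by auto
 hence 1: "p = 0 \<or> (\<exists>n\<in>Nu. p = p1 Fd n \<and> 0 < n\<bullet>lam)" and 2: "q - p = 0 \<or> (\<exists>n\<in>Nu. q - p = p1 Fd n \<and> 0 < n\<bullet>lam)"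
  using assms m mp unfolding posk_def by blast+
 show "q = 0 \<or> (\<exists>n\<in>Nu. q = p1 Fd n \<and> 0 < n\<bullet>lam)"
 proof (cases "p = 0 \<or> q - p = 0")
  case True
  thus ?thesis using 1 2 by auto
 next
  case False
  then obtain n1 n2 where n: "n1\<in>Nu" "p = p1 Fd n1" "0 < n1\<bullet>lam" "n2\<in>Nu" "q - p = p1 Fd n2" "0 < n2\<bullet>lam"
   using 1 2 by blast
  have "q = p + p1 Fd n2" using n(5) by (metis add.commute diff_add_cancel)
  hence "q = p1 Fd (n1 + n2)" using n(2) by (simp add: linear_add[OF linear_p1])
  thus ?thesis using n Nu.add by (intro disjI2 bexI[of _ "n1 + n2"]) (auto simp: inner_left_distrib)
 qed
qed

lemma posk_klist: "(\<And>K. K\<in>set Ks ==> posk Fd lam K) ==> posk Fd lam (klist Ks)"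
proof (induction Ks)
 case (Cons K Ks)
 show ?case unfolding klist_simps by (rule posk_kstar) (use Cons in auto)
qed (simp add: posk_kone)

lemma posk_wk: assumes "n\<in>Nu" "0 < n\<bullet>lam" "g $ 0 = 1" shows "posk Fd lam (wk c (p1 Fd n) g)" unfolding posk_def
proof (intro ballI conjI allI impI)
 have nz: "n\<noteq>0" using assms(2) by auto
 show "wk c (p1 Fd n) g m 0 = 1" for m by (rule wk_0[OF p1_nonzero[OF assms(1) nz] assms(3)])
 fix m q assume "wk c (p1 Fd n) g m q\<noteq>0"
 then obtain j :: nat where j: "q = of_nat j *\<^sub>R p1 Fd n" unfolding wk_def using ray_nonzeroD by blast
 show "q = 0 \<or> (\<exists>n\<in>Nu. q = p1 Fd n \<and> 0 < n\<bullet>lam)"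
 proof (cases "j = 0")
  case False
  thus ?thesis using j assms Nu.scale_nat[OF assms(1)] linear_scale[OF linear_p1]
   by (intro disjI2 bexI[of _ "of_nat j *\<^sub>R n"]) auto
 qed (use j in simp)
qed

definition lamk :: "'i=>'a" where "lamk k = (\<Sum>i\<in>fd_Iuf Fd - {k}. ed i)"

lemma e_lamk: assumes "i\<in>fd_I Fd" shows "e i\<bullet>lamk k = (if i\<in>fd_Iuf Fd - {k} then 1 else 0)"
proof -
 have "e i\<bullet>lamk k = (\<Sum>j\<in>fd_Iuf Fd - {k}. if j = i then 1 else 0)"
  unfolding lamk_def inner_sum_right by (rule sum.cong[OF refl]) (use ed assms IufI in auto)
 thus ?thesis using finIuf by simp
qed

text \<open>At level zero all coordinates except the one at k would vanish and n would be parallel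
  to e_k; but n is orthogonal to x and e_k is not. The general basis f covers both seeds.\<close>

lemma level_pos_basis:
 assumes k: "k\<in>fd_Iuf Fd" and f: "\<And>i. i\<in>fd_Iuf Fd ==> f i\<bullet>lamk k = (if i = k then 0 else 1)" "f k = t *\<^sub>R e k"
  and n: "n\<in>Nplus Fd f" "n\<bullet>x = 0" "e k\<bullet>x\<noteq>0" shows "0 < n\<bullet>lamk k"
proof -
 obtain c :: "'i=>nat" where c: "n = (\<Sum>i\<in>fd_Iuf Fd. of_nat (c i) *\<^sub>R f i)" "n\<noteq>0"
  using n(1) unfolding Nplus_def by blast
 have lev: "n\<bullet>lamk k = (\<Sum>i\<in>fd_Iuf Fd - {k}. of_nat (c i))"
 proof -
  have "n\<bullet>lamk k = (\<Sum>i\<in>fd_Iuf Fd. of_nat (c i) * (f i\<bullet>lamk k))" unfolding c(1) by (simp add: inner_sum_left)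
  also have "\<dots> = (\<Sum>i\<in>fd_Iuf Fd - {k}. of_nat (c i) * (f i\<bullet>lamk k))"
   using finIuf f(1)[OF k] by (intro sum.mono_neutral_right) auto
  also have "\<dots> = (\<Sum>i\<in>fd_Iuf Fd - {k}. of_nat (c i))" using f(1) by (intro sum.cong) auto
  finally show ?thesis .
 qed
 have "n\<bullet>lamk k\<noteq>0"
 proof
  assume "n\<bullet>lamk k = 0"
  hence z: "c i = 0" if "i\<in>fd_Iuf Fd - {k}" for i using lev that finIuf by (simp add: sum_nonneg_eq_0_iff)
  have "n = (\<Sum>i\<in>{k}. of_nat (c i) *\<^sub>R f i)" unfolding c(1) using finIuf k z by (intro sum.mono_neutral_right) auto
  hence n': "n = (of_nat (c k) * t) *\<^sub>R e k" using f(2) by simp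
  hence "of_nat (c k) * t * (e k\<bullet>x) = 0" using n(2) by simp
  thus False using n(3) c(2) n' by auto
 qed
 moreover have "0\<le>n\<bullet>lamk k" unfolding lev by (rule sum_nonneg) simp
 ultimately show ?thesis by simp
qed

lemma level_pos: "k\<in>fd_Iuf Fd ==> n\<in>Nplus Fd e ==> n\<bullet>x = 0 ==> e k\<bullet>x\<noteq>0 ==> 0 < n\<bullet>lamk k"
 by (rule level_pos_basis[of k e 1]) (use e_lamk IufI in auto)

end

context cscat
begin

lemma posk_phi: assumes lev: "\<And>n x. n\<in>Nplus Fd e ==> x\<in>H ==> n\<bullet>x = 0 ==> 0 < n\<bullet>lam"
  and H: "open H" "convex H" "a\<in>H" "b\<in>H" and ab: "regular Fd a" "regular Fd b" "a\<noteq>b" shows "posk Fd lam (phi a b)"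
proof -
 have seg: "posk Fd lam (phi a' b')" if so: "seg_ok Fd a' b'" and in_H: "a'\<in>H" "b'\<in>H" for a' b'
 proof -
  note ad = generic_path_admissible[OF seg_ok_generic_path[OF so]]
  have "posk Fd lam (pkl L (seg a' b') (times L (seg a' b')))" for L unfolding pkl_def
  proof (rule posk_klist)
   fix K assume "K\<in>set (map (\<lambda>t. LocK L (seg a' b' t) (velocity (seg a' b') t)) (times L (seg a' b')))"
   then obtain t where t: "t\<in>{0..1}" "K = LocK L (seg a' b' t) (velocity (seg a' b') t)" using set_times[OF ad] by auto
   let ?x = "seg a' b' t"
   have xH: "?x\<in>H" by (rule seg_convex[OF H(2) in_H t(1)])
   obtain ws where ws: "set ws = walls_at L ?x" "K = klist (map (\<lambda>w. Kw w (velocity (seg a' b') t)) ws)"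
    unfolding t(2) by (rule LocK_list)
   show "posk Fd lam K" unfolding ws(2)
   proof (rule posk_klist)
    fix K' assume "K'\<in>set (map (\<lambda>w. Kw w (velocity (seg a' b') t)) ws)"
    then obtain w where w: "w\<in>walls_at L ?x" "K' = Kw w (velocity (seg a' b') t)" using ws(1) by auto
    note wi = walls_at_index[OF w(1), THEN conjunct1]
    have "wn w\<bullet>?x = 0" using supp_orth[OF wi] walls_at_index[OF w(1)] by (auto simp: orth_def)
    thus "posk Fd lam K'" unfolding w(2) Kw_def
     by (intro posk_wk Nplus_Nu[OF wn_Nplus[OF wi]] lev[OF wn_Nplus[OF wi] xH] series_0[OF wi])
   qed
  qed
  hence "posk Fd lam (pk (seg a' b'))" unfolding posk_def pk_def by blast
  thus ?thesis by (rule posk_cong) (rule phi_seg[OF so])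
 qed
 obtain c where c: "c\<in>H" "regular Fd c" "\<And>z. z\<in>{a, b} ==> seg_ok Fd z c"
  by (rule regular_escape[of "{a, b}" H]) (use ab H in auto)
 have so: "seg_ok Fd a c" "seg_ok Fd c b" using c(3) seg_ok_sym by auto
 hence ne: "a\<noteq>c" "c\<noteq>b" by (auto simp: seg_ok_def)
 show ?thesis by (rule posk_cong[OF posk_kstar[OF seg[OF so(1) H(3) c(1)] seg[OF so(2) c(1) H(4)]]])
   (rule phi_comp[OF ab(1) c(2) ab(2) ne ab(3)])
qed

text \<open>Kernels with exponents of positive level do not contribute to exponents of level zero.\<close>

lemma kstar_level_0:
 fixes K1 K2 K3 :: "'a=>'a=>'r::comm_ring_1"
 assumes K1: "posk Fd lam K1" and K3: "posk Fd lam K3" and n: "n\<in>Nu" "n\<bullet>lam = 0"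
  and K2: "\<And>m q. m\<in>Mc ==> q\<notin>ideal_power P L ==> K2 m q\<noteq>0 ==> \<exists>j::nat. q = of_nat j *\<^sub>R p1 Fd n"
  and q: "of_nat i *\<^sub>R p1 Fd n\<notin>ideal_power P L" "of_nat i *\<^sub>R p1 Fd n\<in>P" and m: "m\<in>Mc"
 shows "(K1\<star>(K2\<star>K3)) m (of_nat i *\<^sub>R p1 Fd n) = K2 m (of_nat i *\<^sub>R p1 Fd n)"
proof -
 let ?q = "of_nat i *\<^sub>R p1 Fd n"
 \<comment> \<open>If an exponent of a positive-level kernel is a multiple of p1(n) minus p1(n'),
   injectivity of \<open>p1\<close> makes its level the negative of that of n', a
   contradiction.\<close>
 have lev0: "q' = 0" if pos: "posk Fd lam K" "m'\<in>Mc" "K m' q'\<noteq>0" and q': "q' = of_int z *\<^sub>R p1 Fd n - p1 Fd n'"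
  and n': "n'\<in>Nu" "0\<le>n'\<bullet>lam" for K :: "'a=>'a=>'r" and m' q' z n'
 proof (rule ccontr)
  assume "q'\<noteq>0"
  then obtain n1 where n1: "n1\<in>Nu" "q' = p1 Fd n1" "0 < n1\<bullet>lam" using poskD(2)[OF pos] by blast
  have "p1 Fd n1 = p1 Fd (of_int z *\<^sub>R n - n')"
   using q' unfolding n1(2) by (simp add: linear_diff[OF linear_p1] linear_scale[OF linear_p1])
  hence "n1 = of_int z *\<^sub>R n - n'" by (rule p1_inj[OF n1(1) Nu.diff[OF Nu.scale_int[OF n(1)] n'(1)]])
  hence "n1\<bullet>lam = - (n'\<bullet>lam)" using n(2) by (simp add: inner_diff_left)
  thus False using n1(3) n'(2) by simp
 qed
 have dc: "p\<notin>ideal_power P L" "m + p\<in>Mc" if "p\<in>dec ?q" for p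
  using down_closedD[OF down_closed_ideal_power[of L] _ that] q(1) m Mc_add_P that by (auto simp: dec_def)
 have "(K2\<star>K3) m ?q = (\<Sum>p\<in>dec ?q. if p = ?q then K2 m ?q else 0)" unfolding kstar_def
 proof (rule sum.cong[OF refl])
  fix p assume p: "p\<in>dec ?q"
  show "K2 m p * K3 (m + p) (?q - p) = (if p = ?q then K2 m ?q else 0)"
  proof (cases "K2 m p\<noteq>0 \<and> K3 (m + p) (?q - p)\<noteq>0")
   case True
   then obtain j :: nat where j: "p = of_nat j *\<^sub>R p1 Fd n" using K2[OF m dc(1)[OF p]] by blast
   have z: "?q - p = of_int (int i - int j) *\<^sub>R p1 Fd n - p1 Fd 0" by (simp add: j scaleR_diff_left)
   have "?q - p = 0" by (rule lev0[OF K3 dc(2)[OF p] _ z]) (use True Nu.zero in auto)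
   thus ?thesis using poskD(1)[OF K3 dc(2)[OF p]] by simp
  next
   case False
   thus ?thesis using poskD(1)[OF K3 dc(2)[OF p]] by auto
  qed
 qed
 hence 23: "(K2\<star>K3) m ?q = K2 m ?q" using dec_ends[OF q(2)] by (simp add: sum.delta)
 have "(K1\<star>(K2\<star>K3)) m ?q = (\<Sum>p\<in>dec ?q. if p = 0 then (K2\<star>K3) m ?q else 0)" unfolding kstar_def[of K1]
 proof (rule sum.cong[OF refl])
  fix p assume p: "p\<in>dec ?q"
  show "K1 m p * (K2\<star>K3) (m + p) (?q - p) = (if p = 0 then (K2\<star>K3) m ?q else 0)"
  proof (cases "p\<noteq>0 \<and> K1 m p\<noteq>0 \<and> (K2\<star>K3) (m + p) (?q - p)\<noteq>0")
   case True
   then obtain p' where p': "p'\<in>dec (?q - p)" "K2 (m + p) p' * K3 (m + p + p') (?q - p - p')\<noteq>0"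
    unfolding kstar_def by (meson sum.neutral)
   have "?q - p\<notin>ideal_power P L" using down_closedD[OF down_closed_ideal_power[of L] _ p] q(1) by simp
   hence "p'\<notin>ideal_power P L" using down_closedD[OF down_closed_ideal_power[of L] _ p'(1)] by simp
   then obtain j :: nat where j: "p' = of_nat j *\<^sub>R p1 Fd n" using K2[OF dc(2)[OF p]] p'(2) by fastforce
   have mp: "m + p + p'\<in>Mc" using Mc_add_P[OF dc(2)[OF p]] p'(1) by (simp add: dec_def)
   have "K3 (m + p + p') (?q - p - p')\<noteq>0" using p'(2) by auto
   hence "?q - p - p' = 0 \<or> (\<exists>n'\<in>Nu. ?q - p - p' = p1 Fd n' \<and> 0 < n'\<bullet>lam)" by (rule poskD(2)[OF K3 mp])
   then obtain n' where n': "n'\<in>Nu" "0\<le>n'\<bullet>lam" "?q - p - p' = p1 Fd n'"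
    by (elim disjE bexE conjE) (use Nu.zero p1_0 in \<open>force intro: less_imp_le\<close>)+
   have z: "p = of_int (int i - int j) *\<^sub>R p1 Fd n - p1 Fd n'" by (simp add: n'(3)[symmetric] j scaleR_diff_left)
   have "p = 0" by (rule lev0[OF K1 m _ z]) (use True n' in auto)
   thus ?thesis using True by blast
  next
   case False
   thus ?thesis using poskD(1)[OF K1 m] by auto
  qed
 qed
 thus ?thesis using dec_ends[OF q(2)] 23 by (simp add: sum.delta)
qed

end

section \<open>The local function along the hyperplane of a seed vector\<close>

context cscat
begin

lemma near_side: assumes A: "finite A" "\<And>z. z\<in>A ==> regular Fd z" and h: "h\<noteq>0" "0\<le>h\<bullet>y" and S: "open S" "y\<in>S"
 obtains a where "a\<in>S" "regular Fd a" "0 < h\<bullet>a" "\<And>z. z\<in>A ==> seg_ok Fd z a"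
proof -
 obtain \<epsilon> where eps: "\<epsilon> > 0" "cball y \<epsilon>\<subseteq>S" using S open_contains_cball by blast
 define t where "t = \<epsilon> / norm h"
 have t: "t > 0" using eps h by (simp add: t_def)
 have "dist y (y + t *\<^sub>R h)\<le>\<epsilon>" using eps h by (simp add: dist_norm t_def)
 hence "y + t *\<^sub>R h\<in>S \<inter> {z. 0 < h\<bullet>z}"
  using eps(2) t h by (auto simp: inner_right_distrib intro!: add_nonneg_pos mult_pos_pos)
 moreover have "open (S \<inter> {z. 0 < h\<bullet>z})" using S(1) open_halfspace_gt by blast
 ultimately obtain a where "a\<in>S \<inter> {z. 0 < h\<bullet>z}" "regular Fd a" "\<And>z. z\<in>A ==> seg_ok Fd z a"
  by (metis regular_escape[OF A] empty_iff)
 thus ?thesis using that by blast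
qed

lemma phi_cross_G: assumes x: "generic Fd x" "n\<bullet>x = 0" and n: "n\<in>Nplus Fd e" "primitive_in N n"
 shows "\<exists>r. crosses L x n (G x n) r"
proof -
 obtain r where r: "crosses L x n (gs L n x) r"
  using phi_cross[OF x Nplus_Nu[OF n(1)] Nplus_nonzero[OF n(1)] generic_same_wn[OF x(1) n x(2)]] by blast
 show ?thesis using r wk_gs_G[OF n(1), of _ L] by (intro exI[of _ r]) (simp add: crosses_def)
qed

lemma pc_floor_nonzero: assumes "n\<in>N" "n\<noteq>0" "m\<in>Mc" "n\<bullet>m\<noteq>0" shows "\<lfloor>pc n\<bullet>m\<rfloor>\<noteq>0"
proof -
 obtain t where t: "t > 0" "pc n = t *\<^sub>R n" using pc(2)[OF assms(1,2)] by blast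
 have "pc n\<bullet>m\<noteq>0" using t assms(4) by simp
 moreover have "pc n\<bullet>m = of_int \<lfloor>pc n\<bullet>m\<rfloor>" using pc_int[OF assms(1-3)] by simp
 ultimately show ?thesis by linarith
qed

lemma ed_M: "i\<in>fd_I Fd ==> ed i\<in>M"
proof -
 assume i: "i\<in>fd_I Fd"
 have "n\<bullet>ed i\<in>\<int>" if n: "n\<in>N" for n
 proof -
  have eq: "N = {(\<Sum>j\<in>fd_I Fd. of_int (c j) *\<^sub>R e j) |c :: 'i=>int. True}"
   using basN by (simp only: lattice_basis_def)
  obtain c :: "'i=>int" where c: "n = (\<Sum>j\<in>fd_I Fd. of_int (c j) *\<^sub>R e j)"
   using n unfolding eq by (elim CollectE exE conjE) (rule that)
  have "n\<bullet>ed i = (\<Sum>j\<in>fd_I Fd. of_int (c j) * (e j\<bullet>ed i))" unfolding c by (simp add: inner_sum_left)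
  also have "\<dots>\<in>\<int>" using ed i by (intro Ints_sum Ints_mult) auto
  finally show ?thesis .
 qed
 thus "ed i\<in>M" by (simp add: fd_M_def dual_lattice_def)
qed

lemma ed_Mc: "i\<in>fd_I Fd ==> ed i\<in>Mc" using ed_M MMc by blast

text \<open>The crossing at y1 is the crossing at y2, preceded and followed by paths inside the open
  half-spaces. These contribute positive levels only, whereas multiples of e_k have level zero. The
  test exponent \<open>ed k\<close> pairs nontrivially with e_k, so equal powers give equal
  coefficients once the lower ones agree.\<close>

lemma G_const: assumes k: "k\<in>fd_Iuf Fd" and y1: "generic Fd y1" "e k\<bullet>y1 = 0" and y2: "generic Fd y2" "e k\<bullet>y2 = 0"
 shows "G y1 (e k) $ j = G y2 (e k) $ j"
proof (induction j rule: less_induct)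
 case (less j)
 show ?case
 proof (cases "j = 0")
  case False
  have kI: "k\<in>fd_I Fd" using k IufI by blast
  note ek = e_Nplus[OF k] primitive_e[OF kI]
  let ?v = "p1 Fd (e k)"
  let ?q = "of_nat j *\<^sub>R ?v"
  define L where "L = Lof ?q"
  have q: "?q\<notin>ideal_power P L" unfolding L_def by (rule Lof)
  obtain r1 where r1: "crosses L y1 (e k) (G y1 (e k)) r1" using phi_cross_G[OF y1 ek] by blast
  obtain r2 where r2: "crosses L y2 (e k) (G y2 (e k)) r2" using phi_cross_G[OF y2 ek] by blast
  have nz: "e k\<noteq>0" "- e k\<noteq>0" "0 < r1" "0 < r2" using e_nonzero[OF kI] r1 r2 by (auto simp: crosses_def)
  obtain a1 where a1: "a1\<in>ball y1 r1" "regular Fd a1" "0 < e k\<bullet>a1"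
   by (rule near_side[of "{}" "e k" y1 "ball y1 r1"]) (use nz y1 in auto)
  obtain b1 where b1: "b1\<in>ball y1 r1" "regular Fd b1" "0 < - e k\<bullet>b1" "\<And>z. z\<in>{a1} ==> seg_ok Fd z b1"
   by (rule near_side[of "{a1}" "- e k" y1 "ball y1 r1"]) (use nz y1 a1 in auto)
  obtain a2 where a2: "a2\<in>ball y2 r2" "regular Fd a2" "0 < e k\<bullet>a2" "\<And>z. z\<in>{a1, b1} ==> seg_ok Fd z a2"
   by (rule near_side[of "{a1, b1}" "e k" y2 "ball y2 r2"]) (use nz y2 a1 b1 in auto)
  obtain b2 where b2: "b2\<in>ball y2 r2" "regular Fd b2" "0 < - e k\<bullet>b2" "\<And>z. z\<in>{a1, b1, a2} ==> seg_ok Fd z b2"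
   by (rule near_side[of "{a1, b1, a2}" "- e k" y2 "ball y2 r2"]) (use nz y2 a1 b1 a2 in auto)
  have ne: "a1\<noteq>b1" "a1\<noteq>a2" "b1\<noteq>a2" "b1\<noteq>b2" "a2\<noteq>b2" using b1(4) a2(4) b2(4) by (auto simp: seg_ok_def)
  have m: "ed k\<in>Mc" by (rule ed_Mc[OF kI])
  have c1: "cnorm (e k) (b1 - a1) = pc (e k)" "cnorm (e k) (b2 - a2) = pc (e k)"
   using a1(3) b1(3) a2(3) b2(3) by (auto simp: cnorm_def inner_diff_right)
  have 1: "phi a1 b1 (ed k) ?q = fpow (G y1 (e k)) \<lfloor>pc (e k)\<bullet>ed k\<rfloor> $ j"
   using crossesD[OF r1 a1(1) b1(1) a1(2) b1(2) _ q m] a1(3) b1(3) c1 p1_Nplus(2)[OF ek(1)] by (simp add: wk_def mult_pos_neg)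
  have 2: "phi a2 b2 (ed k) ?q = fpow (G y2 (e k)) \<lfloor>pc (e k)\<bullet>ed k\<rfloor> $ j"
   using crossesD[OF r2 a2(1) b2(1) a2(2) b2(2) _ q m] a2(3) b2(3) c1 p1_Nplus(2)[OF ek(1)] by (simp add: wk_def mult_pos_neg)
  have pos: "posk Fd (lamk k) (phi a b)" if "regular Fd a" "regular Fd b" "a\<noteq>b" "0 < h\<bullet>a" "0 < h\<bullet>b" "h = e k \<or> h = - e k" for a b h
   by (rule posk_phi[of "{z. 0 < h\<bullet>z}", OF level_pos[OF k]]) (use that open_halfspace_gt convex_halfspace_gt in auto)
  have "phi a2 b1 m' q' = (phi a2 b2\<star>phi b2 b1) m' q'" if "m'\<in>Mc" for m' q'
   by (rule phi_comp) (use a2 b2 b1 ne that in auto)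
  hence "(phi a1 a2\<star>phi a2 b1) (ed k) ?q = (phi a1 a2\<star>(phi a2 b2\<star>phi b2 b1)) (ed k) ?q"
   by (intro kstar_cong_on[of UNIV _ Mc]) (use m Mc_add_P in \<open>auto simp: down_closed_def\<close>)
  moreover have "phi a1 b1 (ed k) ?q = (phi a1 a2\<star>phi a2 b1) (ed k) ?q"
   by (rule phi_comp) (use a1 a2 b1 ne m in auto)
  ultimately have "phi a1 b1 (ed k) ?q = (phi a1 a2\<star>(phi a2 b2\<star>phi b2 b1)) (ed k) ?q" by simp
  also have "\<dots> = phi a2 b2 (ed k) ?q"
  proof (rule kstar_level_0[OF pos[of a1 a2 "e k"] pos[of b2 b1 "- e k"] e_mem(2)[OF k] _ _ q _ m])
   show "e k\<bullet>lamk k = 0" using e_lamk[OF kI, of k] by simp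
   show "?q\<in>P" by (rule nat_scale_mem[OF p1_Nplus(1)[OF ek(1)]])
   fix m' q' assume "m'\<in>Mc" "q'\<notin>ideal_power P L" "phi a2 b2 m' q'\<noteq>0"
   hence "wk (cnorm (e k) (b2 - a2)) ?v (G y2 (e k)) m' q'\<noteq>0"
    using crossesD[OF r2 a2(1) b2(1) a2(2) b2(2)] a2(3) b2(3) by (simp add: mult_pos_neg)
   thus "\<exists>j::nat. q' = of_nat j *\<^sub>R ?v" unfolding wk_def by (rule ray_nonzeroD)
  qed (use a1 a2 b1 b2 ne in auto)
  finally have eq: "fpow (G y1 (e k)) \<lfloor>pc (e k)\<bullet>ed k\<rfloor> $ j - fpow (G y2 (e k)) \<lfloor>pc (e k)\<bullet>ed k\<rfloor> $ j = 0"
   unfolding 1 2 by simp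
  have "of_int \<lfloor>pc (e k)\<bullet>ed k\<rfloor> * (G y1 (e k) $ j - G y2 (e k) $ j) = 0"
   using fpow_nth_diff[OF G_0 G_0 less.IH] False eq by simp
  moreover have "\<lfloor>pc (e k)\<bullet>ed k\<rfloor>\<noteq>0" by (rule pc_floor_nonzero) (use e_mem(1)[OF kI] nz m ed[OF kI kI] in auto)
  ultimately have "G y1 (e k) $ j - G y2 (e k) $ j = 0" by (rule coeff_poly_torsion_free)
  thus ?thesis by simp
 qed (simp add: G_0)
qed

end

lemma palindromic_power_degree: assumes "palindromic d g" "d * n < i" shows "(g ^ n) $ i = 0"
proof -
 have "\<not> i\<le>n * d" using assms(2) by (simp add: mult.commute)
 moreover have "(g ^ n) $ i = (if i\<le>n * d then (g ^ n) $ (n * d - i) else 0)"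
  using palindromic_power[OF assms(1), of n] unfolding palindromic_def by (rule spec)
 ultimately show ?thesis by (simp only: if_False)
qed

definition eser :: "('i, 'a, 'x) fixed_data=>'i=>('x, 'k::field_char_0) coeff_poly fps" where
 "eser Fd k = Abs_fps (ecoeff Fd k)"

lemma eser_palindromic: assumes "\<forall>j\<in>{0<..<fd_r Fd k}. fd_a Fd k j = fd_a Fd k (fd_r Fd k - j)"
 shows "palindromic (fd_r Fd k) (eser Fd k)" unfolding palindromic_def
proof
 fix j
 show "eser Fd k $ j = (if j\<le>fd_r Fd k then eser Fd k $ (fd_r Fd k - j) else 0)"
 proof (cases "j\<in>{0<..<fd_r Fd k}")
  case True
  hence "fd_a Fd k j = fd_a Fd k (fd_r Fd k - j)" using assms by (rule bspec[rotated])
  hence "fd_a Fd k (fd_r Fd k - j) = fd_a Fd k j" by (rule sym)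
  moreover have "fd_r Fd k - j\<noteq>fd_r Fd k" using True by auto
  ultimately show ?thesis using True by (simp add: eser_def ecoeff_def exchange_coeff_def)
 qed (auto simp: eser_def ecoeff_def exchange_coeff_def)
qed

context clus
begin

text \<open>Constancy moves y to a generic point near the multiple j of p1(e_k), where the
  coefficient j comes from the initial wall. Further walls inside this hyperplane thus multiply to 1
  at its generic points.\<close>

lemma G_init: assumes k: "k\<in>fd_Iuf Fd" and y: "generic Fd y" "e k\<bullet>y = 0" shows "G y (e k) = eser Fd k"
proof (rule fps_ext)
 fix j
 have kI: "k\<in>fd_I Fd" using k IufI by blast
 note ek = e_Nplus[OF k] primitive_e[OF kI]
 show "G y (e k) $ j = eser Fd k $ j"
 proof (cases "j = 0")
  case True
  thus ?thesis by (simp add: G_0 eser_def ecoeff_def exchange_coeff_def)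
 next
  case False
  let ?q = "of_nat j *\<^sub>R p1 Fd (e k)"
  obtain r where r: "r > 0" "\<And>z. z\<in>ball ?q r ==> generic Fd z \<and> e k\<bullet>z = 0 ==> G z (e k) $ j = init (e k) j"
   using near_init[OF ek _ Lof, of j] False by blast
  obtain z where z: "z\<in>ball ?q r" "e k\<bullet>z = 0" "generic Fd z"
   by (rule generic_on_hyperplane[of "e k" ?q "ball ?q r"]) (use e_nonzero[OF kI] p1_self r(1) in auto)
  have "G y (e k) $ j = G z (e k) $ j" by (rule G_const[OF k y z(3,2)])
  thus ?thesis using r(2) z init_e[OF k] by (simp add: eser_def)
 qed
qed

lemma phi_cross_init: assumes k: "k\<in>fd_Iuf Fd" and y: "generic Fd y" "e k\<bullet>y = 0"
 shows "\<exists>r. crosses L y (e k) (eser Fd k) r"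
 using phi_cross_G[OF y e_Nplus[OF k] primitive_e[OF subsetD[OF IufI k]]] unfolding G_init[OF k y] by blast

text \<open>The points a0, b0 lie on one side and a1, b1 on the other. The sign condition on q makes
  the exponent of the crossing at y2 nonnegative, so that the crossing multiplies by a
  polynomial.\<close>

definition hcross :: "'i=>'a=>'a=>'a=>real=>bool" where
 "hcross k y1 y2 q r \<longleftrightarrow> 0 < r \<and> (\<forall>a0\<in>ball y1 r. \<forall>a1\<in>ball y1 r. \<forall>b0\<in>ball y2 r. \<forall>b1\<in>ball y2 r. \<forall>m.
   regular Fd a0 \<and> regular Fd a1 \<and> regular Fd b0 \<and> regular Fd b1 \<and> a0\<noteq>b0 \<and> a0\<noteq>b1 \<and> a1\<noteq>b1 \<and>
   (e k\<bullet>a0) * (e k\<bullet>a1) < 0 \<and> (e k\<bullet>b0) * (e k\<bullet>b1) < 0 \<and> 0 < (e k\<bullet>a0) * (e k\<bullet>b0) \<and>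
   0\<le>(e k\<bullet>b0) * (e k\<bullet>q) \<and> m\<in>Mc \<and> e k\<bullet>m = 0 -->
   phi a1 b1 m q = (\<Sum>p\<in>dec q. phi a0 b0 m p * ray (p1 Fd (e k)) (eser Fd k ^ nat \<lfloor>\<bar>pc (e k)\<bullet>q\<bar>\<rfloor>) (q - p)))"

text \<open>On monomials orthogonal to \<open>e\<^sub>k\<close>, the crossing of \<open>e\<^sub>k\<^sup>\<bottom>\<close> at one end of a path is trivial.\<close>

lemma cross_hyperplane:
 assumes k: "k\<in>fd_Iuf Fd" and y1: "generic Fd y1" "e k\<bullet>y1 = 0" and y2: "generic Fd y2" "e k\<bullet>y2 = 0"
 shows "\<exists>r. hcross k y1 y2 q r"
proof -
 let ?v = "p1 Fd (e k)"
 have kI: "k\<in>fd_I Fd" using k IufI by blast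
 define L where "L = Lof q"
 have q: "q\<notin>ideal_power P L" unfolding L_def by (rule Lof)
 obtain r1 where r1: "crosses L y1 (e k) (eser Fd k) r1" using phi_cross_init[OF k y1] by blast
 obtain r2 where r2: "crosses L y2 (e k) (eser Fd k) r2" using phi_cross_init[OF k y2] by blast
 obtain t where t: "t > 0" "pc (e k) = t *\<^sub>R e k" using pc(2)[OF e_mem(1)[OF kI] e_nonzero[OF kI]] by blast
 show ?thesis unfolding hcross_def
 proof (intro exI[of _ "min r1 r2"] conjI ballI allI impI, use r1 r2 in \<open>simp add: crosses_def\<close>, elim conjE)
  fix a0 a1 b0 b1 m
  assume reg: "regular Fd a0" "regular Fd a1" "regular Fd b0" "regular Fd b1"
   and nr: "a0\<in>ball y1 (min r1 r2)" "a1\<in>ball y1 (min r1 r2)" "b0\<in>ball y2 (min r1 r2)" "b1\<in>ball y2 (min r1 r2)"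
   and ne: "a0\<noteq>b0" "a0\<noteq>b1" "a1\<noteq>b1"
   and sides: "(e k\<bullet>a0) * (e k\<bullet>a1) < 0" "(e k\<bullet>b0) * (e k\<bullet>b1) < 0" "0 < (e k\<bullet>a0) * (e k\<bullet>b0)"
   and E: "0\<le>(e k\<bullet>b0) * (e k\<bullet>q)" and m: "m\<in>Mc" "e k\<bullet>m = 0"
  have near: "a0\<in>ball y1 r1" "a1\<in>ball y1 r1" "b0\<in>ball y2 r2" "b1\<in>ball y2 r2" using nr by auto
  have ne': "a0\<noteq>a1" "b0\<noteq>b1" using sides by (auto simp: mult_less_0_iff)
  have c: "cnorm (e k) u\<bullet>m = 0" for u using t m by (simp add: cnorm_def)
  have kone: "phi a0 a1 m p = kone m p" if "p\<notin>ideal_power P L" for p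
   using crossesD[OF r1 near(1,2) reg(1,2) sides(1) that m(1)] c p1_Nplus(2)[OF e_Nplus[OF k]]
   by (simp add: wk_def kone_def ray_one)
  have "(\<Sum>p\<in>dec q. phi a0 a1 m p * phi a1 b1 (m + p) (q - p)) = (\<Sum>p\<in>dec q. if p = 0 then phi a1 b1 m q else 0)"
  proof (rule sum.cong[OF refl])
   fix p assume "p\<in>dec q"
   hence "p\<notin>ideal_power P L" using down_closedD[OF down_closed_ideal_power[of L]] q by blast
   from kone[OF this] show "phi a0 a1 m p * phi a1 b1 (m + p) (q - p) = (if p = 0 then phi a1 b1 m q else 0)"
    by (simp add: kone_def)
  qed
  also have "\<dots> = phi a1 b1 m q"
  proof (cases "q\<in>P")
   case True
   thus ?thesis using dec_ends[OF True] by (simp add: sum.delta)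
  next
   case False
   hence "phi a1 b1 m q = 0" using ksupp_phi[of a1 b1] unfolding ksupp_def by blast
   thus ?thesis by simp
  qed
  finally have 1: "(phi a0 a1\<star>phi a1 b1) m q = phi a1 b1 m q" by (simp add: kstar_def)
  \<comment> \<open>The exponents p and q differ by a multiple of p1(e_k), which is orthogonal to
    e_k; so p pairs with e_k as q does, and m contributes nothing.\<close>
  have exp: "\<lfloor>cnorm (e k) (b1 - b0)\<bullet>(m + p)\<rfloor> = int (nat \<lfloor>\<bar>pc (e k)\<bullet>q\<bar>\<rfloor>)" if p: "q - p = of_nat i *\<^sub>R ?v" for p and i :: nat
  proof -
   have "e k\<bullet>(q - p) = 0" unfolding p using p1_self by simp
   hence ep: "e k\<bullet>p = e k\<bullet>q" by (simp add: inner_diff_right)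
   consider "0 < e k\<bullet>b0" "e k\<bullet>b1 < 0" "0\<le>e k\<bullet>q" | "e k\<bullet>b0 < 0" "0 < e k\<bullet>b1" "e k\<bullet>q\<le>0"
    using sides(2) E by (auto simp: mult_less_0_iff zero_le_mult_iff)
   hence "cnorm (e k) (b1 - b0)\<bullet>(m + p) = \<bar>pc (e k)\<bullet>q\<bar>"
    using t m ep by cases (auto simp: cnorm_def inner_diff_right inner_right_distrib abs_mult)
   thus ?thesis by simp
  qed
  have 2: "phi b0 b1 (m + p) (q - p) = ray ?v (eser Fd k ^ nat \<lfloor>\<bar>pc (e k)\<bullet>q\<bar>\<rfloor>) (q - p)" if p: "p\<in>dec q" for p
  proof -
   have "q - p\<notin>ideal_power P L" using down_closedD[OF down_closed_ideal_power[of L] _ p] q by blast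
   moreover have "m + p\<in>Mc" using p m Mc_add_P by (simp add: dec_def)
   ultimately have w: "phi b0 b1 (m + p) (q - p) = wk (cnorm (e k) (b1 - b0)) ?v (eser Fd k) (m + p) (q - p)"
    by (rule crossesD[OF r2 near(3,4) reg(3,4) sides(2)])
   show ?thesis
   proof (cases "\<exists>i::nat. q - p = of_nat i *\<^sub>R ?v")
    case True
    then obtain i :: nat where "q - p = of_nat i *\<^sub>R ?v" by blast
    from exp[OF this] show ?thesis unfolding w wk_def by (simp only: fpow_of_nat)
   next
    case False
    thus ?thesis unfolding w wk_def using ray_off by metis
   qed
  qed
  have "phi a1 b1 m q = (phi a0 a1\<star>phi a1 b1) m q" using 1 by simp
  also have "\<dots> = phi a0 b1 m q" by (rule phi_comp[symmetric]) (use reg ne ne' m in auto)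
  also have "\<dots> = (phi a0 b0\<star>phi b0 b1) m q" by (rule phi_comp) (use reg ne ne' m in auto)
  also have "\<dots> = (\<Sum>p\<in>dec q. phi a0 b0 m p * ray ?v (eser Fd k ^ nat \<lfloor>\<bar>pc (e k)\<bullet>q\<bar>\<rfloor>) (q - p))"
   unfolding kstar_def using 2 by (intro sum.cong) auto
  finally show "phi a1 b1 m q = (\<Sum>p\<in>dec q. phi a0 b0 m p * ray ?v (eser Fd k ^ nat \<lfloor>\<bar>pc (e k)\<bullet>q\<bar>\<rfloor>) (q - p))" .
 qed
qed

text \<open>Turns the convolution with a polynomial in z^v into a sum whose index set does not
  depend on \<open>P\<close>, as needed to compare the two monoids; terms that leave
  \<open>P\<close> vanish because K is supported there.\<close>

lemma ray_conv_sum: assumes v: "v\<in>P" "v\<noteq>0" and K: "\<And>p. K p\<noteq>0 ==> p\<in>P" and g: "\<And>i. d < i ==> g $ i = 0"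
 shows "(\<Sum>p\<in>dec q. K p * ray v g (q - p)) = (\<Sum>i\<le>d. g $ i * K (q - of_nat i *\<^sub>R v))"
proof -
 let ?h = "\<lambda>i::nat. q - of_nat i *\<^sub>R v"
 have inj: "inj_on ?h {..d}" using v(2) by (auto simp: inj_on_def)
 have "(\<Sum>i\<le>d. g $ i * K (?h i)) = (\<Sum>p\<in>?h ` {..d}. K p * ray v g (q - p))"
  using v(2) by (subst sum.reindex[OF inj]) (auto intro!: sum.cong)
 also have "\<dots> = (\<Sum>p\<in>dec q. K p * ray v g (q - p))"
 proof (rule sum.mono_neutral_cong)
  fix p assume "p\<in>?h ` {..d} - dec q"
  then obtain i where i: "p = ?h i" "?h i\<notin>dec q" by blast
  have "of_nat i *\<^sub>R v\<in>P" by (rule nat_scale_mem[OF v(1)])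
  hence "?h i\<notin>P" using i(2) by (auto simp: dec_def)
  hence "K p = 0" using K i(1) by metis
  thus "K p * ray v g (q - p) = 0" by simp
 next
  fix p assume p: "p\<in>dec q - ?h ` {..d}"
  show "K p * ray v g (q - p) = 0"
  proof (cases "\<exists>i::nat. q - p = of_nat i *\<^sub>R v")
   case True
   then obtain i :: nat where i: "q - p = of_nat i *\<^sub>R v" by blast
   have "p = q - (q - p)" by simp
   hence "p = ?h i" unfolding i .
   hence "d < i" using p by (metis DiffD2 atMost_iff imageI not_le)
   thus ?thesis using i v(2) g by simp
  next
   case False
   hence "ray v g (q - p) = 0" by (intro ray_off) blast
   thus ?thesis by simp
  qed
 next
  show "finite (?h ` {..d})" by simp
  show "finite (dec q)" by simp
  show "K p * ray v g (q - p) = K p * ray v g (q - p)" for p by (rule refl)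
 qed
 finally show ?thesis by (rule sym)
qed

end

section \<open>Linear changes of coordinates\<close>

text \<open>Here \<kappa> acts on N and \<rho> on M. Being dual and integral, they carry bad
  subspaces into bad subspaces, so genericity passes to preimages under \<rho>.\<close>

locale lattice_change =
 fixes Fd :: "('i, 'a::euclidean_space, 'x) fixed_data" and \<kappa> \<rho> :: "'a=>'a"
 assumes lin: "linear \<kappa>" "linear \<rho>" and inj: "inj \<kappa>" "inj \<rho>" and pairing: "\<kappa> n\<bullet>\<rho> y = n\<bullet>y"
  and memN: "n\<in>fd_N Fd ==> \<kappa> n\<in>fd_N Fd" and memM: "m\<in>fd_M Fd ==> \<rho> m\<in>fd_M Fd"
begin

lemma bad_image: assumes "W\<in>bad_spaces Fd" shows "\<exists>W1\<in>bad_spaces Fd. \<rho> ` W\<subseteq>W1"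
proof -
 consider U where "W = span U" "finite U" "U\<subseteq>fd_M Fd" "card U + 2\<le>DIM('a)"
  | n n' where "W = {x. n\<bullet>x = 0 \<and> n'\<bullet>x = 0}" "n\<in>fd_N Fd" "n'\<in>fd_N Fd" "n\<noteq>0" "n'\<notin>span {n}"
  using assms unfolding bad_spaces_def by blast
 thus ?thesis
 proof cases
  case (1 U)
  have "card (\<rho> ` U) + 2\<le>DIM('a)" using card_image_le[OF 1(2), of \<rho>] 1(4) by linarith
  hence "span (\<rho> ` U)\<in>bad_spaces Fd"
   unfolding bad_spaces_def using 1 memM by (intro UnI1 CollectI exI[of _ "\<rho> ` U"]) auto
  moreover have "\<rho> ` W\<subseteq>span (\<rho> ` U)" using 1(1) linear_span_image[OF lin(2)] by auto
  ultimately show ?thesis by blast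
 next
  case (2 n n')
  have "\<kappa> n\<noteq>0" using 2(4) lin inj by (metis injD linear_0)
  moreover have "\<kappa> n'\<notin>span {\<kappa> n}"
  proof
   assume "\<kappa> n'\<in>span {\<kappa> n}"
   hence "\<kappa> n'\<in>\<kappa> ` span {n}" using linear_span_image[OF lin(1), of "{n}"] by simp
   thus False using 2(5) inj(1) by (auto dest: injD)
  qed
  ultimately have "{x. \<kappa> n\<bullet>x = 0 \<and> \<kappa> n'\<bullet>x = 0}\<in>bad_spaces Fd"
   unfolding bad_spaces_def using 2 memN by (intro UnI2 CollectI exI[of _ "\<kappa> n"] exI[of _ "\<kappa> n'"]) auto
  moreover have "\<rho> ` W\<subseteq>{x. \<kappa> n\<bullet>x = 0 \<and> \<kappa> n'\<bullet>x = 0}" using 2(1) pairing by auto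
  ultimately show ?thesis by blast
 qed
qed

lemma generic_pull: assumes "generic Fd (\<rho> y)" shows "generic Fd y" unfolding generic_def
proof
 assume "y\<in>\<Union>(bad_spaces Fd)"
 then obtain W where W: "W\<in>bad_spaces Fd" "y\<in>W" by blast
 then obtain W1 where "W1\<in>bad_spaces Fd" "\<rho> ` W\<subseteq>W1" using bad_image by blast
 thus False using W(2) assms unfolding generic_def by blast
qed

lemma regular_pull: assumes "regular Fd (\<rho> y)" shows "regular Fd y" unfolding regular_def
proof (intro conjI ballI impI)
 show "generic Fd y" using assms generic_pull unfolding regular_def by blast
 fix n assume n: "n\<in>fd_N Fd" "n\<noteq>0"
 have "\<kappa> n\<noteq>0" using n(2) lin inj by (metis injD linear_0)
 hence "\<kappa> n\<bullet>\<rho> y\<noteq>0" using assms memN[OF n(1)] unfolding regular_def by blast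
 thus "n\<bullet>y\<noteq>0" by (simp add: pairing)
qed

lemma seg_ok_pull: assumes "seg_ok Fd (\<rho> a) (\<rho> b)" shows "seg_ok Fd a b" unfolding seg_ok_def
proof (intro conjI ballI)
 show "regular Fd a" "regular Fd b" "a\<noteq>b" using assms regular_pull unfolding seg_ok_def by auto
 fix W assume "W\<in>bad_spaces Fd"
 then obtain W1 where W1: "W1\<in>bad_spaces Fd" "\<rho> ` W\<subseteq>W1" using bad_image by blast
 show "b\<notin>span (insert a W)"
 proof
  assume "b\<in>span (insert a W)"
  hence "\<rho> b\<in>span (insert (\<rho> a) (\<rho> ` W))" using linear_span_image[OF lin(2), of "insert a W"] by (metis imageI image_insert)
  moreover have "span (insert (\<rho> a) (\<rho> ` W))\<subseteq>span (insert (\<rho> a) W1)" by (rule span_mono) (use W1 in blast)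
  ultimately show False using assms W1(1) unfolding seg_ok_def by blast
 qed
qed

end

section \<open>Kernels graded by a level function\<close>

context seed_data
begin

lemma finite_Nu_dec: "finite {n\<in>Nu. p1 Fd n\<in>dec q}"
proof (rule finite_imageD)
 show "finite (p1 Fd ` {n\<in>Nu. p1 Fd n\<in>dec q})" by (rule finite_subset[OF _ finite_dec[of q]]) auto
 show "inj_on (p1 Fd) {n\<in>Nu. p1 Fd n\<in>dec q}" using p1_inj by (auto simp: inj_on_def)
qed

text \<open>The sum runs over lattice vectors instead of exponents in \<open>P\<close>. As S may be
  any sufficiently large finite set, products over two different monoids can be brought to one index
  set.\<close>

lemma kstar_Nu: assumes K1: "\<And>p. K1 m p\<noteq>0 ==> p\<in>p1 Fd ` Nu" and K: "ksupp K1" "ksupp K2"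
  and S: "finite S" "S\<subseteq>Nu" "\<And>n. n\<in>Nu ==> p1 Fd n\<in>dec q ==> n\<in>S"
 shows "(K1\<star>K2) m q = (\<Sum>n\<in>S. K1 m (p1 Fd n) * K2 (m + p1 Fd n) (q - p1 Fd n))"
proof -
 have inj: "inj_on (p1 Fd) S" using p1_inj S(2) by (auto simp: inj_on_def)
 have "(\<Sum>n\<in>S. K1 m (p1 Fd n) * K2 (m + p1 Fd n) (q - p1 Fd n)) = (\<Sum>p\<in>p1 Fd ` S. K1 m p * K2 (m + p) (q - p))"
  by (simp add: sum.reindex[OF inj])
 also have "\<dots> = (\<Sum>p\<in>dec q. K1 m p * K2 (m + p) (q - p))"
 proof (rule sum.mono_neutral_cong)
  show "finite (p1 Fd ` S)" using S(1) by simp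
  show "finite (dec q)" by simp
  show "K1 m p * K2 (m + p) (q - p) = 0" if p: "p\<in>dec q - p1 Fd ` S" for p
  proof (cases "K1 m p = 0")
   case False
   then obtain n where "n\<in>Nu" "p = p1 Fd n" using K1 by blast
   thus ?thesis using p S(3) by blast
  qed simp
  show "K1 m p * K2 (m + p) (q - p) = 0" if p: "p\<in>p1 Fd ` S - dec q" for p
  proof (rule ccontr)
   assume "K1 m p * K2 (m + p) (q - p)\<noteq>0"
   hence "K1 m p\<noteq>0" "K2 (m + p) (q - p)\<noteq>0" by auto
   hence "p\<in>P" "q - p\<in>P" using K unfolding ksupp_def by blast+
   thus False using p by (simp add: dec_def)
  qed
  show "K1 m p * K2 (m + p) (q - p) = K1 m p * K2 (m + p) (q - p)" for p by (rule refl)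
 qed
 finally show ?thesis by (simp add: kstar_def)
qed

end

context scat
begin

text \<open>A wall through x has a normal parallel to n. Both have positive level, so they point the
  same way and, being primitive, coincide, although only the normal is in
  \<open>Nplus\<close>.\<close>

lemma no_wall_off_Nplus: assumes x: "generic Fd x" and lev: "\<And>n'. n'\<in>Nplus Fd e ==> n'\<bullet>x = 0 ==> 0 < n'\<bullet>lam"
  and n: "n\<in>Nu" "primitive_in N n" "0 < n\<bullet>lam" "n\<bullet>x = 0" "n\<notin>Nplus Fd e" and w: "w\<in>sd_index D" "x\<in>sd_supp D w"
 shows False
proof -
 have wx: "wn w\<bullet>x = 0" using supp_orth[OF w(1)] w(2) by (auto simp: orth_def)
 have nz: "n\<noteq>0" using n(3) by auto
 obtain r where r: "wn w = r *\<^sub>R n" using generic_parallel[OF x _ wn_N[OF w(1)] nz n(4) wx] n(1) NuN by blast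
 have "0 < wn w\<bullet>lam" by (rule lev[OF wn_Nplus[OF w(1)] wx])
 hence "0 < r" using r n(3) by (simp add: zero_less_mult_iff)
 hence "wn w = n" by (rule primitive_in_unique[OF basN n(2) wn_prim[OF w(1)] r])
 thus False using n(5) wn_Nplus[OF w(1)] by simp
qed

lemma G_one: assumes "\<And>w. w\<in>sd_index D ==> x\<in>sd_supp D w ==> False" shows "G x n = 1"
proof (rule fps_ext)
 fix j
 have "walls_at L x = {}" for L using assms walls_at_index by blast
 thus "G x n $ j = 1 $ j" by (simp add: G_def gs_def)
qed

text \<open>For n outside \<open>Nplus\<close> there are no walls and \<open>G x n\<close> is 1, so
  one formula covers all n of positive level. A normal vector transported from the other seed is not
  known to lie in \<open>Nplus\<close> beforehand.\<close>

lemma LocK_gen: assumes x: "generic Fd x" and lev: "\<And>n'. n'\<in>Nplus Fd e ==> n'\<bullet>x = 0 ==> 0 < n'\<bullet>lam"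
  and n: "n\<in>Nu" "primitive_in N n" "0 < n\<bullet>lam" "n\<bullet>x = 0" and u: "n\<bullet>u\<noteq>0" and q: "q\<notin>ideal_power P L"
 shows "LocK L x u m q = wk (cnorm n u) (p1 Fd n) (G x n) m q"
proof (cases "n\<in>Nplus Fd e")
 case True
 thus ?thesis by (rule LocK_G[OF x _ n(2,4) u q])
next
 case False
 have nw: "False" if "w\<in>sd_index D" "x\<in>sd_supp D w" for w by (rule no_wall_off_Nplus[OF x lev n False that])
 have "walls_at L x = {}" using nw walls_at_index by blast
 moreover have "p1 Fd n\<noteq>0" by (rule p1_nonzero[OF n(1)]) (use n(3) in auto)
 moreover have "G x n = 1" by (rule G_one) (rule nw)
 ultimately show ?thesis by (simp add: LocK_kone wk_one)
qed

lemma ksupp_wk_gen: assumes x: "generic Fd x" and lev: "\<And>n'. n'\<in>Nplus Fd e ==> n'\<bullet>x = 0 ==> 0 < n'\<bullet>lam"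
  and n: "n\<in>Nu" "primitive_in N n" "0 < n\<bullet>lam" "n\<bullet>x = 0" shows "ksupp (wk c (p1 Fd n) (G x n))"
proof (cases "n\<in>Nplus Fd e")
 case True
 thus ?thesis using p1_Nplus(1) by (intro ksupp_wk)
next
 case False
 have "G x n = 1" by (rule G_one) (rule no_wall_off_Nplus[OF x lev n False])
 moreover have "p1 Fd n\<noteq>0" by (rule p1_nonzero[OF n(1)]) (use n(3) in auto)
 ultimately show ?thesis by (simp add: wk_one)
qed

end

context cscat
begin

lemma phi_cross_gen: assumes x: "generic Fd x" and lev: "\<And>n'. n'\<in>Nplus Fd e ==> n'\<bullet>x = 0 ==> 0 < n'\<bullet>lam"
  and n: "n\<in>Nu" "primitive_in N n" "0 < n\<bullet>lam" "n\<bullet>x = 0" shows "\<exists>r. crosses L x n (G x n) r"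
proof (cases "n\<in>Nplus Fd e")
 case True
 thus ?thesis by (rule phi_cross_G[OF x n(4) _ n(2)])
next
 case False
 note nw = no_wall_off_Nplus[OF x lev n False]
 have "gs L n x = 1" using nw walls_at_index by (metis (no_types, lifting) gs_def prod.neutral)
 moreover have "G x n = 1" by (rule G_one) (rule nw)
 moreover have "n\<noteq>0" using n(3) by auto
 ultimately show ?thesis using phi_cross[OF x n(4,1), of L] nw by metis
qed

end

section \<open>Mutation\<close>

lemma primitive_in_image:
 assumes f: "linear f" "\<And>x. x\<in>L ==> f x\<in>L" and g: "linear g" "\<And>x. x\<in>L ==> g x\<in>L" "\<And>x. g (f x) = x"
  and n: "primitive_in L n" shows "primitive_in L (f n)" unfolding primitive_in_def
proof (intro conjI ballI allI impI)
 show "f n\<in>L" using n f(2) by (simp add: primitive_in_def)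
 show "f n\<noteq>0" using n g(1,3) linear_0 by (metis primitive_in_def)
 fix x and c :: nat assume x: "x\<in>L" "f n = of_nat c *\<^sub>R x"
 hence "n = of_nat c *\<^sub>R g x" using g(1,3) linear_scale by metis
 thus "c = 1" using n g(2)[OF x(1)] unfolding primitive_in_def by blast
qed

locale mut = A: clus Fd e P D + B: clus Fd "mutate_seed Fd k e" P' D'
 for Fd :: "('i, 'a::euclidean_space, 'x) fixed_data" and e and k and P P'
  and D :: "('w, 'a, ('x, 'k::field_char_0) coeff_poly) diagram" and D' :: "('v, 'a, ('x, 'k) coeff_poly) diagram" +
 assumes k: "k\<in>fd_Iuf Fd" and seed: "reciprocal_torus_seed Fd e"
begin

definition cc :: real where "cc = of_nat (fd_r Fd k) * of_nat (fd_d Fd k)"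

text \<open>The value 1 of \<sigma> gives \<open>T_{k,+}\<close>, 0 gives \<open>T_{k,-}\<close> and
  -1 the inverse of \<open>T_{k,+}\<close>; all belong to one one-parameter group of shears.\<close>

definition TT :: "real=>'a=>'a" where "TT \<sigma> m = m + (\<sigma> * cc * (e k\<bullet>m)) *\<^sub>R p1 Fd (e k)"

text \<open>The companion of \<open>TT\<close> on N: together they preserve the pairing, by
  skew-symmetry of the form, and \<open>p1\<close> intertwines them.\<close>

definition TN :: "real=>'a=>'a" where "TN \<sigma> n = n + (\<sigma> * cc * (e k\<bullet>p1 Fd n)) *\<^sub>R e k"

lemma kI: "k\<in>fd_I Fd" using k A.IufI by blast

lemma linear_TT: "linear (TT \<sigma>)"
 by (rule linearI) (simp_all add: TT_def inner_right_distrib distrib_left distrib_right scaleR_add_left scaleR_add_right mult.left_commute)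

lemma linear_TN: "linear (TN \<sigma>)" by (rule linearI)
  (simp_all add: TN_def linear_add[OF A.linear_p1] linear_scale[OF A.linear_p1] inner_right_distrib distrib_left scaleR_add_left scaleR_add_right mult.left_commute)

lemma ek_TT [simp]: "e k\<bullet>TT \<sigma> m = e k\<bullet>m" by (simp add: TT_def inner_right_distrib A.p1_self)

lemma TT_TT: "TT \<sigma> (TT \<rho> m) = TT (\<sigma> + \<rho>) m"
proof -
 have "TT \<sigma> (TT \<rho> m) = TT \<rho> m + (\<sigma> * cc * (e k\<bullet>m)) *\<^sub>R p1 Fd (e k)" by (simp add: TT_def[of \<sigma>])
 thus ?thesis by (simp add: TT_def distrib_right scaleR_add_left)
qed

lemma TT_0 [simp]: "TT 0 m = m" by (simp add: TT_def)

lemma TN_0 [simp]: "TN 0 m = m" by (simp add: TN_def)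

lemma p1_TN: "p1 Fd (TN \<sigma> n) = TT \<sigma> (p1 Fd n)"
 by (simp add: TN_def TT_def linear_add[OF A.linear_p1] linear_scale[OF A.linear_p1])

lemma TN_TN: "TN \<sigma> (TN \<rho> n) = TN (\<sigma> + \<rho>) n"
proof -
 have "TN \<sigma> (TN \<rho> n) = TN \<rho> n + (\<sigma> * cc * (e k\<bullet>p1 Fd n)) *\<^sub>R e k" by (simp add: TN_def[of \<sigma>] p1_TN)
 thus ?thesis by (simp add: TN_def distrib_right scaleR_add_left)
qed

lemma TT_inv [simp]: "TT (- \<sigma>) (TT \<sigma> m) = m" "TT \<sigma> (TT (- \<sigma>) m) = m" by (simp_all add: TT_TT)

lemma TN_inv [simp]: "TN (- \<sigma>) (TN \<sigma> m) = m" "TN \<sigma> (TN (- \<sigma>) m) = m" by (simp_all add: TN_TN)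

lemma inj_TT: "inj (TT \<sigma>)" by (metis TT_inv(1) injI)

lemma inj_TN: "inj (TN \<sigma>)" by (metis TN_inv(1) injI)

lemma p1_skew: "n\<bullet>p1 Fd n' = - (n'\<bullet>p1 Fd n)" unfolding A.p1_inner by (rule A.skew)

lemma TN_pairing: "TN \<sigma> n\<bullet>TT \<sigma> m = n\<bullet>m"
proof -
 have "TN \<sigma> n\<bullet>TT \<sigma> m = n\<bullet>TT \<sigma> m + (\<sigma> * cc * (e k\<bullet>p1 Fd n)) * (e k\<bullet>m)" by (simp add: TN_def inner_left_distrib)
 also have "n\<bullet>TT \<sigma> m = n\<bullet>m + (\<sigma> * cc * (e k\<bullet>m)) * (n\<bullet>p1 Fd (e k))" by (simp add: TT_def inner_right_distrib)
 also have "n\<bullet>p1 Fd (e k) = - (e k\<bullet>p1 Fd n)" by (rule p1_skew)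
 finally show ?thesis by simp
qed

lemma inner_TT: "n\<bullet>TT \<sigma> m = TN (- \<sigma>) n\<bullet>m" using TN_pairing[of "- \<sigma>" n "TT \<sigma> m"] by simp

lemma basNc: "lattice_basis (fd_I Fd) (\<lambda>i. of_nat (fd_d Fd i) *\<^sub>R e i) (fd_Ncirc Fd)"
 using seed unfolding reciprocal_torus_seed_def by (elim conjE) assumption

lemma dk_pos: "0 < fd_d Fd k"
proof -
 have "\<forall>i\<in>fd_I Fd. 0 < fd_d Fd i" using A.gfd unfolding generalized_fixed_data_def by (elim conjE) assumption
 thus ?thesis using kI by blast
qed

lemma dkek: "of_nat (fd_d Fd k) *\<^sub>R e k\<in>fd_Ncirc Fd" "of_nat (fd_d Fd k) *\<^sub>R e k\<in>fd_Nuf Fd"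
 using lattice_basis_vec[OF basNc kI] A.Nu.scale_nat[OF A.e_mem(2)[OF k]] by auto

lemma pc_ek: "A.pc (e k) = of_nat (fd_d Fd k) *\<^sub>R e k"
 by (rule A.pc_unique[symmetric, OF A.e_mem(1)[OF kI] A.e_nonzero[OF kI] lattice_basis_primitive[OF basNc kI] refl])
  (use dk_pos in simp)

lemma dk_int: assumes "n\<in>fd_N Fd" shows "of_nat (fd_d Fd k) * (e k\<bullet>p1 Fd n)\<in>\<int>"
proof -
 have "\<forall>x\<in>fd_N Fd. \<forall>y\<in>fd_Nuf Fd \<inter> fd_Ncirc Fd. fd_form Fd x y\<in>\<int>"
  using A.gfd unfolding generalized_fixed_data_def by (elim conjE) assumption
 hence "fd_form Fd n (of_nat (fd_d Fd k) *\<^sub>R e k)\<in>\<int>" using dkek assms by blast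
 thus ?thesis by (simp flip: A.p1_inner)
qed

lemma ek_int: assumes "n\<in>fd_Ncirc Fd" shows "e k\<bullet>p1 Fd n\<in>\<int>"
proof -
 have "\<forall>x\<in>fd_Nuf Fd. \<forall>y\<in>fd_Ncirc Fd. fd_form Fd x y\<in>\<int>"
  using A.gfd unfolding generalized_fixed_data_def by (elim conjE) assumption
 hence "fd_form Fd (e k) n\<in>\<int>" using A.e_mem(2)[OF k] assms by blast
 hence "- (n\<bullet>p1 Fd (e k))\<in>\<int>" by (simp add: A.p1_inner)
 thus ?thesis by (simp add: p1_skew[of "e k" n])
qed

lemma cc_int: "n\<in>fd_N Fd ==> \<sigma>\<in>\<int> ==> \<sigma> * cc * (e k\<bullet>p1 Fd n)\<in>\<int>"
 using Ints_mult[OF Ints_mult[OF _ Ints_of_nat[of "fd_r Fd k"]] dk_int] by (simp add: cc_def mult.assoc)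

lemma TN_N: "n\<in>fd_N Fd ==> \<sigma>\<in>\<int> ==> TN \<sigma> n\<in>fd_N Fd"
 unfolding TN_def by (intro A.N.add A.N.scale_Ints cc_int A.e_mem(1) kI)

lemma TN_Nu: "n\<in>fd_Nuf Fd ==> \<sigma>\<in>\<int> ==> TN \<sigma> n\<in>fd_Nuf Fd"
 unfolding TN_def using A.NuN by (intro A.Nu.add A.Nu.scale_Ints cc_int A.e_mem(2) k) auto

text \<open>On \<open>fd_Ncirc\<close> the form with e_k is already integral, so the factor
  \<open>d_k\<close> of \<open>cc\<close> can be moved into the vector \<open>d_k e_k\<close>, which
  belongs to \<open>fd_Ncirc\<close>.\<close>

lemma TN_Nc: assumes "n\<in>fd_Ncirc Fd" "\<sigma>\<in>\<int>" shows "TN \<sigma> n\<in>fd_Ncirc Fd"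
proof -
 have "TN \<sigma> n = n + (\<sigma> * of_nat (fd_r Fd k) * (e k\<bullet>p1 Fd n)) *\<^sub>R (of_nat (fd_d Fd k) *\<^sub>R e k)"
  by (simp add: TN_def cc_def mult_ac)
 also have "\<dots>\<in>fd_Ncirc Fd"
  by (intro A.Nc.add[OF assms(1)] A.Nc.scale_Ints[OF dkek(1)] Ints_mult assms(2) ek_int[OF assms(1)] Ints_of_nat)
 finally show ?thesis .
qed

lemma TT_Mc: "m\<in>fd_Mcirc Fd ==> \<sigma>\<in>\<int> ==> TT \<sigma> m\<in>fd_Mcirc Fd"
 using TN_Nc[of _ "- \<sigma>"] by (auto simp: fd_Mcirc_def dual_lattice_def inner_TT)

lemma TT_M: "m\<in>fd_M Fd ==> \<sigma>\<in>\<int> ==> TT \<sigma> m\<in>fd_M Fd"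
 using TN_N[of _ "- \<sigma>"] by (auto simp: fd_M_def dual_lattice_def inner_TT)

lemma change: "\<sigma>\<in>\<int> ==> lattice_change Fd (TN \<sigma>) (TT \<sigma>)"
 by (rule lattice_change.intro) (simp_all add: linear_TN linear_TT inj_TN inj_TT TN_pairing TN_N TT_M)

lemma generic_TT: assumes "\<sigma>\<in>\<int>" shows "generic Fd (TT \<sigma> x) \<longleftrightarrow> generic Fd x"
 using lattice_change.generic_pull[OF change[OF assms], of x]
  lattice_change.generic_pull[OF change[of "- \<sigma>"], of "TT \<sigma> x"] assms by auto

lemma regular_TT: assumes "\<sigma>\<in>\<int>" shows "regular Fd (TT \<sigma> x) \<longleftrightarrow> regular Fd x"
 using lattice_change.regular_pull[OF change[OF assms], of x]
  lattice_change.regular_pull[OF change[of "- \<sigma>"], of "TT \<sigma> x"] assms by auto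

lemma seg_ok_TT: assumes "\<sigma>\<in>\<int>" shows "seg_ok Fd (TT \<sigma> a) (TT \<sigma> b) \<longleftrightarrow> seg_ok Fd a b"
 using lattice_change.seg_ok_pull[OF change[OF assms], of a b]
  lattice_change.seg_ok_pull[OF change[of "- \<sigma>"], of "TT \<sigma> a" "TT \<sigma> b"] assms by auto

lemma primitive_TN: assumes "\<sigma>\<in>\<int>" "primitive_in (fd_N Fd) n" shows "primitive_in (fd_N Fd) (TN \<sigma> n)"
 by (rule primitive_in_image[OF linear_TN _ linear_TN[of "- \<sigma>"] _ _ assms(2)]) (use TN_N assms(1) in auto)

lemma pc_TN: assumes s: "\<sigma>\<in>\<int>" and n: "n\<in>fd_N Fd" "n\<noteq>0" shows "A.pc (TN \<sigma> n) = TN \<sigma> (A.pc n)"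
proof -
 obtain t where t: "t > 0" "A.pc n = t *\<^sub>R n" using A.pc(2)[OF n] by blast
 have "TN \<sigma> n\<noteq>0" using n(2) linear_0[OF linear_TN] by (metis TN_inv(1))
 moreover have "primitive_in (fd_Ncirc Fd) (TN \<sigma> (A.pc n))"
  by (rule primitive_in_image[OF linear_TN _ linear_TN[of "- \<sigma>"] _ _ A.pc(1)[OF n]]) (use TN_Nc s in auto)
 moreover have "TN \<sigma> (A.pc n) = t *\<^sub>R TN \<sigma> n" using t(2) linear_scale[OF linear_TN] by simp
 ultimately show ?thesis using A.pc_unique[OF TN_N[OF n(1) s]] t(1) by metis
qed

lemma cnorm_TN: assumes s: "\<sigma>\<in>\<int>" and n: "n\<in>fd_N Fd" "n\<noteq>0" shows "A.cnorm (TN \<sigma> n) (TT \<sigma> u) = TN \<sigma> (A.cnorm n u)"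
 by (simp add: A.cnorm_def TN_pairing pc_TN[OF assms] linear_neg[OF linear_TN])

lemma wk_TT: assumes s: "\<sigma>\<in>\<int>" and n: "n\<in>fd_N Fd" "n\<noteq>0" "p1 Fd n\<noteq>0"
 shows "wk (A.cnorm (TN \<sigma> n) (TT \<sigma> u)) (p1 Fd (TN \<sigma> n)) g (TT \<sigma> m) (TT \<sigma> q) = wk (A.cnorm n u) (p1 Fd n) g m q"
 unfolding wk_def cnorm_TN[OF s n(1,2)] TN_pairing p1_TN by (rule ray_linear_image[OF linear_TT inj_TT n(3)])

definition lam :: 'a where "lam = A.lamk k"

lemma ek_lam [simp]: "e k\<bullet>lam = 0" using A.e_lamk[OF kI] by (simp add: lam_def)

lemma lam_int: "n\<in>fd_N Fd ==> n\<bullet>lam\<in>\<int>"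
proof -
 assume n: "n\<in>fd_N Fd"
 have "lam\<in>fd_M Fd" unfolding lam_def A.lamk_def by (rule A.M.sum) (use A.ed_M A.IufI in blast)
 thus ?thesis using n by (simp add: fd_M_def dual_lattice_def)
qed

lemma TN_lam [simp]: "TN \<sigma> n\<bullet>lam = n\<bullet>lam" by (simp add: TN_def inner_left_distrib)

lemma levA: "n\<in>Nplus Fd e ==> n\<bullet>x = 0 ==> e k\<bullet>x\<noteq>0 ==> 0 < n\<bullet>lam" unfolding lam_def by (rule A.level_pos[OF k])

text \<open>Mutation changes the seed vectors other than e_k by multiples of e_k only, so the level
  of the original seed counts the same coordinates for the mutated one.\<close>

lemma levB: "n\<in>Nplus Fd (mutate_seed Fd k e) ==> n\<bullet>x = 0 ==> e k\<bullet>x\<noteq>0 ==> 0 < n\<bullet>lam" unfolding lam_def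
proof (rule A.level_pos_basis[OF k, of "mutate_seed Fd k e" "- 1"])
 fix i assume "i\<in>fd_Iuf Fd"
 thus "mutate_seed Fd k e i\<bullet>A.lamk k = (if i = k then 0 else 1)"
  using A.e_lamk[of i k] A.e_lamk[OF kI, of k] A.IufI by (auto simp: mutate_seed_def inner_left_distrib)
qed (simp_all add: mutate_seed_def)

section \<open>Comparison of kernels on the two sides of the mutation\<close>

text \<open>The shear parameter on the half-space s, chosen so that \<open>TT (sig s)\<close> is the
  map \<open>T_sign\<close>; the sign itself is \<open>sg\<close>.\<close>

definition sig :: "bool=>real" where "sig s = of_bool s"

lemma sig_Ints [simp]: "sig s\<in>\<int>" by (simp add: sig_def)

abbreviation "Tm s \<equiv> TT (sig s)"
abbreviation "Tn s \<equiv> TN (sig s)"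

definition sg :: "bool=>real" where "sg s = (if s then 1 else - 1)"

definition HH :: "bool=>'a set" where "HH s = {x. 0 < sg s * (e k\<bullet>x)}"

lemma HH_eq: "HH s = {x. 0 < (sg s *\<^sub>R e k)\<bullet>x}" by (simp add: HH_def)

lemma HH_open: "open (HH s)" and HH_convex: "convex (HH s)"
 unfolding HH_eq by (rule open_halfspace_gt, rule convex_halfspace_gt)

lemma HH_nonzero: "x\<in>HH s ==> e k\<bullet>x\<noteq>0" by (auto simp: HH_def)

text \<open>A splitting of n into n1 and n - n1 contributes only if both parts have positive level,
  where \<open>low\<close> gives the same value on both sides, or if one part is zero. The two
  trivial splittings remain in the difference.\<close>

lemma kstar_diff:
 fixes K1 K2 K1' K2' :: "'a=>'a=>('x, 'k) coeff_poly"
 assumes K: "posk Fd lam K1" "posk Fd lam K2" "A.ksupp K1" "A.ksupp K2"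
  and K': "posk Fd lam K1'" "posk Fd lam K2'" "B.ksupp K1'" "B.ksupp K2'"
  and m: "m\<in>fd_Mcirc Fd" and n: "n\<in>fd_Nuf Fd" "n\<noteq>0"
  and low: "\<And>n1 m. n1\<in>fd_Nuf Fd ==> 0 < n1\<bullet>lam ==> 0 < (n - n1)\<bullet>lam ==> m\<in>fd_Mcirc Fd ==>
    K1 m (p1 Fd n1) = K1' (Tm s m) (Tm s (p1 Fd n1)) \<and>
    K2 m (p1 Fd (n - n1)) = K2' (Tm s m) (Tm s (p1 Fd (n - n1)))"
 shows "A.kstar K1 K2 m (p1 Fd n) - B.kstar K1' K2' (Tm s m) (Tm s (p1 Fd n)) =
  (K1 m (p1 Fd n) - K1' (Tm s m) (Tm s (p1 Fd n))) + (K2 m (p1 Fd n) - K2' (Tm s m) (Tm s (p1 Fd n)))"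
proof -
 let ?q = "p1 Fd n"
 let ?\<tau> = "Tm s" and ?\<nu> = "Tn s"
 have sZ: "sig s\<in>\<int>" by (rule sig_Ints)
 define SB where "SB = {n\<in>fd_Nuf Fd. p1 Fd n\<in>B.dec (?\<tau> ?q)}"
 \<comment> \<open>The monoids \<open>P\<close> and \<open>P'\<close> allow different splittings. S
   contains those of both, the second ones moved back by the inverse of \<open>Tn s\<close>, and the
   two trivial splittings.\<close>
 define S where "S = {n'\<in>fd_Nuf Fd. p1 Fd n'\<in>A.dec ?q} \<union> TN (- sig s) ` SB \<union> {0, n}"
 have finS: "finite S" unfolding S_def SB_def by (simp add: A.finite_Nu_dec B.finite_Nu_dec)
 have "TN (- sig s) ` SB\<subseteq>fd_Nuf Fd" unfolding SB_def by (rule image_subsetI, rule TN_Nu) (use sZ in auto)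
 hence SNu: "S\<subseteq>fd_Nuf Fd" unfolding S_def using n(1) A.Nu.zero by simp
 have pos: "\<exists>n\<in>fd_Nuf Fd. q = p1 Fd n \<and> (n = 0 \<or> 0 < n\<bullet>lam)"
  if "posk Fd lam K" "K m q\<noteq>0" "m\<in>fd_Mcirc Fd" for K :: "'a=>'a=>('x, 'k) coeff_poly" and m q
 proof -
  have "q = 0 \<or> (\<exists>n\<in>fd_Nuf Fd. q = p1 Fd n \<and> 0 < n\<bullet>lam)" by (rule poskD(2)[OF that(1,3,2)])
  thus ?thesis
  proof
   assume "q = 0"
   thus ?thesis by (intro bexI[of _ 0]) (auto simp: A.Nu.zero)
  qed auto
 qed
 have "p\<in>p1 Fd ` fd_Nuf Fd" if "K1 m p\<noteq>0" for p using pos[OF K(1) that m] by blast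
 hence A: "A.kstar K1 K2 m ?q = (\<Sum>n1\<in>S. K1 m (p1 Fd n1) * K2 (m + p1 Fd n1) (?q - p1 Fd n1))"
  by (rule A.kstar_Nu[OF _ K(3,4) finS SNu]) (auto simp: S_def)
 have m': "?\<tau> m\<in>fd_Mcirc Fd" by (rule TT_Mc[OF m sZ])
 have "p\<in>p1 Fd ` fd_Nuf Fd" if "K1' (?\<tau> m) p\<noteq>0" for p using pos[OF K'(1) that m'] by blast
 hence "B.kstar K1' K2' (?\<tau> m) (?\<tau> ?q) =
   (\<Sum>n1\<in>?\<nu> ` S. K1' (?\<tau> m) (p1 Fd n1) * K2' (?\<tau> m + p1 Fd n1) (?\<tau> ?q - p1 Fd n1))"
 proof (rule B.kstar_Nu[OF _ K'(3,4)])
  show "finite (?\<nu> ` S)" using finS by simp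
  show "?\<nu> ` S\<subseteq>fd_Nuf Fd" using SNu TN_Nu sZ by blast
  fix n' assume "n'\<in>fd_Nuf Fd" "p1 Fd n'\<in>B.dec (?\<tau> ?q)"
  hence "TN (- sig s) n'\<in>S" unfolding S_def SB_def by blast
  thus "n'\<in>?\<nu> ` S" by (metis TN_inv(2) imageI)
 qed
 also have "\<dots> = (\<Sum>n1\<in>S. K1' (?\<tau> m) (?\<tau> (p1 Fd n1)) * K2' (?\<tau> (m + p1 Fd n1)) (?\<tau> (?q - p1 Fd n1)))"
  by (simp add: sum.reindex[OF inj_on_subset[OF inj_TN subset_UNIV]] p1_TN linear_add[OF linear_TT] linear_diff[OF linear_TT])
 finally have B: "B.kstar K1' K2' (?\<tau> m) (?\<tau> ?q) =
   (\<Sum>n1\<in>S. K1' (?\<tau> m) (?\<tau> (p1 Fd n1)) * K2' (?\<tau> (m + p1 Fd n1)) (?\<tau> (?q - p1 Fd n1)))" .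
 define t where "t n1 = K1 m (p1 Fd n1) * K2 (m + p1 Fd n1) (?q - p1 Fd n1) -
   K1' (?\<tau> m) (?\<tau> (p1 Fd n1)) * K2' (?\<tau> (m + p1 Fd n1)) (?\<tau> (?q - p1 Fd n1))" for n1
 have one: "K m 0 = 1" if "posk Fd lam K" "m\<in>fd_Mcirc Fd" for K :: "'a=>'a=>('x, 'k) coeff_poly" and m
  by (rule poskD(1)[OF that])
 have p1M: "p1 Fd n1\<in>fd_Mcirc Fd" if "n1\<in>fd_Nuf Fd" for n1
 proof -
  have "\<forall>x\<in>fd_Nuf Fd. \<forall>y\<in>fd_Ncirc Fd. fd_form Fd x y\<in>\<int>"
   using A.gfd unfolding generalized_fixed_data_def by (elim conjE) assumption
  thus ?thesis using that by (simp add: fd_Mcirc_def dual_lattice_def A.p1_inner)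
 qed
 have zero: "t n1 = 0" if n1: "n1\<in>S" "n1\<noteq>0" "n1\<noteq>n" for n1
 proof -
  have n1u: "n1\<in>fd_Nuf Fd" using n1 SNu by blast
  have mn: "m + p1 Fd n1\<in>fd_Mcirc Fd" by (rule A.Mc.add[OF m p1M[OF n1u]])
  have q: "?q - p1 Fd n1 = p1 Fd (n - n1)" by (simp add: linear_diff[OF A.linear_p1])
  have nn: "n - n1\<in>fd_Nuf Fd" by (rule A.Nu.diff[OF n(1) n1u])
  show ?thesis
  proof (cases "0 < n1\<bullet>lam \<and> 0 < (n - n1)\<bullet>lam")
   case True
   thus ?thesis using low[OF n1u _ _ m] low[OF n1u _ _ mn] unfolding t_def q by simp
  next
   case False
   then consider "\<not> 0 < n1\<bullet>lam" | "\<not> 0 < (n - n1)\<bullet>lam" by blast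
   thus ?thesis
   proof cases
    case 1
    have "K1 m (p1 Fd n1) = 0" using pos[OF K(1) _ m, of "p1 Fd n1"] A.p1_inj[OF n1u] n1(2) 1 by blast
    moreover have "K1' (?\<tau> m) (p1 Fd (?\<nu> n1)) = 0"
    proof (rule ccontr)
     assume "K1' (?\<tau> m) (p1 Fd (?\<nu> n1))\<noteq>0"
     then obtain n' where n': "n'\<in>fd_Nuf Fd" "p1 Fd (?\<nu> n1) = p1 Fd n'" "n' = 0 \<or> 0 < n'\<bullet>lam"
      using pos[OF K'(1) _ m'] by blast
     hence "?\<nu> n1 = n'" using A.p1_inj TN_Nu[OF n1u sZ] by blast
     moreover have "?\<nu> n1\<noteq>0" using n1(2) linear_0[OF linear_TN] by (metis TN_inv(1))
     ultimately show False using n'(3) 1 TN_lam by metis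
    qed
    ultimately show ?thesis unfolding t_def by (simp add: p1_TN)
   next
    case 2
    have "K2 (m + p1 Fd n1) (p1 Fd (n - n1)) = 0"
    proof (rule ccontr)
     assume "K2 (m + p1 Fd n1) (p1 Fd (n - n1))\<noteq>0"
     then obtain n' where n': "n'\<in>fd_Nuf Fd" "p1 Fd (n - n1) = p1 Fd n'" "n' = 0 \<or> 0 < n'\<bullet>lam"
      using pos[OF K(2) _ mn] by blast
     hence "n - n1 = n'" using A.p1_inj nn by blast
     thus False using n'(3) 2 n1(3) by auto
    qed
    moreover have "K2' (?\<tau> (m + p1 Fd n1)) (p1 Fd (?\<nu> (n - n1))) = 0"
    proof (rule ccontr)
     assume "K2' (?\<tau> (m + p1 Fd n1)) (p1 Fd (?\<nu> (n - n1)))\<noteq>0"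
     then obtain n' where n': "n'\<in>fd_Nuf Fd" "p1 Fd (?\<nu> (n - n1)) = p1 Fd n'" "n' = 0 \<or> 0 < n'\<bullet>lam"
      using pos[OF K'(2) _ TT_Mc[OF mn sZ]] by blast
     hence "?\<nu> (n - n1) = n'" using A.p1_inj TN_Nu[OF nn sZ] by blast
     moreover have "?\<nu> (n - n1)\<noteq>0" using n1(3) linear_0[OF linear_TN] by (metis TN_inv(1) right_minus_eq)
     ultimately show False using n'(3) 2 TN_lam by metis
    qed
    ultimately show ?thesis unfolding t_def q by (simp add: p1_TN)
   qed
  qed
 qed
 have "A.kstar K1 K2 m ?q - B.kstar K1' K2' (?\<tau> m) (?\<tau> ?q) = (\<Sum>n1\<in>S. t n1)"
  unfolding A B t_def by (simp add: sum_subtractf)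
 also have "\<dots> = (\<Sum>n1\<in>{0, n}. t n1)" using finS zero by (intro sum.mono_neutral_right) (auto simp: S_def)
 also have "\<dots> = t 0 + t n" using n(2) by simp
 also have "t 0 = K2 m ?q - K2' (?\<tau> m) (?\<tau> ?q)"
  using one[OF K(1) m] one[OF K'(1) m'] by (simp add: t_def linear_0[OF linear_TT])
 also have "t n = K1 m ?q - K1' (?\<tau> m) (?\<tau> ?q)"
  using one[OF K(2) A.Mc.add[OF m p1M[OF n(1)]]] one[OF K'(2) TT_Mc[OF A.Mc.add[OF m p1M[OF n(1)]] sZ]]
  by (simp add: t_def linear_0[OF linear_TT])
 finally show ?thesis by simp
qed

end

context clus
begin

text \<open>Extends \<open>near_init\<close> to vectors n outside \<open>Nplus\<close>, for which
  there are no walls on H and the initial contribution vanishes too.\<close>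

lemma near_init_gen: assumes lev: "\<And>n' x. n'\<in>Nplus Fd e ==> x\<in>H ==> n'\<bullet>x = 0 ==> 0 < n'\<bullet>lam"
  and n: "n\<in>Nu" "primitive_in N n" "0 < n\<bullet>lam" and j: "0 < j"
 shows "\<exists>r>0. \<forall>y\<in>ball (of_nat j *\<^sub>R p1 Fd n) r. generic Fd y \<and> n\<bullet>y = 0 \<and> y\<in>H --> G y n $ j = init n j"
proof (cases "n\<in>Nplus Fd e")
 case True
 thus ?thesis using near_init[OF True n(2) j Lof] by blast
next
 case False
 have "init n j = 0" using False e_Nplus by (auto simp: init_def)
 moreover have "G y n $ j = 0" if y: "generic Fd y" "n\<bullet>y = 0" "y\<in>H" for y
 proof -
  have "G y n = 1" by (rule G_one) (rule no_wall_off_Nplus[OF y(1) lev[OF _ y(3)] n y(2) False])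
  thus ?thesis using j by simp
 qed
 ultimately show ?thesis by (intro exI[of _ 1]) auto
qed

end

section \<open>Local kernels of both diagrams off e_k^perp\<close>

context mut
begin

definition prn :: "'a=>'a=>bool" where "prn n x \<longleftrightarrow> n\<in>fd_Nuf Fd \<and> primitive_in (fd_N Fd) n \<and> 0 < n\<bullet>lam \<and> n\<bullet>x = 0"

definition exn :: "'a=>bool" where "exn x \<longleftrightarrow> (\<exists>n. prn n x)"

definition nn :: "'a=>'a" where "nn x = (SOME n. prn n x)"

lemma prn_nn: "exn x ==> prn (nn x) x" unfolding exn_def nn_def by (rule someI_ex)

lemma prnD: assumes "prn n x"
 shows "n\<in>fd_Nuf Fd" "primitive_in (fd_N Fd) n" "0 < n\<bullet>lam" "n\<bullet>x = 0" "n\<in>fd_N Fd" "n\<noteq>0" "p1 Fd n\<noteq>0"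
proof -
 show n: "n\<in>fd_Nuf Fd" "primitive_in (fd_N Fd) n" "0 < n\<bullet>lam" "n\<bullet>x = 0" using assms by (auto simp: prn_def)
 show "n\<in>fd_N Fd" using n(1) A.NuN by blast
 show "n\<noteq>0" using n(3) by auto
 thus "p1 Fd n\<noteq>0" by (rule A.p1_nonzero[OF n(1)])
qed

lemma prn_TN: "prn n x ==> \<sigma>\<in>\<int> ==> prn (TN \<sigma> n) (TT \<sigma> x)" by (simp add: prn_def TN_Nu primitive_TN TN_pairing)

text \<open>The local kernel without truncation level. A generic point is orthogonal to at most one
  primitive vector of positive level; if there is none, no wall passes.\<close>

definition KA :: "'a=>'a=>'a=>'a=>('x, 'k) coeff_poly" where
 "KA x u = (if exn x then wk (A.cnorm (nn x) u) (p1 Fd (nn x)) (A.G x (nn x)) else A.kone)"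

text \<open>The local kernel of the second diagram at the image of x, indexed by x and u before
  transport, so that both kernels refer to one segment.\<close>

definition KB :: "bool=>'a=>'a=>'a=>'a=>('x, 'k) coeff_poly" where
 "KB s x u = (if exn x then wk (A.cnorm (Tn s (nn x)) (Tm s u)) (p1 Fd (Tn s (nn x))) (B.G (Tm s x) (Tn s (nn x))) else A.kone)"

lemma KA_LocK: assumes x: "generic Fd x" "e k\<bullet>x\<noteq>0" and u: "\<And>n. n\<in>fd_N Fd ==> n\<noteq>0 ==> n\<bullet>x = 0 ==> n\<bullet>u\<noteq>0"
  and q: "q\<notin>ideal_power P L" shows "A.LocK L x u m q = KA x u m q"
proof (cases "exn x")
 case True
 note n = prnD[OF prn_nn[OF True]]
 show ?thesis using A.LocK_gen[OF x(1) levA[OF _ _ x(2)] n(1-4) u[OF n(5,6,4)] q] True by (simp add: KA_def)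
next
 case False
 have "A.walls_at L x = {}"
 proof (rule ccontr)
  assume "A.walls_at L x\<noteq>{}"
  then obtain w where "w\<in>A.walls_at L x" by blast
  hence w: "w\<in>sd_index D" "x\<in>sd_supp D w" using A.walls_at_index by auto
  hence wx: "A.wn w\<bullet>x = 0" using A.supp_orth[OF w(1)] by (auto simp: orth_def)
  have "prn (A.wn w) x"
   using A.Nplus_Nu[OF A.wn_Nplus[OF w(1)]] A.wn_prim[OF w(1)] levA[OF A.wn_Nplus[OF w(1)] wx x(2)] wx by (simp add: prn_def)
  thus False using False by (auto simp: exn_def)
 qed
 thus ?thesis using False by (simp add: KA_def A.LocK_kone)
qed

lemma KB_LocK: assumes x: "generic Fd x" "e k\<bullet>x\<noteq>0" and u: "\<And>n. n\<in>fd_N Fd ==> n\<noteq>0 ==> n\<bullet>x = 0 ==> n\<bullet>u\<noteq>0"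
  and q: "q\<notin>ideal_power P' L" shows "B.LocK L (Tm s x) (Tm s u) m q = KB s x u m q"
proof (cases "exn x")
 case True
 note n = prnD[OF prn_nn[OF True]]
 note n' = prnD[OF prn_TN[OF prn_nn[OF True], of "sig s", simplified]]
 have x': "generic Fd (Tm s x)" "e k\<bullet>Tm s x\<noteq>0" using x by (simp_all add: generic_TT)
 have u': "Tn s (nn x)\<bullet>Tm s u\<noteq>0" using u[OF n(5,6,4)] by (simp add: TN_pairing)
 show ?thesis using B.LocK_gen[OF x'(1) levB[OF _ _ x'(2)] n'(1-4) u' q] True by (simp add: KB_def)
next
 case False
 have "B.walls_at L (Tm s x) = {}"
 proof (rule ccontr)
  assume "B.walls_at L (Tm s x)\<noteq>{}"
  then obtain w where "w\<in>B.walls_at L (Tm s x)" by blast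
  hence w: "w\<in>sd_index D'" "Tm s x\<in>sd_supp D' w" using B.walls_at_index by auto
  hence wx: "B.wn w\<bullet>Tm s x = 0" using B.supp_orth[OF w(1)] by (auto simp: orth_def)
  have "prn (B.wn w) (Tm s x)"
   using B.Nplus_Nu[OF B.wn_Nplus[OF w(1)]] B.wn_prim[OF w(1)] levB[OF B.wn_Nplus[OF w(1)] wx] x(2) wx by (simp add: prn_def)
  from prn_TN[OF this, of "- sig s"] show False using False by (auto simp: exn_def)
 qed
 thus ?thesis using False by (simp add: KB_def B.LocK_kone)
qed

definition goodk :: "('a=>'a=>('x, 'k) coeff_poly)=>('a=>'a=>('x, 'k) coeff_poly)=>bool" where
 "goodk K K' \<longleftrightarrow> posk Fd lam K \<and> A.ksupp K \<and> posk Fd lam K' \<and> B.ksupp K'"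

lemma goodk_kone: "goodk A.kone A.kone" by (simp add: goodk_def A.posk_kone)

lemma goodk_local: assumes x: "generic Fd x" "e k\<bullet>x\<noteq>0" shows "goodk (KA x u) (KB s x u)"
proof (cases "exn x")
 case True
 note n = prnD[OF prn_nn[OF True]]
 note n' = prnD[OF prn_TN[OF prn_nn[OF True], of "sig s", simplified]]
 have x': "generic Fd (Tm s x)" "e k\<bullet>Tm s x\<noteq>0" using x by (simp_all add: generic_TT)
 have "posk Fd lam (KA x u)" using True A.posk_wk[OF n(1,3) A.G_0] by (simp add: KA_def)
 moreover have "posk Fd lam (KB s x u)" using True A.posk_wk[OF n'(1,3) B.G_0] by (simp add: KB_def)
 moreover have "A.ksupp (KA x u)" using True A.ksupp_wk_gen[OF x(1) levA[OF _ _ x(2)] n(1-4)] by (simp add: KA_def)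
 moreover have "B.ksupp (KB s x u)"
  using True B.ksupp_wk_gen[OF x'(1) levB[OF _ _ x'(2)] n'(1-4)] by (simp add: KB_def)
 ultimately show ?thesis by (simp add: goodk_def)
next
 case False
 thus ?thesis using goodk_kone by (simp add: KA_def KB_def)
qed

lemma goodk_kstar: "goodk K1 K1' ==> goodk K2 K2' ==> goodk (A.kstar K1 K2) (B.kstar K1' K2')"
 unfolding goodk_def using A.posk_kstar B.posk_kstar A.ksupp_kstar B.ksupp_kstar by auto

text \<open>Sets closed under passing to a summand when it and its complement have positive level:
  agreement of kernels on such a set is inherited by products.\<close>

definition dcl :: "'a set=>bool" where "dcl \<A> \<longleftrightarrow> (\<forall>n\<in>\<A>. n\<in>fd_Nuf Fd \<and> 0 < n\<bullet>lam \<and>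
   (\<forall>n1\<in>fd_Nuf Fd. 0 < n1\<bullet>lam \<and> 0 < (n - n1)\<bullet>lam --> n1\<in>\<A>))"

lemma dclD: assumes "dcl \<A>" "n\<in>\<A>"
 shows "n\<in>fd_Nuf Fd" "0 < n\<bullet>lam" "n\<noteq>0" "n1\<in>fd_Nuf Fd ==> 0 < n1\<bullet>lam ==> 0 < (n - n1)\<bullet>lam ==> n1\<in>\<A> \<and> n - n1\<in>\<A>"
proof -
 have *: "n\<in>fd_Nuf Fd \<and> 0 < n\<bullet>lam \<and> (\<forall>n1\<in>fd_Nuf Fd. 0 < n1\<bullet>lam \<and> 0 < (n - n1)\<bullet>lam --> n1\<in>\<A>)"
  using assms unfolding dcl_def by (rule bspec)
 thus n: "n\<in>fd_Nuf Fd" "0 < n\<bullet>lam" by auto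
 thus "n\<noteq>0" by auto
 assume n1: "n1\<in>fd_Nuf Fd" "0 < n1\<bullet>lam" "0 < (n - n1)\<bullet>lam"
 have "n - n1\<in>fd_Nuf Fd" by (rule A.Nu.diff[OF n(1) n1(1)])
 moreover have "0 < (n - (n - n1))\<bullet>lam" using n1(2) by simp
 ultimately show "n1\<in>\<A> \<and> n - n1\<in>\<A>" using * n1 by blast
qed

definition agr :: "bool=>'a set=>('a=>'a=>('x, 'k) coeff_poly)=>('a=>'a=>('x, 'k) coeff_poly)=>bool" where
 "agr s \<A> K K' \<longleftrightarrow> (\<forall>m\<in>fd_Mcirc Fd. \<forall>n\<in>\<A>. K m (p1 Fd n) = K' (Tm s m) (Tm s (p1 Fd n)))"

lemma agrD: "agr s \<A> K K' ==> m\<in>fd_Mcirc Fd ==> n\<in>\<A> ==> K m (p1 Fd n) = K' (Tm s m) (Tm s (p1 Fd n))"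
 unfolding agr_def by blast

lemma kstar_diff_good: assumes g: "goodk K1 K1'" "goodk K2 K2'" and \<A>: "dcl \<A>" "agr s \<A> K1 K1'" "agr s \<A> K2 K2'"
  and m: "m\<in>fd_Mcirc Fd" and n: "n\<in>fd_Nuf Fd" "n\<noteq>0"
  and low: "\<And>n1. n1\<in>fd_Nuf Fd ==> 0 < n1\<bullet>lam ==> 0 < (n - n1)\<bullet>lam ==> n1\<in>\<A> \<and> n - n1\<in>\<A>"
 shows "A.kstar K1 K2 m (p1 Fd n) - B.kstar K1' K2' (Tm s m) (Tm s (p1 Fd n)) =
  (K1 m (p1 Fd n) - K1' (Tm s m) (Tm s (p1 Fd n))) + (K2 m (p1 Fd n) - K2' (Tm s m) (Tm s (p1 Fd n)))"
proof (rule kstar_diff[OF _ _ _ _ _ _ _ _ m n])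
 show "posk Fd lam K1" "posk Fd lam K2" "A.ksupp K1" "A.ksupp K2" "posk Fd lam K1'" "posk Fd lam K2'" "B.ksupp K1'" "B.ksupp K2'"
  using g by (auto simp: goodk_def)
 fix n1 m assume n1: "n1\<in>fd_Nuf Fd" "0 < n1\<bullet>lam" "0 < (n - n1)\<bullet>lam" and m: "m\<in>fd_Mcirc Fd"
 hence "n1\<in>\<A>" "n - n1\<in>\<A>" using low by auto
 thus "K1 m (p1 Fd n1) = K1' (Tm s m) (Tm s (p1 Fd n1)) \<and> K2 m (p1 Fd (n - n1)) = K2' (Tm s m) (Tm s (p1 Fd (n - n1)))"
  using agrD[OF \<A>(2) m] agrD[OF \<A>(3) m] by simp
qed

lemma agr_kstar: assumes g: "goodk K1 K1'" "goodk K2 K2'" and \<A>: "dcl \<A>" "agr s \<A> K1 K1'" "agr s \<A> K2 K2'"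
 shows "agr s \<A> (A.kstar K1 K2) (B.kstar K1' K2')" unfolding agr_def
proof (intro ballI)
 fix m n assume m: "m\<in>fd_Mcirc Fd" and n: "n\<in>\<A>"
 note nD = dclD[OF \<A>(1) n]
 have "A.kstar K1 K2 m (p1 Fd n) - B.kstar K1' K2' (Tm s m) (Tm s (p1 Fd n)) = 0"
  using kstar_diff_good[OF g \<A> m nD(1,3) nD(4)] agrD[OF \<A>(2) m n] agrD[OF \<A>(3) m n] by simp
 thus "A.kstar K1 K2 m (p1 Fd n) = B.kstar K1' K2' (Tm s m) (Tm s (p1 Fd n))" by simp
qed

lemma agr_kone: assumes "dcl \<A>" shows "agr s \<A> A.kone A.kone" unfolding agr_def
proof (intro ballI)
 fix m n assume "n\<in>\<A>"
 note nD = dclD[OF assms this]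
 have "p1 Fd n\<noteq>0" by (rule A.p1_nonzero[OF nD(1,3)])
 moreover from this have "Tm s (p1 Fd n)\<noteq>0" using linear_0[OF linear_TT] by (metis TT_inv(1))
 ultimately show "A.kone m (p1 Fd n) = A.kone (Tm s m) (Tm s (p1 Fd n))" by (simp add: A.kone_def)
qed

lemma agr_klist: assumes \<A>: "dcl \<A>" and t: "\<And>t. t\<in>set ts ==> goodk (f t) (g t) \<and> agr s \<A> (f t) (g t)"
 shows "goodk (A.klist (map f ts)) (B.klist (map g ts)) \<and> agr s \<A> (A.klist (map f ts)) (B.klist (map g ts))" using t
proof (induction ts)
 case Nil
 thus ?case using goodk_kone agr_kone[OF \<A>] by simp
next
 case (Cons t ts)
 hence 1: "goodk (f t) (g t)" "agr s \<A> (f t) (g t)" and 2: "goodk (A.klist (map f ts)) (B.klist (map g ts))"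
  "agr s \<A> (A.klist (map f ts)) (B.klist (map g ts))" by auto
 show ?case using goodk_kstar[OF 1(1) 2(1)] agr_kstar[OF 1(1) 2(1) \<A> 1(2) 2(2)] by simp
qed

text \<open>Coefficient j of a power involves only the coefficients i <= j of the local function.
  The multiples of the primitive vector that belong to them lie in \<open>\<A>\<close> by its
  closure property.\<close>

lemma agr_local: assumes x: "generic Fd x" and \<A>: "dcl \<A>"
  and loc: "\<And>n j. prn n x ==> 0 < j ==> of_nat j *\<^sub>R n\<in>\<A> ==> A.G x n $ j = B.G (Tm s x) (Tn s n) $ j"
 shows "agr s \<A> (KA x u) (KB s x u)"
proof (cases "exn x")
 case True
 note pn = prn_nn[OF True]
 note n0 = prnD[OF pn]
 show ?thesis unfolding agr_def
 proof (intro ballI)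
  fix m n assume m: "m\<in>fd_Mcirc Fd" and n: "n\<in>\<A>"
  note nD = dclD[OF \<A> n]
  let ?g = "A.G x (nn x)" and ?h = "B.G (Tm s x) (Tn s (nn x))" and ?N = "\<lfloor>A.cnorm (nn x) u\<bullet>m\<rfloor>"
  have B: "KB s x u (Tm s m) (Tm s (p1 Fd n)) = ray (p1 Fd (nn x)) (fpow ?h ?N) (p1 Fd n)"
   using True wk_TT[OF sig_Ints n0(5-7), of s u ?h m "p1 Fd n"] by (simp add: KB_def wk_def)
  have A: "KA x u m (p1 Fd n) = ray (p1 Fd (nn x)) (fpow ?g ?N) (p1 Fd n)" using True by (simp add: KA_def wk_def)
  show "KA x u m (p1 Fd n) = KB s x u (Tm s m) (Tm s (p1 Fd n))"
  proof (cases "\<exists>j::nat. p1 Fd n = of_nat j *\<^sub>R p1 Fd (nn x)")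
   case True
   then obtain j :: nat where j: "p1 Fd n = of_nat j *\<^sub>R p1 Fd (nn x)" by blast
   hence "p1 Fd n = p1 Fd (of_nat j *\<^sub>R nn x)" by (simp add: linear_scale[OF A.linear_p1])
   hence nj: "n = of_nat j *\<^sub>R nn x" by (rule A.p1_inj[OF nD(1) A.Nu.scale_nat[OF n0(1)]])
   have "?g $ i = ?h $ i" if i: "i\<le>j" for i
   proof (cases "i = 0")
    case False
    have "of_nat i *\<^sub>R nn x\<in>\<A>"
    proof (cases "i = j")
     case False
     have "n - of_nat i *\<^sub>R nn x = of_nat (j - i) *\<^sub>R nn x" using i by (simp add: nj of_nat_diff scaleR_diff_left)
     moreover have "0 < of_nat (j - i) * (nn x\<bullet>lam)" using i False n0(3) by simp
     ultimately have "0 < (n - of_nat i *\<^sub>R nn x)\<bullet>lam" by (simp only: inner_scaleR_left)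
     moreover have "0 < (of_nat i *\<^sub>R nn x)\<bullet>lam" using n0(3) \<open>i\<noteq>0\<close> by simp
     ultimately show ?thesis using nD(4)[OF A.Nu.scale_nat[OF n0(1)]] by blast
    qed (use n nj in simp)
    thus ?thesis using loc[OF pn] False by simp
   qed (simp add: A.G_0 B.G_0)
   hence "fpow ?g ?N $ j = fpow ?h ?N $ j" by (rule fpow_nth_cong[OF A.G_0 B.G_0])
   thus ?thesis unfolding A B unfolding j using n0(7) by simp
  next
   case False
   thus ?thesis unfolding A B using ray_off by metis
  qed
 qed
next
 case False
 thus ?thesis using agr_kone[OF \<A>] by (simp add: KA_def KB_def)
qed

lemma seg_TT: "quad (TT \<sigma> a) (TT \<sigma> b) 0 t = TT \<sigma> (seg a b t)"
 by (simp add: quad_def linear_add[OF linear_TT] linear_scale[OF linear_TT] linear_diff[OF linear_TT])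

text \<open>The two exponents may need different truncations, and the two diagrams may be crossed at
  different times; one list of times contains both sets.\<close>

lemma seg_phi: assumes so: "seg_ok Fd a b" and ab: "a\<in>HH s" "b\<in>HH s" and m: "m\<in>fd_Mcirc Fd" "m'\<in>fd_Mcirc Fd"
 shows "\<exists>ts. set ts\<subseteq>{0..1} \<and> A.phi a b m q = A.klist (map (\<lambda>t. KA (seg a b t) (b - a)) ts) m q \<and>
  B.phi (Tm s a) (Tm s b) m' q' = B.klist (map (\<lambda>t. KB s (seg a b t) (b - a)) ts) m' q'"
proof -
 let ?ga = "seg a b" and ?ga' = "seg (Tm s a) (Tm s b)"
 have so': "seg_ok Fd (Tm s a) (Tm s b)" using so by (simp add: seg_ok_TT)
 note g = seg_ok_generic_path[OF so] and g' = seg_ok_generic_path[OF so']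
 note adA = A.generic_path_admissible[OF g] and adB = B.generic_path_admissible[OF g']
 define LA LB where "LA = A.Lof q" and "LB = B.Lof q'"
 have q: "q\<notin>ideal_power P LA" "q'\<notin>ideal_power P' LB" unfolding LA_def LB_def by (rule A.Lof, rule B.Lof)
 define X where "X = {t\<in>{0..1}. A.walls_at LA (?ga t)\<noteq>{}} \<union> {t\<in>{0..1}. B.walls_at LB (?ga' t)\<noteq>{}}"
 have finX: "finite X" unfolding X_def using A.finite_times[OF adA] B.finite_times[OF adB] by (intro finite_UnI)
 define ts where "ts = sorted_list_of_set X"
 have ts: "set ts = X" "sorted_wrt (<) ts" unfolding ts_def using finX by auto
 have ts01: "set ts\<subseteq>{0..1}" unfolding ts by (auto simp: X_def)
 have gA: "A.good_ts LA ?ga ts" and gB: "B.good_ts LB ?ga' ts"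
  unfolding A.good_ts_def B.good_ts_def using ts ts01 by (auto simp: X_def)
 have loc: "generic Fd (?ga t) \<and> e k\<bullet>?ga t\<noteq>0 \<and> (\<forall>n\<in>fd_N Fd. n\<noteq>0 --> n\<bullet>?ga t = 0 --> n\<bullet>(b - a)\<noteq>0)"
  if t: "t\<in>{0..1}" for t
 proof -
  have "generic Fd (?ga t)" "\<forall>n\<in>fd_N Fd. n\<noteq>0 \<and> n\<bullet>?ga t = 0 --> n\<bullet>velocity ?ga t\<noteq>0"
   using g t unfolding generic_path_def by blast+
  thus ?thesis using HH_nonzero[OF seg_convex[OF HH_convex ab t]] velocity_quad[OF t, of a b 0] by simp
 qed
 have "A.phi a b m q = A.pk ?ga m q" by (rule A.phi_seg[OF so m(1)])
 also have "\<dots> = A.pkl LA ?ga ts m q" by (rule A.pk_eq[OF adA q(1) gA])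
 also have "\<dots> = A.klist (map (\<lambda>t. KA (?ga t) (b - a)) ts) m q" unfolding A.pkl_def
 proof (rule A.klist_cong_on[OF A.down_closed_ideal_power[of LA], where M = UNIV])
  show "list_all2 (\<lambda>K K'. \<forall>m\<in>UNIV. \<forall>p\<in>- ideal_power P LA. K m p = K' m p)
   (map (\<lambda>t. A.LocK LA (?ga t) (velocity ?ga t)) ts) (map (\<lambda>t. KA (?ga t) (b - a)) ts)"
   unfolding list_all2_conv_all_nth
  proof (intro conjI allI impI ballI)
   fix i m p assume i: "i < length (map (\<lambda>t. A.LocK LA (?ga t) (velocity ?ga t)) ts)" and p: "p\<in>- ideal_power P LA"
   have t: "ts ! i\<in>{0..1}" using ts01 i by (metis length_map nth_mem subsetD)
   have "A.LocK LA (?ga (ts ! i)) (b - a) m p = KA (?ga (ts ! i)) (b - a) m p"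
    by (rule KA_LocK) (use loc[OF t] p in auto)
   thus "(map (\<lambda>t. A.LocK LA (?ga t) (velocity ?ga t)) ts ! i) m p = (map (\<lambda>t. KA (?ga t) (b - a)) ts ! i) m p"
    using i t by (simp add: velocity_quad)
  qed simp
 qed (use q in auto)
 finally have 1: "A.phi a b m q = A.klist (map (\<lambda>t. KA (?ga t) (b - a)) ts) m q" .
 have "B.phi (Tm s a) (Tm s b) m' q' = B.pk ?ga' m' q'" by (rule B.phi_seg[OF so' m(2)])
 also have "\<dots> = B.pkl LB ?ga' ts m' q'" by (rule B.pk_eq[OF adB q(2) gB])
 also have "\<dots> = B.klist (map (\<lambda>t. KB s (?ga t) (b - a)) ts) m' q'" unfolding B.pkl_def
 proof (rule B.klist_cong_on[OF B.down_closed_ideal_power[of LB], where M = UNIV])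
  show "list_all2 (\<lambda>K K'. \<forall>m\<in>UNIV. \<forall>p\<in>- ideal_power P' LB. K m p = K' m p)
   (map (\<lambda>t. B.LocK LB (?ga' t) (velocity ?ga' t)) ts) (map (\<lambda>t. KB s (?ga t) (b - a)) ts)"
   unfolding list_all2_conv_all_nth
  proof (intro conjI allI impI ballI)
   fix i m p assume i: "i < length (map (\<lambda>t. B.LocK LB (?ga' t) (velocity ?ga' t)) ts)" and p: "p\<in>- ideal_power P' LB"
   have t: "ts ! i\<in>{0..1}" using ts01 i by (metis length_map nth_mem subsetD)
   have "B.LocK LB (Tm s (?ga (ts ! i))) (Tm s (b - a)) m p = KB s (?ga (ts ! i)) (b - a) m p"
    by (rule KB_LocK) (use loc[OF t] p in auto)
   thus "(map (\<lambda>t. B.LocK LB (?ga' t) (velocity ?ga' t)) ts ! i) m p = (map (\<lambda>t. KB s (?ga t) (b - a)) ts ! i) m p"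
    using i t by (simp add: velocity_quad seg_TT linear_diff[OF linear_TT])
  qed simp
 qed (use q in auto)
 finally show ?thesis using 1 ts01 by blast
qed

end

section \<open>Differences of the two cocycles in the lowest level\<close>

context mut
begin

definition loc_agr :: "bool=>'a=>'a=>nat=>bool" where "loc_agr s x n j \<longleftrightarrow> A.G x n $ j = B.G (Tm s x) (Tn s n) $ j"

lemma goodk_phi: assumes "regular Fd a" "regular Fd b" "a\<noteq>b" "a\<in>HH s" "b\<in>HH s"
 shows "goodk (A.phi a b) (B.phi (Tm s a) (Tm s b))" unfolding goodk_def
proof (intro conjI A.ksupp_phi B.ksupp_phi)
 show "posk Fd lam (A.phi a b)" by (rule A.posk_phi[OF levA[OF _ _ HH_nonzero] HH_open HH_convex assms(4,5,1-3)])
 have T: "Tm s a\<in>HH s" "Tm s b\<in>HH s" "regular Fd (Tm s a)" "regular Fd (Tm s b)" "Tm s a\<noteq>Tm s b"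
  using assms inj_TT by (auto simp: HH_def regular_TT dest: injD)
 show "posk Fd lam (B.phi (Tm s a) (Tm s b))" by (rule B.posk_phi[OF levB[OF _ _ HH_nonzero] HH_open HH_convex T])
qed

lemma agr_phi_seg: assumes so: "seg_ok Fd a b" and S: "convex S" "S\<subseteq>HH s" "a\<in>S" "b\<in>S" and \<A>: "dcl \<A>"
  and loc: "\<And>x n j. x\<in>S ==> generic Fd x ==> prn n x ==> 0 < j ==> of_nat j *\<^sub>R n\<in>\<A> ==> loc_agr s x n j"
 shows "agr s \<A> (A.phi a b) (B.phi (Tm s a) (Tm s b))"
proof -
 have ab: "a\<in>HH s" "b\<in>HH s" using S by auto
 have main: "goodk (A.klist (map (\<lambda>t. KA (seg a b t) (b - a)) ts)) (B.klist (map (\<lambda>t. KB s (seg a b t) (b - a)) ts)) \<and>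
  agr s \<A> (A.klist (map (\<lambda>t. KA (seg a b t) (b - a)) ts)) (B.klist (map (\<lambda>t. KB s (seg a b t) (b - a)) ts))"
  if ts: "set ts\<subseteq>{0..1}" for ts
 proof (rule agr_klist[OF \<A>])
  fix t assume "t\<in>set ts"
  hence t: "t\<in>{0..1}" using ts by blast
  have x: "seg a b t\<in>S" by (rule seg_convex[OF S(1,3,4) t])
  have gx: "generic Fd (seg a b t)" using seg_ok_generic_path[OF so] t unfolding generic_path_def by blast
  have "e k\<bullet>seg a b t\<noteq>0" using HH_nonzero x S(2) by blast
  from goodk_local[OF gx this] agr_local[OF gx \<A>] loc[OF x gx]
  show "goodk (KA (seg a b t) (b - a)) (KB s (seg a b t) (b - a)) \<and> agr s \<A> (KA (seg a b t) (b - a)) (KB s (seg a b t) (b - a))"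
   unfolding loc_agr_def by blast
 qed
 show ?thesis unfolding agr_def
 proof (intro ballI)
  fix m n assume m: "m\<in>fd_Mcirc Fd" and n: "n\<in>\<A>"
  obtain ts where ts: "set ts\<subseteq>{0..1}" "A.phi a b m (p1 Fd n) = A.klist (map (\<lambda>t. KA (seg a b t) (b - a)) ts) m (p1 Fd n)"
   "B.phi (Tm s a) (Tm s b) (Tm s m) (Tm s (p1 Fd n)) = B.klist (map (\<lambda>t. KB s (seg a b t) (b - a)) ts) (Tm s m) (Tm s (p1 Fd n))"
   using seg_phi[OF so ab m TT_Mc[OF m sig_Ints], of "p1 Fd n" s "Tm s (p1 Fd n)"] by blast
  show "A.phi a b m (p1 Fd n) = B.phi (Tm s a) (Tm s b) (Tm s m) (Tm s (p1 Fd n))"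
   unfolding ts(2,3) using main[OF ts(1)] agrD[OF _ m n] by blast
 qed
qed

lemma phi_comp_both:
 assumes reg: "regular Fd a" "regular Fd b" "regular Fd c" and ne: "a\<noteq>b" "b\<noteq>c" "a\<noteq>c" and m: "m\<in>fd_Mcirc Fd"
 shows "A.phi a c m q = A.kstar (A.phi a b) (A.phi b c) m q"
  "B.phi (Tm s a) (Tm s c) m q = B.kstar (B.phi (Tm s a) (Tm s b)) (B.phi (Tm s b) (Tm s c)) m q"
proof -
 show "A.phi a c m q = A.kstar (A.phi a b) (A.phi b c) m q" by (rule A.phi_comp[OF reg ne m])
 show "B.phi (Tm s a) (Tm s c) m q = B.kstar (B.phi (Tm s a) (Tm s b)) (B.phi (Tm s b) (Tm s c)) m q"
  by (rule B.phi_comp) (use reg ne m inj_TT in \<open>auto simp: regular_TT dest: injD\<close>)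
qed

lemma agr_phi:
 assumes ab: "regular Fd a" "regular Fd b" "a\<noteq>b" and S: "open S" "convex S" "S\<subseteq>HH s" "a\<in>S" "b\<in>S" and \<A>: "dcl \<A>"
  and loc: "\<And>x n j. x\<in>S ==> generic Fd x ==> prn n x ==> 0 < j ==> of_nat j *\<^sub>R n\<in>\<A> ==> loc_agr s x n j"
 shows "goodk (A.phi a b) (B.phi (Tm s a) (Tm s b))" "agr s \<A> (A.phi a b) (B.phi (Tm s a) (Tm s b))"
proof -
 obtain c where c: "c\<in>S" "regular Fd c" "\<And>z. z\<in>{a, b} ==> seg_ok Fd z c"
  by (rule A.regular_escape[of "{a, b}" S]) (use ab S in auto)
 have so: "seg_ok Fd a c" "seg_ok Fd c b" using c(3) seg_ok_sym by auto
 hence ne: "a\<noteq>c" "c\<noteq>b" by (auto simp: seg_ok_def)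
 have H: "a\<in>HH s" "b\<in>HH s" "c\<in>HH s" using S c(1) by auto
 show "goodk (A.phi a b) (B.phi (Tm s a) (Tm s b))" by (rule goodk_phi[OF ab H(1,2)])
 have 1: "goodk (A.phi a c) (B.phi (Tm s a) (Tm s c))" "agr s \<A> (A.phi a c) (B.phi (Tm s a) (Tm s c))"
  by (rule goodk_phi[OF ab(1) c(2) ne(1) H(1,3)], rule agr_phi_seg[OF so(1) S(2-4) c(1) \<A> loc])
 have 2: "goodk (A.phi c b) (B.phi (Tm s c) (Tm s b))" "agr s \<A> (A.phi c b) (B.phi (Tm s c) (Tm s b))"
  by (rule goodk_phi[OF c(2) ab(2) ne(2) H(3,2)], rule agr_phi_seg[OF so(2) S(2,3) c(1) S(5) \<A> loc])
 note comp = phi_comp_both[OF ab(1) c(2) ab(2) ne ab(3)]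
 show "agr s \<A> (A.phi a b) (B.phi (Tm s a) (Tm s b))" unfolding agr_def
 proof (intro ballI)
  fix m n assume m: "m\<in>fd_Mcirc Fd" and n: "n\<in>\<A>"
  show "A.phi a b m (p1 Fd n) = B.phi (Tm s a) (Tm s b) (Tm s m) (Tm s (p1 Fd n))"
   using comp(1)[OF m] comp(2)[OF TT_Mc[OF m sig_Ints]] agrD[OF agr_kstar[OF 1(1) 2(1) \<A> 1(2) 2(2)] m n] by simp
 qed
qed

definition below :: "bool=>real=>bool" where
 "below s l \<longleftrightarrow> (\<forall>x n j. generic Fd x \<and> x\<in>HH s \<and> prn n x \<and> 0 < j \<and> of_nat j * (n\<bullet>lam) < l --> loc_agr s x n j)"

definition lowset :: "real=>'a set" where "lowset l = {n\<in>fd_Nuf Fd. 0 < n\<bullet>lam \<and> n\<bullet>lam < l}"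

text \<open>The parts of a vector of level at most l in a splitting into positive levels have level
  below l, so any vectors of level l may be added.\<close>

lemma dcl_extend: assumes "X\<subseteq>{n\<in>fd_Nuf Fd. 0 < n\<bullet>lam \<and> n\<bullet>lam = l}" shows "dcl (lowset l \<union> X)" unfolding dcl_def
proof (intro ballI conjI impI)
 fix n assume n: "n\<in>lowset l \<union> X"
 thus "n\<in>fd_Nuf Fd" "0 < n\<bullet>lam" using assms by (auto simp: lowset_def)
 have "n\<bullet>lam\<le>l" using n assms by (auto simp: lowset_def)
 thus "n1\<in>lowset l \<union> X" if "n1\<in>fd_Nuf Fd" "0 < n1\<bullet>lam \<and> 0 < (n - n1)\<bullet>lam" for n1
  using that by (auto simp: lowset_def inner_diff_left)
qed

lemma below_lowset: "below s l ==> x\<in>HH s ==> generic Fd x ==> prn n x ==> 0 < j ==> of_nat j *\<^sub>R n\<in>lowset l ==> loc_agr s x n j"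
 unfolding below_def lowset_def by auto

abbreviation dphi :: "bool=>'a=>'a=>'a=>'a=>('x, 'k) coeff_poly" where
 "dphi s a b m n \<equiv> A.phi a b m (p1 Fd n) - B.phi (Tm s a) (Tm s b) (Tm s m) (Tm s (p1 Fd n))"

lemma dphi_comp: assumes below: "below s (n\<bullet>lam)" and n: "n\<in>fd_Nuf Fd" "0 < n\<bullet>lam"
  and reg: "regular Fd a" "regular Fd b" "regular Fd c" and ne: "a\<noteq>b" "b\<noteq>c" "a\<noteq>c"
  and H: "a\<in>HH s" "b\<in>HH s" "c\<in>HH s" and m: "m\<in>fd_Mcirc Fd" shows "dphi s a c m n = dphi s a b m n + dphi s b c m n"
proof -
 have dcl: "dcl (lowset (n\<bullet>lam))" using dcl_extend[of "{}" "n\<bullet>lam"] by simp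
 note ab = agr_phi[OF reg(1,2) ne(1) HH_open HH_convex subset_refl H(1,2) dcl below_lowset[OF below]]
 note bc = agr_phi[OF reg(2,3) ne(2) HH_open HH_convex subset_refl H(2,3) dcl below_lowset[OF below]]
 have "A.kstar (A.phi a b) (A.phi b c) m (p1 Fd n) -
   B.kstar (B.phi (Tm s a) (Tm s b)) (B.phi (Tm s b) (Tm s c)) (Tm s m) (Tm s (p1 Fd n)) = dphi s a b m n + dphi s b c m n"
 proof (rule kstar_diff_good[OF ab(1) bc(1) dcl ab(2) bc(2) m n(1)])
  show "n\<noteq>0" using n(2) by auto
  show "n1\<in>lowset (n\<bullet>lam) \<and> n - n1\<in>lowset (n\<bullet>lam)"
   if "n1\<in>fd_Nuf Fd" "0 < n1\<bullet>lam" "0 < (n - n1)\<bullet>lam" for n1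
   using that A.Nu.diff[OF n(1) that(1)] by (auto simp: lowset_def inner_diff_left)
 qed
 thus ?thesis using phi_comp_both(1)[OF reg ne m] phi_comp_both(2)[OF reg ne TT_Mc[OF m sig_Ints]] by simp
qed

text \<open>The vector n may be added to the vectors of lower level, because S does not meet the
  hyperplane n^perp and so imposes no condition in this direction.\<close>

lemma dphi_same_side: assumes below: "below s (n\<bullet>lam)" and n: "n\<in>fd_Nuf Fd" "0 < n\<bullet>lam"
  and reg: "regular Fd a" "regular Fd b" "a\<noteq>b" and H: "a\<in>HH s" "b\<in>HH s"
  and side: "0 < t * (n\<bullet>a)" "0 < t * (n\<bullet>b)" and m: "m\<in>fd_Mcirc Fd" shows "dphi s a b m n = 0"
proof -
 define S where "S = HH s \<inter> {y. 0 < (t *\<^sub>R n)\<bullet>y}"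
 have "open S" "convex S" unfolding S_def
  by (intro open_Int HH_open open_halfspace_gt, intro convex_Int HH_convex convex_halfspace_gt)
 hence S: "open S" "convex S" "S\<subseteq>HH s" "a\<in>S" "b\<in>S" using H side by (auto simp: S_def)
 have dcl: "dcl (lowset (n\<bullet>lam) \<union> {n})" by (rule dcl_extend) (use n in auto)
 have "agr s (lowset (n\<bullet>lam) \<union> {n}) (A.phi a b) (B.phi (Tm s a) (Tm s b))"
 proof (rule agr_phi(2)[OF reg S dcl])
  fix x n' j assume x: "x\<in>S" "generic Fd x" "prn n' x" "0 < (j::nat)" "of_nat j *\<^sub>R n'\<in>lowset (n\<bullet>lam) \<union> {n}"
  have "of_nat j *\<^sub>R n'\<noteq>n"
  proof
   assume "of_nat j *\<^sub>R n' = n"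
   hence "n\<bullet>x = 0" using prnD(4)[OF x(3)] by (metis inner_scaleR_left mult_zero_right)
   thus False using x(1) by (simp add: S_def)
  qed
  thus "loc_agr s x n' j" using below_lowset[OF below _ x(2-4)] x(1,5) S(3) by blast
 qed
 from agrD[OF this m, of n] show ?thesis by simp
qed

text \<open>By additivity the path may be replaced by a passage of n^perp close to x, as the
  connecting pieces contribute nothing; there both cocycles are powers of local functions that agree
  below j. The left side does not mention x, so the difference of local functions is the same along
  n^perp.\<close>

lemma delta:
 assumes x: "generic Fd x" "x\<in>HH s" "prn n x" and j: "0 < (j::nat)" and below: "below s (of_nat j * (n\<bullet>lam))"
  and ab: "regular Fd a" "regular Fd b" "a\<in>HH s" "b\<in>HH s" "n\<bullet>a < 0" "0 < n\<bullet>b" and m: "m\<in>fd_Mcirc Fd"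
 shows "dphi s a b m (of_nat j *\<^sub>R n) = of_int \<lfloor>- (A.pc n\<bullet>m)\<rfloor> * (A.G x n $ j - B.G (Tm s x) (Tn s n) $ j)"
proof -
 note n = prnD[OF x(3)]
 note n' = prnD[OF prn_TN[OF x(3), of "sig s", simplified]]
 let ?n = "of_nat j *\<^sub>R n"
 have nN: "?n\<in>fd_Nuf Fd" "0 < ?n\<bullet>lam" using A.Nu.scale_nat[OF n(1)] n(3) j by auto
 have bel: "below s (?n\<bullet>lam)" using below by simp
 have x': "generic Fd (Tm s x)" "e k\<bullet>x\<noteq>0" "e k\<bullet>Tm s x\<noteq>0" using x HH_nonzero[OF x(2)] by (simp_all add: generic_TT)
 define LA LB where "LA = A.Lof (p1 Fd ?n)" and "LB = B.Lof (Tm s (p1 Fd ?n))"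
 have q: "p1 Fd ?n\<notin>ideal_power P LA" "Tm s (p1 Fd ?n)\<notin>ideal_power P' LB" unfolding LA_def LB_def by (rule A.Lof, rule B.Lof)
 obtain r where r: "A.crosses LA x n (A.G x n) r" using A.phi_cross_gen[OF x(1) levA[OF _ _ x'(2)] n(1-4)] by blast
 obtain r' where r': "B.crosses LB (Tm s x) (Tn s n) (B.G (Tm s x) (Tn s n)) r'"
  using B.phi_cross_gen[OF x'(1) levB[OF _ _ x'(3)] n'(1-4)] by blast
 have rp: "0 < r" "0 < r'" using r r' by (auto simp: A.crosses_def B.crosses_def)
 define S where "S = ball x r \<inter> Tm s -` ball (Tm s x) r' \<inter> HH s"
 have S: "open S" "x\<in>S" unfolding S_def using rp x(2) HH_open
  by (auto intro!: open_Int open_vimage linear_continuous_on simp: linear_TT linear_conv_bounded_linear[symmetric])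
 obtain a2 where a2: "a2\<in>S" "regular Fd a2" "0 < - n\<bullet>a2" "\<And>z. z\<in>{a, b} ==> seg_ok Fd z a2"
  by (rule A.near_side[of "{a, b}" "- n" x S]) (use ab n(4,6) S in auto)
 obtain b2 where b2: "b2\<in>S" "regular Fd b2" "0 < n\<bullet>b2" "\<And>z. z\<in>{a, b, a2} ==> seg_ok Fd z b2"
  by (rule A.near_side[of "{a, b, a2}" "n" x S]) (use ab a2 n(4,6) S in auto)
 have ne: "a\<noteq>a2" "a2\<noteq>b" "a2\<noteq>b2" "b2\<noteq>b" "a\<noteq>b"
  using a2(4)[of a] a2(4)[of b] b2(4)[of a2] b2(4)[of b] ab by (auto simp: seg_ok_def)
 have H2: "a2\<in>HH s" "b2\<in>HH s" using a2(1) b2(1) by (auto simp: S_def)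
 have "dphi s a b m ?n = dphi s a a2 m ?n + dphi s a2 b m ?n"
  by (rule dphi_comp[OF bel nN ab(1) a2(2) ab(2) ne(1,2,5) ab(3) H2(1) ab(4) m])
 also have "dphi s a a2 m ?n = 0"
  by (rule dphi_same_side[OF bel nN ab(1) a2(2) ne(1) ab(3) H2(1), of "-1"]) (use ab a2 j m in \<open>auto simp: mult_pos_neg\<close>)
 also have "dphi s a2 b m ?n = dphi s a2 b2 m ?n + dphi s b2 b m ?n"
  by (rule dphi_comp[OF bel nN a2(2) b2(2) ab(2) ne(3,4,2) H2 ab(4) m])
 also have "dphi s b2 b m ?n = 0"
  by (rule dphi_same_side[OF bel nN b2(2) ab(2) ne(4) H2(2) ab(4), of 1]) (use ab b2 j m in auto)
 finally have 1: "dphi s a b m ?n = dphi s a2 b2 m ?n" by simp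
 let ?N = "\<lfloor>- (A.pc n\<bullet>m)\<rfloor>"
 have cn: "A.cnorm n (b2 - a2) = - A.pc n" using a2(3) b2(3) by (simp add: A.cnorm_def inner_diff_right)
 have side: "(n\<bullet>a2) * (n\<bullet>b2) < 0" using a2(3) b2(3) by (simp add: mult_neg_pos)
 have pj: "p1 Fd ?n = of_nat j *\<^sub>R p1 Fd n" by (simp add: linear_scale[OF A.linear_p1])
 have "A.phi a2 b2 m (p1 Fd ?n) = wk (A.cnorm n (b2 - a2)) (p1 Fd n) (A.G x n) m (p1 Fd ?n)"
  by (rule A.crossesD[OF r _ _ a2(2) b2(2) side q(1) m]) (use a2(1) b2(1) in \<open>auto simp: S_def\<close>)
 hence A: "A.phi a2 b2 m (p1 Fd ?n) = fpow (A.G x n) ?N $ j" unfolding cn pj wk_def using n(7) by simp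
 have "B.phi (Tm s a2) (Tm s b2) (Tm s m) (Tm s (p1 Fd ?n)) =
   wk (A.cnorm (Tn s n) (Tm s b2 - Tm s a2)) (p1 Fd (Tn s n)) (B.G (Tm s x) (Tn s n)) (Tm s m) (Tm s (p1 Fd ?n))"
  by (rule B.crossesD[OF r']) (use a2 b2 side q TT_Mc[OF m] in \<open>auto simp: S_def regular_TT TN_pairing\<close>)
 also have "\<dots> = wk (A.cnorm n (b2 - a2)) (p1 Fd n) (B.G (Tm s x) (Tn s n)) m (p1 Fd ?n)"
  unfolding linear_diff[OF linear_TT, symmetric] by (rule wk_TT[OF sig_Ints n(5-7)])
 finally have B: "B.phi (Tm s a2) (Tm s b2) (Tm s m) (Tm s (p1 Fd ?n)) = fpow (B.G (Tm s x) (Tn s n)) ?N $ j"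
  unfolding cn pj wk_def using n(7) by simp
 have "A.G x n $ i = B.G (Tm s x) (Tn s n) $ i" if i: "i < j" for i
 proof (cases "i = 0")
  case False
  have "of_nat i * (n\<bullet>lam) < of_nat j * (n\<bullet>lam)" using i n(3) by simp
  thus ?thesis using below False x unfolding below_def loc_agr_def by blast
 qed (simp add: A.G_0 B.G_0)
 from fpow_nth_diff[OF A.G_0 B.G_0 this j, where N = ?N] show ?thesis unfolding 1 A B by simp
qed

end

section \<open>Local functions before and after mutation\<close>

context mut
begin

lemma p1_e': "p1 Fd (mutate_seed Fd k e k) = - p1 Fd (e k)" by (simp add: mutate_seed_def linear_neg[OF A.linear_p1])

lemma ek_p1_e': assumes "i\<noteq>k" shows "e k\<bullet>p1 Fd (mutate_seed Fd k e i) = e k\<bullet>p1 Fd (e i)"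
 using assms by (simp add: mutate_seed_def linear_add[OF A.linear_p1] linear_scale[OF A.linear_p1] inner_right_distrib A.p1_self)

text \<open>The positive part in the mutation formula is the full entry or zero according to the
  side of e_k^perp to which p1(e_i) points; the same side decides whether \<open>Tn s\<close> shears
  or is the identity.\<close>

lemma TN_e: assumes "i\<noteq>k" "0\<le>sg s * (e k\<bullet>p1 Fd (e i))" shows "Tn s (e i) = mutate_seed Fd k e i"
proof -
 have eps: "seed_epsilon Fd e i k = (e k\<bullet>p1 Fd (e i)) * of_nat (fd_d Fd k)"
  by (simp add: seed_epsilon_def A.p1_inner)
 show ?thesis
 proof (cases s)
  case True
  hence "0\<le>seed_epsilon Fd e i k" using assms(2) by (simp add: eps sg_def)
  thus ?thesis using True assms(1) by (simp add: mutate_seed_def TN_def eps cc_def sig_def mult_ac)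
 next
  case False
  hence "e k\<bullet>p1 Fd (e i)\<le>0" using assms(2) by (simp add: sg_def)
  hence "seed_epsilon Fd e i k\<le>0" by (simp add: eps mult_nonpos_nonneg)
  thus ?thesis using False assms(1) by (simp add: mutate_seed_def TN_def sig_def)
 qed
qed

text \<open>On the matching side, seed vectors correspond to mutated seed vectors of the same index,
  which have the same exchange coefficients; the index k is excluded by positive level.\<close>

lemma init_eq: assumes n: "0 < n\<bullet>lam" "0\<le>sg s * (e k\<bullet>p1 Fd n)" shows "A.init n j = B.init (Tn s n) j"
proof (cases "\<exists>i\<in>fd_Iuf Fd. e i = n")
 case True
 then obtain i where i: "i\<in>fd_Iuf Fd" "e i = n" by blast
 have "i\<noteq>k" using i(2) n(1) by auto
 hence "Tn s n = mutate_seed Fd k e i" using TN_e n(2) i(2) by blast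
 thus ?thesis using A.init_e[OF i(1)] B.init_e[OF i(1)] i(2) by simp
next
 case False
 have "\<not> (\<exists>i\<in>fd_Iuf Fd. mutate_seed Fd k e i = Tn s n)"
 proof
  assume "\<exists>i\<in>fd_Iuf Fd. mutate_seed Fd k e i = Tn s n"
  then obtain i where i: "i\<in>fd_Iuf Fd" "mutate_seed Fd k e i = Tn s n" by blast
  have ik: "i\<noteq>k"
  proof
   assume "i = k"
   hence "Tn s n\<bullet>lam = (- e k)\<bullet>lam" using i(2) by (simp add: mutate_seed_def)
   thus False using n(1) by simp
  qed
  have "e k\<bullet>p1 Fd n = e k\<bullet>p1 Fd (Tn s n)" by (simp add: p1_TN)
  also have "\<dots> = e k\<bullet>p1 Fd (e i)" unfolding i(2)[symmetric] by (rule ek_p1_e'[OF ik])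
  finally have "Tn s (e i) = Tn s n" using TN_e[OF ik] n(2) i(2) by simp
  hence "e i = n" using inj_TN by (metis injD)
  thus False using False i(1) by blast
 qed
 thus ?thesis using False by (simp add: A.init_def B.init_def)
qed

lemma not_parallel: assumes "0 < n\<bullet>lam" shows "e k\<noteq>t *\<^sub>R n"
proof
 assume *: "e k = t *\<^sub>R n"
 hence "t * (n\<bullet>lam) = 0" using ek_lam by (metis inner_scaleR_left)
 hence "t = 0" using assms by simp
 thus False using * A.e_nonzero[OF kI] by simp
qed

lemma hyperplane_side: assumes "\<And>t. g\<noteq>t *\<^sub>R n" "n\<noteq>(0::'a)"
 obtains z where "n\<bullet>z = 0" "0 < g\<bullet>z"
proof
 define z where "z = g - ((g\<bullet>n) / (n\<bullet>n)) *\<^sub>R n"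
 show nz: "n\<bullet>z = 0" using assms(2) by (simp add: z_def inner_diff_right inner_commute)
 have "z\<noteq>0" using assms(1) by (simp add: z_def)
 moreover have "g\<bullet>z = z\<bullet>z"
 proof -
  have "z\<bullet>z = g\<bullet>z - ((g\<bullet>n) / (n\<bullet>n)) * (n\<bullet>z)" by (simp add: z_def[of] inner_diff_left)
  thus ?thesis using nz by simp
 qed
 ultimately show "0 < g\<bullet>z" by simp
qed

text \<open>Near the multiple j of p1(n) both diagrams show only initial walls in this direction.
  That point may lie on e_k^perp, so it is first moved along n^perp into the open
  half-space.\<close>

lemma incoming_side: assumes n: "n\<in>fd_Nuf Fd" "primitive_in (fd_N Fd) n" "0 < n\<bullet>lam" and j: "0 < (j::nat)"
  and side: "0\<le>sg s * (e k\<bullet>p1 Fd n)" shows "\<exists>x. generic Fd x \<and> x\<in>HH s \<and> prn n x \<and> loc_agr s x n j"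
proof -
 have nz: "n\<noteq>0" using n(3) by auto
 let ?p = "of_nat j *\<^sub>R p1 Fd n"
 have n': "Tn s n\<in>fd_Nuf Fd" "primitive_in (fd_N Fd) (Tn s n)" "0 < Tn s n\<bullet>lam"
  using TN_Nu[OF n(1)] primitive_TN[OF _ n(2)] n(3) by auto
 have Tp: "of_nat j *\<^sub>R p1 Fd (Tn s n) = Tm s ?p" by (simp add: p1_TN linear_scale[OF linear_TT])
 obtain r where r: "r > 0" "\<forall>y\<in>ball ?p r. generic Fd y \<and> n\<bullet>y = 0 \<and> y\<in>HH s --> A.G y n $ j = A.init n j"
  using A.near_init_gen[of "HH s" lam n j] levA HH_nonzero n j by blast
 obtain r' where r': "r' > 0" "\<forall>y\<in>ball (Tm s ?p) r'. generic Fd y \<and> Tn s n\<bullet>y = 0 \<and> y\<in>HH s --> B.G y (Tn s n) $ j = B.init (Tn s n) j"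
  using B.near_init_gen[of "HH s" lam "Tn s n" j] levB HH_nonzero n' j unfolding Tp by blast
 define S where "S = ball ?p r \<inter> Tm s -` ball (Tm s ?p) r'"
 have S: "open S" "?p\<in>S" unfolding S_def using r(1) r'(1)
  by (auto intro!: open_Int open_vimage linear_continuous_on simp: linear_TT linear_conv_bounded_linear[symmetric])
 obtain z0 where z0: "n\<bullet>z0 = 0" "0 < e k\<bullet>z0" by (rule hyperplane_side[OF not_parallel[OF n(3)] nz])
 define z where "z = sg s *\<^sub>R z0"
 have z: "n\<bullet>z = 0" "0 < sg s * (e k\<bullet>z)" using z0 by (auto simp: z_def sg_def)
 have "open ((\<lambda>t::real. ?p + t *\<^sub>R z) -` S)" by (intro open_vimage S(1) continuous_intros)
 moreover have "0\<in>(\<lambda>t::real. ?p + t *\<^sub>R z) -` S" using S(2) by simp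
 ultimately obtain \<epsilon> where eps: "\<epsilon> > 0" "ball 0 \<epsilon>\<subseteq>(\<lambda>t::real. ?p + t *\<^sub>R z) -` S" by (metis openE)
 define y0 where "y0 = ?p + (\<epsilon> / 2) *\<^sub>R z"
 have "\<epsilon> / 2\<in>ball 0 \<epsilon>" using eps(1) by simp
 hence y0S: "y0\<in>S" using eps(2) unfolding y0_def by blast
 have "sg s * (e k\<bullet>y0) = of_nat j * (sg s * (e k\<bullet>p1 Fd n)) + (\<epsilon> / 2) * (sg s * (e k\<bullet>z))"
  by (simp add: y0_def inner_right_distrib distrib_left mult_ac)
 also have "\<dots> > 0" 
  by (rule add_nonneg_pos[OF mult_nonneg_nonneg[OF _ side] mult_pos_pos[OF _ z(2)]]) (use eps(1) in auto)
 finally have y0H: "y0\<in>HH s" by (simp add: HH_def)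
 have ny0: "n\<bullet>y0 = 0" using z(1) A.p1_self by (simp add: y0_def inner_right_distrib)
 obtain x where x: "x\<in>S \<inter> HH s" "n\<bullet>x = 0" "generic Fd x"
  by (rule A.generic_on_hyperplane[OF nz ny0, of "S \<inter> HH s"]) (use y0S y0H S(1) HH_open in auto)
 have "A.G x n $ j = A.init n j" using r(2) x by (auto simp: S_def)
 moreover have "B.G (Tm s x) (Tn s n) $ j = B.init (Tn s n) j"
 proof -
  have "Tm s x\<in>ball (Tm s ?p) r'" "Tm s x\<in>HH s" using x(1) by (auto simp: S_def HH_def)
  moreover have "generic Fd (Tm s x)" "Tn s n\<bullet>Tm s x = 0" using x by (simp_all add: generic_TT TN_pairing)
  ultimately show ?thesis using r'(2) by blast
 qed
 ultimately have "loc_agr s x n j" using init_eq[OF n(3) side] by (simp add: loc_agr_def)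
 moreover have "prn n x" using n x(2) by (simp add: prn_def)
 ultimately show ?thesis using x by blast
qed

text \<open>Since the level is the sum of the pairings with the dual basis vectors other than
  \<open>ed k\<close>, one of these pairs nontrivially with n; all of them are orthogonal to
  e_k.\<close>

lemma ed_detects: assumes n: "n\<in>fd_Nuf Fd" "0 < n\<bullet>lam"
 obtains m where "m\<in>fd_Mcirc Fd" "e k\<bullet>m = 0" "n\<bullet>m\<noteq>0"
proof -
 have "n\<bullet>lam = (\<Sum>i\<in>fd_Iuf Fd - {k}. n\<bullet>A.ed i)" by (simp add: lam_def A.lamk_def inner_sum_right)
 then obtain i where i: "i\<in>fd_Iuf Fd - {k}" "n\<bullet>A.ed i\<noteq>0" using n(2) by (metis less_irrefl sum.neutral)
 hence iI: "i\<in>fd_I Fd" using A.IufI by blast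
 show ?thesis by (rule that[OF A.ed_Mc[OF iI]]) (use i A.ed[OF iI kI] in auto)
qed

lemma delta_zero:
 assumes x: "generic Fd x" "x\<in>HH s" "prn n x" and j: "0 < (j::nat)" and below: "below s (of_nat j * (n\<bullet>lam))"
  and ab: "regular Fd a" "regular Fd b" "a\<in>HH s" "b\<in>HH s" "n\<bullet>a < 0" "0 < n\<bullet>b"
  and z: "\<And>m. m\<in>fd_Mcirc Fd ==> e k\<bullet>m = 0 ==> dphi s a b m (of_nat j *\<^sub>R n) = 0" shows "loc_agr s x n j"
proof -
 note n = prnD[OF x(3)]
 obtain m where m: "m\<in>fd_Mcirc Fd" "e k\<bullet>m = 0" "n\<bullet>m\<noteq>0" by (rule ed_detects[OF n(1,3)])
 have "\<lfloor>- (A.pc n\<bullet>m)\<rfloor> = - \<lfloor>A.pc n\<bullet>m\<rfloor>" using A.pc_int[OF n(5,6) m(1)] by (auto elim!: Ints_cases)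
 hence "\<lfloor>- (A.pc n\<bullet>m)\<rfloor>\<noteq>0" using A.pc_floor_nonzero[OF n(5,6) m(1,3)] by simp
 moreover have "of_int \<lfloor>- (A.pc n\<bullet>m)\<rfloor> * (A.G x n $ j - B.G (Tm s x) (Tn s n) $ j) = 0"
  using delta[OF x j below ab m(1)] z[OF m(1,2)] by simp
 ultimately have "A.G x n $ j - B.G (Tm s x) (Tn s n) $ j = 0" by (rule coeff_poly_torsion_free[rotated])
 thus ?thesis by (simp add: loc_agr_def)
qed

lemma sides_exist: assumes x: "x\<in>HH s" "n\<bullet>x = 0" "n\<noteq>0"
 obtains a b where "regular Fd a" "regular Fd b" "a\<in>HH s" "b\<in>HH s" "n\<bullet>a < 0" "0 < n\<bullet>b"
proof -
 obtain a where a: "a\<in>HH s" "regular Fd a" "0 < - n\<bullet>a"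
  by (rule A.near_side[of "{}" "- n" x "HH s"]) (use x HH_open in auto)
 obtain b where b: "b\<in>HH s" "regular Fd b" "0 < n\<bullet>b"
  by (rule A.near_side[of "{}" "n" x "HH s"]) (use x HH_open in auto)
 show ?thesis by (rule that[of a b]) (use a b in auto)
qed

text \<open>Agreement at one point of n^perp makes the difference of the cocycles vanish, and
  \<open>delta\<close> carries this to every other point on the same side.\<close>

lemma matching_side:
 assumes x: "generic Fd x" "x\<in>HH s" "prn n x" and j: "0 < (j::nat)" and below: "below s (of_nat j * (n\<bullet>lam))"
  and side: "0\<le>sg s * (e k\<bullet>p1 Fd n)" shows "loc_agr s x n j"
proof -
 note n = prnD[OF x(3)]
 obtain x2 where x2: "generic Fd x2" "x2\<in>HH s" "prn n x2" "loc_agr s x2 n j"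
  using incoming_side[OF n(1-3) j side] by blast
 obtain a b where ab: "regular Fd a" "regular Fd b" "a\<in>HH s" "b\<in>HH s" "n\<bullet>a < 0" "0 < n\<bullet>b"
  by (rule sides_exist[OF x(2) n(4,6)])
 have "dphi s a b m (of_nat j *\<^sub>R n) = 0" if "m\<in>fd_Mcirc Fd" for m
  using delta[OF x2(1-3) j below ab that] x2(4) by (simp add: loc_agr_def)
 thus ?thesis by (rule delta_zero[OF x j below ab])
qed

text \<open>The shears fix y1 and y2, so points close to these have images close to them. The
  vectors n - i e_k are those whose exponents a polynomial in z^(p1 e_k) can move to p1(n).\<close>

definition bcross :: "bool=>'a=>'a=>'a=>real=>bool" where
 "bcross s n y1 y2 r \<longleftrightarrow> 0 < r \<and> (\<forall>a0 a1 b0 b1 m. regular Fd a0 \<and> regular Fd a1 \<and> regular Fd b0 \<and> regular Fd b1 \<and>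
   {a0, Tm s a0, a1, Tm (\<not> s) a1}\<subseteq>ball y1 r \<and> {b0, Tm s b0, b1, Tm (\<not> s) b1}\<subseteq>ball y2 r \<and>
   a0\<noteq>b0 \<and> a1\<noteq>b1 \<and> a0\<in>HH s \<and> b0\<in>HH s \<and> a1\<in>HH (\<not> s) \<and> b1\<in>HH (\<not> s) \<and> m\<in>fd_Mcirc Fd \<and> e k\<bullet>m = 0 \<and>
   (\<forall>i::nat. dphi s a0 b0 m (n - of_nat i *\<^sub>R e k) = 0) --> dphi (\<not> s) a1 b1 m n = 0)"

text \<open>With v = p1(e_k), both cocycles on the far side arise from those on the side s by
  multiplication with the same power of the exchange polynomial, in z^v for one seed and in z^(-v)
  for the other. The shears reverse the order of the terms, and palindromy identifies the two
  sums.\<close>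

lemma cross_both: assumes n: "n\<in>fd_Nuf Fd" and y1: "generic Fd y1" "e k\<bullet>y1 = 0" and y2: "generic Fd y2" "e k\<bullet>y2 = 0"
  and side: "0\<le>sg s * (e k\<bullet>p1 Fd n)" shows "\<exists>r. bcross s n y1 y2 r"
proof -
 let ?e = "mutate_seed Fd k e"
 let ?v = "p1 Fd (e k)" and ?q = "p1 Fd n" and ?q' = "Tm (\<not> s) (p1 Fd n)"
 let ?F = "eser Fd k :: ('x, 'k) coeff_poly fps"
 \<comment> \<open>N is the exponent with which e_k^perp is crossed here. The degree of the N-th
   power is at most d, and d is also the number of steps v by which \<open>Tm s\<close> and
   \<open>Tm (\<not> s)\<close> differ on p1(n).\<close>
 define N where "N = nat \<lfloor>\<bar>A.pc (e k)\<bullet>?q\<bar>\<rfloor>"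
 define d where "d = fd_r Fd k * N"
 have e'k: "?e k = - e k" by (simp add: mutate_seed_def)
 have y': "?e k\<bullet>y1 = 0" "?e k\<bullet>y2 = 0" using y1 y2 by (simp_all add: e'k)
 have pal: "palindromic (fd_r Fd k) ?F"
 proof (rule eser_palindromic)
  have "\<forall>i\<in>fd_I Fd. \<forall>j\<in>{0<..<fd_r Fd i}. fd_a Fd i j = fd_a Fd i (fd_r Fd i - j)"
   using seed unfolding reciprocal_torus_seed_def by (elim conjE) assumption
  thus "\<forall>j\<in>{0<..<fd_r Fd k}. fd_a Fd k j = fd_a Fd k (fd_r Fd k - j)" using kI by (rule bspec)
 qed
 have palN: "(?F ^ N) $ i = (?F ^ N) $ (d - i)" if "i\<le>d" for i
 proof -
  have "(?F ^ N) $ i = (if i\<le>N * fd_r Fd k then (?F ^ N) $ (N * fd_r Fd k - i) else 0)"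
   using palindromic_power[OF pal, of N] unfolding palindromic_def by (rule spec)
  thus ?thesis using that by (simp only: d_def mult.commute[of "fd_r Fd k"] if_True)
 qed
 have deg: "(?F ^ N) $ i = 0" if "d < i" for i
  by (rule palindromic_power_degree[OF pal]) (use that in \<open>simp add: d_def\<close>)
 have pcq: "A.pc (e k)\<bullet>?q = of_nat (fd_d Fd k) * (e k\<bullet>?q)" by (simp add: pc_ek)
 have "A.pc (e k)\<bullet>?q\<in>\<int>" unfolding pcq by (rule dk_int) (use n A.NuN in blast)
 then obtain z where z: "A.pc (e k)\<bullet>?q = of_int z" by (auto elim: Ints_cases)
 have "of_nat N = \<bar>A.pc (e k)\<bullet>?q\<bar>" unfolding N_def z by (simp flip: of_int_abs)
 also have "\<dots> = of_nat (fd_d Fd k) * (sg s * (e k\<bullet>?q))"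
  unfolding pcq abs_mult using side by (cases s) (auto simp: sg_def)
 finally have NR: "of_nat d = cc * (sg s * (e k\<bullet>?q))" by (simp add: d_def cc_def)
 \<comment> \<open>Counted from the image on the far side in steps of -v, step i becomes step d -
   i.\<close>
 have shift: "Tm s (?q - of_nat i *\<^sub>R ?v) = ?q' - of_nat (d - i) *\<^sub>R (- ?v)" if "i\<le>d" for i
 proof -
  have "Tm s (?q - of_nat i *\<^sub>R ?v) = ?q + (sig s * cc * (e k\<bullet>?q)) *\<^sub>R ?v - of_nat i *\<^sub>R ?v"
   by (simp add: TT_def inner_diff_right A.p1_self)
  moreover have "?q' = ?q + (sig (\<not> s) * cc * (e k\<bullet>?q)) *\<^sub>R ?v" by (simp add: TT_def)
  moreover have "sig s * cc * (e k\<bullet>?q) = sig (\<not> s) * cc * (e k\<bullet>?q) + of_nat d"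
   unfolding NR by (cases s) (auto simp: sig_def sg_def)
  ultimately show ?thesis using that by (simp add: of_nat_diff scaleR_diff_left scaleR_add_left)
 qed
 obtain rA where rA: "A.hcross k y1 y2 ?q rA" using A.cross_hyperplane[OF k y1 y2] by blast
 obtain rB where rB: "B.hcross k y1 y2 ?q' rB" using B.cross_hyperplane[OF k y1(1) y'(1) y2(1) y'(2)] by blast
 have N': "nat \<lfloor>\<bar>A.pc (?e k)\<bullet>?q'\<bar>\<rfloor> = N"
  unfolding N_def e'k A.pc_uminus[OF A.e_mem(1)[OF kI] A.e_nonzero[OF kI]] pc_ek by simp
 show ?thesis unfolding bcross_def
 proof (intro exI[of _ "min rA rB"] conjI allI impI, use rA rB in \<open>simp add: A.hcross_def B.hcross_def\<close>, elim conjE)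
  fix a0 a1 b0 b1 m
  assume reg: "regular Fd a0" "regular Fd a1" "regular Fd b0" "regular Fd b1"
   and near: "{a0, Tm s a0, a1, Tm (\<not> s) a1}\<subseteq>ball y1 (min rA rB)" "{b0, Tm s b0, b1, Tm (\<not> s) b1}\<subseteq>ball y2 (min rA rB)"
   and ne: "a0\<noteq>b0" "a1\<noteq>b1" and H: "a0\<in>HH s" "b0\<in>HH s" "a1\<in>HH (\<not> s)" "b1\<in>HH (\<not> s)"
   and m: "m\<in>fd_Mcirc Fd" "e k\<bullet>m = 0" and agr: "\<forall>i::nat. dphi s a0 b0 m (n - of_nat i *\<^sub>R e k) = 0"
  have Tmm: "TT \<sigma> m = m" for \<sigma> using m(2) by (simp add: TT_def)
  have sides: "(e k\<bullet>a0) * (e k\<bullet>a1) < 0" "(e k\<bullet>b0) * (e k\<bullet>b1) < 0" "0 < (e k\<bullet>a0) * (e k\<bullet>b0)" "0\<le>(e k\<bullet>b0) * (e k\<bullet>?q)"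
   using H side by (cases s; auto simp: HH_def sg_def mult_less_0_iff zero_less_mult_iff zero_le_mult_iff)+
  have ne': "a0\<noteq>b1" "Tm s a0\<noteq>Tm (\<not> s) b1" "Tm s a0\<noteq>Tm s b0" "Tm (\<not> s) a1\<noteq>Tm (\<not> s) b1"
  proof -
   have "e k\<bullet>a0\<noteq>e k\<bullet>b1" using H by (cases s) (auto simp: HH_def sg_def)
   thus "a0\<noteq>b1" "Tm s a0\<noteq>Tm (\<not> s) b1" by (metis, metis ek_TT)
   show "Tm s a0\<noteq>Tm s b0" "Tm (\<not> s) a1\<noteq>Tm (\<not> s) b1" using ne inj_TT by (metis injD)+
  qed
  have "A.phi a1 b1 m ?q = (\<Sum>p\<in>A.dec ?q. A.phi a0 b0 m p * ray ?v (?F ^ N) (?q - p))"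
   unfolding N_def by (rule rA[unfolded A.hcross_def, THEN conjunct2, rule_format]) (use reg near ne ne' sides m in auto)
  also have "\<dots> = (\<Sum>i\<le>d. (?F ^ N) $ i * A.phi a0 b0 m (?q - of_nat i *\<^sub>R ?v))"
   by (rule A.ray_conv_sum) (use A.p1_Nplus[OF A.e_Nplus[OF k]] A.ksupp_phi deg in \<open>auto simp: A.ksupp_def\<close>)
  finally have 1: "A.phi a1 b1 m ?q = (\<Sum>i\<le>d. (?F ^ N) $ i * A.phi a0 b0 m (?q - of_nat i *\<^sub>R ?v))" .
  have "B.phi (Tm (\<not> s) a1) (Tm (\<not> s) b1) m ?q' =
    (\<Sum>p\<in>B.dec ?q'. B.phi (Tm s a0) (Tm s b0) m p * ray (p1 Fd (?e k)) (?F ^ N) (?q' - p))"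
   unfolding N'[symmetric] by (rule rB[unfolded B.hcross_def, THEN conjunct2, rule_format]) (use reg near ne ne' sides m in \<open>auto simp: regular_TT e'k\<close>)
  also have "\<dots> = (\<Sum>i\<le>d. (?F ^ N) $ i * B.phi (Tm s a0) (Tm s b0) m (?q' - of_nat i *\<^sub>R p1 Fd (?e k)))"
   by (rule B.ray_conv_sum) (use B.p1_Nplus[OF B.e_Nplus[OF k]] B.ksupp_phi deg in \<open>auto simp: B.ksupp_def\<close>)
  also have "\<dots> = (\<Sum>i\<le>d. (?F ^ N) $ (d - i) * B.phi (Tm s a0) (Tm s b0) m (?q' - of_nat (d - i) *\<^sub>R p1 Fd (?e k)))"
   by (rule sum.nat_diff_reindex[of _ "Suc d", simplified lessThan_Suc_atMost, simplified, symmetric])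
  also have "\<dots> = (\<Sum>i\<le>d. (?F ^ N) $ i * A.phi a0 b0 m (?q - of_nat i *\<^sub>R ?v))"
  proof (rule sum.cong[OF refl])
   fix i assume "i\<in>{..d}"
   hence i: "i\<le>d" by simp
   have qi: "p1 Fd (n - of_nat i *\<^sub>R e k) = ?q - of_nat i *\<^sub>R ?v"
    by (simp add: linear_diff[OF A.linear_p1] linear_scale[OF A.linear_p1])
   have "B.phi (Tm s a0) (Tm s b0) m (?q' - of_nat (d - i) *\<^sub>R p1 Fd (?e k)) = A.phi a0 b0 m (?q - of_nat i *\<^sub>R ?v)"
    using spec[OF agr, of i] unfolding qi shift[OF i] p1_e' Tmm by simp
   thus "(?F ^ N) $ (d - i) * B.phi (Tm s a0) (Tm s b0) m (?q' - of_nat (d - i) *\<^sub>R p1 Fd (?e k)) =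
     (?F ^ N) $ i * A.phi a0 b0 m (?q - of_nat i *\<^sub>R ?v)" using palN[OF i] by simp
  qed
  finally show "dphi (\<not> s) a1 b1 m n = 0" using 1 Tmm by simp
 qed
qed

text \<open>When p1(n) points to the side s, the incoming argument is available there, and agreement
  is carried across e_k^perp by \<open>cross_both\<close>. The vectors n - i e_k have the level of n
  and pair with e_k under the form as n does, so they lie in X and are settled by
  \<open>matching_side\<close>.\<close>

lemma other_side: assumes x: "generic Fd x" "x\<in>HH (\<not> s)" "prn n x" and j: "0 < (j::nat)"
  and below: "below s (of_nat j * (n\<bullet>lam))" "below (\<not> s) (of_nat j * (n\<bullet>lam))" and side: "0\<le>sg s * (e k\<bullet>p1 Fd n)"
 shows "loc_agr (\<not> s) x n j"
proof -
 note n = prnD[OF x(3)]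
 let ?n = "of_nat j *\<^sub>R n"
 define l where "l = of_nat j * (n\<bullet>lam)"
 have l: "0 < l" "?n\<bullet>lam = l" using j n(3) by (simp_all add: l_def)
 have nN: "?n\<in>fd_Nuf Fd" by (rule A.Nu.scale_nat[OF n(1)])
 have side': "0\<le>sg s * (e k\<bullet>p1 Fd ?n)"
  using mult_nonneg_nonneg[OF of_nat_0_le_iff[of j] side] by (simp add: linear_scale[OF A.linear_p1] mult.left_commute)
 define X where "X = {n'\<in>fd_Nuf Fd. 0 < n'\<bullet>lam \<and> n'\<bullet>lam = l \<and> 0\<le>sg s * (e k\<bullet>p1 Fd n')}"
 have dcl: "dcl (lowset l \<union> X)" by (rule dcl_extend) (auto simp: X_def)
 have zero: "dphi s a0 b0 m (?n - of_nat i *\<^sub>R e k) = 0"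
  if ab: "regular Fd a0" "regular Fd b0" "a0\<noteq>b0" "a0\<in>HH s" "b0\<in>HH s" and m: "m\<in>fd_Mcirc Fd" for a0 b0 m and i :: nat
 proof -
  have "agr s (lowset l \<union> X) (A.phi a0 b0) (B.phi (Tm s a0) (Tm s b0))"
  proof (rule agr_phi(2)[OF ab(1-3) HH_open HH_convex subset_refl ab(4,5) dcl])
   fix x' n' j' assume x': "x'\<in>HH s" "generic Fd x'" "prn n' x'" "0 < (j'::nat)" "of_nat j' *\<^sub>R n'\<in>lowset l \<union> X"
   show "loc_agr s x' n' j'"
   proof (cases "of_nat j' *\<^sub>R n'\<in>lowset l")
    case True
    thus ?thesis using below_lowset[OF below(1)] x' unfolding l_def by blast
   next
    case False
    hence X: "of_nat j' * (n'\<bullet>lam) = l" "0\<le>sg s * (e k\<bullet>p1 Fd (of_nat j' *\<^sub>R n'))"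
     using x'(5) by (auto simp: X_def)
    have "0\<le>of_nat j' * (sg s * (e k\<bullet>p1 Fd n'))" using X(2) by (simp add: linear_scale[OF A.linear_p1] mult.left_commute)
    hence s': "0\<le>sg s * (e k\<bullet>p1 Fd n')" using x'(4) by (simp add: zero_le_mult_iff)
    have "below s (of_nat j' * (n'\<bullet>lam))" using below(1) X(1) by (simp add: l_def)
    thus ?thesis by (rule matching_side[OF x'(2,1,3,4) _ s'])
   qed
  qed
  moreover have "?n - of_nat i *\<^sub>R e k\<in>lowset l \<union> X"
  proof -
   have "?n - of_nat i *\<^sub>R e k\<in>fd_Nuf Fd" by (intro A.Nu.diff[OF nN] A.Nu.scale_nat A.e_mem(2)[OF k])
   moreover have "e k\<bullet>p1 Fd (?n - of_nat i *\<^sub>R e k) = e k\<bullet>p1 Fd ?n"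
    by (simp add: linear_diff[OF A.linear_p1] linear_scale[OF A.linear_p1] inner_diff_right A.p1_self)
   moreover have "(?n - of_nat i *\<^sub>R e k)\<bullet>lam = l" unfolding inner_diff_left l(2) by simp
   ultimately show ?thesis using l(1) side' by (simp add: X_def)
  qed
  ultimately show ?thesis using agrD[OF _ m] by simp
 qed
 have "n\<noteq>t *\<^sub>R e k" for t using n(3) by auto
 then obtain z where z: "e k\<bullet>z = 0" "0 < n\<bullet>z" using hyperplane_side A.e_nonzero[OF kI] by metis
 obtain y1 where y1: "y1\<in>{y. n\<bullet>y < 0}" "e k\<bullet>y1 = 0" "generic Fd y1"
  by (rule A.generic_on_hyperplane[of "e k" "- z" "{y. n\<bullet>y < 0}"]) (use z A.e_nonzero[OF kI] open_halfspace_lt in auto)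
 obtain y2 where y2: "y2\<in>{y. n\<bullet>y > 0}" "e k\<bullet>y2 = 0" "generic Fd y2"
  by (rule A.generic_on_hyperplane[of "e k" "z" "{y. n\<bullet>y > 0}"]) (use z A.e_nonzero[OF kI] open_halfspace_gt in auto)
 obtain r where r: "bcross s ?n y1 y2 r" using cross_both[OF nN y1(3,2) y2(3,2) side'] by blast
 hence r0: "0 < r" by (simp add: bcross_def)
 \<comment> \<open>The preimage under \<open>TT 1\<close> ensures that both a point and its shear
   stay in the ball, for either sign, since \<open>TT 0\<close> is the identity.\<close>
 define S where "S y = ball y r \<inter> TT 1 -` ball y r" for y
 have S: "open (S y)" for y unfolding S_def
  by (auto intro!: open_Int open_vimage linear_continuous_on simp: linear_TT linear_conv_bounded_linear[symmetric])
 have yS: "y\<in>S y" if "e k\<bullet>y = 0" for y using that r0 by (simp add: S_def TT_def)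
 have Sball: "{a, Tm s' a}\<subseteq>ball y r" if "a\<in>S y" for a y s' using that by (cases s') (auto simp: S_def sig_def)
 have hz: "sg s' *\<^sub>R e k\<noteq>0" for s' using A.e_nonzero[OF kI] by (auto simp: sg_def)
 have pick: "\<exists>a. a\<in>S y \<inter> W \<and> regular Fd a \<and> a\<in>HH s'" if yW: "e k\<bullet>y = 0" "open W" "y\<in>W" for y W s'
 proof -
  obtain a where "a\<in>S y \<inter> W" "regular Fd a" "0 < (sg s' *\<^sub>R e k)\<bullet>a"
   by (rule A.near_side[of "{}" "sg s' *\<^sub>R e k" y "S y \<inter> W"]) (use yW hz S yS in auto)
  thus ?thesis unfolding HH_eq by blast
 qed
 note p1 = pick[OF y1(2) open_halfspace_lt y1(1)] and p2 = pick[OF y2(2) open_halfspace_gt y2(1)]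
 obtain a0 where a0: "a0\<in>S y1 \<inter> {y. n\<bullet>y < 0}" "regular Fd a0" "a0\<in>HH s" using p1[of s] by blast
 obtain a1 where a1: "a1\<in>S y1 \<inter> {y. n\<bullet>y < 0}" "regular Fd a1" "a1\<in>HH (\<not> s)" using p1[of "\<not> s"] by blast
 obtain b0 where b0: "b0\<in>S y2 \<inter> {y. n\<bullet>y > 0}" "regular Fd b0" "b0\<in>HH s" using p2[of s] by blast
 obtain b1 where b1: "b1\<in>S y2 \<inter> {y. n\<bullet>y > 0}" "regular Fd b1" "b1\<in>HH (\<not> s)" using p2[of "\<not> s"] by blast
 have ne: "a0\<noteq>b0" "a1\<noteq>b1" using a0(1) a1(1) b0(1) b1(1) by auto
 have balls: "{a0, Tm s a0, a1, Tm (\<not> s) a1}\<subseteq>ball y1 r" "{b0, Tm s b0, b1, Tm (\<not> s) b1}\<subseteq>ball y2 r"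
  using a0(1) a1(1) b0(1) b1(1) Sball by blast+
 show ?thesis
 proof (rule delta_zero[OF x j below(2) a1(2) b1(2) a1(3) b1(3)])
  show "n\<bullet>a1 < 0" "0 < n\<bullet>b1" using a1(1) b1(1) by auto
  fix m assume m: "m\<in>fd_Mcirc Fd" "e k\<bullet>m = 0"
  have "\<forall>i::nat. dphi s a0 b0 m (?n - of_nat i *\<^sub>R e k) = 0"
   by (intro allI zero[OF a0(2) b0(2) ne(1) a0(3) b0(3) m(1)])
  thus "dphi (\<not> s) a1 b1 m ?n = 0" using r a0(2,3) a1(2,3) b0(2,3) b1(2,3) balls ne m unfolding bcross_def by blast
 qed
qed

theorem local_functions: assumes "generic Fd x" "x\<in>HH s" "prn n x" shows "A.G x n = B.G (Tm s x) (Tn s n)"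
proof (rule fps_ext)
 \<comment> \<open>Levels are positive integers, which allows induction. Both half-spaces are
   treated together because \<open>other_side\<close> uses the lower levels of both.\<close>
 have main: "\<forall>s x n j. generic Fd x \<and> x\<in>HH s \<and> prn n x \<and> 0 < j \<and> of_nat j * (n\<bullet>lam) = of_nat l --> loc_agr s x n j" for l :: nat
 proof (induction l rule: less_induct)
  case (less l)
  have below: "below s (of_nat l)" for s unfolding below_def
  proof (intro allI impI, elim conjE)
   fix x n j assume x: "generic Fd x" "x\<in>HH s" "prn n x" "0 < (j::nat)" "of_nat j * (n\<bullet>lam) < of_nat l"
   have "n\<bullet>lam\<in>\<int>" by (rule lam_int[OF prnD(5)[OF x(3)]])
   hence "of_nat j * (n\<bullet>lam)\<in>\<int>" by simp
   then obtain z where z: "of_nat j * (n\<bullet>lam) = of_int z" by (auto elim: Ints_cases)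
   have "0 < of_nat j * (n\<bullet>lam)" using prnD(3)[OF x(3)] x(4) by simp
   hence z0: "0 < z" using z by simp
   have "z < int l" using x(5) unfolding z by linarith
   hence zl: "nat z < l" using z0 by simp
   have "of_nat j * (n\<bullet>lam) = of_nat (nat z)" using z z0 by simp
   thus "loc_agr s x n j" using less.IH[OF zl] x by blast
  qed
  show ?case
  proof (intro allI impI, elim conjE)
   fix s x n j assume x: "generic Fd x" "x\<in>HH s" "prn n x" and j: "0 < (j::nat)" and l: "of_nat j * (n\<bullet>lam) = of_nat l"
   have b: "below s' (of_nat j * (n\<bullet>lam))" for s' unfolding l by (rule below)
   show "loc_agr s x n j"
   proof (cases "0\<le>sg s * (e k\<bullet>p1 Fd n)")
    case True
    show ?thesis by (rule matching_side[OF x j b True])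
   next
    case False
    hence "0\<le>sg (\<not> s) * (e k\<bullet>p1 Fd n)" by (cases s) (auto simp: sg_def)
    thus ?thesis using other_side[of x "\<not> s" n j, OF x(1) _ x(3) j b b] x(2) by simp
   qed
  qed
 qed
 fix j
 show "A.G x n $ j = B.G (Tm s x) (Tn s n) $ j"
 proof (cases "j = 0")
  case False
  have "n\<bullet>lam\<in>\<int>" by (rule lam_int[OF prnD(5)[OF assms(3)]])
  then obtain z where z: "n\<bullet>lam = of_int z" by (auto elim: Ints_cases)
  hence "0 < z" using prnD(3)[OF assms(3)] by simp
  hence "of_nat j * (n\<bullet>lam) = of_nat (j * nat z)" using z by simp
  thus ?thesis using main[of "j * nat z"] assms False unfolding loc_agr_def by blast
 qed (simp add: A.G_0 B.G_0)
qed

end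

section \<open>The mutated diagram\<close>

lemma convex_cone_hull_sum: "finite A ==> (\<And>i. i\<in>A ==> f i\<in>convex_cone hull S) ==> sum f A\<in>convex_cone hull S"
 by (induction A rule: finite_induct) (auto intro: convex_cone_hull_add convex_cone_hull_contains_0)

text \<open>Elimination in the manner of Fourier and Motzkin: the intersection is generated by the
  generators in the half-space and, for each pair of generators on opposite sides, by a positive
  combination on the boundary. Integrality of h keeps these in the lattice.\<close>

lemma rational_cone_halfspace:
 fixes Fd :: "('i, 'a::euclidean_space, 'x) fixed_data"
 assumes C: "rational_cone Fd C" and h: "\<And>u. u\<in>fd_M Fd ==> h\<bullet>u\<in>\<int>" shows "rational_cone Fd (C \<inter> {x. 0\<le>h\<bullet>x})"
proof -
 interpret M: real_subgroup "fd_M Fd" unfolding fd_M_def by (rule real_subgroup_dual_lattice)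
 obtain U where U: "finite U" "U\<subseteq>fd_M Fd" "C = convex_cone hull U"
  using C unfolding rational_cone_def by (elim exE conjE) (rule that; assumption)
 define A B where "A = {u\<in>U. 0 < h\<bullet>u}" and "B = {u\<in>U. h\<bullet>u < 0}"
 have fin: "finite A" "finite B" using U(1) by (auto simp: A_def B_def)
 define g where "g = (\<lambda>(u, u'). (h\<bullet>u) *\<^sub>R u' + (- (h\<bullet>u')) *\<^sub>R u)"
 define V where "V = {u\<in>U. 0\<le>h\<bullet>u} \<union> g ` (A \<times> B)"
 have finV: "finite V" using U(1) fin by (simp add: V_def)
 have "g p\<in>fd_M Fd" if "p\<in>A \<times> B" for p
  using that U(2) h unfolding g_def A_def B_def by (auto intro!: M.diff M.scale_Ints)
 hence VM: "V\<subseteq>fd_M Fd" using U(2) by (auto simp: V_def)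
 have "V\<subseteq>C \<inter> {x. 0\<le>h\<bullet>x}"
 proof
  fix v assume "v\<in>V"
  then consider "v\<in>U" "0\<le>h\<bullet>v" | u u' where "u\<in>A" "u'\<in>B" "v = g (u, u')" by (auto simp: V_def)
  thus "v\<in>C \<inter> {x. 0\<le>h\<bullet>x}"
  proof cases
   case 1
   thus ?thesis unfolding U(3) by (auto intro: hull_inc)
  next
   case (2 u u')
   have uU: "u\<in>convex_cone hull U" "u'\<in>convex_cone hull U" using 2 by (auto simp: A_def B_def intro: hull_inc)
   have "v = (h\<bullet>u) *\<^sub>R u' + (- (h\<bullet>u')) *\<^sub>R u" unfolding 2(3) g_def prod.case ..
   also have "\<dots>\<in>C" unfolding U(3)
    by (rule convex_cone_hull_add[OF convex_cone_hull_mul[OF uU(2)] convex_cone_hull_mul[OF uU(1)]])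
     (use 2(1,2) in \<open>auto simp: A_def B_def\<close>)
   finally have "v\<in>C" .
   moreover have "h\<bullet>v = 0" by (simp add: 2(3) g_def inner_diff_right)
   ultimately show ?thesis by simp
  qed
 qed
 moreover have "convex_cone (C \<inter> {x. 0\<le>h\<bullet>x})"
  using convex_cone_convex_cone_hull[of U] convex_cone_halfspace_ge[of h] unfolding U(3) convex_cone_iff by simp
 ultimately have "convex_cone hull V\<subseteq>C \<inter> {x. 0\<le>h\<bullet>x}" by (rule hull_minimal)
 moreover have "x\<in>convex_cone hull V" if x: "x\<in>C" "0\<le>h\<bullet>x" for x
 proof -
  obtain c where c: "x = (\<Sum>u\<in>U. c u *\<^sub>R u)" "\<forall>u\<in>U. 0\<le>c u"
   using x(1) unfolding U(3) convex_cone_hull_finite[OF U(1)] by blast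
  define Z where "Z = {u\<in>U. h\<bullet>u = 0}"
  have split: "sum f U = sum f Z + sum f A + sum f B" for f :: "'a=>'b::comm_monoid_add"
  proof -
   have "U = (Z \<union> A) \<union> B" by (auto simp: Z_def A_def B_def)
   moreover have "finite Z" "(Z \<union> A) \<inter> B = {}" "Z \<inter> A = {}" using U(1) by (auto simp: Z_def A_def B_def)
   ultimately show ?thesis using fin by (simp add: sum.union_disjoint)
  qed
  define p q where "p = (\<Sum>u\<in>A. c u * (h\<bullet>u))" and "q = (\<Sum>u\<in>B. c u * - (h\<bullet>u))"
  have cA: "0\<le>c u" if "u\<in>A" for u using c(2) that by (auto simp: A_def)
  have cB: "0\<le>c u" if "u\<in>B" for u using c(2) that by (auto simp: B_def)
  have q0: "0\<le>q" unfolding q_def using cB by (intro sum_nonneg mult_nonneg_nonneg) (auto simp: B_def)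
  have "h\<bullet>x = (\<Sum>u\<in>U. c u * (h\<bullet>u))" unfolding c(1) by (simp add: inner_sum_right)
  also have "\<dots> = p - q" unfolding split[of "\<lambda>u. c u * (h\<bullet>u)"] p_def q_def by (simp add: Z_def sum_negf)
  finally have pq: "q\<le>p" using x(2) by simp
  have ZV: "(\<Sum>u\<in>Z. c u *\<^sub>R u)\<in>convex_cone hull V"
   using U(1) c(2) by (intro convex_cone_hull_sum convex_cone_hull_mul hull_inc) (auto simp: Z_def V_def)
  have AV: "(\<Sum>u\<in>A. c u *\<^sub>R u)\<in>convex_cone hull V"
   using fin c(2) by (intro convex_cone_hull_sum convex_cone_hull_mul hull_inc) (auto simp: A_def V_def)
  show ?thesis
  proof (cases "p = 0")
   case True
   hence "q = 0" using q0 pq by simp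
   hence "c u * - (h\<bullet>u) = 0" if "u\<in>B" for u
    using that fin cB unfolding q_def by (subst (asm) sum_nonneg_eq_0_iff) (auto simp: B_def intro: mult_nonneg_nonpos)
   hence "c u = 0" if "u\<in>B" for u using that by (auto simp: B_def)
   hence "x = (\<Sum>u\<in>Z. c u *\<^sub>R u) + (\<Sum>u\<in>A. c u *\<^sub>R u)" unfolding c(1) split by simp
   thus ?thesis using ZV AV convex_cone_hull_add by metis
  next
   case False
   hence p: "0 < p" using q0 pq by simp
   \<comment> \<open>Each negative generator is balanced against all positive ones in proportion to
     their heights. This uses the fraction q/p of the positive part, and since q <= p the rest is
     still nonnegative.\<close>
   define y where "y = (\<Sum>u\<in>A. \<Sum>u'\<in>B. (c u * c u' / p) *\<^sub>R g (u, u'))"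
   have yV: "y\<in>convex_cone hull V" unfolding y_def
    using fin cA cB p by (intro convex_cone_hull_sum convex_cone_hull_mul hull_inc) (auto simp: V_def)
   have "y = (\<Sum>u\<in>A. \<Sum>u'\<in>B. (c u * (h\<bullet>u) / p) *\<^sub>R (c u' *\<^sub>R u') + (c u' * - (h\<bullet>u') / p) *\<^sub>R (c u *\<^sub>R u))"
    unfolding y_def g_def by (intro sum.cong refl) (simp add: scaleR_diff_right mult.commute mult.left_commute)
   also have "\<dots> = (\<Sum>u\<in>A. (c u * (h\<bullet>u) / p) *\<^sub>R (\<Sum>u'\<in>B. c u' *\<^sub>R u') + (q / p) *\<^sub>R (c u *\<^sub>R u))"
    unfolding q_def sum.distrib scaleR_sum_right sum_divide_distrib scaleR_sum_left ..
   also have "\<dots> = (\<Sum>u'\<in>B. c u' *\<^sub>R u') + (q / p) *\<^sub>R (\<Sum>u\<in>A. c u *\<^sub>R u)"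
   proof -
    have "(\<Sum>u\<in>A. c u * (h\<bullet>u) / p) = 1" using p unfolding p_def sum_divide_distrib[symmetric] by simp
    hence "(\<Sum>u\<in>A. (c u * (h\<bullet>u) / p) *\<^sub>R (\<Sum>u'\<in>B. c u' *\<^sub>R u')) = (\<Sum>u'\<in>B. c u' *\<^sub>R u')"
     using scaleR_sum_left[of "\<lambda>u. c u * (h\<bullet>u) / p" A "\<Sum>u'\<in>B. c u' *\<^sub>R u'"] by (simp only: scaleR_one)
    thus ?thesis unfolding sum.distrib scaleR_sum_right[of "q / p"] by (simp only:)
   qed
   finally have "(\<Sum>u\<in>B. c u *\<^sub>R u) = y - (q / p) *\<^sub>R (\<Sum>u\<in>A. c u *\<^sub>R u)" by simp
   hence "x = (\<Sum>u\<in>Z. c u *\<^sub>R u) + y + (1 - q / p) *\<^sub>R (\<Sum>u\<in>A. c u *\<^sub>R u)"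
    unfolding c(1) split by (simp add: scaleR_diff_left)
   moreover have "0\<le>1 - q / p" using p pq by simp
   ultimately show ?thesis using ZV yV AV convex_cone_hull_add convex_cone_hull_mul by metis
  qed
 qed
 ultimately have "C \<inter> {x. 0\<le>h\<bullet>x} = convex_cone hull V" by blast
 thus ?thesis unfolding rational_cone_def using finV VM by blast
qed

lemma rational_cone_image: assumes "rational_cone Fd C" "linear f" "\<And>m. m\<in>fd_M Fd ==> f m\<in>fd_M Fd"
 shows "rational_cone Fd (f ` C)"
proof -
 obtain U where U: "finite U" "U\<subseteq>fd_M Fd" "C = convex_cone hull U"
  using assms(1) unfolding rational_cone_def by (elim exE conjE) (rule that; assumption)
 have "f ` C = convex_cone hull (f ` U)" unfolding U(3) by (rule convex_cone_hull_linear_image[OF assms(2), symmetric])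
 moreover have "f ` U\<subseteq>fd_M Fd" using U(2) assms(3) by blast
 ultimately show ?thesis unfolding rational_cone_def using U(1) by blast
qed

lemma fps_mult_cancel:
 fixes f g :: "'r::comm_ring_1 fps" assumes f: "f $ 0 = 1" and fg: "\<And>i. i\<le>j ==> (f * g) $ i = f $ i" and "i\<le>j"
 shows "g $ i = 1 $ i"
proof -
 define h where "h = fps_right_inverse f 1"
 have h: "h * f = 1" unfolding h_def using fps_right_inverse_one[OF f] by (simp add: mult.commute)
 have "(h * (f * g)) $ i = (h * f) $ i" by (rule fps_mult_nth_cong[where j = j]) (use assms in auto)
 thus ?thesis unfolding mult.assoc[symmetric] h by simp
qed

context scat
begin

lemma G_prod: assumes "n\<in>Nplus Fd e" "of_nat j *\<^sub>R p1 Fd n\<notin>ideal_power P L" "finite W" "walls_at L x\<subseteq>W"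
  "W\<subseteq>{w\<in>sd_index D. x\<in>sd_supp D w}" shows "G x n $ j = (\<Prod>w\<in>W. ray_series (p1 Fd n) (sd_fun D w)) $ j"
 unfolding G_nth[OF assms(1,2)] gs_def
 by (rule prod_series_mod[symmetric, OF assms(3) _ assms(4) _ assms(1,2)]) (use assms(5) in \<open>auto simp: walls_at_def\<close>)

text \<open>All walls through a generic point of n^perp have normal n, so the product in the
  definition of reducedness is a series in z^(p1 n); it differs from 1 in a coefficient whose
  exponent is outside some ideal power.\<close>

lemma reduced_series:
 assumes red: "reduced_diagram Fd P D" and x: "generic Fd x" and n: "n\<in>Nplus Fd e" "primitive_in N n" "n\<bullet>x = 0"
  and S: "S\<noteq>{}" "S\<subseteq>{w\<in>sd_index D. x\<in>sd_supp D w}" shows "\<exists>L j. of_nat j *\<^sub>R p1 Fd n\<notin>ideal_power P L \<and>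
  (\<Prod>w\<in>S \<inter> sd_walls_mod Fd P L D. ray_series (p1 Fd n) (sd_fun D w)) $ j\<noteq>1 $ j"
proof -
 let ?v = "p1 Fd n"
 note v = p1_Nplus[OF n(1)]
 obtain L where L: "\<not> cong_mod P L (finprod (completed_ring Fd P) (sd_fun D) (S \<inter> sd_walls_mod Fd P L D)) \<one>\<^bsub>completed_ring Fd P\<^esub>"
  using red S generic_not_sing[OF x] unfolding reduced_diagram_def by meson
 let ?Q = "S \<inter> sd_walls_mod Fd P L D"
 let ?g = "\<lambda>w. ray_series ?v (sd_fun D w)"
 have "finprod (completed_ring Fd P) (sd_fun D) ?Q = ray ?v (\<Prod>w\<in>?Q. ?g w)"
 proof (rule ray_finprod[OF v])
  show "finite ?Q" using finite_walls by blast
  fix w assume "w\<in>?Q"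
  hence w: "w\<in>sd_index D" "x\<in>sd_supp D w" using S(2) by auto
  show "?g w $ j\<in>coeff_ring Fd" for j using fun_carrier[OF w(1)] by simp
  have "wn w = n" by (rule generic_same_wn[OF x n w])
  thus "sd_fun D w = ray ?v (?g w)" using ray_ray_series[OF v(2), of "sd_fun D w"] fun_ray[OF w(1)] by simp
 qed
 then obtain m where m: "m\<in>P" "m\<notin>ideal_power P L" "ray ?v (\<Prod>w\<in>?Q. ?g w) m\<noteq>\<one>\<^bsub>completed_ring Fd P\<^esub> m"
  using L unfolding cong_mod_def by auto
 have "\<exists>j::nat. m = of_nat j *\<^sub>R ?v"
 proof (rule ccontr)
  assume no: "\<not> (\<exists>j::nat. m = of_nat j *\<^sub>R ?v)"
  hence "m\<noteq>of_nat 0 *\<^sub>R ?v" by blast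
  hence "m\<noteq>0" by simp
  moreover have "ray ?v (\<Prod>w\<in>?Q. ?g w) m = 0" using no by (intro ray_off) blast
  ultimately show False using m(3) by simp
 qed
 then obtain j :: nat where j: "m = of_nat j *\<^sub>R ?v" by blast
 have "(\<Prod>w\<in>?Q. ?g w) $ j\<noteq>1 $ j" using m(3) v(2) unfolding j by (auto split: if_splits)
 thus ?thesis using m(2) unfolding j by blast
qed

text \<open>A piece of full dimension contains a relatively open part of the hyperplane of the wall,
  where \<open>generic_on_hyperplane\<close> applies.\<close>

lemma generic_in_wall: assumes w: "w\<in>sd_index D" and S: "convex S" "S\<subseteq>sd_supp D w" "aff_dim S = int DIM('a) - 1"
 shows "\<exists>x\<in>S. generic Fd x"
proof -
 have ne: "S\<noteq>{}" using S(3) DIM2 by (auto simp: aff_dim_empty[symmetric])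
 have "affine hull S\<subseteq>orth (wn w)" unfolding supp_affine[OF w, symmetric] by (rule hull_mono[OF S(2)])
 moreover have "affine (orth (wn w))" using orth_dim(1)[OF wn_nonzero[OF w]] by (rule subspace_imp_affine)
 moreover have "aff_dim (orth (wn w)) = int DIM('a) - 1"
  using supp_dim[OF w] aff_dim_affine_hull[of "sd_supp D w"] by (simp add: supp_affine[OF w])
 ultimately have hull: "affine hull S = orth (wn w)"
  using ne S(3) affine_dim_equal[of "affine hull S" "orth (wn w)"] by (simp add: aff_dim_affine_hull)
 obtain x0 where "x0\<in>rel_interior S" using rel_interior_eq_empty[OF S(1)] ne by blast
 then obtain r where r: "x0\<in>S" "r > 0" "ball x0 r \<inter> orth (wn w)\<subseteq>S" unfolding mem_rel_interior_ball hull by blast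
 have x0: "wn w\<bullet>x0 = 0" using r(1) S(2) supp_orth[OF w] by (auto simp: orth_def)
 obtain y where y: "y\<in>ball x0 r" "wn w\<bullet>y = 0" "generic Fd y"
  by (rule generic_on_hyperplane[OF wn_nonzero[OF w] x0, of "ball x0 r"]) (use r in auto)
 hence "y\<in>S" using r(3) by (auto simp: orth_def)
 thus ?thesis using y(3) by blast
qed

lemma ideal_power_avoid: assumes "finite Y" shows "\<exists>L. \<forall>y\<in>Y. y\<notin>ideal_power P L" using assms
proof (induction Y rule: finite_induct)
 case (insert y Y)
 obtain L where L: "\<forall>y\<in>Y. y\<notin>ideal_power P L" using insert.IH by blast
 obtain L' where L': "y\<notin>ideal_power P L'" using ideal_power_escape by blast
 show ?case using L L' ideal_power_antimono[of L "max L L'"] ideal_power_antimono[of L' "max L L'"]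
  by (intro exI[of _ "max L L'"]) auto
qed auto

text \<open>A coordinate of size at least L already puts p1(n) into the L-th power of the
  ideal.\<close>

lemma finite_Nplus_mod: "finite {n\<in>Nplus Fd e. p1 Fd n\<notin>ideal_power P L}"
proof (rule finite_subset)
 let ?F = "(\<lambda>c. \<Sum>i\<in>fd_Iuf Fd. of_nat (c i) *\<^sub>R e i) ` (PiE (fd_Iuf Fd) (\<lambda>_. {..<L}))"
 show "finite ?F" using finIuf by (intro finite_imageI finite_PiE) auto
 show "{n\<in>Nplus Fd e. p1 Fd n\<notin>ideal_power P L}\<subseteq>?F"
 proof
  fix n assume "n\<in>{n\<in>Nplus Fd e. p1 Fd n\<notin>ideal_power P L}"
  hence n: "n\<in>Nplus Fd e" "p1 Fd n\<notin>ideal_power P L" by auto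
  obtain c :: "'i=>nat" where c: "n = (\<Sum>i\<in>fd_Iuf Fd. of_nat (c i) *\<^sub>R e i)" using n(1) unfolding Nplus_def by blast
  have "c i < L" if i: "i\<in>fd_Iuf Fd" for i
  proof (rule ccontr)
   assume "\<not> c i < L"
   hence "of_nat (c i) *\<^sub>R p1 Fd (e i)\<in>ideal_power P L"
    using nat_scale_ideal_power p1_Nplus[OF e_Nplus[OF i]] by simp
   moreover have "(\<Sum>i'\<in>fd_Iuf Fd - {i}. of_nat (c i') *\<^sub>R p1 Fd (e i'))\<in>P"
   proof -
    have "(\<Sum>i'\<in>I. of_nat (c i') *\<^sub>R p1 Fd (e i'))\<in>P" if "finite I" "I\<subseteq>fd_Iuf Fd" for I using that
    proof (induction I rule: finite_induct)
     case (insert i I)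
     thus ?case using add_mem nat_scale_mem p1_Nplus(1)[OF e_Nplus] by simp
    qed (simp add: zero_mem)
    thus ?thesis using finIuf by simp
   qed
   ultimately have "of_nat (c i) *\<^sub>R p1 Fd (e i) + (\<Sum>i'\<in>fd_Iuf Fd - {i}. of_nat (c i') *\<^sub>R p1 Fd (e i'))\<in>ideal_power P L"
    by (rule ideal_power_add)
   also have "of_nat (c i) *\<^sub>R p1 Fd (e i) + (\<Sum>i'\<in>fd_Iuf Fd - {i}. of_nat (c i') *\<^sub>R p1 Fd (e i')) = p1 Fd n"
   proof -
    have "p1 Fd n = (\<Sum>i'\<in>fd_Iuf Fd. of_nat (c i') *\<^sub>R p1 Fd (e i'))"
     unfolding c by (simp add: linear_sum[OF linear_p1] linear_scale[OF linear_p1])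
    thus ?thesis using sum.remove[OF finIuf i, of "\<lambda>i'. of_nat (c i') *\<^sub>R p1 Fd (e i')"] by simp
   qed
   finally show False using n(2) by simp
  qed
  thus "n\<in>?F" unfolding c by (intro image_eqI[of _ _ "restrict c (fd_Iuf Fd)"]) (auto intro!: sum.cong)
 qed
qed

end

section \<open>Walls and local functions of the mutated diagram\<close>

locale mutr = mut Fd e k P P' D D'
 for Fd :: "('i, 'a::euclidean_space, 'x) fixed_data" and e and k and P P'
  and D :: "('w, 'a, ('x, 'k::field_char_0) coeff_poly) diagram" and D' :: "('v, 'a, ('x, 'k) coeff_poly) diagram" +
 assumes red: "reduced_diagram Fd P D"
begin

lemma initial_series: "ray_series (p1 Fd (e k)) (sd_fun D (A.w0 k)) = eser Fd k" by (rule fps_ext)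
  (simp add: A.w0_facts(3)[OF k] exchange_fun_nth[OF A.p1_Nplus(2)[OF A.e_Nplus[OF k]]] eser_def)

text \<open>By \<open>G_init\<close> the local function on e_k^perp is the exchange polynomial,
  which the initial wall alone supplies. Further walls there would multiply to 1 at a generic point,
  contrary to reducedness; so mutation replaces exactly one wall.\<close>

lemma wall_k: assumes w: "w\<in>sd_index D" "A.wn w = e k" shows "w = A.w0 k"
proof (rule ccontr)
 assume ne: "w\<noteq>A.w0 k"
 note ek = A.e_Nplus[OF k] A.primitive_e[OF kI]
 obtain x where x: "x\<in>sd_supp D w" "generic Fd x"
  using A.generic_in_wall[OF w(1) A.supp_convex[OF w(1)] subset_refl A.supp_dim[OF w(1)]] by blast
 have ex: "e k\<bullet>x = 0" using A.supp_orth[OF w(1)] x(1) w(2) by (auto simp: orth_def)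
 define S where "S = {w\<in>sd_index D. x\<in>sd_supp D w} - {A.w0 k}"
 have S: "S\<noteq>{}" "S\<subseteq>{w\<in>sd_index D. x\<in>sd_supp D w}" using w(1) x(1) ne by (auto simp: S_def)
 obtain L j where L: "of_nat j *\<^sub>R p1 Fd (e k)\<notin>ideal_power P L"
  "(\<Prod>w\<in>S \<inter> sd_walls_mod Fd P L D. ray_series (p1 Fd (e k)) (sd_fun D w)) $ j\<noteq>1 $ j"
  using A.reduced_series[OF red x(2) ek ex S] by blast
 let ?Q = "S \<inter> sd_walls_mod Fd P L D"
 let ?g = "\<lambda>w. ray_series (p1 Fd (e k)) (sd_fun D w)"
 have fin: "finite ?Q" using A.finite_walls by blast
 have w0: "A.w0 k\<in>sd_index D" "x\<in>sd_supp D (A.w0 k)" using A.w0_facts(1,2)[OF k] ex by (auto simp: orth_def)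
 have eq: "(eser Fd k * (\<Prod>w\<in>?Q. ?g w)) $ i = eser Fd k $ i" if i: "i\<le>j" for i
 proof -
  have "A.G x (e k) $ i = (\<Prod>w\<in>insert (A.w0 k) ?Q. ?g w) $ i"
   by (rule A.G_prod[OF ek(1) A.multiple_ideal_power[OF ek(1) L(1) i]])
    (use fin w0 S(2) in \<open>auto simp: A.walls_at_def S_def A.walls_mod_index\<close>)
  also have "(\<Prod>w\<in>insert (A.w0 k) ?Q. ?g w) = ?g (A.w0 k) * (\<Prod>w\<in>?Q. ?g w)"
   by (rule prod.insert[OF fin]) (simp add: S_def)
  finally show ?thesis unfolding initial_series A.G_init[OF k x(2) ex] by simp
 qed
 have "eser Fd k $ 0 = (1 :: ('x, 'k) coeff_poly)" by (simp add: eser_def ecoeff_def exchange_coeff_def)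
 from fps_mult_cancel[OF this eq order_refl] show False using L(2) by simp
qed

lemma initial_iff: assumes w: "w\<in>sd_index D" shows "is_initial_wall Fd e k D w \<longleftrightarrow> w = A.w0 k"
proof
 assume "is_initial_wall Fd e k D w"
 hence "sd_supp D w = orth (e k)" by (simp add: is_initial_wall_def)
 hence "A.wn w = e k" using A.wn_unique[OF w A.e_Nplus[OF k] A.primitive_e[OF kI]] by simp
 thus "w = A.w0 k" by (rule wall_k[OF w])
qed (simp add: A.w0(2)[OF k])

lemma halfspace_eq: "halfspace e k s = {x. 0\<le>(sg s *\<^sub>R e k)\<bullet>x}" by (auto simp: halfspace_def sg_def)

lemma T_sign_eq: "T_sign Fd e k s = Tm s" by (rule ext) (simp add: T_sign_def TT_def sig_def cc_def)

text \<open>Both linear maps are the identity on e_k^perp, so the piecewise map agrees with each of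
  them on the corresponding closed half-space.\<close>

lemma T_map_image: "T_map Fd e k ` (C \<inter> halfspace e k s) = Tm s ` (C \<inter> halfspace e k s)"
proof (rule image_cong[OF refl])
 fix x assume "x\<in>C \<inter> halfspace e k s"
 hence x: "x\<in>halfspace e k s" by blast
 show "T_map Fd e k x = Tm s x"
 proof (cases "e k\<bullet>x = 0")
  case True
  thus ?thesis unfolding T_map_def T_sign_eq by (simp add: TT_def)
 next
  case False
  hence "(x\<in>halfspace e k True) = s" using x by (cases s) (auto simp: halfspace_def)
  thus ?thesis unfolding T_map_def T_sign_eq by simp
 qed
qed

lemma inv_T_sign: "inv_into UNIV (T_sign Fd e k s) = TT (- sig s)" unfolding T_sign_eq by (rule inv_equality) simp_all

lemma aff_dim_piece: "aff_dim (T_map Fd e k ` (C \<inter> halfspace e k s)) = aff_dim (C \<inter> halfspace e k s)"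
 unfolding T_map_image by (rule aff_dim_injective_linear_image[OF linear_TT inj_TT])

lemma wall_side: assumes w: "w\<in>sd_index D" "w\<noteq>A.w0 k" and x: "generic Fd x" "x\<in>sd_supp D w"
 shows "e k\<bullet>x\<noteq>0" "prn (A.wn w) x"
proof -
 have wx: "A.wn w\<bullet>x = 0" using A.supp_orth[OF w(1)] x(2) by (auto simp: orth_def)
 show ex: "e k\<bullet>x\<noteq>0"
 proof
  assume "e k\<bullet>x = 0"
  hence "A.wn w = e k" by (rule A.generic_same_wn[OF x(1) A.e_Nplus[OF k] A.primitive_e[OF kI] _ w(1) x(2)])
  thus False using wall_k[OF w(1)] w(2) by simp
 qed
 show "prn (A.wn w) x"
  using A.Nplus_Nu[OF A.wn_Nplus[OF w(1)]] A.wn_prim[OF w(1)] levA[OF A.wn_Nplus[OF w(1)] wx ex] wx by (simp add: prn_def)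
qed

lemma halfspace_HH: "x\<in>halfspace e k s ==> e k\<bullet>x\<noteq>0 ==> x\<in>HH s" by (cases s) (auto simp: halfspace_def HH_def sg_def)

lemma HH_halfspace: "HH s\<subseteq>halfspace e k s" by (cases s) (auto simp: halfspace_def HH_def sg_def)

lemma HH_unique: "x\<in>HH s ==> x\<in>halfspace e k s' ==> s' = s"
 by (cases s; cases s') (auto simp: halfspace_def HH_def sg_def)

text \<open>
  If the transformed normal vector were not positive for the mutated seed, the local function at a
  general point of the piece would be trivial, which is excluded for a reduced diagram.
\<close>

lemma piece_normal:
 assumes w: "w\<in>sd_index D" "w\<noteq>A.w0 k" and dim: "aff_dim (sd_supp D w \<inter> halfspace e k s) = int DIM('a) - 1"
 shows "Tn s (A.wn w)\<in>Nplus Fd (mutate_seed Fd k e)"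
proof (rule ccontr)
 assume no: "Tn s (A.wn w)\<notin>Nplus Fd (mutate_seed Fd k e)"
 have "convex (sd_supp D w \<inter> halfspace e k s)"
  unfolding halfspace_eq by (intro convex_Int A.supp_convex[OF w(1)] convex_halfspace_ge)
 then obtain x where x: "x\<in>sd_supp D w" "x\<in>halfspace e k s" "generic Fd x"
  using A.generic_in_wall[OF w(1) _ Int_lower1 dim] by blast
 note ws = wall_side[OF w x(3,1)]
 have xH: "x\<in>HH s" by (rule halfspace_HH[OF x(2) ws(1)])
 note n = prnD[OF ws(2)]
 note n' = prnD[OF prn_TN[OF ws(2) sig_Ints[of s]]]
 have x': "generic Fd (Tm s x)" "e k\<bullet>Tm s x\<noteq>0" using x(3) ws(1) by (simp_all add: generic_TT)
 have "B.G (Tm s x) (Tn s (A.wn w)) = 1"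
  by (rule B.G_one) (rule B.no_wall_off_Nplus[OF x'(1) levB[OF _ _ x'(2)] n'(1-4) no])
 hence G1: "A.G x (A.wn w) = 1" using local_functions[OF x(3) xH ws(2)] by simp
 let ?S = "{w\<in>sd_index D. x\<in>sd_supp D w}"
 have S: "?S\<noteq>{}" using w(1) x(1) by blast
 obtain L j where L: "of_nat j *\<^sub>R p1 Fd (A.wn w)\<notin>ideal_power P L"
  "(\<Prod>w'\<in>?S \<inter> sd_walls_mod Fd P L D. ray_series (p1 Fd (A.wn w)) (sd_fun D w')) $ j\<noteq>1 $ j"
  using A.reduced_series[OF red x(3) A.wn_Nplus[OF w(1)] n(2,4) S subset_refl] by blast
 have "A.G x (A.wn w) $ j = (\<Prod>w'\<in>?S \<inter> sd_walls_mod Fd P L D. ray_series (p1 Fd (A.wn w)) (sd_fun D w')) $ j"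
  by (rule A.G_prod[OF A.wn_Nplus[OF w(1)] L(1)]) (use A.finite_walls in \<open>auto simp: A.walls_at_def A.walls_mod_index\<close>)
 thus False using L(2) G1 by simp
qed

definition MD :: "('w \<times> bool, 'a, ('x, 'k) coeff_poly) diagram" where "MD = mutate_diagram Fd e k D"

lemma MD_index: "(w, s)\<in>sd_index MD \<longleftrightarrow> w\<in>sd_index D \<and>
  (if w = A.w0 k then s else aff_dim (sd_supp D w \<inter> halfspace e k s) = int DIM('a) - 1)"
 unfolding MD_def mutate_diagram_def by (auto simp: initial_iff aff_dim_piece)

lemma MD_initial: "sd_supp MD (A.w0 k, s) = orth (e k)" "sd_fun MD (A.w0 k, s) = exchange_fun Fd k (- p1 Fd (e k))"
 unfolding MD_def mutate_diagram_def using A.w0(2)[OF k] by simp_all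

lemma MD_other: assumes "w\<in>sd_index D" "w\<noteq>A.w0 k"
 shows "sd_supp MD (w, s) = Tm s ` (sd_supp D w \<inter> halfspace e k s)" "sd_fun MD (w, s) = (\<lambda>q. sd_fun D w (TT (- sig s) q))"
 unfolding MD_def mutate_diagram_def using initial_iff[OF assms(1)] assms(2) by (simp_all add: T_map_image inv_T_sign comp_def)

lemma MD_wall_initial: "wall_for Fd (mutate_seed Fd k e) P' (mutate_seed Fd k e k) (sd_supp MD (A.w0 k, s)) (sd_fun MD (A.w0 k, s))"
proof -
 have "orth (mutate_seed Fd k e k) = orth (e k)" by (simp add: mutate_seed_def orth_def)
 thus ?thesis using B.wall[OF B.w0_facts(1)[OF k]] unfolding B.w0_facts[OF k] MD_initial p1_e' by simp
qed

lemma MD_wall_other: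
 assumes w: "w\<in>sd_index D" "w\<noteq>A.w0 k" and dim: "aff_dim (sd_supp D w \<inter> halfspace e k s) = int DIM('a) - 1"
 shows "wall_for Fd (mutate_seed Fd k e) P' (Tn s (A.wn w)) (sd_supp MD (w, s)) (sd_fun MD (w, s))"
proof -
 note Np = piece_normal[OF w dim]
 note MD = MD_other[OF w]
 have ray: "\<exists>j::nat. q = of_nat j *\<^sub>R p1 Fd (Tn s (A.wn w))" if fq: "sd_fun MD (w, s) q\<noteq>0" for q
 proof -
  obtain j :: nat where j: "TT (- sig s) q = of_nat j *\<^sub>R p1 Fd (A.wn w)" using A.fun_ray[OF w(1)] fq unfolding MD(2) by blast
  have "q = Tm s (TT (- sig s) q)" by simp
  also have "\<dots> = of_nat j *\<^sub>R p1 Fd (Tn s (A.wn w))" unfolding j by (simp add: linear_scale[OF linear_TT] p1_TN)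
  finally show ?thesis by blast
 qed
 show ?thesis unfolding wall_for_def
 proof (intro conjI allI impI)
  show "Tn s (A.wn w)\<in>Nplus Fd (mutate_seed Fd k e)" by (rule Np)
  show "primitive_in (fd_N Fd) (Tn s (A.wn w))" by (rule primitive_TN[OF sig_Ints A.wn_prim[OF w(1)]])
  have "(sg s *\<^sub>R e k)\<bullet>u\<in>\<int>" if "u\<in>fd_M Fd" for u
   using that A.e_mem(1)[OF kI] by (cases s) (auto simp: sg_def fd_M_def dual_lattice_def)
  thus "rational_cone Fd (sd_supp MD (w, s))" unfolding MD(1) halfspace_eq
   by (intro rational_cone_image rational_cone_halfspace A.supp_cone[OF w(1)] linear_TT TT_M sig_Ints)
  show "aff_dim (sd_supp MD (w, s)) = int DIM('a) - 1"
   unfolding MD(1) aff_dim_injective_linear_image[OF linear_TT inj_TT] by (rule dim)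
  show "sd_supp MD (w, s)\<subseteq>orth (Tn s (A.wn w))"
   unfolding MD(1) using A.supp_orth[OF w(1)] by (auto simp: orth_def TN_pairing)
  show "sd_fun MD (w, s) 0 = 1" unfolding MD(2) using A.fun_0[OF w(1)] by (simp add: linear_0[OF linear_TT])
  have "sd_fun MD (w, s) q = 0" if "q\<notin>P'" for q
   using ray[of q] that B.nat_scale_mem[OF B.p1_Nplus(1)[OF Np]] by blast
  moreover have "sd_fun MD (w, s) q\<in>coeff_ring Fd" for q unfolding MD(2) using A.fun_carrier[OF w(1)] by simp
  ultimately show "sd_fun MD (w, s)\<in>carrier (completed_ring Fd P')" by simp
 qed (rule ray)
qed

text \<open>A nontrivial exponent of a mutated wall outside the ideal power of \<open>P'\<close> is
  one of finitely many p1(n) with n positive for the mutated seed. Pulled back, these avoid some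
  ideal power of \<open>P\<close>, modulo which the original wall is then nontrivial.\<close>

lemma MD_finite: "finite (sd_walls_mod Fd P' l MD)"
proof -
 let ?Z = "{n\<in>Nplus Fd (mutate_seed Fd k e). p1 Fd n\<notin>ideal_power P' l}"
 define Y where "Y = (\<Union>s. (\<lambda>n. TT (- sig s) (p1 Fd n)) ` ?Z)"
 have "finite Y" unfolding Y_def using B.finite_Nplus_mod[of l] by simp
 then obtain L where L: "\<forall>y\<in>Y. y\<notin>ideal_power P L" using A.ideal_power_avoid by blast
 have "sd_walls_mod Fd P' l MD\<subseteq>insert (A.w0 k) (sd_walls_mod Fd P L D) \<times> UNIV"
 proof
  fix ws assume ws: "ws\<in>sd_walls_mod Fd P' l MD"
  obtain w s where wseq: "ws = (w, s)" by (cases ws)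
  have idx: "(w, s)\<in>sd_index MD" and nc: "\<not> cong_mod P' l (sd_fun MD (w, s)) \<one>\<^bsub>completed_ring Fd P'\<^esub>"
   using ws unfolding wseq sd_walls_mod_def by auto
  have "w = A.w0 k \<or> w\<in>sd_walls_mod Fd P L D"
  proof (rule disjCI)
   assume nin: "w\<notin>sd_walls_mod Fd P L D"
   show "w = A.w0 k"
   proof (rule ccontr)
    assume ne: "w\<noteq>A.w0 k"
    have w: "w\<in>sd_index D" and dim: "aff_dim (sd_supp D w \<inter> halfspace e k s) = int DIM('a) - 1"
     using idx ne unfolding MD_index by auto
    note wf = MD_wall_other[OF w ne dim]
    obtain q where q: "q\<in>P'" "q\<notin>ideal_power P' l" "sd_fun MD (w, s) q\<noteq>\<one>\<^bsub>completed_ring Fd P'\<^esub> q"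
     using nc unfolding cong_mod_def by blast
    have "sd_fun MD (w, s) 0 = 1" using wf unfolding wall_for_def by blast
    hence q0: "q\<noteq>0" using q(3) by auto
    hence fq: "sd_fun MD (w, s) q\<noteq>0" using q(3) by simp
    then obtain j :: nat where j: "q = of_nat j *\<^sub>R p1 Fd (Tn s (A.wn w))" using wf unfolding wall_for_def by blast
    hence jp: "0 < j" using q0 by (cases j) auto
    have "of_nat j *\<^sub>R Tn s (A.wn w)\<in>Nplus Fd (mutate_seed Fd k e)"
     by (rule B.Nplus_scale[OF piece_normal[OF w ne dim] jp])
    moreover have "p1 Fd (of_nat j *\<^sub>R Tn s (A.wn w)) = q" using j by (simp add: linear_scale[OF A.linear_p1])
    ultimately have "TT (- sig s) q\<in>Y" unfolding Y_def using q(2) by blast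
    hence nJ: "TT (- sig s) q\<notin>ideal_power P L" using L by blast
    have fD: "sd_fun D w (TT (- sig s) q)\<noteq>0" using fq unfolding MD_other[OF w ne] .
    hence inP: "TT (- sig s) q\<in>P" using A.fun_carrier[OF w] by auto
    have "TT (- sig s) q\<noteq>0" using q0 linear_0[OF linear_TT] by (metis TT_inv(2))
    hence "sd_fun D w (TT (- sig s) q)\<noteq>\<one>\<^bsub>completed_ring Fd P\<^esub> (TT (- sig s) q)" using fD by simp
    hence "\<not> cong_mod P L (sd_fun D w) \<one>\<^bsub>completed_ring Fd P\<^esub>" using inP nJ unfolding cong_mod_def by blast
    thus False using nin w unfolding sd_walls_mod_def by blast
   qed
  qed
  thus "ws\<in>insert (A.w0 k) (sd_walls_mod Fd P L D) \<times> UNIV" unfolding wseq by auto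
 qed
 moreover have "finite (insert (A.w0 k) (sd_walls_mod Fd P L D) \<times> (UNIV :: bool set))" using A.finite_walls by simp
 ultimately show ?thesis by (rule finite_subset)
qed

lemma MD_scattering: "scattering_diagram Fd (mutate_seed Fd k e) P' MD" unfolding scattering_diagram_def
proof (intro conjI ballI allI)
 fix ws assume ws: "ws\<in>sd_index MD"
 obtain w s where wseq: "ws = (w, s)" by (cases ws)
 show "\<exists>n0. wall_for Fd (mutate_seed Fd k e) P' n0 (sd_supp MD ws) (sd_fun MD ws)"
 proof (cases "w = A.w0 k")
  case True
  thus ?thesis unfolding wseq using MD_wall_initial by blast
 next
  case False
  thus ?thesis using ws MD_wall_other unfolding wseq MD_index by auto
 qed
qed (rule MD_finite)

lemma MD_scat: "scat Fd (mutate_seed Fd k e) P' MD"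
 by (intro scat.intro scat_axioms.intro B.seed_data_axioms MD_scattering)

text \<open>Off e_k^perp, the walls of the mutated diagram through a generic point are the images of
  those through its preimage, and \<open>local_functions\<close> applies. On e_k^perp the only wall
  is the replaced initial one, and \<open>G_init\<close> for the mutated seed gives the same
  series.\<close>

lemma MD_G:
 assumes x': "generic Fd x'" and n': "n'\<in>Nplus Fd (mutate_seed Fd k e)" "primitive_in (fd_N Fd) n'" "n'\<bullet>x' = 0"
 shows "scat.G Fd P' MD x' n' = B.G x' n'"
proof -
 interpret M: scat Fd "mutate_seed Fd k e" P' MD by (rule MD_scat)
 show ?thesis
 proof (cases "e k\<bullet>x' = 0")
  case True
  have e'k: "mutate_seed Fd k e k = - e k" by (simp add: mutate_seed_def)
  have ex: "mutate_seed Fd k e k\<bullet>x' = 0" using True by (simp add: e'k)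
  note ek = B.e_Nplus[OF k] B.primitive_e[OF kI]
  obtain r where "n' = r *\<^sub>R mutate_seed Fd k e k"
   using B.generic_parallel[OF x' B.Nplus_N[OF ek(1)] B.Nplus_N[OF n'(1)] B.Nplus_nonzero[OF ek(1)] ex n'(3)] by blast
  hence n'k: "n' = mutate_seed Fd k e k" by (rule B.Nplus_primitive_eq[OF ek(1) n'(1) ek(2) n'(2)])
  have only: "ws = (A.w0 k, True)" if ws: "ws\<in>sd_index MD" "x'\<in>sd_supp MD ws" for ws
  proof -
   obtain w s where wseq: "ws = (w, s)" by (cases ws)
   have w: "w\<in>sd_index D" using ws(1) unfolding wseq MD_index by blast
   have "w = A.w0 k"
   proof (rule ccontr)
    assume ne: "w\<noteq>A.w0 k"
    obtain y where y: "y\<in>sd_supp D w" "x' = Tm s y" using ws(2) unfolding wseq MD_other[OF w ne] by blast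
    have "generic Fd y" using x' unfolding y(2) by (simp add: generic_TT)
    from wall_side(1)[OF w ne this y(1)] show False using True unfolding y(2) by simp
   qed
   thus ?thesis using ws(1) unfolding wseq MD_index by simp
  qed
  have idx: "(A.w0 k, True)\<in>sd_index MD" using A.w0_facts(1)[OF k] by (simp add: MD_index)
  have xs: "x'\<in>sd_supp MD (A.w0 k, True)" using True by (simp add: MD_initial orth_def)
  show ?thesis unfolding n'k B.G_init[OF k x' ex]
  proof (rule fps_ext)
   fix j
   have "M.G x' (mutate_seed Fd k e k) $ j =
     (\<Prod>w\<in>{(A.w0 k, True)}. ray_series (p1 Fd (mutate_seed Fd k e k)) (sd_fun MD w)) $ j"
   proof (rule M.G_prod[OF ek(1) B.Lof])
    show "finite {(A.w0 k, True)}" by simp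
    show "M.walls_at L x'\<subseteq>{(A.w0 k, True)}" for L using only M.walls_at_index by blast
    show "{(A.w0 k, True)}\<subseteq>{w\<in>sd_index MD. x'\<in>sd_supp MD w}" using idx xs by blast
   qed
   also have "\<dots> = eser Fd k $ j"
    using exchange_fun_nth[OF B.p1_Nplus(2)[OF ek(1)], of Fd k j] by (simp add: MD_initial p1_e' eser_def)
   finally show "M.G x' (mutate_seed Fd k e k) $ j = eser Fd k $ j" .
  qed
 next
  case False
  define s where "s = (0 < e k\<bullet>x')"
  have x'H: "x'\<in>HH s" using False by (auto simp: HH_def sg_def s_def)
  define x n where "x = TT (- sig s) x'" and "n = TN (- sig s) n'"
  have Tx: "Tm s x = x'" "Tn s n = n'" by (simp_all add: x_def n_def)
  have xH: "x\<in>HH s" using x'H by (simp add: HH_def x_def)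
  have gx: "generic Fd x" using x' unfolding x_def by (simp add: generic_TT)
  have "prn n' x'" using n' levB[OF n'(1,3) False] B.Nplus_Nu[OF n'(1)] by (simp add: prn_def)
  hence pn: "prn n x" unfolding x_def n_def by (rule prn_TN) simp
  have loc: "A.G x n = B.G x' n'" using local_functions[OF gx xH pn] unfolding Tx .
  have walls: "ws\<in>sd_index MD \<and> x'\<in>sd_supp MD ws \<longleftrightarrow> (\<exists>w. ws = (w, s) \<and> w\<in>sd_index D \<and> x\<in>sd_supp D w)" for ws
  proof
   assume ws: "ws\<in>sd_index MD \<and> x'\<in>sd_supp MD ws"
   obtain w s' where wseq: "ws = (w, s')" by (cases ws)
   have w: "w\<in>sd_index D" using ws unfolding wseq MD_index by blast
   have ne: "w\<noteq>A.w0 k" using ws False unfolding wseq by (auto simp: MD_initial orth_def)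
   obtain y where y: "y\<in>sd_supp D w" "y\<in>halfspace e k s'" "x' = Tm s' y" using ws unfolding wseq MD_other[OF w ne] by blast
   have "y\<in>HH s" using x'H unfolding y(3) by (simp add: HH_def)
   hence s': "s' = s" using y(2) by (rule HH_unique)
   have "x = y" unfolding x_def y(3) s' by simp
   thus "\<exists>w. ws = (w, s) \<and> w\<in>sd_index D \<and> x\<in>sd_supp D w" using wseq s' w y(1) by blast
  next
   assume "\<exists>w. ws = (w, s) \<and> w\<in>sd_index D \<and> x\<in>sd_supp D w"
   then obtain w where w: "ws = (w, s)" "w\<in>sd_index D" "x\<in>sd_supp D w" by blast
   have ne: "w\<noteq>A.w0 k" using w(3) HH_nonzero[OF xH] A.w0_facts(2)[OF k] by (auto simp: orth_def)
   have "x\<in>interior (halfspace e k s)" using xH HH_open HH_halfspace by (meson interior_maximal subsetD)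
   hence "aff_dim (sd_supp D w \<inter> halfspace e k s) = aff_dim (sd_supp D w)"
    using w(3) by (intro aff_dim_convex_Int_nonempty_interior A.supp_convex[OF w(2)]) blast
   hence "ws\<in>sd_index MD" using w(2) ne A.supp_dim[OF w(2)] unfolding w(1) MD_index by simp
   moreover have "x'\<in>sd_supp MD ws" unfolding w(1) MD_other[OF w(2) ne] using w(3) xH HH_halfspace Tx(1) by blast
   ultimately show "ws\<in>sd_index MD \<and> x'\<in>sd_supp MD ws" by blast
  qed
  show ?thesis
  proof (cases "n\<in>Nplus Fd e")
   case False
   have no: False if "w\<in>sd_index D" "x\<in>sd_supp D w" for w
    by (rule A.no_wall_off_Nplus[OF gx levA[OF _ _ HH_nonzero[OF xH]] prnD(1-4)[OF pn] False that])
   have "M.G x' n' = 1" by (rule M.G_one) (use walls no in blast)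
   moreover have "A.G x n = 1" by (rule A.G_one) (rule no)
   ultimately show ?thesis using loc by simp
  next
   case True
   show ?thesis unfolding loc[symmetric]
   proof (rule fps_ext)
    fix j
    define L L' where "L = A.Lof (of_nat j *\<^sub>R p1 Fd n)" and "L' = B.Lof (of_nat j *\<^sub>R p1 Fd n')"
    have q: "of_nat j *\<^sub>R p1 Fd n\<notin>ideal_power P L" "of_nat j *\<^sub>R p1 Fd n'\<notin>ideal_power P' L'"
     unfolding L_def L'_def by (rule A.Lof, rule B.Lof)
    define W where "W = A.walls_at L x \<union> fst ` M.walls_at L' x'"
    have finW: "finite W" by (simp add: W_def)
    have WD: "W\<subseteq>{w\<in>sd_index D. x\<in>sd_supp D w}"
    proof
     fix w assume "w\<in>W"
     then consider "w\<in>A.walls_at L x" | ws where "ws\<in>M.walls_at L' x'" "w = fst ws" unfolding W_def by blast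
     thus "w\<in>{w\<in>sd_index D. x\<in>sd_supp D w}"
     proof cases
      case 1
      thus ?thesis using A.walls_at_index by blast
     next
      case (2 ws)
      obtain w' where "ws = (w', s)" "w'\<in>sd_index D" "x\<in>sd_supp D w'"
       using iffD1[OF walls M.walls_at_index[OF 2(1)]] by blast
      thus ?thesis using 2(2) by simp
     qed
    qed
    let ?W = "(\<lambda>w. (w, s)) ` W"
    have 1: "A.G x n $ j = (\<Prod>w\<in>W. ray_series (p1 Fd n) (sd_fun D w)) $ j"
     by (rule A.G_prod[OF True q(1) finW _ WD]) (simp add: W_def)
    have "M.walls_at L' x'\<subseteq>?W"
    proof
     fix ws assume ws: "ws\<in>M.walls_at L' x'"
     then obtain w where w: "ws = (w, s)" using iffD1[OF walls M.walls_at_index[OF ws]] by blast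
     have "fst ws\<in>W" using ws unfolding W_def by blast
     thus "ws\<in>?W" using w by simp
    qed
    hence "M.G x' n' $ j = (\<Prod>ws\<in>?W. ray_series (p1 Fd n') (sd_fun MD ws)) $ j"
     by (rule M.G_prod[OF n'(1) q(2) finite_imageI[OF finW]]) (use WD iffD2[OF walls] in blast)
    also have "(\<Prod>ws\<in>?W. ray_series (p1 Fd n') (sd_fun MD ws)) = (\<Prod>w\<in>W. ray_series (p1 Fd n') (sd_fun MD (w, s)))"
     by (simp add: prod.reindex inj_on_def)
    also have "\<dots> = (\<Prod>w\<in>W. ray_series (p1 Fd n) (sd_fun D w))"
    proof (rule prod.cong[OF refl])
     fix w assume "w\<in>W"
     hence w: "w\<in>sd_index D" "x\<in>sd_supp D w" using WD by auto
     have ne: "w\<noteq>A.w0 k" using w(2) HH_nonzero[OF xH] A.w0_facts(2)[OF k] by (auto simp: orth_def)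
     have "TT (- sig s) (of_nat i *\<^sub>R p1 Fd n') = of_nat i *\<^sub>R p1 Fd n" for i :: nat
      by (simp add: n_def p1_TN linear_scale[OF linear_TT])
     thus "ray_series (p1 Fd n') (sd_fun MD (w, s)) = ray_series (p1 Fd n) (sd_fun D w)"
      by (intro fps_ext) (simp add: MD_other[OF w(1) ne])
    qed
    finally show "M.G x' n' $ j = A.G x n $ j" using 1 by simp
   qed
  qed
 qed
qed

lemma mutation_pair: "scat_pair Fd (mutate_seed Fd k e) P' MD D'"
 unfolding scat_pair_def scat_pair_axioms_def using MD_scat B.cscat_axioms MD_G by blast

end

section \<open>Mutation of seeds\<close>

lemma dual_independent:
 fixes b w :: "'i=>'a::euclidean_space"
 assumes "finite I" and dual: "\<And>i j. i\<in>I ==> j\<in>I ==> b j\<bullet>w i = (if j = i then 1 else 0)"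
 shows "inj_on b I" "independent (b ` I)"
proof -
 show inj: "inj_on b I"
 proof (rule inj_onI)
  fix i j assume "i\<in>I" "j\<in>I" "b i = b j"
  thus "i = j" using dual[of i i] dual[of i j] by (metis zero_neq_one)
 qed
 show "independent (b ` I)"
 proof (rule independent_if_scalars_zero)
  show "finite (b ` I)" using assms(1) by simp
  fix f x assume f: "(\<Sum>x\<in>b ` I. f x *\<^sub>R x) = 0" and "x\<in>b ` I"
  then obtain i where i: "i\<in>I" "x = b i" by blast
  have "(\<Sum>j\<in>I. f (b j) *\<^sub>R b j)\<bullet>w i = 0" using f by (simp add: sum.reindex[OF inj])
  hence "(\<Sum>j\<in>I. f (b j) * (b j\<bullet>w i)) = 0" by (simp add: inner_sum_left)
  moreover have "(\<Sum>j\<in>I. f (b j) * (b j\<bullet>w i)) = (\<Sum>j\<in>I. if j = i then f (b j) else 0)"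
   using dual i by (intro sum.cong) auto
  ultimately show "f x = 0" using i assms(1) by simp
 qed
qed

text \<open>Independence follows from an explicit dual basis w'. With f for the new vectors, the
  substitution inverts itself, e_i = f_i + z_i f_k, so both lattices coincide.\<close>

lemma lattice_basis_mutate:
 fixes e :: "'i=>'a::euclidean_space" assumes L: "lattice_basis I e L" and k: "k\<in>I" and z: "\<And>i. i\<in>I ==> z i\<in>\<int>"
 shows "lattice_basis I (\<lambda>i. if i = k then - e k else e i + z i *\<^sub>R e k) L"
proof -
 let ?f = "\<lambda>i. if i = k then - e k else e i + z i *\<^sub>R e k"
 have fin: "finite I" using L by (simp add: lattice_basis_def)
 obtain w where w: "\<forall>i\<in>I. \<forall>j\<in>I. e j\<bullet>w i = (if j = i then 1 else 0)" using lattice_basis_dual[OF L] by blast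
 define w' where "w' = (\<lambda>i. if i = k then (\<Sum>j\<in>I - {k}. z j *\<^sub>R w j) - w k else w i)"
 have dual: "?f j\<bullet>w' i = (if j = i then 1 else 0)" if ij: "i\<in>I" "j\<in>I" for i j
 proof (cases "i = k")
  case False
  thus ?thesis using w ij k by (auto simp: w'_def inner_left_distrib)
 next
  case True
  have "e j'\<bullet>(\<Sum>j\<in>I - {k}. z j *\<^sub>R w j) = (\<Sum>j\<in>I - {k}. if j = j' then z j else 0)" if "j'\<in>I" for j'
   unfolding inner_sum_right using w that by (intro sum.cong) auto
  hence s: "e j'\<bullet>(\<Sum>j\<in>I - {k}. z j *\<^sub>R w j) = (if j' = k then 0 else z j')" if "j'\<in>I" for j' using that fin by simp
  have "e j\<bullet>w' k = (if j = k then - 1 else z j)" "e k\<bullet>w' k = - 1"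
   using s[OF ij(2)] s[OF k] w ij k by (auto simp: w'_def inner_diff_right)
  thus ?thesis using True by (auto simp: inner_left_distrib)
 qed
 note ind = dual_independent[OF fin dual]
 define L' where "L' = {(\<Sum>i\<in>I. of_int (c i) *\<^sub>R ?f i) | c :: 'i=>int. True}"
 have L': "lattice_basis I ?f L'" unfolding lattice_basis_def L'_def using fin ind by blast
 interpret L: real_subgroup L by (rule real_subgroup_lattice_basis[OF L])
 interpret L': real_subgroup L' by (rule real_subgroup_lattice_basis[OF L'])
 have f: "?f i\<in>L" if "i\<in>I" for i
  using lattice_basis_vec[OF L that] lattice_basis_vec[OF L k] z[OF that] by (auto intro: L.uminus L.add L.scale_Ints)
 have e: "e i\<in>L'" if i: "i\<in>I" for i
 proof (cases "i = k")
  case True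
  thus ?thesis using L'.uminus[OF lattice_basis_vec[OF L' k]] by simp
 next
  case False
  have "?f i + z i *\<^sub>R ?f k\<in>L'" by (intro L'.add L'.scale_Ints lattice_basis_vec[OF L'] i k z)
  thus ?thesis using False by simp
 qed
 have "L'\<subseteq>L"
 proof
  fix x assume "x\<in>L'"
  then obtain c :: "'i=>int" where "x = (\<Sum>i\<in>I. of_int (c i) *\<^sub>R ?f i)" unfolding L'_def by blast
  thus "x\<in>L" using f by (auto intro!: L.sum L.scale_int)
 qed
 moreover have "L\<subseteq>L'"
 proof
  fix x assume "x\<in>L"
  moreover have "L = {(\<Sum>i\<in>I. of_int (c i) *\<^sub>R e i) | c :: 'i=>int. True}" using L by (simp only: lattice_basis_def)
  ultimately have "x\<in>{(\<Sum>i\<in>I. of_int (c i) *\<^sub>R e i) | c :: 'i=>int. True}" by (rule subst[rotated])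
  then obtain c :: "'i=>int" where "x = (\<Sum>i\<in>I. of_int (c i) *\<^sub>R e i)" by blast
  thus "x\<in>L'" using e by (auto intro!: L'.sum L'.scale_int)
 qed
 ultimately show ?thesis using L' by (metis subset_antisym)
qed

lemma clus_intro: assumes "seed_data Fd e P" "cluster_scattering_diagram Fd e P D" shows "clus Fd e P D"
proof -
 have "scattering_diagram Fd e P D" "consistent_diagram Fd P D"
  using assms(2) unfolding cluster_scattering_diagram_def by blast+
 thus ?thesis using assms
  by (intro clus.intro clus_axioms.intro cscat.intro cscat_axioms.intro scat.intro scat_axioms.intro)
qed

theorem theorem3p25:
  fixes \<Gamma> :: "('i, 'a::euclidean_space, 'x) fixed_data"
    and e :: "'i \<Rightarrow> 'a" and k :: 'i and P P' :: "'a set"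
    and D :: "('w, 'a, ('x, 'k::field_char_0) coeff_poly) diagram"
    and D' :: "('v, 'a, ('x, 'k) coeff_poly) diagram"
  assumes "generalized_fixed_data \<Gamma>"
    and "reciprocal_torus_seed \<Gamma> e"
    and "injectivity_assumption \<Gamma>"
    and "k \<in> fd_Iuf \<Gamma>"
    and "seed_monoid \<Gamma> e P"
    and "seed_monoid \<Gamma> (mutate_seed \<Gamma> k e) P'"
    and "cluster_scattering_diagram \<Gamma> e P D"
    and "reduced_diagram \<Gamma> P D"
    and "cluster_scattering_diagram \<Gamma> (mutate_seed \<Gamma> k e) P' D'"
  shows "scattering_diagram \<Gamma> (mutate_seed \<Gamma> k e) P' (mutate_diagram \<Gamma> e k D) \<and>
         consistent_diagram \<Gamma> P' (mutate_diagram \<Gamma> e k D) \<and>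
         equivalent_diagrams \<Gamma> P' D' (mutate_diagram \<Gamma> e k D)"
proof -
 have bN: "lattice_basis (fd_I \<Gamma>) e (fd_N \<Gamma>)" and bU: "lattice_basis (fd_Iuf \<Gamma>) e (fd_Nuf \<Gamma>)"
  and bC: "lattice_basis (fd_I \<Gamma>) (\<lambda>i. of_nat (fd_d \<Gamma> i) *\<^sub>R e i) (fd_Ncirc \<Gamma>)"
  using assms(2) unfolding reciprocal_torus_seed_def by (simp_all only: simp_thms)
 have kI: "k\<in>fd_I \<Gamma>" and UI: "fd_Iuf \<Gamma>\<subseteq>fd_I \<Gamma>" and bil: "bilinear (fd_form \<Gamma>)"
  and int: "\<forall>x\<in>fd_N \<Gamma>. \<forall>y\<in>fd_Nuf \<Gamma> \<inter> fd_Ncirc \<Gamma>. fd_form \<Gamma> x y\<in>\<int>"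
  using assms(1,4) unfolding generalized_fixed_data_def by blast+
 interpret U: real_subgroup "fd_Nuf \<Gamma>" by (rule real_subgroup_lattice_basis[OF bU])
 \<comment> \<open>The vector \<open>d_k e_k\<close> lies in both \<open>fd_Nuf\<close> and
   \<open>fd_Ncirc\<close>, and on that intersection the form with N is integral.\<close>
 have eps: "of_nat (fd_r \<Gamma> k) * max 0 (seed_epsilon \<Gamma> e i k)\<in>\<int>" if "i\<in>fd_I \<Gamma>" for i
 proof -
  have "of_nat (fd_d \<Gamma> k) *\<^sub>R e k\<in>fd_Nuf \<Gamma> \<inter> fd_Ncirc \<Gamma>"
   using U.scale_nat[OF lattice_basis_vec[OF bU assms(4)]] lattice_basis_vec[OF bC kI] by blast
  hence "fd_form \<Gamma> (e i) (of_nat (fd_d \<Gamma> k) *\<^sub>R e k)\<in>\<int>" using int lattice_basis_vec[OF bN that] by blast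
  hence "seed_epsilon \<Gamma> e i k\<in>\<int>" using bilinear_rmul[OF bil] by (simp add: seed_epsilon_def mult.commute)
  thus ?thesis by (simp add: max_def)
 qed
 have bN': "lattice_basis (fd_I \<Gamma>) (mutate_seed \<Gamma> k e) (fd_N \<Gamma>)"
  unfolding mutate_seed_def by (rule lattice_basis_mutate[OF bN kI eps])
 have bU': "lattice_basis (fd_Iuf \<Gamma>) (mutate_seed \<Gamma> k e) (fd_Nuf \<Gamma>)"
  unfolding mutate_seed_def by (rule lattice_basis_mutate[OF bU assms(4)]) (use eps UI in blast)
 have ne: "fd_Iuf \<Gamma>\<noteq>{}" using assms(4) by blast
 have sA: "seed_data \<Gamma> e P"
  by (rule seed_data.intro[OF assms(1) bN bU exI[of _ "\<lambda>i. of_nat (fd_d \<Gamma> i) *\<^sub>R e i"] assms(3,5) ne]) (rule bC)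
 have sB: "seed_data \<Gamma> (mutate_seed \<Gamma> k e) P'"
  by (rule seed_data.intro[OF assms(1) bN' bU' exI[of _ "\<lambda>i. of_nat (fd_d \<Gamma> i) *\<^sub>R e i"] assms(3,6) ne]) (rule bC)
 interpret mutr \<Gamma> e k P P' D D'
  by (intro mutr.intro mut.intro mut_axioms.intro mutr_axioms.intro clus_intro sA sB assms)
 interpret S: scat_pair \<Gamma> "mutate_seed \<Gamma> k e" P' MD D' by (rule mutation_pair)
 show ?thesis using MD_scattering S.consistent_D1 S.equivalent unfolding MD_def by blast
qed

end
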